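(* Let $p\ge 2$ be an integer, $\Delta>0$, and let $P_X$ be a probability distribution on $\mathbb{R}$ with finite second moment. In the rank-one spiked tensor model described in the context, for every $\Delta>0$, $$F_N \equiv \frac{1}{N}\mathbb{E}\left[\log \mathcal{Z}_N\right] \xrightarrow[N\to\infty]{} \sup_{m\ge 0}\phi_{\rm RS}(m).$$
   Context: Rank-one spiked tensor model: $X^0=(x^0_1,\dots,x^0_N)$ with $x^0_i$ i.i.d. $\sim P_X$; one observes, for $1\le i_1<\dots<i_p\le N$, $$Y_{i_1,\dots,i_p}=\frac{\sqrt{(p-1)!}}{N^{(p-1)/2}}x^0_{i_1}\cdots x^0_{i_p}+V_{i_1,\dots,i_p},$$ where the $V_{i_1,\dots,i_p}$ are i.i.d. $\mathcal N(0,\Delta)$, independent of $X^0$. For $X=(x_1,\dots,x_N)\in\mathbb{R}^N$ define the Hamiltonian $$H_N(X)=\Delta^{-1}\sum_{i_1<\dots<i_p}\left[\frac{\sqrt{(p-1)!}}{N^{(p-1)/2}}Y_{i_1,\dots,i_p}x_{i_1}\cdots x_{i_p}-\frac{(p-1)!}{2N^{p-1}}(x_{i_1}\cdots x_{i_p})^2\right],$$ and $\mathcal Z_N=\int e^{H_N(X)}\prod_{i=1}^N dP_X(x_i)$ (so the posterior of $X^0$ given $Y$ is $\mathcal Z_N^{-1}e^{H_N(X)}\prod_i dP_X(x_i)$). The expectation $\mathbb{E}$ is over $X^0$ and $V$. For $m\ge0$, $$\phi_{\rm RS}(m)=\mathbb{E}\left[\log\int dP_X(x)\exp\left(\sqrt{\tfrac{m^{p-1}}{\Delta}}Zx+\tfrac{m^{p-1}}{\Delta}xx_0-\tfrac{m^{p-1}}{2\Delta}x^2\right)\right]-\frac{p-1}{2p\Delta}m^p,$$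 where $x_0\sim P_X$ and $Z\sim\mathcal N(0,1)$ are independent. *)

theory Defs
  imports "HOL-Probability.Probability"
begin

text \<open>Index set of the observations: increasing p-tuples i_1 < ... < i_p in {0..N-1},
  represented as p-element subsets of {..<N}.\<close>
definition tuples :: "nat \<Rightarrow> nat \<Rightarrow> nat set set" where
  "tuples N p = {S. S \<subseteq> {..<N} \<and> card S = p}"

definition gauss :: "real \<Rightarrow> real measure" where
  "gauss \<Delta> = density lborel (normal_density 0 (sqrt \<Delta>))"

definition coef :: "nat \<Rightarrow> nat \<Rightarrow> real" where
  "coef p N = sqrt (fact (p - 1)) / (real N powr ((real p - 1) / 2))"

definition obs :: "nat \<Rightarrow> nat \<Rightarrow> (nat \<Rightarrow> real) \<Rightarrow> (nat set \<Rightarrow> real) \<Rightarrow> nat set \<Rightarrow> real" where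
  "obs p N X0 V S = coef p N * (\<Prod>i\<in>S. X0 i) + V S"

definition hamiltonian :: "nat \<Rightarrow> real \<Rightarrow> nat \<Rightarrow> (nat set \<Rightarrow> real) \<Rightarrow> (nat \<Rightarrow> real) \<Rightarrow> real" where
  "hamiltonian p \<Delta> N Y X = (1 / \<Delta>) * (\<Sum>S\<in>tuples N p.
      coef p N * Y S * (\<Prod>i\<in>S. X i)
      - fact (p - 1) / (2 * real N ^ (p - 1)) * (\<Prod>i\<in>S. X i)\<^sup>2)"

definition partition_fn :: "real measure \<Rightarrow> nat \<Rightarrow> real \<Rightarrow> nat \<Rightarrow> (nat set \<Rightarrow> real) \<Rightarrow> real" where
  "partition_fn PX p \<Delta> N Y = (\<integral>X. exp (hamiltonian p \<Delta> N Y X) \<partial>(PiM {..<N} (\<lambda>_. PX)))"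

definition free_entropy :: "real measure \<Rightarrow> nat \<Rightarrow> real \<Rightarrow> nat \<Rightarrow> real" where
  "free_entropy PX p \<Delta> N = (1 / real N) *
     (\<integral>XV. ln (partition_fn PX p \<Delta> N (obs p N (fst XV) (snd XV)))
        \<partial>(PiM {..<N} (\<lambda>_. PX) \<Otimes>\<^sub>M PiM (tuples N p) (\<lambda>_. gauss \<Delta>)))"

definition phi_RS :: "real measure \<Rightarrow> nat \<Rightarrow> real \<Rightarrow> real \<Rightarrow> real" where
  "phi_RS PX p \<Delta> m =
     (\<integral>xz. ln (\<integral>x. exp (sqrt (m ^ (p - 1) / \<Delta>) * snd xz * x
                          + m ^ (p - 1) / \<Delta> * x * fst xz
                          - m ^ (p - 1) / (2 * \<Delta>) * x\<^sup>2) \<partial>PX)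
        \<partial>(PX \<Otimes>\<^sub>M density lborel std_normal_density))
     - (real p - 1) / (2 * real p * \<Delta>) * m ^ p"

end

theory Submission
  imports Defs
begin

text \<open>
Observe, in addition to the tensor, every coordinate of the signal through a scalar Gaussian channel.
The free energy is convex in the vector of signal-to-noise ratios, since its Hessian is made of squared
posterior covariances; so it lies above its tangents.

For the lower bound, take the tangent at the point where the tensor is switched off.  There the
coordinates decouple, the overlap of a monomial is the \<open>p\<close>-th power of the scalar overlap, and
\<open>q ^ p\<close> lies above its own tangent at \<open>m\<close>.

For the upper bound, take the tangent at the point with the full tensor and a side channel of small
strength \<open>r\<^sup>2\<close>, and move to the decoupled point.  For a suitable \<open>r\<close> the overlap of a posterior sample
with the signal concentrates around its mean \<open>m\<close>: pigeonholing the second differences of the free energy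
in \<open>r\<close> controls the thermal part, Efron--Stein the disorder.  The tensor then contributes \<open>m ^ p\<close>, and the
tangent is the replica-symmetric potential at this \<open>m\<close>.

All of this is done for priors of finite support.  The Nishimori identity shows that the free energy is
continuous in the signal with respect to the \<open>L\<^sup>2\<close> norm, uniformly in \<open>N\<close>, which gives the case of a
finite second moment.
\<close>

section \<open>Gaussian noise\<close>

text \<open>Jensen's inequality compares the \<open>p\<close>-th moment of an overlap with the
  \<open>p\<close>-th power of its mean in one direction only. The lower bound uses that direction,
  for an average of squared posterior means, which is nonnegative, so odd \<open>p\<close> is
  covered. The upper bound needs the reverse inequality, which holds only up to the variance of the
  overlap; the side channel exists to make that variance small. Its strength is written as a square
  because the log-likelihood at fixed signal and noise is then a quadratic polynomial in
  \<open>r\<close>. Values at neighbouring \<open>r\<close> can be compared for the same noise, so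
  finite differences replace derivatives of the random free energy. The good \<open>r\<close>
  depends on \<open>N\<close>, and with it \<open>m\<close>; this is harmless because only a
  supremum over \<open>m\<close> is claimed. The range of \<open>r\<close> is fixed before
  \<open>N\<close> grows; the side channel changes the free energy per coordinate by an amount of
  order \<open>r\<^sup>2\<close>, which is counted as part of the error.\<close>

definition ngauss :: "real measure" where
  "ngauss = density lborel std_normal_density"

text \<open>The noise has unit variance everywhere; the variance \<open>\<Delta>\<close> of the
  model is absorbed into signal-to-noise ratios.\<close>

definition gaussK :: "'k set \<Rightarrow> ('k \<Rightarrow> real) measure" where
  "gaussK K = PiM K (\<lambda>_. ngauss)"

lemma prob_space_ngauss [simp]: "prob_space ngauss"
  unfolding ngauss_def by (rule prob_space_normal_density) simp

lemma sets_ngauss [simp, measurable_cong]: "sets ngauss = sets borel"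
  by (simp add: ngauss_def)

lemma space_ngauss [simp]: "space ngauss = UNIV"
  by (simp add: ngauss_def)

interpretation ngauss: product_sigma_finite "\<lambda>_::'k. ngauss"
  by (simp add: product_sigma_finite_def prob_space_imp_sigma_finite)

lemma sets_gaussK [measurable_cong]: "sets (gaussK K) = sets (PiM K (\<lambda>_. borel))"
  unfolding gaussK_def by (rule sets_PiM_cong) simp_all

lemma space_gaussK: "space (gaussK K) = PiE K (\<lambda>_. UNIV)"
  by (simp add: gaussK_def space_PiM)

lemma prob_space_gaussK [simp]: "prob_space (gaussK K)"
  unfolding gaussK_def by (rule prob_space_PiM) simp

text \<open>Completing the square: \<open>exp (a * z - a\<^sup>2 / 2)\<close> is the density ratio
  of the shifted to the centred Gaussian. The nonnegative integral needs no integrability of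
  \<open>g\<close>, and in this form the formula can later identify measures.\<close>

lemma nn_integral_ngauss_shift:
  assumes [measurable]: "g \<in> borel_measurable borel"
  shows "(\<integral>\<^sup>+z. g (z + a) \<partial>ngauss) = (\<integral>\<^sup>+z. g z * ennreal (exp (a * z - a\<^sup>2 / 2)) \<partial>ngauss)"
proof -
  have "(\<integral>\<^sup>+z. g z * ennreal (exp (a * z - a\<^sup>2 / 2)) \<partial>ngauss)
      = (\<integral>\<^sup>+z. ennreal (std_normal_density z) * (g z * ennreal (exp (a * z - a\<^sup>2 / 2))) \<partial>lborel)"
    unfolding ngauss_def by (rule nn_integral_density) auto
  also have "\<dots> = (\<integral>\<^sup>+z. ennreal (std_normal_density (z - a)) * g z \<partial>lborel)"
  proof (rule nn_integral_cong)
    fix z :: real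
    have "std_normal_density z * exp (a * z - a\<^sup>2 / 2) = std_normal_density (z - a)"
      unfolding std_normal_density_def
      by (simp add: mult.assoc exp_add [symmetric] power2_eq_square field_simps)
    moreover have "ennreal (std_normal_density z) * (g z * ennreal (exp (a * z - a\<^sup>2 / 2)))
        = ennreal (std_normal_density z * exp (a * z - a\<^sup>2 / 2)) * g z"
      by (simp add: ennreal_mult mult_ac)
    ultimately show "ennreal (std_normal_density z) * (g z * ennreal (exp (a * z - a\<^sup>2 / 2)))
        = ennreal (std_normal_density (z - a)) * g z" by simp
  qed
  also have "\<dots> = (\<integral>\<^sup>+z. ennreal (std_normal_density (z - a)) * g z \<partial>distr lborel borel ((+) a))"
    by (simp add: lborel_distr_plus)
  also have "\<dots> = (\<integral>\<^sup>+z. ennreal (std_normal_density z) * g (z + a) \<partial>lborel)"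
    by (subst nn_integral_distr) (auto simp: add.commute)
  also have "\<dots> = (\<integral>\<^sup>+z. g (z + a) \<partial>ngauss)"
    unfolding ngauss_def by (subst nn_integral_density) auto
  finally show ?thesis by simp
qed

text \<open>The Cameron--Martin formula, one coordinate at a time. The weight is the likelihood
  ratio of the signal \<open>a\<close> seen through unit noise against pure noise, the expression
  that reappears in \<open>expo\<close>. The restricted lambda keeps the shifted point inside the
  product space.\<close>

lemma nn_integral_gaussK_shift:
  assumes "finite K" and "g \<in> borel_measurable (gaussK K)"
  shows "(\<integral>\<^sup>+z. g (\<lambda>k\<in>K. z k + a k) \<partial>gaussK K)
    = (\<integral>\<^sup>+z. g z * ennreal (exp (\<Sum>k\<in>K. a k * z k - (a k)\<^sup>2 / 2)) \<partial>gaussK K)"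
  using assms
proof (induction K arbitrary: g rule: finite_induct)
  case empty
  have "gaussK {} = count_space {\<lambda>k::'a. undefined}"
    unfolding gaussK_def by (simp add: PiM_empty)
  then show ?case by (simp add: nn_integral_count_space_finite)
next
  case (insert i K)
  have [measurable]: "g \<in> borel_measurable (PiM (insert i K) (\<lambda>_. borel))"
    using insert.prems by (simp add: sets_gaussK cong: measurable_cong_sets)
  let ?e = "\<lambda>k z. ennreal (exp (a k * z - (a k)\<^sup>2 / 2))"
  have m1: "(\<lambda>z. g (\<lambda>k\<in>insert i K. z k + a k)) \<in> borel_measurable (PiM (insert i K) (\<lambda>_. ngauss))"
    by measurable
  have m2: "(\<lambda>z. g z * ennreal (exp (\<Sum>k\<in>insert i K. a k * z k - (a k)\<^sup>2 / 2)))
      \<in> borel_measurable (PiM (insert i K) (\<lambda>_. ngauss))"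
    by measurable
  have e: "ennreal (exp (\<Sum>k\<in>insert i K. a k * (x(i := y)) k - (a k)\<^sup>2 / 2))
      = ?e i y * ennreal (exp (\<Sum>k\<in>K. a k * x k - (a k)\<^sup>2 / 2))" for x y
  proof -
    have "(\<Sum>k\<in>K. a k * (x(i := y)) k - (a k)\<^sup>2 / 2) = (\<Sum>k\<in>K. a k * x k - (a k)\<^sup>2 / 2)"
      using insert.hyps by (intro sum.cong) auto
    then show ?thesis
      using insert.hyps by (simp add: exp_add ennreal_mult)
  qed
  have "(\<integral>\<^sup>+z. g (\<lambda>k\<in>insert i K. z k + a k) \<partial>gaussK (insert i K))
      = (\<integral>\<^sup>+x. \<integral>\<^sup>+y. g (\<lambda>k\<in>insert i K. (x(i := y)) k + a k) \<partial>ngauss \<partial>gaussK K)"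
    unfolding gaussK_def
    by (rule ngauss.product_nn_integral_insert[OF insert.hyps m1])
  also have "\<dots> = (\<integral>\<^sup>+x. \<integral>\<^sup>+y. g ((\<lambda>k\<in>K. x k + a k)(i := y + a i)) \<partial>ngauss \<partial>gaussK K)"
    using insert.hyps by (intro nn_integral_cong arg_cong[where f=g]) auto
  also have "\<dots> = (\<integral>\<^sup>+x. \<integral>\<^sup>+y. g ((\<lambda>k\<in>K. x k + a k)(i := y)) * ?e i y \<partial>ngauss \<partial>gaussK K)"
  proof (rule nn_integral_cong)
    fix x assume "x \<in> space (gaussK K)"
    have "(\<lambda>k\<in>K. x k + a k) \<in> space (PiM K (\<lambda>_. borel))" by (simp add: space_PiM)
    then have [measurable]: "(\<lambda>y. g ((\<lambda>k\<in>K. x k + a k)(i := y))) \<in> borel_measurable borel"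
      by measurable
    show "(\<integral>\<^sup>+y. g ((\<lambda>k\<in>K. x k + a k)(i := y + a i)) \<partial>ngauss)
        = (\<integral>\<^sup>+y. g ((\<lambda>k\<in>K. x k + a k)(i := y)) * ?e i y \<partial>ngauss)"
      by (rule nn_integral_ngauss_shift) measurable
  qed
  also have "\<dots> = (\<integral>\<^sup>+x. (\<integral>\<^sup>+y. g (x(i := y)) * ?e i y \<partial>ngauss)
      * ennreal (exp (\<Sum>k\<in>K. a k * x k - (a k)\<^sup>2 / 2)) \<partial>gaussK K)"
    by (rule insert.IH[where g = "\<lambda>x. \<integral>\<^sup>+y. g (x(i := y)) * ?e i y \<partial>ngauss"]) measurable
  also have "\<dots> = (\<integral>\<^sup>+x. \<integral>\<^sup>+y. g (x(i := y)) * ?e i y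
      * ennreal (exp (\<Sum>k\<in>K. a k * x k - (a k)\<^sup>2 / 2)) \<partial>ngauss \<partial>gaussK K)"
  proof (rule nn_integral_cong)
    fix x assume "x \<in> space (gaussK K)"
    then have "x \<in> space (PiM K (\<lambda>_. borel))" by (simp add: space_PiM space_gaussK)
    then have [measurable]: "(\<lambda>y. g (x(i := y))) \<in> borel_measurable borel"
      by measurable
    show "(\<integral>\<^sup>+y. g (x(i := y)) * ?e i y \<partial>ngauss) * ennreal (exp (\<Sum>k\<in>K. a k * x k - (a k)\<^sup>2 / 2))
      = (\<integral>\<^sup>+y. g (x(i := y)) * ?e i y * ennreal (exp (\<Sum>k\<in>K. a k * x k - (a k)\<^sup>2 / 2)) \<partial>ngauss)"
      by (rule nn_integral_multc[symmetric]) measurable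
  qed
  also have "\<dots> = (\<integral>\<^sup>+x. \<integral>\<^sup>+y. g (x(i := y))
      * ennreal (exp (\<Sum>k\<in>insert i K. a k * (x(i := y)) k - (a k)\<^sup>2 / 2)) \<partial>ngauss \<partial>gaussK K)"
    unfolding e by (simp add: mult.assoc)
  also have "\<dots> = (\<integral>\<^sup>+z. g z * ennreal (exp (\<Sum>k\<in>insert i K. a k * z k - (a k)\<^sup>2 / 2)) \<partial>gaussK (insert i K))"
    unfolding gaussK_def
    by (rule ngauss.product_nn_integral_insert[OF insert.hyps m2, symmetric])
  finally show ?case .
qed

lemma distr_gaussK_shift:
  assumes "finite K"
  shows "distr (gaussK K) (gaussK K) (\<lambda>z. \<lambda>k\<in>K. z k + a k)
    = density (gaussK K) (\<lambda>z. ennreal (exp (\<Sum>k\<in>K. a k * z k - (a k)\<^sup>2 / 2)))"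
proof (rule measure_eqI)
  fix A assume "A \<in> sets (distr (gaussK K) (gaussK K) (\<lambda>z. \<lambda>k\<in>K. z k + a k))"
  then have A [measurable]: "A \<in> sets (gaussK K)" by simp
  have [measurable]: "(\<lambda>z. \<lambda>k\<in>K. z k + a k) \<in> measurable (gaussK K) (gaussK K)"
    by measurable
  have "emeasure (distr (gaussK K) (gaussK K) (\<lambda>z. \<lambda>k\<in>K. z k + a k)) A
      = (\<integral>\<^sup>+z. indicator A (\<lambda>k\<in>K. z k + a k) \<partial>gaussK K)"
    by (subst nn_integral_indicator[symmetric], simp) (subst nn_integral_distr, auto)
  also have "\<dots> = (\<integral>\<^sup>+z. indicator A z * ennreal (exp (\<Sum>k\<in>K. a k * z k - (a k)\<^sup>2 / 2)) \<partial>gaussK K)"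
    by (rule nn_integral_gaussK_shift[OF assms]) measurable
  also have "\<dots> = emeasure (density (gaussK K) (\<lambda>z. ennreal (exp (\<Sum>k\<in>K. a k * z k - (a k)\<^sup>2 / 2)))) A"
    by (subst emeasure_density) (auto simp: mult.commute)
  finally show "emeasure (distr (gaussK K) (gaussK K) (\<lambda>z. \<lambda>k\<in>K. z k + a k)) A
    = emeasure (density (gaussK K) (\<lambda>z. ennreal (exp (\<Sum>k\<in>K. a k * z k - (a k)\<^sup>2 / 2)))) A" .
qed simp

lemma integral_gaussK_shift:
  assumes "finite K" and [measurable]: "g \<in> borel_measurable (gaussK K)"
  shows "(\<integral>z. g (\<lambda>k\<in>K. z k + a k) \<partial>gaussK K)
      = (\<integral>z. exp (\<Sum>k\<in>K. a k * z k - (a k)\<^sup>2 / 2) * g z \<partial>gaussK K)"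
proof -
  have [measurable]: "(\<lambda>z. \<lambda>k\<in>K. z k + a k) \<in> measurable (gaussK K) (gaussK K)"
    by measurable
  have "(\<integral>z. g (\<lambda>k\<in>K. z k + a k) \<partial>gaussK K)
      = (\<integral>z. g z \<partial>distr (gaussK K) (gaussK K) (\<lambda>z. \<lambda>k\<in>K. z k + a k))"
    by (subst integral_distr) auto
  also have "\<dots> = (\<integral>z. exp (\<Sum>k\<in>K. a k * z k - (a k)\<^sup>2 / 2) * g z \<partial>gaussK K)"
    unfolding distr_gaussK_shift[OF assms(1)] by (subst integral_density) auto
  finally show ?thesis .
qed

lemma integrable_ngauss_exp: "integrable ngauss (\<lambda>z. exp (a * z))"
proof -
  have "(\<integral>\<^sup>+z. ennreal (exp (a * z - a\<^sup>2 / 2)) \<partial>ngauss) = 1"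
    using nn_integral_ngauss_shift[of "\<lambda>_. 1" a] by (simp add: prob_space.emeasure_space_1[OF prob_space_ngauss, simplified])
  then have "integrable ngauss (\<lambda>z. exp (a * z - a\<^sup>2 / 2))"
    by (intro integrableI_nonneg) auto
  then have "integrable ngauss (\<lambda>z. exp (a\<^sup>2 / 2) * exp (a * z - a\<^sup>2 / 2))"
    by (rule integrable_mult_right)
  then show ?thesis by (simp add: exp_add [symmetric])
qed

lemma integrable_ngauss_exp_abs: "integrable ngauss (\<lambda>z. exp (c * \<bar>z\<bar>))"
proof (rule Bochner_Integration.integrable_bound)
  show "integrable ngauss (\<lambda>z. exp (c * z) + exp (- c * z))"
    by (intro Bochner_Integration.integrable_add integrable_ngauss_exp)
  show "AE z in ngauss. norm (exp (c * \<bar>z\<bar>)) \<le> norm (exp (c * z) + exp (- c * z))"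
  proof (rule AE_I2)
    fix z :: real
    have "exp (c * \<bar>z\<bar>) \<le> exp (c * z) + exp (- c * z)"
      by (cases "z \<ge> 0") auto
    then show "norm (exp (c * \<bar>z\<bar>)) \<le> norm (exp (c * z) + exp (- c * z))"
      by (smt (verit) exp_gt_zero real_norm_def)
  qed
qed auto

lemma integrable_gaussK_exp_abs:
  assumes "finite K"
  shows "integrable (gaussK K) (\<lambda>z. exp (c * (\<Sum>k\<in>K. \<bar>z k\<bar>)))"
proof -
  have "integrable (PiM K (\<lambda>_. ngauss)) (\<lambda>z. \<Prod>k\<in>K. exp (c * \<bar>z k\<bar>))"
    by (rule ngauss.product_integrable_prod[OF assms integrable_ngauss_exp_abs])
  moreover have "(\<Prod>k\<in>K. exp (c * \<bar>z k\<bar>)) = exp (c * (\<Sum>k\<in>K. \<bar>z k\<bar>))" for z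
    by (simp add: exp_sum[OF assms] sum_distrib_left)
  ultimately show ?thesis by (simp add: gaussK_def)
qed

section \<open>Differentiation under the integral and Gaussian integration by parts\<close>

lemma DERIV_integral_dominated:
  fixes f f' :: "real \<Rightarrow> 'a \<Rightarrow> real"
  assumes ab: "a < t" "t < b"
    and meas: "\<And>x. a < x \<Longrightarrow> x < b \<Longrightarrow> integrable M (f x)"
    and meas': "f' t \<in> borel_measurable M"
    and der: "\<And>x \<omega>. a < x \<Longrightarrow> x < b \<Longrightarrow> \<omega> \<in> space M \<Longrightarrow> ((\<lambda>x. f x \<omega>) has_real_derivative f' x \<omega>) (at x)"
    and bd: "\<And>x \<omega>. a < x \<Longrightarrow> x < b \<Longrightarrow> \<omega> \<in> space M \<Longrightarrow> \<bar>f' x \<omega>\<bar> \<le> W \<omega>"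
    and W: "integrable M W"
  shows "((\<lambda>x. \<integral>\<omega>. f x \<omega> \<partial>M) has_real_derivative (\<integral>\<omega>. f' t \<omega> \<partial>M)) (at t)"
  unfolding has_field_derivative_iff tendsto_at_iff_sequentially comp_def
proof (intro allI impI)
  fix X :: "nat \<Rightarrow> real"
  assume X: "\<forall>i. X i \<in> UNIV - {t}" "X \<longlonglongrightarrow> t"
  have ev: "eventually (\<lambda>n. a < X n \<and> X n < b) sequentially"
    using order_tendstoD[OF X(2)] ab by (auto intro: eventually_conj)
  \<comment> \<open>The integrands are controlled only strictly between \<open>a\<close> and
    \<open>b\<close>, so the initial part of the sequence, which may lie outside, is cut
    off.\<close>
  then obtain n0 where n0: "\<And>n. n \<ge> n0 \<Longrightarrow> a < X n \<and> X n < b"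
    unfolding eventually_sequentially by auto
  define Y where "Y n = X (n + n0)" for n
  have Y: "a < Y n" "Y n < b" "Y n \<noteq> t" for n
    using n0[of "n + n0"] X(1) by (auto simp: Y_def)
  have Yt: "Y \<longlonglongrightarrow> t" unfolding Y_def by (rule LIMSEQ_ignore_initial_segment[OF X(2)])
  have it: "integrable M (f t)" using meas ab by auto
  have lim: "(\<lambda>n. \<integral>\<omega>. (f (Y n) \<omega> - f t \<omega>) / (Y n - t) \<partial>M) \<longlonglongrightarrow> (\<integral>\<omega>. f' t \<omega> \<partial>M)"
  proof (rule integral_dominated_convergence[OF meas' _ W])
    show "(\<lambda>\<omega>. (f (Y n) \<omega> - f t \<omega>) / (Y n - t)) \<in> borel_measurable M" for n
      using meas[OF Y(1,2)] it by (intro borel_measurable_divide borel_measurable_diff) auto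
    show "AE \<omega> in M. (\<lambda>n. (f (Y n) \<omega> - f t \<omega>) / (Y n - t)) \<longlonglongrightarrow> f' t \<omega>"
    proof (rule AE_I2)
      fix \<omega> assume "\<omega> \<in> space M"
      from der[OF ab this] show "(\<lambda>n. (f (Y n) \<omega> - f t \<omega>) / (Y n - t)) \<longlonglongrightarrow> f' t \<omega>"
        unfolding has_field_derivative_iff tendsto_at_iff_sequentially comp_def
        using Y(3) Yt by auto
    qed
    show "AE \<omega> in M. norm ((f (Y n) \<omega> - f t \<omega>) / (Y n - t)) \<le> W \<omega>" for n
    proof (rule AE_I2)
      fix \<omega> assume w: "\<omega> \<in> space M"
      \<comment> \<open>The mean value theorem turns the bound \<open>W\<close> on the derivative
        into a bound on every difference quotient, which is what dominated convergence
        needs.\<close>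
      have "\<exists>\<xi>. a < \<xi> \<and> \<xi> < b \<and> (f (Y n) \<omega> - f t \<omega>) / (Y n - t) = f' \<xi> \<omega>"
      proof (cases "t < Y n")
        case True
        have "\<exists>z>t. z < Y n \<and> f (Y n) \<omega> - f t \<omega> = (Y n - t) * f' z \<omega>"
          using Y(2)[of n] ab by (intro MVT2 True der w) auto
        then obtain z where "t < z" "z < Y n" "f (Y n) \<omega> - f t \<omega> = (Y n - t) * f' z \<omega>" by auto
        then show ?thesis using ab Y[of n] by (intro exI[of _ z]) auto
      next
        case False
        then have lt: "Y n < t" using Y(3)[of n] by auto
        have "\<exists>z>Y n. z < t \<and> f t \<omega> - f (Y n) \<omega> = (t - Y n) * f' z \<omega>"
          using Y(1)[of n] ab by (intro MVT2 lt der w) auto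
        then obtain z where z: "Y n < z" "z < t" "f t \<omega> - f (Y n) \<omega> = (t - Y n) * f' z \<omega>" by auto
        then have "f (Y n) \<omega> - f t \<omega> = f' z \<omega> * (Y n - t)" by (simp add: algebra_simps)
        then show ?thesis using z ab Y[of n] by (intro exI[of _ z]) auto
      qed
      then show "norm ((f (Y n) \<omega> - f t \<omega>) / (Y n - t)) \<le> W \<omega>" using bd w by (metis real_norm_def)
    qed
  qed
  have "(\<integral>\<omega>. (f (Y n) \<omega> - f t \<omega>) / (Y n - t) \<partial>M)
      = ((\<integral>\<omega>. f (Y n) \<omega> \<partial>M) - (\<integral>\<omega>. f t \<omega> \<partial>M)) / (Y n - t)" for n
    by (subst integral_divide_zero) (simp only: Bochner_Integration.integral_diff[OF meas[OF Y(1,2)] it])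
  then have "(\<lambda>n. ((\<integral>\<omega>. f (Y n) \<omega> \<partial>M) - (\<integral>\<omega>. f t \<omega> \<partial>M)) / (Y n - t)) \<longlonglongrightarrow> (\<integral>\<omega>. f' t \<omega> \<partial>M)"
    by (intro Lim_transform_eventually[OF lim always_eventually] allI)
  then have "(\<lambda>n. ((\<integral>\<omega>. f (X (n + n0)) \<omega> \<partial>M) - (\<integral>\<omega>. f t \<omega> \<partial>M)) / (X (n + n0) - t)) \<longlonglongrightarrow> (\<integral>\<omega>. f' t \<omega> \<partial>M)"
    by (simp only: Y_def)
  then show "(\<lambda>n. ((\<integral>\<omega>. f (X n) \<omega> \<partial>M) - (\<integral>\<omega>. f t \<omega> \<partial>M)) / (X n - t)) \<longlonglongrightarrow> (\<integral>\<omega>. f' t \<omega> \<partial>M)"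
    by (rule LIMSEQ_offset)
qed

text \<open>Differentiates the shift formula in direction \<open>k\<close> at
  \<open>\<epsilon> = 0\<close>: the shifted side gives the mean of \<open>g'\<close>, the weighted
  side the mean of \<open>z k * g z\<close>. No boundary terms arise, and exponential growth
  justifies both exchanges of derivative and integral.\<close>

lemma gaussK_integration_by_parts:
  fixes g g' :: "('k \<Rightarrow> real) \<Rightarrow> real"
  assumes K: "finite K" "k \<in> K"
    and [measurable]: "g \<in> borel_measurable (gaussK K)" "g' \<in> borel_measurable (gaussK K)"
    and der: "\<And>z. z \<in> space (gaussK K) \<Longrightarrow> ((\<lambda>y. g (z(k := y))) has_real_derivative g' z) (at (z k))"
    and bd: "\<And>z. z \<in> space (gaussK K) \<Longrightarrow> \<bar>g z\<bar> \<le> exp (c * (\<Sum>k\<in>K. \<bar>z k\<bar>) + d)"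
    and bd': "\<And>z. z \<in> space (gaussK K) \<Longrightarrow> \<bar>g' z\<bar> \<le> exp (c * (\<Sum>k\<in>K. \<bar>z k\<bar>) + d)"
    and c: "c \<ge> 0"
  shows "(\<integral>z. z k * g z \<partial>gaussK K) = (\<integral>z. g' z \<partial>gaussK K)"
proof -
  define N where "N z = (\<Sum>k\<in>K. \<bar>z k\<bar>)" for z :: "'k \<Rightarrow> real"
  have [measurable]: "N \<in> borel_measurable (gaussK K)" unfolding N_def by measurable
  have iN: "integrable (gaussK K) (\<lambda>z. exp (C * N z + D))" for C D
    using integrable_gaussK_exp_abs[OF K(1), of C] unfolding N_def
    by (simp add: exp_add)
  define sh where "sh \<epsilon> z = z(k := z k + \<epsilon>)" for \<epsilon> and z :: "'k \<Rightarrow> real"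
  have sp: "sh \<epsilon> z \<in> space (gaussK K)" if "z \<in> space (gaussK K)" for \<epsilon> z
    using that K(2) by (auto simp: space_gaussK sh_def PiE_iff extensional_def)
  have Nsh: "N (sh \<epsilon> z) \<le> N z + \<bar>\<epsilon>\<bar>" for \<epsilon> z
    unfolding N_def sh_def by (simp add: sum.remove[OF K])
  have [measurable]: "sh \<epsilon> \<in> measurable (gaussK K) (gaussK K)" for \<epsilon>
  proof -
    have "k \<in> K" by (rule K(2))
    have "(\<lambda>z. \<lambda>j\<in>K. z j + (if j = k then \<epsilon> else 0)) \<in> measurable (gaussK K) (gaussK K)"
      by measurable
    moreover have "sh \<epsilon> z = (\<lambda>j\<in>K. z j + (if j = k then \<epsilon> else 0))" if "z \<in> space (gaussK K)" for z
      using that K(2) by (auto simp: space_gaussK sh_def PiE_iff extensional_def)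
    ultimately show ?thesis by (simp cong: measurable_cong)
  qed
  have eq: "(\<integral>z. g (sh \<epsilon> z) \<partial>gaussK K) = (\<integral>z. exp (\<epsilon> * z k - \<epsilon>\<^sup>2 / 2) * g z \<partial>gaussK K)" for \<epsilon>
  proof -
    let ?a = "\<lambda>j. if j = k then \<epsilon> else 0"
    have "(\<integral>z. g (sh \<epsilon> z) \<partial>gaussK K) = (\<integral>z. g (\<lambda>j\<in>K. z j + ?a j) \<partial>gaussK K)"
    proof (rule Bochner_Integration.integral_cong[OF refl])
      fix z assume "z \<in> space (gaussK K)"
      then have "sh \<epsilon> z = (\<lambda>j\<in>K. z j + ?a j)"
        using K(2) by (auto simp: space_gaussK sh_def PiE_iff extensional_def)
      then show "g (sh \<epsilon> z) = g (\<lambda>j\<in>K. z j + ?a j)" by simp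
    qed
    also have "\<dots> = (\<integral>z. exp (\<Sum>j\<in>K. ?a j * z j - (?a j)\<^sup>2 / 2) * g z \<partial>gaussK K)"
      by (rule integral_gaussK_shift[OF K(1)]) measurable
    also have "(\<lambda>z. \<Sum>j\<in>K. ?a j * z j - (?a j)\<^sup>2 / 2) = (\<lambda>z. \<epsilon> * z k - \<epsilon>\<^sup>2 / 2)"
      by (rule ext, subst sum.remove[OF K]) (auto intro!: sum.neutral)
    finally show ?thesis .
  qed
  have D1: "((\<lambda>\<epsilon>. \<integral>z. g (sh \<epsilon> z) \<partial>gaussK K) has_real_derivative (\<integral>z. g' (sh 0 z) \<partial>gaussK K)) (at 0)"
  proof (rule DERIV_integral_dominated[where a = "-1" and b = 1 and W = "\<lambda>z. exp (c * N z + (c + d))"])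
    fix x :: real assume x: "-1 < x" "x < 1"
    have cN: "c * N (sh x z) + d \<le> c * N z + (c + d)" for z
    proof -
      have "c * N (sh x z) \<le> c * (N z + 1)"
        using Nsh[of x z] x c by (intro mult_left_mono) auto
      then show ?thesis by (simp add: algebra_simps)
    qed
    show "integrable (gaussK K) (\<lambda>z. g (sh x z))"
    proof (rule Bochner_Integration.integrable_bound[OF iN[of c "c + d"]])
      show "AE z in gaussK K. norm (g (sh x z)) \<le> norm (exp (c * N z + (c + d)))"
      proof (rule AE_I2)
        fix z assume "z \<in> space (gaussK K)"
        from bd[OF sp[OF this], folded N_def, of x] cN[of z]
        show "norm (g (sh x z)) \<le> norm (exp (c * N z + (c + d)))"
          by (smt (verit) exp_le_cancel_iff real_norm_def)
      qed
    qed measurable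
    fix z assume z: "z \<in> space (gaussK K)"
    from bd'[OF sp[OF z], folded N_def, of x] cN[of z]
    show "\<bar>g' (sh x z)\<bar> \<le> exp (c * N z + (c + d))"
      by (smt (verit) exp_le_cancel_iff real_norm_def)
    have "((\<lambda>y. g ((sh x z)(k := y))) has_real_derivative g' (sh x z)) (at (z k + x))"
      using der[OF sp[OF z], of x] by (simp add: sh_def)
    then have "((\<lambda>y. g (z(k := y))) has_real_derivative g' (sh x z)) (at (z k + x))"
      by (simp add: sh_def)
    then show "((\<lambda>x. g (sh x z)) has_real_derivative g' (sh x z)) (at x)"
      using DERIV_shift[of "\<lambda>y. g (z(k := y))" "g' (sh x z)" x "z k"]
      by (simp add: sh_def add.commute)
  qed (auto intro: iN)
  have D2: "((\<lambda>\<epsilon>. \<integral>z. exp (\<epsilon> * z k - \<epsilon>\<^sup>2 / 2) * g z \<partial>gaussK K) has_real_derivative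
      (\<integral>z. (z k - 0) * exp (0 * z k - 0\<^sup>2 / 2) * g z \<partial>gaussK K)) (at 0)"
  proof (rule DERIV_integral_dominated[where a = "-1" and b = 1 and W = "\<lambda>z. exp ((c + 2) * N z + (1 + d))"
        and f' = "\<lambda>x z. (z k - x) * exp (x * z k - x\<^sup>2 / 2) * g z"])
    have zN: "\<bar>z k\<bar> \<le> N z" for z
      unfolding N_def using K by (intro member_le_sum) auto
    fix x :: real assume x: "-1 < x" "x < 1"
    have e: "exp (x * z k - x\<^sup>2 / 2) \<le> exp (N z)" for z
    proof -
      have "x * z k \<le> \<bar>x\<bar> * \<bar>z k\<bar>" by (metis abs_ge_self abs_mult)
      also have "\<dots> \<le> 1 * \<bar>z k\<bar>" using x by (intro mult_right_mono) auto
      also have "\<dots> \<le> N z" using zN by simp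
      finally show ?thesis by (smt (verit) exp_le_cancel_iff zero_le_power2 divide_nonneg_nonneg)
    qed
    have gg: "\<bar>exp (x * z k - x\<^sup>2 / 2) * g z\<bar> \<le> exp ((c + 1) * N z + d)" if "z \<in> space (gaussK K)" for z
    proof -
      have "\<bar>exp (x * z k - x\<^sup>2 / 2) * g z\<bar> \<le> exp (N z) * exp (c * N z + d)"
        using bd[OF that, folded N_def] e[of z] by (simp add: abs_mult mult_mono)
      then show ?thesis by (simp add: exp_add[symmetric] algebra_simps)
    qed
    show "integrable (gaussK K) (\<lambda>z. exp (x * z k - x\<^sup>2 / 2) * g z)"
    proof (rule Bochner_Integration.integrable_bound[OF iN[of "c + 1" d]])
      show "AE z in gaussK K. norm (exp (x * z k - x\<^sup>2 / 2) * g z) \<le> norm (exp ((c + 1) * N z + d))"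
        using gg by (intro AE_I2) simp
    qed (use K in measurable)
    fix z assume z: "z \<in> space (gaussK K)"
    have "\<bar>z k - x\<bar> \<le> exp (N z + 1)"
      using zN[of z] x exp_ge_add_one_self[of "N z + 1"] by linarith
    then have "\<bar>z k - x\<bar> * \<bar>exp (x * z k - x\<^sup>2 / 2) * g z\<bar> \<le> exp (N z + 1) * exp ((c + 1) * N z + d)"
      using gg[OF z] by (intro mult_mono) auto
    moreover have "exp (N z + 1) * exp ((c + 1) * N z + d) = exp ((c + 2) * N z + (1 + d))"
      by (simp add: exp_add[symmetric] algebra_simps)
    ultimately show "\<bar>(z k - x) * exp (x * z k - x\<^sup>2 / 2) * g z\<bar> \<le> exp ((c + 2) * N z + (1 + d))"
      by (simp add: abs_mult mult.assoc)
    show "((\<lambda>x. exp (x * z k - x\<^sup>2 / 2) * g z) has_real_derivative (z k - x) * exp (x * z k - x\<^sup>2 / 2) * g z) (at x)"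
      by (auto intro!: derivative_eq_intros simp: algebra_simps)
  qed (use K in \<open>auto intro: iN\<close>)
  show ?thesis using DERIV_unique[OF D1[unfolded eq] D2] by (simp add: sh_def)
qed

lemma continuous_on_integral_dominated:
  fixes f :: "real \<Rightarrow> 'a \<Rightarrow> real"
  assumes meas: "\<And>x. x \<in> A \<Longrightarrow> f x \<in> borel_measurable M"
    and cont: "\<And>\<omega>. \<omega> \<in> space M \<Longrightarrow> continuous_on A (\<lambda>x. f x \<omega>)"
    and bd: "\<And>x \<omega>. x \<in> A \<Longrightarrow> \<omega> \<in> space M \<Longrightarrow> \<bar>f x \<omega>\<bar> \<le> W \<omega>"
    and W: "integrable M W"
  shows "continuous_on A (\<lambda>x. \<integral>\<omega>. f x \<omega> \<partial>M)"
  unfolding continuous_on_sequentially comp_def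
proof (intro allI ballI impI, elim conjE)
  fix X :: "nat \<Rightarrow> real" and a
  assume X: "a \<in> A" "\<forall>n. X n \<in> A" "X \<longlonglongrightarrow> a"
  show "(\<lambda>n. \<integral>\<omega>. f (X n) \<omega> \<partial>M) \<longlonglongrightarrow> (\<integral>\<omega>. f a \<omega> \<partial>M)"
  proof (rule integral_dominated_convergence[OF _ _ W])
    show "AE \<omega> in M. (\<lambda>n. f (X n) \<omega>) \<longlonglongrightarrow> f a \<omega>"
      using cont X unfolding continuous_on_sequentially comp_def by (intro AE_I2) blast
  qed (use X meas bd in auto)
qed

lemma gaussK_integrable_bounded:
  assumes "finite K" "f \<in> borel_measurable (gaussK K)"
    and "\<And>z. z \<in> space (gaussK K) \<Longrightarrow> \<bar>f z\<bar> \<le> exp (c * (\<Sum>k\<in>K. \<bar>z k\<bar>) + d)"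
  shows "integrable (gaussK K) f"
proof (rule Bochner_Integration.integrable_bound)
  show "integrable (gaussK K) (\<lambda>z. exp (c * (\<Sum>k\<in>K. \<bar>z k\<bar>) + d))"
    using integrable_gaussK_exp_abs[OF assms(1), of c] by (simp add: exp_add)
  show "AE z in gaussK K. norm (f z) \<le> norm (exp (c * (\<Sum>k\<in>K. \<bar>z k\<bar>) + d))"
    by (rule AE_I2) (simp add: assms(3))
qed (rule assms(2))

text \<open>Common core of the two derivative computations in the signal-to-noise ratios. The noise
  enters as \<open>sqrt (s k) * z k\<close>, so the derivative along the segment carries
  \<open>z k / (2 * sqrt (s k))\<close>; integration by parts trades it for
  \<open>(Q + R) / 2\<close>, and \<open>Q / 2\<close> cancels against the drift that comes from the
  quadratic term of the log-likelihood. Only \<open>R\<close> survives.\<close>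

lemma gaussK_heat_flow:
  fixes \<Psi> :: "real \<Rightarrow> ('k \<Rightarrow> real) \<Rightarrow> real" and G Q R :: "real \<Rightarrow> 'k \<Rightarrow> ('k \<Rightarrow> real) \<Rightarrow> real"
    and s0 s1 :: "'k \<Rightarrow> real" and K :: "'k set"
  defines "s \<equiv> \<lambda>\<tau> k. s0 k + \<tau> * (s1 k - s0 k)"
  defines "N \<equiv> \<lambda>z. \<Sum>k\<in>K. \<bar>z k :: real\<bar>"
  assumes K: "finite K"
    and s0: "\<And>k. k \<in> K \<Longrightarrow> s0 k \<ge> 0" and s1: "\<And>k. k \<in> K \<Longrightarrow> s1 k \<ge> 0"
    and \<tau>: "0 < \<tau>" "\<tau> < 1" and c: "c \<ge> 0"
    and meas: "\<And>t. 0 < t \<Longrightarrow> t < 1 \<Longrightarrow> \<Psi> t \<in> borel_measurable (gaussK K)"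
      "\<And>t k. 0 < t \<Longrightarrow> t < 1 \<Longrightarrow> k \<in> K \<Longrightarrow> G t k \<in> borel_measurable (gaussK K)"
      "\<And>t k. 0 < t \<Longrightarrow> t < 1 \<Longrightarrow> k \<in> K \<Longrightarrow> Q t k \<in> borel_measurable (gaussK K)"
      "\<And>t k. 0 < t \<Longrightarrow> t < 1 \<Longrightarrow> k \<in> K \<Longrightarrow> R t k \<in> borel_measurable (gaussK K)"
    and bd: "\<And>t z. 0 < t \<Longrightarrow> t < 1 \<Longrightarrow> \<bar>\<Psi> t z\<bar> \<le> exp (c * N z + d)"
      "\<And>t k z. 0 < t \<Longrightarrow> t < 1 \<Longrightarrow> k \<in> K \<Longrightarrow> \<bar>G t k z\<bar> \<le> exp (c * N z + d)"
      "\<And>t k z. 0 < t \<Longrightarrow> t < 1 \<Longrightarrow> k \<in> K \<Longrightarrow> \<bar>Q t k z\<bar> \<le> exp (c * N z + d)"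
      "\<And>t k z. 0 < t \<Longrightarrow> t < 1 \<Longrightarrow> k \<in> K \<Longrightarrow> \<bar>R t k z\<bar> \<le> exp (c * N z + d)"
    and der: "\<And>t z. 0 < t \<Longrightarrow> t < 1 \<Longrightarrow> ((\<lambda>t. \<Psi> t z) has_real_derivative
        (\<Sum>k\<in>K. (s1 k - s0 k) * (z k / (2 * sqrt (s t k)) * G t k z - Q t k z / 2))) (at t)"
    and der': "\<And>t k z. 0 < t \<Longrightarrow> t < 1 \<Longrightarrow> k \<in> K \<Longrightarrow> ((\<lambda>y. G t k (z(k := y))) has_real_derivative
        sqrt (s t k) * (Q t k z + R t k z)) (at (z k))"
  shows "((\<lambda>t. \<integral>z. \<Psi> t z \<partial>gaussK K) has_real_derivative
      (\<Sum>k\<in>K. (s1 k - s0 k) * (\<integral>z. R \<tau> k z \<partial>gaussK K) / 2)) (at \<tau>)"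
proof -
  \<comment> \<open>The factor \<open>1 / sqrt (s t k)\<close> can blow up only at the ends of the
    segment; staying \<open>\<eta>\<close> away from them makes it bounded in terms of
    \<open>m k\<close>.\<close>
  define \<eta> where "\<eta> = min \<tau> (1 - \<tau>) / 2"
  have \<eta>: "0 < \<eta>" "\<eta> < \<tau>" "\<tau> < 1 - \<eta>" using \<tau> by (auto simp: \<eta>_def min_def field_simps)
  define v where "v k = s1 k - s0 k" for k
  define m where "m k = 1 / (2 * sqrt (\<eta> * (s0 k + s1 k)))" for k
  define C where "C = (\<Sum>k\<in>K. \<bar>v k\<bar> * (m k + 1))"
  define D where "D t z = (\<Sum>k\<in>K. v k * (z k / (2 * sqrt (s t k)) * G t k z - Q t k z / 2))" for t z
  have [measurable]: "N \<in> borel_measurable (gaussK K)" unfolding N_def by measurable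
  have zN: "\<bar>z k\<bar> \<le> N z" if "k \<in> K" for k z
    unfolding N_def using K that by (intro member_le_sum) auto
  have N0: "N z \<ge> 0" for z unfolding N_def by (intro sum_nonneg) auto
  have int: "integrable (gaussK K) f" if "f \<in> borel_measurable (gaussK K)" "\<And>z. \<bar>f z\<bar> \<le> exp (a * N z + b)" for f a b
    by (rule gaussK_integrable_bounded[OF K that(1) that(2)[unfolded N_def]])
  \<comment> \<open>A coordinate whose ratio moves has a positive ratio at one end, hence in the
    whole open segment. Coordinates with \<open>v k = 0\<close> may have ratio zero, but their
    contribution carries the factor \<open>v k\<close>.\<close>
  have spos: "s t k > 0" if "k \<in> K" "v k \<noteq> 0" "0 < t" "t < 1" for t k
  proof -
    have "s t k = (1 - t) * s0 k + t * s1 k" by (simp add: s_def algebra_simps)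
    moreover have "s0 k > 0 \<or> s1 k > 0" using that s0[of k] s1[of k] by (auto simp: v_def)
    ultimately show ?thesis using s0[of k] s1[of k] that
      by (smt (verit) mult_pos_pos mult_nonneg_nonneg)
  qed
  have sm: "1 / (2 * sqrt (s t k)) \<le> m k" if "k \<in> K" "v k \<noteq> 0" "\<eta> < t" "t < 1 - \<eta>" for t k
  proof -
    have "s t k = (1 - t) * s0 k + t * s1 k" by (simp add: s_def algebra_simps)
    also have "\<dots> \<ge> \<eta> * s0 k + \<eta> * s1 k"
      using that s0[of k] s1[of k] by (intro add_mono mult_right_mono) auto
    finally have le: "\<eta> * (s0 k + s1 k) \<le> s t k" by (simp add: algebra_simps)
    have "s0 k + s1 k > 0" using that s0[of k] s1[of k] by (auto simp: v_def)
    then have "0 < \<eta> * (s0 k + s1 k)" using \<eta> by simp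
    with le show ?thesis unfolding m_def
      by (intro divide_left_mono mult_left_mono) auto
  qed
  have Dbd: "\<bar>D t z\<bar> \<le> C * exp ((c + 1) * N z + d)" if t: "\<eta> < t" "t < 1 - \<eta>" for t z
  proof -
    have t': "0 < t" "t < 1" using t \<eta> by auto
    let ?E = "exp (c * N z + d)"
    have "\<bar>v k * (z k / (2 * sqrt (s t k)) * G t k z - Q t k z / 2)\<bar> \<le> \<bar>v k\<bar> * (m k + 1) * exp ((c + 1) * N z + d)"
      if k: "k \<in> K" for k
    proof (cases "v k = 0")
      case False
      have m0: "m k \<ge> 0" unfolding m_def using s0[OF k] s1[OF k] \<eta> by simp
      have "\<bar>z k / (2 * sqrt (s t k)) * G t k z - Q t k z / 2\<bar>
          \<le> \<bar>z k / (2 * sqrt (s t k)) * G t k z\<bar> + \<bar>Q t k z\<bar>" by linarith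
      also have "\<bar>z k / (2 * sqrt (s t k)) * G t k z\<bar> = \<bar>z k\<bar> * (1 / (2 * sqrt (s t k))) * \<bar>G t k z\<bar>"
        using spos[OF k False t'] by (simp add: abs_mult)
      also have "\<dots> \<le> N z * m k * ?E"
        using zN[OF k] sm[OF k False t] bd(2)[OF t' k] m0 spos[OF k False t'] N0
        by (intro mult_mono) auto
      also have "\<bar>Q t k z\<bar> \<le> ?E" by (rule bd(3)[OF t' k])
      also have "N z * m k * ?E + ?E \<le> (m k + 1) * (exp (N z) * ?E)"
      proof -
        have "N z * (m k * ?E) \<le> exp (N z) * (m k * ?E)"
          using m0 exp_ge_add_one_self[of "N z"] by (intro mult_right_mono) (linarith | simp)+
        moreover have "1 * ?E \<le> exp (N z) * ?E" using N0[of z] by (intro mult_right_mono) auto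
        moreover have "(m k + 1) * (exp (N z) * ?E) = exp (N z) * (m k * ?E) + exp (N z) * ?E"
          by (simp add: ring_distribs)
        moreover have "N z * m k * ?E = N z * (m k * ?E)" by (simp only: mult.assoc)
        ultimately show ?thesis by linarith
      qed
      also have "exp (N z) * ?E = exp ((c + 1) * N z + d)"
        by (simp add: exp_add[symmetric] algebra_simps)
      finally have "\<bar>z k / (2 * sqrt (s t k)) * G t k z - Q t k z / 2\<bar> \<le> (m k + 1) * exp ((c + 1) * N z + d)" by simp
      then show ?thesis by (simp add: abs_mult mult.assoc mult_left_mono)
    qed simp
    then have "(\<Sum>k\<in>K. \<bar>v k * (z k / (2 * sqrt (s t k)) * G t k z - Q t k z / 2)\<bar>)
        \<le> (\<Sum>k\<in>K. \<bar>v k\<bar> * (m k + 1) * exp ((c + 1) * N z + d))"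
      by (rule sum_mono)
    also have "\<dots> = C * exp ((c + 1) * N z + d)"
      by (simp only: C_def sum_distrib_right)
    finally show ?thesis unfolding D_def by (rule order_trans[OF sum_abs])
  qed
  have Dm: "D \<tau> \<in> borel_measurable (gaussK K)"
    unfolding D_def using meas(2,3)[OF \<tau>] by measurable
  have "((\<lambda>t. \<integral>z. \<Psi> t z \<partial>gaussK K) has_real_derivative (\<integral>z. D \<tau> z \<partial>gaussK K)) (at \<tau>)"
  proof (rule DERIV_integral_dominated[where f' = D and a = \<eta> and b = "1 - \<eta>"
        and W = "\<lambda>z. C * exp ((c + 1) * N z + d)"])
    show "integrable (gaussK K) (\<lambda>z. C * exp ((c + 1) * N z + d))"
      by (intro integrable_mult_right int) auto
    show "integrable (gaussK K) (\<Psi> x)" if "\<eta> < x" "x < 1 - \<eta>" for x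
      using that \<eta> by (intro int[OF meas(1) bd(1)]) auto
    show "((\<lambda>x. \<Psi> x z) has_real_derivative D x z) (at x)" if "\<eta> < x" "x < 1 - \<eta>" for x z
      unfolding D_def v_def using that \<eta> by (intro der) auto
  qed (use \<eta> Dm Dbd in auto)
  also have "(\<integral>z. D \<tau> z \<partial>gaussK K) = (\<Sum>k\<in>K. v k * (\<integral>z. R \<tau> k z \<partial>gaussK K) / 2)"
  proof -
    have part: "integrable (gaussK K) (\<lambda>z. v k * (z k / (2 * sqrt (s \<tau> k)) * G \<tau> k z - Q \<tau> k z / 2)) \<and>
        (\<integral>z. v k * (z k / (2 * sqrt (s \<tau> k)) * G \<tau> k z - Q \<tau> k z / 2) \<partial>gaussK K)
          = v k * (\<integral>z. R \<tau> k z \<partial>gaussK K) / 2" if k: "k \<in> K" for k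
    proof (cases "v k = 0")
      case False
      have [measurable]: "G \<tau> k \<in> borel_measurable (gaussK K)" "Q \<tau> k \<in> borel_measurable (gaussK K)"
          "R \<tau> k \<in> borel_measurable (gaussK K)" "(\<lambda>z. z k) \<in> borel_measurable (gaussK K)"
        using meas(2-)[OF \<tau> k] k by (auto simp: gaussK_def)
      define r where "r = sqrt (s \<tau> k)"
      have r: "r > 0" using spos[OF k False \<tau>] by (simp add: r_def)
      have iQ: "integrable (gaussK K) (Q \<tau> k)" and iR: "integrable (gaussK K) (R \<tau> k)"
        by (rule int[OF _ bd(3)[OF \<tau> k]], simp) (rule int[OF _ bd(4)[OF \<tau> k]], simp)
      have izG: "integrable (gaussK K) (\<lambda>z. z k * G \<tau> k z)"
      proof (rule int[where a = "c + 1" and b = d])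
        fix z
        have "\<bar>z k\<bar> * \<bar>G \<tau> k z\<bar> \<le> exp (N z) * exp (c * N z + d)"
          using zN[OF k, of z] exp_ge_add_one_self[of "N z"] bd(2)[OF \<tau> k, of z]
          by (intro mult_mono) (linarith | simp)+
        then show "\<bar>z k * G \<tau> k z\<bar> \<le> exp ((c + 1) * N z + d)"
          by (simp add: abs_mult exp_add[symmetric] algebra_simps)
      qed measurable
      have "(\<integral>z. z k * G \<tau> k z \<partial>gaussK K) = (\<integral>z. r * (Q \<tau> k z + R \<tau> k z) \<partial>gaussK K)"
      proof (rule gaussK_integration_by_parts[OF K k, where c = c and d = "d + 2 * r"])
        fix z
        show "((\<lambda>y. G \<tau> k (z(k := y))) has_real_derivative r * (Q \<tau> k z + R \<tau> k z)) (at (z k))"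
          unfolding r_def by (rule der'[OF \<tau> k])
        show "\<bar>G \<tau> k z\<bar> \<le> exp (c * (\<Sum>k\<in>K. \<bar>z k\<bar>) + (d + 2 * r))"
          using bd(2)[OF \<tau> k, of z] r unfolding N_def by (smt (verit) exp_le_cancel_iff)
        have "\<bar>r * (Q \<tau> k z + R \<tau> k z)\<bar> \<le> r * (2 * exp (c * N z + d))"
          using bd(3,4)[OF \<tau> k, of z] r by (simp add: abs_mult)
        also have "\<dots> = (2 * r) * exp (c * N z + d)" by simp
        also have "\<dots> \<le> exp (2 * r) * exp (c * N z + d)"
          using exp_ge_add_one_self[of "2 * r"] by (intro mult_right_mono) (linarith | simp)+
        finally show "\<bar>r * (Q \<tau> k z + R \<tau> k z)\<bar> \<le> exp (c * (\<Sum>k\<in>K. \<bar>z k\<bar>) + (d + 2 * r))"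
          by (simp add: exp_add[symmetric] algebra_simps N_def)
      qed (use c in measurable)
      also have "\<dots> = r * ((\<integral>z. Q \<tau> k z \<partial>gaussK K) + (\<integral>z. R \<tau> k z \<partial>gaussK K))"
        using iQ iR by simp
      finally have I: "(\<integral>z. z k * G \<tau> k z \<partial>gaussK K)
          = r * ((\<integral>z. Q \<tau> k z \<partial>gaussK K) + (\<integral>z. R \<tau> k z \<partial>gaussK K))" .
      have e: "v k * (z k / (2 * sqrt (s \<tau> k)) * G \<tau> k z - Q \<tau> k z / 2)
          = (v k / (2 * r)) * (z k * G \<tau> k z) - (v k / 2) * Q \<tau> k z" for z
        by (simp add: r_def field_simps)
      have i1: "integrable (gaussK K) (\<lambda>z. (v k / (2 * r)) * (z k * G \<tau> k z))"
        and i2: "integrable (gaussK K) (\<lambda>z. (v k / 2) * Q \<tau> k z)"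
        using izG iQ by (auto intro: integrable_mult_right)
      have "(\<integral>z. (v k / (2 * r)) * (z k * G \<tau> k z) - (v k / 2) * Q \<tau> k z \<partial>gaussK K)
          = (v k / (2 * r)) * (r * ((\<integral>z. Q \<tau> k z \<partial>gaussK K) + (\<integral>z. R \<tau> k z \<partial>gaussK K)))
            - (v k / 2) * (\<integral>z. Q \<tau> k z \<partial>gaussK K)"
        by (simp only: Bochner_Integration.integral_diff[OF i1 i2] integral_mult_right_zero I)
      also have "\<dots> = v k * (\<integral>z. R \<tau> k z \<partial>gaussK K) / 2"
        using r by (simp add: field_simps)
      finally show ?thesis
        unfolding e by (rule conjI[OF Bochner_Integration.integrable_diff[OF i1 i2]])
    qed simp
    have "(\<integral>z. D \<tau> z \<partial>gaussK K)
        = (\<Sum>k\<in>K. \<integral>z. v k * (z k / (2 * sqrt (s \<tau> k)) * G \<tau> k z - Q \<tau> k z / 2) \<partial>gaussK K)"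
      unfolding D_def by (rule Bochner_Integration.integral_sum) (rule part[THEN conjunct1])
    also have "\<dots> = (\<Sum>k\<in>K. v k * (\<integral>z. R \<tau> k z \<partial>gaussK K) / 2)"
      by (rule sum.cong[OF refl]) (rule part[THEN conjunct2])
    finally show ?thesis .
  qed
  finally show ?thesis unfolding v_def .
qed

section \<open>Gaussian channels with a finite input alphabet\<close>

text \<open>The input is drawn from \<open>\<Omega>\<close> with weights \<open>w\<close>, and
  channel \<open>k\<close> returns \<open>sqrt (s k) * u k x\<close> plus unit noise. The ratios
  \<open>s\<close> are not fixed by the locale, because the free energy is studied as a function of
  them.\<close>

locale finite_channel =
  fixes K :: "'k set" and \<Omega> :: "'x set" and w :: "'x \<Rightarrow> real" and u :: "'k \<Rightarrow> 'x \<Rightarrow> real"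
  assumes finite_K: "finite K" and finite_\<Omega>: "finite \<Omega>"
    and w_nonneg: "\<And>x. x \<in> \<Omega> \<Longrightarrow> w x \<ge> 0" and sum_w: "(\<Sum>x\<in>\<Omega>. w x) = 1"
begin

text \<open>Log-likelihood ratio of the observation \<open>z\<close> under input \<open>x\<close>
  against pure noise.\<close>

definition expo :: "('k \<Rightarrow> real) \<Rightarrow> ('k \<Rightarrow> real) \<Rightarrow> 'x \<Rightarrow> real" where
  "expo s z x = (\<Sum>k\<in>K. sqrt (s k) * z k * u k x - s k * (u k x)\<^sup>2 / 2)"

definition wsum :: "('k \<Rightarrow> real) \<Rightarrow> ('k \<Rightarrow> real) \<Rightarrow> ('x \<Rightarrow> real) \<Rightarrow> real" where
  "wsum s z f = (\<Sum>x\<in>\<Omega>. w x * exp (expo s z x) * f x)"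

abbreviation Z :: "('k \<Rightarrow> real) \<Rightarrow> ('k \<Rightarrow> real) \<Rightarrow> real" where
  "Z s z \<equiv> wsum s z (\<lambda>_. 1)"

definition gibbs :: "('k \<Rightarrow> real) \<Rightarrow> ('k \<Rightarrow> real) \<Rightarrow> ('x \<Rightarrow> real) \<Rightarrow> real" where
  "gibbs s z f = wsum s z f / Z s z"

text \<open>Expectation over input and noise of a quantity that sees both the input
  \<open>x0\<close> and the observation.\<close>

definition planted :: "('k \<Rightarrow> real) \<Rightarrow> ('x \<Rightarrow> ('k \<Rightarrow> real) \<Rightarrow> real) \<Rightarrow> real" where
  "planted s A = (\<Sum>x0\<in>\<Omega>. w x0 * (\<integral>z. A x0 (\<lambda>k\<in>K. z k + sqrt (s k) * u k x0) \<partial>gaussK K))"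

text \<open>Relative entropy of the law of the observation with respect to pure noise.\<close>

definition free_energy :: "('k \<Rightarrow> real) \<Rightarrow> real" where
  "free_energy s = planted s (\<lambda>_ z. ln (Z s z))"

lemma exists_pos_w: "\<exists>x\<in>\<Omega>. w x > 0"
proof (rule ccontr)
  assume "\<not> ?thesis"
  then have "w x = 0" if "x \<in> \<Omega>" for x using w_nonneg[OF that] that by force
  then show False using sum_w by simp
qed

lemma Z_pos: "Z s z > 0"
proof -
  obtain x where x: "x \<in> \<Omega>" "w x > 0" using exists_pos_w by auto
  then have "0 < w x * exp (expo s z x)" by simp
  also have "\<dots> \<le> Z s z" unfolding wsum_def using x w_nonneg
    by (auto intro!: member_le_sum[of x \<Omega> "\<lambda>x. w x * exp (expo s z x)"] finite_\<Omega>)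
  finally show ?thesis .
qed

lemma measurable_expo [measurable]: "(\<lambda>z. expo s z x) \<in> borel_measurable (gaussK K)"
  unfolding expo_def by measurable

lemma measurable_wsum [measurable]:
  assumes "\<And>x. x \<in> \<Omega> \<Longrightarrow> (\<lambda>z. f z x) \<in> borel_measurable (gaussK K)"
  shows "(\<lambda>z. wsum s z (f z)) \<in> borel_measurable (gaussK K)"
  unfolding wsum_def using assms by measurable

lemma measurable_wsum' [measurable]: "(\<lambda>z. wsum s z f) \<in> borel_measurable (gaussK K)"
  by (rule measurable_wsum) simp

lemma measurable_gibbs [measurable]: "(\<lambda>z. gibbs s z f) \<in> borel_measurable (gaussK K)"
  unfolding gibbs_def by measurable

lemma wsum_cong: "(\<And>x. x \<in> \<Omega> \<Longrightarrow> f x = g x) \<Longrightarrow> wsum s z f = wsum s z g"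
  unfolding wsum_def by (intro sum.cong) auto

lemma wsum_mono: "(\<And>x. x \<in> \<Omega> \<Longrightarrow> f x \<le> g x) \<Longrightarrow> wsum s z f \<le> wsum s z g"
  unfolding wsum_def using w_nonneg by (intro sum_mono mult_left_mono) auto

lemma wsum_add: "wsum s z (\<lambda>x. f x + g x) = wsum s z f + wsum s z g"
  unfolding wsum_def by (simp add: algebra_simps sum.distrib)

lemma wsum_diff: "wsum s z (\<lambda>x. f x - g x) = wsum s z f - wsum s z g"
  unfolding wsum_def by (simp add: algebra_simps sum_subtractf)

lemma wsum_cmult: "wsum s z (\<lambda>x. c * f x) = c * wsum s z f"
  unfolding wsum_def sum_distrib_left by (intro sum.cong) auto

lemma wsum_multc: "wsum s z (\<lambda>x. f x * c) = wsum s z f * c"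
  unfolding wsum_def sum_distrib_right by (intro sum.cong) auto

lemma wsum_sum: "wsum s z (\<lambda>x. \<Sum>i\<in>I. f i x) = (\<Sum>i\<in>I. wsum s z (f i))"
  unfolding wsum_def by (simp add: sum_distrib_left) (rule sum.swap)

lemma wsum_const: "wsum s z (\<lambda>_. c) = c * Z s z"
  using wsum_cmult[of s z c "\<lambda>_. 1"] by simp

lemma wsum_eq_gibbs: "wsum s z f = Z s z * gibbs s z f"
  unfolding gibbs_def using Z_pos[of s z] by simp

lemma gibbs_cong: "(\<And>x. x \<in> \<Omega> \<Longrightarrow> f x = g x) \<Longrightarrow> gibbs s z f = gibbs s z g"
  unfolding gibbs_def using wsum_cong by metis

lemma gibbs_mono: "(\<And>x. x \<in> \<Omega> \<Longrightarrow> f x \<le> g x) \<Longrightarrow> gibbs s z f \<le> gibbs s z g"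
  unfolding gibbs_def using wsum_mono Z_pos by (simp add: divide_right_mono less_imp_le)

lemma gibbs_add: "gibbs s z (\<lambda>x. f x + g x) = gibbs s z f + gibbs s z g"
  unfolding gibbs_def by (simp add: wsum_add add_divide_distrib)

lemma gibbs_diff: "gibbs s z (\<lambda>x. f x - g x) = gibbs s z f - gibbs s z g"
  unfolding gibbs_def by (simp add: wsum_diff diff_divide_distrib)

lemma gibbs_cmult: "gibbs s z (\<lambda>x. c * f x) = c * gibbs s z f"
  unfolding gibbs_def by (simp add: wsum_cmult)

lemma gibbs_multc: "gibbs s z (\<lambda>x. f x * c) = gibbs s z f * c"
  unfolding gibbs_def by (simp add: wsum_multc)

lemma gibbs_sum: "gibbs s z (\<lambda>x. \<Sum>i\<in>I. f i x) = (\<Sum>i\<in>I. gibbs s z (f i))"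
  unfolding gibbs_def by (simp add: wsum_sum sum_divide_distrib)

lemma gibbs_const [simp]: "gibbs s z (\<lambda>_. c) = c"
proof -
  have "wsum s z (\<lambda>_. c) = c * Z s z" by (rule wsum_const)
  then show ?thesis unfolding gibbs_def using Z_pos[of s z] by (metis less_irrefl nonzero_mult_div_cancel_right)
qed

lemma gibbs_abs_le:
  assumes "\<And>x. x \<in> \<Omega> \<Longrightarrow> \<bar>f x\<bar> \<le> c" shows "\<bar>gibbs s z f\<bar> \<le> c"
proof -
  have "gibbs s z f \<le> gibbs s z (\<lambda>_. c)"
    by (rule gibbs_mono) (use assms in \<open>force simp: abs_le_iff\<close>)
  moreover have "gibbs s z (\<lambda>_. - c) \<le> gibbs s z f"
    by (rule gibbs_mono) (use assms in \<open>force simp: abs_le_iff\<close>)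
  ultimately show ?thesis by (simp add: abs_le_iff)
qed

lemma wsum_abs_le:
  assumes "\<And>x. x \<in> \<Omega> \<Longrightarrow> \<bar>f x\<bar> \<le> c" shows "\<bar>wsum s z f\<bar> \<le> c * Z s z"
proof -
  have "\<bar>wsum s z f\<bar> = \<bar>gibbs s z f\<bar> * Z s z"
    unfolding wsum_eq_gibbs[of s z f] using Z_pos[of s z] by (simp add: abs_mult)
  also have "\<dots> \<le> c * Z s z"
    using gibbs_abs_le[OF assms] Z_pos[of s z] by (intro mult_right_mono) auto
  finally show ?thesis .
qed

end

section \<open>Functions of exponential growth\<close>

text \<open>Exponential growth in the sum of the absolute coordinates is stable under sums, products
  and shifts and is integrable against Gaussian noise, so integrability can be read off from the
  syntax of an expression.\<close>

definition tame :: "'k set \<Rightarrow> (('k \<Rightarrow> real) \<Rightarrow> real) \<Rightarrow> bool" where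
  "tame K f \<longleftrightarrow> f \<in> borel_measurable (gaussK K) \<and>
    (\<exists>c d. c \<ge> 0 \<and> (\<forall>z. \<bar>f z\<bar> \<le> exp (c * (\<Sum>k\<in>K. \<bar>z k\<bar>) + d)))"

lemma tameI:
  assumes "f \<in> borel_measurable (gaussK K)" "c \<ge> 0" "\<And>z. \<bar>f z\<bar> \<le> exp (c * (\<Sum>k\<in>K. \<bar>z k\<bar>) + d)"
  shows "tame K f"
  using assms unfolding tame_def by blast

lemma tame_measurable: "tame K f \<Longrightarrow> f \<in> borel_measurable (gaussK K)"
  by (simp add: tame_def)

lemma tame_integrable: "finite K \<Longrightarrow> tame K f \<Longrightarrow> integrable (gaussK K) f"
  unfolding tame_def by (auto intro: gaussK_integrable_bounded)

lemma tame_mult: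
  assumes "tame K f" "tame K g" shows "tame K (\<lambda>z. f z * g z)"
proof -
  from assms obtain c d c' d' where h: "c \<ge> 0" "\<And>z. \<bar>f z\<bar> \<le> exp (c * (\<Sum>k\<in>K. \<bar>z k\<bar>) + d)"
    "c' \<ge> 0" "\<And>z. \<bar>g z\<bar> \<le> exp (c' * (\<Sum>k\<in>K. \<bar>z k\<bar>) + d')" unfolding tame_def by blast
  show ?thesis
  proof (rule tameI[of _ _ "c + c'" "d + d'"])
    show "\<bar>f z * g z\<bar> \<le> exp ((c + c') * (\<Sum>k\<in>K. \<bar>z k\<bar>) + (d + d'))" for z
      using mult_mono[OF h(2)[of z] h(4)[of z]]
      by (simp add: abs_mult exp_add[symmetric] algebra_simps)
    show "(\<lambda>z. f z * g z) \<in> borel_measurable (gaussK K)"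
      using assms[THEN tame_measurable] by (rule borel_measurable_times)
  qed (use h in simp)
qed

lemma tame_add:
  assumes "tame K f" "tame K g" shows "tame K (\<lambda>z. f z + g z)"
proof -
  from assms obtain c d c' d' where h: "c \<ge> 0" "\<And>z. \<bar>f z\<bar> \<le> exp (c * (\<Sum>k\<in>K. \<bar>z k\<bar>) + d)"
    "c' \<ge> 0" "\<And>z. \<bar>g z\<bar> \<le> exp (c' * (\<Sum>k\<in>K. \<bar>z k\<bar>) + d')" unfolding tame_def by blast
  show ?thesis
  proof (rule tameI[of _ _ "c + c'" "\<bar>d\<bar> + \<bar>d'\<bar> + 1"])
    fix z :: "'a \<Rightarrow> real"
    define n where "n = (\<Sum>k\<in>K. \<bar>z k\<bar>)"
    have n: "n \<ge> 0" unfolding n_def by (intro sum_nonneg) auto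
    let ?e = "(c + c') * n + \<bar>d\<bar> + \<bar>d'\<bar>"
    have "c * n \<ge> 0" "c' * n \<ge> 0" using h n by auto
    then have "c * n + d \<le> ?e" "c' * n + d' \<le> ?e" by (auto simp: distrib_right)
    then have "\<bar>f z\<bar> \<le> exp ?e" "\<bar>g z\<bar> \<le> exp ?e"
      using h(2)[of z] h(4)[of z] unfolding n_def[symmetric]
      by (meson exp_le_cancel_iff order_trans)+
    then have "\<bar>f z + g z\<bar> \<le> 2 * exp ?e" by linarith
    also have "\<dots> \<le> exp 1 * exp ?e"
      using exp_ge_add_one_self[of 1] by (intro mult_right_mono) auto
    finally show "\<bar>f z + g z\<bar> \<le> exp ((c + c') * (\<Sum>k\<in>K. \<bar>z k\<bar>) + (\<bar>d\<bar> + \<bar>d'\<bar> + 1))"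
      by (simp add: exp_add[symmetric] n_def algebra_simps)
    show "(\<lambda>z. f z + g z) \<in> borel_measurable (gaussK K)"
      using assms[THEN tame_measurable] by (rule borel_measurable_add)
  qed (use h in simp)
qed

lemma tame_bounded:
  assumes "f \<in> borel_measurable (gaussK K)" "\<And>z. \<bar>f z\<bar> \<le> B" shows "tame K f"
proof (rule tameI[of _ _ 0 B])
  show "\<bar>f z\<bar> \<le> exp (0 * (\<Sum>k\<in>K. \<bar>z k\<bar>) + B)" for z
    using assms(2)[of z] exp_ge_add_one_self[of B] unfolding mult_zero_left add_0_left by linarith
qed (use assms in auto)

lemma tame_const [simp]: "tame K (\<lambda>_. c)"
  by (rule tame_bounded[of _ _ "\<bar>c\<bar>"]) auto

lemma tame_cmult: "tame K f \<Longrightarrow> tame K (\<lambda>z. c * f z)"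
  by (intro tame_mult) auto

lemma tame_uminus: "tame K f \<Longrightarrow> tame K (\<lambda>z. - f z)"
  using tame_cmult[of K f "-1"] by simp

lemma tame_diff: "tame K f \<Longrightarrow> tame K g \<Longrightarrow> tame K (\<lambda>z. f z - g z)"
  using tame_add[OF _ tame_uminus, of K f g] by simp

lemma tame_abs: "tame K f \<Longrightarrow> tame K (\<lambda>z. \<bar>f z\<bar>)"
  unfolding tame_def by auto

lemma tame_sum: "(\<And>i. i \<in> I \<Longrightarrow> tame K (f i)) \<Longrightarrow> tame K (\<lambda>z. \<Sum>i\<in>I. f i z)"
  by (induction I rule: infinite_finite_induct) (auto intro: tame_add)

lemma tame_coord:
  assumes "finite K" "k \<in> K" shows "tame K (\<lambda>z. z k)"
proof (rule tameI[of _ _ 1 0])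
  show "\<bar>z k\<bar> \<le> exp (1 * (\<Sum>k\<in>K. \<bar>z k\<bar>) + 0)" for z :: "'a \<Rightarrow> real"
  proof -
    have "\<bar>z k\<bar> \<le> (\<Sum>k\<in>K. \<bar>z k\<bar>)" using assms by (intro member_le_sum) auto
    then show ?thesis using exp_ge_add_one_self[of "\<Sum>k\<in>K. \<bar>z k\<bar>"]
      unfolding mult_1_left add_0_right by linarith
  qed
qed (use assms in \<open>auto simp: gaussK_def\<close>)

context finite_channel
begin

definition U :: real where "U = 1 + (\<Sum>k\<in>K. \<Sum>x\<in>\<Omega>. \<bar>u k x\<bar>)"

lemma U_ge_1: "U \<ge> 1" unfolding U_def by (simp add: sum_nonneg)

lemma u_le_U: "k \<in> K \<Longrightarrow> x \<in> \<Omega> \<Longrightarrow> \<bar>u k x\<bar> \<le> U"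
proof -
  assume "k \<in> K" "x \<in> \<Omega>"
  then have "\<bar>u k x\<bar> \<le> (\<Sum>x\<in>\<Omega>. \<bar>u k x\<bar>)" using finite_\<Omega> by (intro member_le_sum) auto
  also have "\<dots> \<le> (\<Sum>k\<in>K. \<Sum>x\<in>\<Omega>. \<bar>u k x\<bar>)"
    using \<open>k \<in> K\<close> finite_K by (intro member_le_sum[of k K "\<lambda>k. \<Sum>x\<in>\<Omega>. \<bar>u k x\<bar>"]) (auto intro: sum_nonneg)
  finally show ?thesis unfolding U_def by simp
qed

lemma expo_bound:
  assumes B: "B \<ge> 1" and s: "\<And>k. k \<in> K \<Longrightarrow> 0 \<le> s k \<and> s k \<le> B" and x: "x \<in> \<Omega>"
  shows "\<bar>expo s z x\<bar> \<le> (B * U) * (\<Sum>k\<in>K. \<bar>z k\<bar>) + card K * (B * U\<^sup>2)"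
proof -
  have "\<bar>expo s z x\<bar> \<le> (\<Sum>k\<in>K. (B * U) * \<bar>z k\<bar> + B * U\<^sup>2)"
    unfolding expo_def
  proof (rule order_trans[OF sum_abs sum_mono])
    fix k assume k: "k \<in> K"
    have "sqrt (s k) \<le> sqrt (B * B)" using s[OF k] B
      by (intro real_sqrt_le_mono) (smt (verit) mult_le_cancel_left1)
    then have sq: "sqrt (s k) \<le> B" using B by simp
    have "\<bar>sqrt (s k) * z k * u k x\<bar> = sqrt (s k) * \<bar>u k x\<bar> * \<bar>z k\<bar>"
      using s[OF k] by (simp add: abs_mult)
    also have "\<dots> \<le> (B * U) * \<bar>z k\<bar>"
      using sq u_le_U[OF k x] s[OF k] B by (intro mult_right_mono mult_mono) auto
    finally have 1: "\<bar>sqrt (s k) * z k * u k x\<bar> \<le> (B * U) * \<bar>z k\<bar>" .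
    have "(u k x)\<^sup>2 \<le> U\<^sup>2" using u_le_U[OF k x] by (metis abs_ge_zero power2_abs power_mono)
    then have "s k * (u k x)\<^sup>2 \<le> B * U\<^sup>2" using s[OF k] B by (intro mult_mono) auto
    moreover have "s k * (u k x)\<^sup>2 \<ge> 0" using s[OF k] by simp
    ultimately show "\<bar>sqrt (s k) * z k * u k x - s k * (u k x)\<^sup>2 / 2\<bar> \<le> (B * U) * \<bar>z k\<bar> + B * U\<^sup>2"
      using 1 by linarith
  qed
  also have "\<dots> = (B * U) * (\<Sum>k\<in>K. \<bar>z k\<bar>) + card K * (B * U\<^sup>2)"
    by (simp add: sum.distrib sum_distrib_left)
  finally show ?thesis .
qed

lemma Z_bounds:
  assumes e: "\<And>x. x \<in> \<Omega> \<Longrightarrow> \<bar>expo s z x\<bar> \<le> b"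
  shows "Z s z \<le> exp b" "Z s z \<ge> exp (- b)" "\<bar>ln (Z s z)\<bar> \<le> b"
proof -
  have "Z s z \<le> (\<Sum>x\<in>\<Omega>. w x * exp b)" unfolding wsum_def
    using w_nonneg e by (intro sum_mono) (auto intro!: mult_left_mono simp: abs_le_iff)
  then show 1: "Z s z \<le> exp b" by (simp add: sum_distrib_right[symmetric] sum_w)
  have "(\<Sum>x\<in>\<Omega>. w x * exp (- b)) \<le> Z s z" unfolding wsum_def
    using w_nonneg e by (intro sum_mono) (fastforce intro!: mult_left_mono simp: abs_le_iff)
  then show 2: "Z s z \<ge> exp (- b)" by (simp only: sum_distrib_right[symmetric] sum_w mult_1_left)
  have "ln (Z s z) \<le> b" using 1 Z_pos[of s z] ln_le_cancel_iff[of "Z s z" "exp b"] by simp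
  moreover have "- b \<le> ln (Z s z)" using 2 Z_pos[of s z] ln_le_cancel_iff[of "exp (- b)" "Z s z"] by simp
  ultimately show "\<bar>ln (Z s z)\<bar> \<le> b" by linarith
qed

lemma s_bound: "\<exists>B\<ge>1. \<forall>k\<in>K. s k \<le> (B::real)"
proof (intro exI conjI ballI)
  show "1 + (\<Sum>k\<in>K. \<bar>s k\<bar>) \<ge> (1::real)" by (simp add: sum_nonneg)
  fix k assume "k \<in> K"
  then have "\<bar>s k\<bar> \<le> (\<Sum>k\<in>K. \<bar>s k\<bar>)" using finite_K by (intro member_le_sum) auto
  then show "s k \<le> 1 + (\<Sum>k\<in>K. \<bar>s k\<bar>)" by linarith
qed

lemma tame_exp_expo:
  assumes "\<And>k. k \<in> K \<Longrightarrow> s k \<ge> 0" "x \<in> \<Omega>"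
  shows "tame K (\<lambda>z. exp (expo s z x))"
proof -
  obtain B where B: "B \<ge> 1" "\<forall>k\<in>K. s k \<le> B" using s_bound by blast
  show ?thesis
  proof (rule tameI[of _ _ "B * U" "card K * (B * U\<^sup>2)"])
    show "\<bar>exp (expo s z x)\<bar> \<le> exp ((B * U) * (\<Sum>k\<in>K. \<bar>z k\<bar>) + card K * (B * U\<^sup>2))" for z
      using expo_bound[OF B(1), of s x z] assms B(2) by (auto simp: abs_le_iff)
  qed (use B U_ge_1 in auto)
qed

lemma tame_wsum:
  assumes "\<And>k. k \<in> K \<Longrightarrow> s k \<ge> 0" "\<And>x. x \<in> \<Omega> \<Longrightarrow> tame K (\<lambda>z. f z x)"
  shows "tame K (\<lambda>z. wsum s z (f z))"
  unfolding wsum_def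
  by (intro tame_sum tame_mult tame_const tame_exp_expo assms)

lemma tame_ln_Z:
  assumes "\<And>k. k \<in> K \<Longrightarrow> s k \<ge> 0"
  shows "tame K (\<lambda>z. ln (Z s z))"
proof -
  obtain B where B: "B \<ge> 1" "\<forall>k\<in>K. s k \<le> B" using s_bound by blast
  show ?thesis
  proof (rule tameI[of _ _ "B * U" "card K * (B * U\<^sup>2)"])
    fix z
    let ?b = "(B * U) * (\<Sum>k\<in>K. \<bar>z k\<bar>) + card K * (B * U\<^sup>2)"
    have "\<bar>ln (Z s z)\<bar> \<le> ?b" using assms B(2) by (intro Z_bounds(3) expo_bound[OF B(1)]) auto
    then show "\<bar>ln (Z s z)\<bar> \<le> exp ?b" using exp_ge_add_one_self[of ?b] by linarith
  qed (use B U_ge_1 in auto)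
qed

lemma gibbs_abs_exists: "\<exists>B\<ge>1. \<forall>x\<in>\<Omega>. \<bar>f x\<bar> \<le> (B::real)"
proof (intro exI conjI ballI)
  show "1 + (\<Sum>x\<in>\<Omega>. \<bar>f x\<bar>) \<ge> 1" by (simp add: sum_nonneg)
  fix x assume "x \<in> \<Omega>"
  then have "\<bar>f x\<bar> \<le> (\<Sum>x\<in>\<Omega>. \<bar>f x\<bar>)" using finite_\<Omega> by (intro member_le_sum) auto
  then show "\<bar>f x\<bar> \<le> 1 + (\<Sum>x\<in>\<Omega>. \<bar>f x\<bar>)" by linarith
qed

lemma tame_gibbs: "tame K (\<lambda>z. gibbs s z f)"
proof -
  obtain B where "B \<ge> 1" "\<forall>x\<in>\<Omega>. \<bar>f x\<bar> \<le> B" using gibbs_abs_exists by blast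
  then show ?thesis by (intro tame_bounded[of _ _ B] gibbs_abs_le) auto
qed

text \<open>Shifting the noise by the signal \<open>x\<close> costs the weight
  \<open>exp (expo s z x)\<close>; averaging over \<open>x\<close> then turns the planted
  expectation into a \<open>wsum\<close> under pure noise. Inputs are thereby traded for posterior
  averages.\<close>

lemma planted_eq:
  assumes s: "\<And>k. k \<in> K \<Longrightarrow> s k \<ge> 0" and A: "\<And>x. x \<in> \<Omega> \<Longrightarrow> tame K (A x)"
  shows "planted s A = (\<integral>z. wsum s z (\<lambda>x. A x z) \<partial>gaussK K)"
proof -
  have "(\<integral>z. A x (\<lambda>k\<in>K. z k + sqrt (s k) * u k x) \<partial>gaussK K)
      = (\<integral>z. exp (expo s z x) * A x z \<partial>gaussK K)" if x: "x \<in> \<Omega>" for x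
  proof -
    have "(\<Sum>k\<in>K. sqrt (s k) * u k x * z k - (sqrt (s k) * u k x)\<^sup>2 / 2) = expo s z x" for z
      unfolding expo_def using s by (intro sum.cong) (auto simp: power_mult_distrib mult_ac)
    then show ?thesis
      using integral_gaussK_shift[OF finite_K tame_measurable[OF A[OF x]], of "\<lambda>k. sqrt (s k) * u k x"]
      by simp
  qed
  then have "planted s A = (\<Sum>x\<in>\<Omega>. \<integral>z. w x * exp (expo s z x) * A x z \<partial>gaussK K)"
    unfolding planted_def by (intro sum.cong) (auto simp: mult.assoc)
  also have "\<dots> = (\<integral>z. wsum s z (\<lambda>x. A x z) \<partial>gaussK K)"
    unfolding wsum_def
  proof (rule Bochner_Integration.integral_sum[symmetric])
    fix x assume x: "x \<in> \<Omega>"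
    show "integrable (gaussK K) (\<lambda>z. w x * exp (expo s z x) * A x z)"
    proof (rule tame_integrable[OF finite_K tame_mult[OF tame_cmult A[OF x]]])
      show "tame K (\<lambda>z. exp (expo s z x))" by (rule tame_exp_expo[OF s x])
    qed
  qed
  finally show ?thesis .
qed

lemma free_energy_eq:
  assumes "\<And>k. k \<in> K \<Longrightarrow> s k \<ge> 0"
  shows "free_energy s = (\<integral>z. Z s z * ln (Z s z) \<partial>gaussK K)"
proof -
  have w: "wsum s z (\<lambda>_. ln (Z s z)) = Z s z * ln (Z s z)" for z
    using wsum_const[of s z "ln (Z s z)"] by (simp only: mult.commute)
  have "free_energy s = (\<integral>z. wsum s z (\<lambda>_. ln (Z s z)) \<partial>gaussK K)"
    unfolding free_energy_def by (rule planted_eq[OF assms tame_ln_Z[OF assms]])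
  then show ?thesis by (simp only: w)
qed

section \<open>Derivatives along segments of signal-to-noise ratios\<close>

lemma DERIV_wsum_path:
  fixes s0 s1 :: "'k \<Rightarrow> real"
  defines "s \<equiv> \<lambda>\<tau> k. s0 k + \<tau> * (s1 k - s0 k)"
  assumes s0: "\<And>k. k \<in> K \<Longrightarrow> s0 k \<ge> 0" and s1: "\<And>k. k \<in> K \<Longrightarrow> s1 k \<ge> 0"
    and t: "0 < t" "t < 1"
  shows "((\<lambda>t. wsum (s t) z f) has_real_derivative
    (\<Sum>k\<in>K. (s1 k - s0 k) * (z k / (2 * sqrt (s t k)) * wsum (s t) z (\<lambda>x. f x * u k x)
      - wsum (s t) z (\<lambda>x. f x * (u k x)\<^sup>2) / 2))) (at t)"
proof -
  have gen: "a * (inverse q / 2) * y * b - a * b\<^sup>2 / 2 = a * (y / (2 * q) * b - b\<^sup>2 / 2)" for a q y b :: real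
    by (cases "q = 0") (simp_all add: field_simps)
  have gen': "a * (e * (v * (y * b - c / 2))) * g = a * e * (v * (y * (g * b) - g * c * (1/2)))"
    for a e v y b c g :: real by (simp add: algebra_simps)
  have "((\<lambda>t. expo (s t) z x) has_real_derivative
    (\<Sum>k\<in>K. (s1 k - s0 k) * (z k / (2 * sqrt (s t k)) * u k x - (u k x)\<^sup>2 / 2))) (at t)" for x
    unfolding expo_def
  proof (rule DERIV_sum)
    fix k assume k: "k \<in> K"
    show "((\<lambda>t. sqrt (s t k) * z k * u k x - s t k * (u k x)\<^sup>2 / 2) has_real_derivative
      (s1 k - s0 k) * (z k / (2 * sqrt (s t k)) * u k x - (u k x)\<^sup>2 / 2)) (at t)"
    proof (cases "s1 k = s0 k")
      case True then show ?thesis by (simp add: s_def)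
    next
      case False
      have "s t k = (1 - t) * s0 k + t * s1 k" by (simp add: s_def algebra_simps)
      moreover have "s0 k > 0 \<or> s1 k > 0" using False s0[OF k] s1[OF k] by auto
      ultimately have p: "s t k > 0" using s0[OF k] s1[OF k] t
        by (smt (verit) mult_pos_pos mult_nonneg_nonneg)
      have "((\<lambda>t. s t k) has_real_derivative (s1 k - s0 k)) (at t)"
        unfolding s_def by (auto intro!: derivative_eq_intros)
      from DERIV_chain'[OF this DERIV_real_sqrt[OF p]]
      have "((\<lambda>t. sqrt (s t k)) has_real_derivative (s1 k - s0 k) * (inverse (sqrt (s t k)) / 2)) (at t)"
        by (simp add: mult.commute)
      from DERIV_diff[OF DERIV_cmult_right[OF DERIV_cmult_right[OF this, of "z k"], of "u k x"]
          DERIV_cdivide[OF DERIV_cmult_right[OF \<open>((\<lambda>t. s t k) has_real_derivative (s1 k - s0 k)) (at t)\<close>, of "(u k x)\<^sup>2"], of 2]]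
      show ?thesis
        by (rule DERIV_cong) (rule gen)
    qed
  qed
  then have "((\<lambda>t. wsum (s t) z f) has_real_derivative
    (\<Sum>x\<in>\<Omega>. w x * (exp (expo (s t) z x) *
      (\<Sum>k\<in>K. (s1 k - s0 k) * (z k / (2 * sqrt (s t k)) * u k x - (u k x)\<^sup>2 / 2))) * f x)) (at t)"
    unfolding wsum_def by (intro DERIV_sum DERIV_cmult_right DERIV_cmult DERIV_fun_exp)
  then show ?thesis
  proof (rule DERIV_cong)
    have "(\<Sum>x\<in>\<Omega>. w x * (exp (expo (s t) z x) *
      (\<Sum>k\<in>K. (s1 k - s0 k) * (z k / (2 * sqrt (s t k)) * u k x - (u k x)\<^sup>2 / 2))) * f x)
      = wsum (s t) z (\<lambda>x. \<Sum>k\<in>K. (s1 k - s0 k) * (z k / (2 * sqrt (s t k)) * (f x * u k x) - (f x * (u k x)\<^sup>2) * (1/2)))"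
      unfolding wsum_def
      unfolding sum_distrib_left sum_distrib_right by (intro sum.cong refl gen')
    also have "\<dots> = (\<Sum>k\<in>K. (s1 k - s0 k) * (z k / (2 * sqrt (s t k)) * wsum (s t) z (\<lambda>x. f x * u k x)
      - wsum (s t) z (\<lambda>x. f x * (u k x)\<^sup>2) / 2))"
      unfolding wsum_sum wsum_cmult wsum_diff wsum_multc by simp
    finally show "(\<Sum>x\<in>\<Omega>. w x * (exp (expo (s t) z x) *
      (\<Sum>k\<in>K. (s1 k - s0 k) * (z k / (2 * sqrt (s t k)) * u k x - (u k x)\<^sup>2 / 2))) * f x)
      = (\<Sum>k\<in>K. (s1 k - s0 k) * (z k / (2 * sqrt (s t k)) * wsum (s t) z (\<lambda>x. f x * u k x)
      - wsum (s t) z (\<lambda>x. f x * (u k x)\<^sup>2) / 2))" .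
  qed
qed

lemma DERIV_wsum_coord:
  assumes k: "k \<in> K"
  shows "((\<lambda>y. wsum s (z(k := y)) f) has_real_derivative sqrt (s k) * wsum s z (\<lambda>x. f x * u k x)) (at (z k))"
proof -
  have e: "expo s (z(k := y)) x = (\<Sum>j\<in>K - {k}. sqrt (s j) * z j * u j x - s j * (u j x)\<^sup>2 / 2)
      + (sqrt (s k) * u k x * y - s k * (u k x)\<^sup>2 / 2)" for x y
    unfolding expo_def by (subst sum.remove[OF finite_K k]) (simp add: algebra_simps)
  have "((\<lambda>y. expo s (z(k := y)) x) has_real_derivative sqrt (s k) * u k x) (at (z k))" for x
    unfolding e by (auto intro!: derivative_eq_intros)
  then have "((\<lambda>y. wsum s (z(k := y)) f) has_real_derivative
    (\<Sum>x\<in>\<Omega>. w x * (exp (expo s (z(k := z k)) x) * (sqrt (s k) * u k x)) * f x)) (at (z k))"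
    unfolding wsum_def by (intro DERIV_sum DERIV_cmult_right DERIV_cmult DERIV_fun_exp)
  then show ?thesis
    unfolding fun_upd_triv
    by (rule DERIV_cong) (unfold wsum_def sum_distrib_left, intro sum.cong refl, simp)
qed

lemma DERIV_gibbs_coord:
  assumes k: "k \<in> K"
  shows "((\<lambda>y. gibbs s (z(k := y)) f) has_real_derivative
    sqrt (s k) * (gibbs s z (\<lambda>x. f x * u k x) - gibbs s z f * gibbs s z (u k))) (at (z k))"
proof -
  note d = DERIV_wsum_coord[OF k, of s z]
  have "((\<lambda>y. gibbs s (z(k := y)) f) has_real_derivative
     (sqrt (s k) * wsum s z (\<lambda>x. f x * u k x) * Z s z - wsum s z f * (sqrt (s k) * wsum s z (\<lambda>x. 1 * u k x)))
       / (Z s z * Z s z)) (at (z k))"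
    using DERIV_divide[OF d[of f] d[of "\<lambda>_. 1"]] Z_pos[of s z]
    unfolding gibbs_def by simp
  then show ?thesis
    by (rule DERIV_cong) (use Z_pos[of s z] in \<open>simp add: gibbs_def field_simps\<close>)
qed

text \<open>\<open>Z\<close> is the likelihood ratio of the observation to pure noise, so \<open>info s f\<close> is the expected square
of the posterior mean of \<open>f\<close>.\<close>
definition info :: "('k \<Rightarrow> real) \<Rightarrow> ('x \<Rightarrow> real) \<Rightarrow> real" where
  "info s f = (\<integral>z. Z s z * (gibbs s z f)\<^sup>2 \<partial>gaussK K)"

lemma expo_bound_path:
  obtains c d where "c \<ge> 0" "d \<ge> (0::real)"
    "\<And>s z x. (\<And>k. k \<in> K \<Longrightarrow> 0 \<le> s k \<and> s k \<le> B) \<Longrightarrow> x \<in> \<Omega> \<Longrightarrow>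
      \<bar>expo s z x\<bar> \<le> c * (\<Sum>k\<in>K. \<bar>z k\<bar>) + d"
proof -
  define B' where "B' = max B 1"
  have "\<bar>expo s z x\<bar> \<le> (B' * U) * (\<Sum>k\<in>K. \<bar>z k\<bar>) + card K * (B' * U\<^sup>2)"
    if "\<And>k. k \<in> K \<Longrightarrow> 0 \<le> s k \<and> s k \<le> B" "x \<in> \<Omega>" for s z x
    using that by (intro expo_bound) (auto simp: B'_def le_max_iff_disj)
  moreover have "B' * U \<ge> 0" "card K * (B' * U\<^sup>2) \<ge> 0" using U_ge_1 by (auto simp: B'_def)
  ultimately show ?thesis by (rule that[rotated 2])
qed

definition line :: "('k \<Rightarrow> real) \<Rightarrow> ('k \<Rightarrow> real) \<Rightarrow> real \<Rightarrow> 'k \<Rightarrow> real" where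
  "line s0 s1 t k = s0 k + t * (s1 k - s0 k)"

lemma line_bounds:
  assumes "s0 k \<ge> 0" "s1 k \<ge> 0" "0 \<le> t" "t \<le> 1"
  shows "0 \<le> line s0 s1 t k" "line s0 s1 t k \<le> s0 k + s1 k"
proof -
  have e: "line s0 s1 t k = (1 - t) * s0 k + t * s1 k" by (simp add: line_def algebra_simps)
  show "0 \<le> line s0 s1 t k" unfolding e using assms by simp
  have "(1 - t) * s0 k \<le> 1 * s0 k" "t * s1 k \<le> 1 * s1 k" using assms by (intro mult_right_mono; simp)+
  then show "line s0 s1 t k \<le> s0 k + s1 k" unfolding e by simp
qed

lemma expo_bound_line:
  assumes s0: "\<And>k. k \<in> K \<Longrightarrow> s0 k \<ge> 0" and s1: "\<And>k. k \<in> K \<Longrightarrow> s1 k \<ge> 0"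
  obtains c d where "c \<ge> 0" "d \<ge> (0::real)"
    "\<And>t z x. 0 \<le> t \<Longrightarrow> t \<le> 1 \<Longrightarrow> x \<in> \<Omega> \<Longrightarrow>
      \<bar>expo (line s0 s1 t) z x\<bar> \<le> c * (\<Sum>k\<in>K. \<bar>z k\<bar>) + d"
proof -
  obtain B where B: "\<forall>k\<in>K. s0 k + s1 k \<le> B" using s_bound[of "\<lambda>k. s0 k + s1 k"] by blast
  obtain c d where cd: "c \<ge> 0" "d \<ge> (0::real)"
    "\<And>s z x. (\<And>k. k \<in> K \<Longrightarrow> 0 \<le> s k \<and> s k \<le> B) \<Longrightarrow> x \<in> \<Omega> \<Longrightarrow>
      \<bar>expo s z x\<bar> \<le> c * (\<Sum>k\<in>K. \<bar>z k\<bar>) + d"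
    using expo_bound_path[of B] by blast
  have "\<bar>expo (line s0 s1 t) z x\<bar> \<le> c * (\<Sum>k\<in>K. \<bar>z k\<bar>) + d" if t: "0 \<le> t" "t \<le> 1" and x: "x \<in> \<Omega>" for t z x
  proof (rule cd(3)[OF _ x])
    fix k assume k: "k \<in> K"
    show "0 \<le> line s0 s1 t k \<and> line s0 s1 t k \<le> B"
      using line_bounds[of s0 k s1 t, OF s0[OF k] s1[OF k] t] B k by force
  qed
  with cd(1,2) show ?thesis by (rule that)
qed

lemma le_exp_mono: "x \<le> C * exp a \<Longrightarrow> 0 \<le> C \<Longrightarrow> C \<le> D \<Longrightarrow> x \<le> exp (a + D)" for x C a D :: real
proof -
  assume a: "x \<le> C * exp a" "0 \<le> C" "C \<le> D"
  have "C \<le> exp D" using a exp_ge_add_one_self[of D] by linarith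
  then have "C * exp a \<le> exp D * exp a" by (intro mult_right_mono) auto
  from order_trans[OF a(1) this] show "x \<le> exp (a + D)" by (simp add: exp_add mult.commute)
qed

text \<open>The I-MMSE relation: the slope of the free energy in one ratio is half the expected
  squared posterior mean. In \<open>Z * ln Z\<close> the noise derivative of \<open>1 + ln Z\<close>
  leaves the square of \<open>wsum (u k)\<close> over \<open>Z\<close>, which is the term
  \<open>R\<close> of the heat flow; the rest of the noise derivative is \<open>Q\<close>.\<close>

lemma DERIV_free_energy_line:
  assumes s0: "\<And>k. k \<in> K \<Longrightarrow> s0 k \<ge> 0" and s1: "\<And>k. k \<in> K \<Longrightarrow> s1 k \<ge> 0"
    and \<tau>: "0 < \<tau>" "\<tau> < 1"
  shows "((\<lambda>t. \<integral>z. Z (line s0 s1 t) z * ln (Z (line s0 s1 t) z) \<partial>gaussK K) has_real_derivative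
    (\<Sum>k\<in>K. (s1 k - s0 k) * info (line s0 s1 \<tau>) (u k) / 2)) (at \<tau>)"
proof -
  obtain c d where c: "c \<ge> 0" and d: "d \<ge> 0" and e:
    "\<And>t z x. 0 \<le> t \<Longrightarrow> t \<le> 1 \<Longrightarrow> x \<in> \<Omega> \<Longrightarrow>
      \<bar>expo (line s0 s1 t) z x\<bar> \<le> c * (\<Sum>k\<in>K. \<bar>z k\<bar>) + d"
    using expo_bound_line[of s0 s1, OF s0 s1] by blast
  define N where "N z = (\<Sum>k\<in>K. \<bar>z k\<bar>)" for z :: "'k \<Rightarrow> real"
  have N0: "N z \<ge> 0" for z unfolding N_def by (intro sum_nonneg) auto
  have Zb: "Z (line s0 s1 t) z \<le> exp (c * N z + d)" "\<bar>ln (Z (line s0 s1 t) z)\<bar> \<le> c * N z + d"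
    if "0 < t" "t < 1" for t z
    using Z_bounds[of "line s0 s1 t" z "c * N z + d"] e[of t _ z] that unfolding N_def by auto
  have lnb: "\<bar>1 + ln (Z (line s0 s1 t) z)\<bar> \<le> exp (c * N z + d)" if "0 < t" "t < 1" for t z
    using Zb(2)[OF that, of z] exp_ge_add_one_self[of "c * N z + d"] by linarith
  have wb: "\<bar>wsum (line s0 s1 t) z f\<bar> \<le> b * exp (c * N z + d)"
    if "0 < t" "t < 1" "\<And>x. x \<in> \<Omega> \<Longrightarrow> \<bar>f x\<bar> \<le> b" "b \<ge> 0" for t z f b
    by (rule order_trans[OF wsum_abs_le[OF that(3)] mult_left_mono[OF Zb(1)[OF that(1,2)] that(4)]])
  have wlb: "\<bar>wsum (line s0 s1 t) z f * (1 + ln (Z (line s0 s1 t) z))\<bar> \<le> exp ((2 * c) * N z + (2 * d + U\<^sup>2))"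
    if t: "0 < t" "t < 1" and f: "\<And>x. x \<in> \<Omega> \<Longrightarrow> \<bar>f x\<bar> \<le> b" "b \<ge> 0" "b \<le> U\<^sup>2" for t z f b
  proof -
    have "\<bar>wsum (line s0 s1 t) z f * (1 + ln (Z (line s0 s1 t) z))\<bar>
        \<le> (b * exp (c * N z + d)) * exp (c * N z + d)"
      unfolding abs_mult using f(2) by (intro mult_mono wb[OF t f(1,2)] lnb[OF t]) auto
    also have "\<dots> = b * exp (2 * c * N z + 2 * d)" by (simp add: exp_add[symmetric] algebra_simps)
    finally have "\<bar>wsum (line s0 s1 t) z f * (1 + ln (Z (line s0 s1 t) z))\<bar> \<le> exp ((2 * c * N z + 2 * d) + U\<^sup>2)"
      by (rule le_exp_mono[OF _ f(2,3)])
    then show ?thesis by (simp add: add.assoc)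
  qed
  have UU: "U \<le> U\<^sup>2" using U_ge_1 by (simp add: power2_eq_square)
  have u2: "\<bar>(u k x)\<^sup>2\<bar> \<le> U\<^sup>2" if "k \<in> K" "x \<in> \<Omega>" for k x
    using power_mono[OF u_le_U[OF that] abs_ge_zero, of 2] unfolding power2_abs abs_power2 .
  have "((\<lambda>t. \<integral>z. Z (line s0 s1 t) z * ln (Z (line s0 s1 t) z) \<partial>gaussK K) has_real_derivative
    (\<Sum>k\<in>K. (s1 k - s0 k) * (\<integral>z. Z (line s0 s1 \<tau>) z * (gibbs (line s0 s1 \<tau>) z (u k))\<^sup>2 \<partial>gaussK K) / 2)) (at \<tau>)"
  proof (rule gaussK_heat_flow[where c = "2 * c" and d = "2 * d + U\<^sup>2" and K = K
        and G = "\<lambda>t k z. wsum (line s0 s1 t) z (u k) * (1 + ln (Z (line s0 s1 t) z))"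
        and Q = "\<lambda>t k z. wsum (line s0 s1 t) z (\<lambda>x. (u k x)\<^sup>2) * (1 + ln (Z (line s0 s1 t) z))"
        and R = "\<lambda>t k z. Z (line s0 s1 t) z * (gibbs (line s0 s1 t) z (u k))\<^sup>2"])
    fix t :: real and z assume t: "0 < t" "t < 1"
    have "\<bar>Z (line s0 s1 t) z * ln (Z (line s0 s1 t) z)\<bar> \<le> 1 * (exp (c * N z + d) * exp (c * N z + d))"
      unfolding abs_mult mult_1_left
      using Zb[OF t, of z] lnb[OF t, of z] Z_pos[of "line s0 s1 t" z] exp_ge_add_one_self[of "c * N z + d"]
      by (intro mult_mono) (linarith | simp)+
    then have "\<bar>Z (line s0 s1 t) z * ln (Z (line s0 s1 t) z)\<bar> \<le> 1 * exp (2 * c * N z + 2 * d)"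
      by (simp add: exp_add[symmetric] algebra_simps)
    then have "\<bar>Z (line s0 s1 t) z * ln (Z (line s0 s1 t) z)\<bar> \<le> exp (2 * c * N z + 2 * d + U\<^sup>2)"
      by (rule le_exp_mono) (use UU U_ge_1 in auto)
    then show "\<bar>Z (line s0 s1 t) z * ln (Z (line s0 s1 t) z)\<bar> \<le> exp (2 * c * (\<Sum>k\<in>K. \<bar>z k\<bar>) + (2 * d + U\<^sup>2))"
      unfolding N_def by (simp only: add.assoc)
    show "((\<lambda>t. Z (line s0 s1 t) z * ln (Z (line s0 s1 t) z)) has_real_derivative
        (\<Sum>k\<in>K. (s1 k - s0 k) * (z k / (2 * sqrt (s0 k + t * (s1 k - s0 k))) *
          (wsum (line s0 s1 t) z (u k) * (1 + ln (Z (line s0 s1 t) z)))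
          - wsum (line s0 s1 t) z (\<lambda>x. (u k x)\<^sup>2) * (1 + ln (Z (line s0 s1 t) z)) / 2))) (at t)"
    proof -
      let ?L = "Z (line s0 s1 t) z"
      define D where "D = (\<Sum>k\<in>K. (s1 k - s0 k) * (z k / (2 * sqrt (line s0 s1 t k)) * wsum (line s0 s1 t) z (\<lambda>x. 1 * u k x)
        - wsum (line s0 s1 t) z (\<lambda>x. 1 * (u k x)\<^sup>2) / 2))"
      have dZ: "((\<lambda>t. Z (line s0 s1 t) z) has_real_derivative D) (at t)"
        unfolding D_def line_def by (rule DERIV_wsum_path[OF s0 s1 t])
      have "((\<lambda>t. Z (line s0 s1 t) z * ln (Z (line s0 s1 t) z)) has_real_derivative
          D * ln ?L + (inverse ?L * D) * ?L) (at t)"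
        by (rule DERIV_mult[OF dZ DERIV_chain2[OF DERIV_ln[OF Z_pos] dZ]])
      then show ?thesis
      proof (rule DERIV_cong)
        have "D * ln ?L + (inverse ?L * D) * ?L = D * (1 + ln ?L)"
          using Z_pos[of "line s0 s1 t" z] by (simp add: field_simps)
        also have "\<dots> = (\<Sum>k\<in>K. (s1 k - s0 k) * (z k / (2 * sqrt (s0 k + t * (s1 k - s0 k))) *
          (wsum (line s0 s1 t) z (u k) * (1 + ln ?L))
          - wsum (line s0 s1 t) z (\<lambda>x. (u k x)\<^sup>2) * (1 + ln ?L) / 2))"
          unfolding D_def sum_distrib_right line_def[of s0 s1 t, symmetric] mult_1_left
          by (intro sum.cong refl) (simp add: left_diff_distrib mult.assoc)
        finally show "D * ln ?L + (inverse ?L * D) * ?L = (\<Sum>k\<in>K. (s1 k - s0 k) * (z k / (2 * sqrt (s0 k + t * (s1 k - s0 k))) *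
          (wsum (line s0 s1 t) z (u k) * (1 + ln ?L))
          - wsum (line s0 s1 t) z (\<lambda>x. (u k x)\<^sup>2) * (1 + ln ?L) / 2))" .
      qed
    qed
    fix k assume k: "k \<in> K"
    show "\<bar>wsum (line s0 s1 t) z (u k) * (1 + ln (Z (line s0 s1 t) z))\<bar> \<le> exp (2 * c * (\<Sum>k\<in>K. \<bar>z k\<bar>) + (2 * d + U\<^sup>2))"
      unfolding N_def[symmetric] by (rule wlb[OF t u_le_U[OF k] _ UU]) (use U_ge_1 in auto)
    show "\<bar>wsum (line s0 s1 t) z (\<lambda>x. (u k x)\<^sup>2) * (1 + ln (Z (line s0 s1 t) z))\<bar> \<le> exp (2 * c * (\<Sum>k\<in>K. \<bar>z k\<bar>) + (2 * d + U\<^sup>2))"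
      unfolding N_def[symmetric] by (rule wlb[OF t u2[OF k] _ order_refl]) auto
    show "\<bar>Z (line s0 s1 t) z * (gibbs (line s0 s1 t) z (u k))\<^sup>2\<bar> \<le> exp (2 * c * (\<Sum>k\<in>K. \<bar>z k\<bar>) + (2 * d + U\<^sup>2))"
    proof -
      have g: "(gibbs (line s0 s1 t) z (u k))\<^sup>2 \<le> U\<^sup>2"
        using power_mono[OF gibbs_abs_le[OF u_le_U[OF k], where s = "line s0 s1 t" and z = z] abs_ge_zero, where n = 2]
        unfolding power2_abs by assumption
      have cd: "0 \<le> c * N z + d" using c d N0[of z] by simp
      have "\<bar>Z (line s0 s1 t) z * (gibbs (line s0 s1 t) z (u k))\<^sup>2\<bar> \<le> exp (c * N z + d) * U\<^sup>2"
        unfolding abs_mult abs_power2 using Zb(1)[OF t, of z] Z_pos[of "line s0 s1 t" z] g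
        by (intro mult_mono) auto
      then have "\<bar>Z (line s0 s1 t) z * (gibbs (line s0 s1 t) z (u k))\<^sup>2\<bar> \<le> U\<^sup>2 * exp (c * N z + d)"
        by (simp only: mult.commute)
      then have "\<bar>Z (line s0 s1 t) z * (gibbs (line s0 s1 t) z (u k))\<^sup>2\<bar> \<le> exp ((c * N z + d) + U\<^sup>2)"
        by (rule le_exp_mono) auto
      also have "\<dots> \<le> exp (2 * c * N z + (2 * d + U\<^sup>2))" using cd by simp
      finally show ?thesis unfolding N_def .
    qed
    show "((\<lambda>y. wsum (line s0 s1 t) (z(k := y)) (u k) * (1 + ln (Z (line s0 s1 t) (z(k := y))))) has_real_derivative
        sqrt (s0 k + t * (s1 k - s0 k)) * (wsum (line s0 s1 t) z (\<lambda>x. (u k x)\<^sup>2) * (1 + ln (Z (line s0 s1 t) z))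
          + Z (line s0 s1 t) z * (gibbs (line s0 s1 t) z (u k))\<^sup>2)) (at (z k))"
    proof -
      let ?s = "line s0 s1 t" and ?r = "sqrt (line s0 s1 t k)"
      have 1: "((\<lambda>y. wsum ?s (z(k := y)) (u k)) has_real_derivative ?r * wsum ?s z (\<lambda>x. u k x * u k x)) (at (z k))"
        by (rule DERIV_wsum_coord[OF k])
      have 2: "((\<lambda>y. Z ?s (z(k := y))) has_real_derivative ?r * wsum ?s z (\<lambda>x. 1 * u k x)) (at (z k))"
        by (rule DERIV_wsum_coord[OF k])
      have 3: "((\<lambda>y. 1 + ln (Z ?s (z(k := y)))) has_real_derivative 0 + inverse (Z ?s (z(k := z k))) * (?r * wsum ?s z (\<lambda>x. 1 * u k x))) (at (z k))"
        by (rule DERIV_add[OF DERIV_const DERIV_chain2[OF DERIV_ln[OF Z_pos] 2]])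
      show ?thesis
        using DERIV_mult[OF 1 3]
      proof (rule DERIV_cong)
        have "wsum ?s z (u k) = Z ?s z * gibbs ?s z (u k)" by (rule wsum_eq_gibbs)
        then show "?r * wsum ?s z (\<lambda>x. u k x * u k x) * (1 + ln (Z ?s (z(k := z k)))) +
            (0 + inverse (Z ?s (z(k := z k))) * (?r * wsum ?s z (\<lambda>x. 1 * u k x))) * wsum ?s (z(k := z k)) (u k)
          = sqrt (s0 k + t * (s1 k - s0 k)) * (wsum ?s z (\<lambda>x. (u k x)\<^sup>2) * (1 + ln (Z ?s z))
          + Z ?s z * (gibbs ?s z (u k))\<^sup>2)"
          using Z_pos[of ?s z] unfolding line_def[of s0 s1 t, symmetric] fun_upd_triv mult_1_left power2_eq_square
          by (simp add: field_simps)
      qed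
    qed
  qed (use s0 s1 \<tau> c finite_K in auto)
  then show ?thesis unfolding info_def .
qed

definition cov :: "('k \<Rightarrow> real) \<Rightarrow> ('k \<Rightarrow> real) \<Rightarrow> ('x \<Rightarrow> real) \<Rightarrow> ('x \<Rightarrow> real) \<Rightarrow> real" where
  "cov s z f g = gibbs s z (\<lambda>x. f x * g x) - gibbs s z f * gibbs s z g"

lemma measurable_cov [measurable]: "(\<lambda>z. cov s z f g) \<in> borel_measurable (gaussK K)"
  unfolding cov_def by measurable

lemma cov_eq: "cov s z f g = gibbs s z (\<lambda>x. (f x - gibbs s z f) * (g x - gibbs s z g))"
  unfolding cov_def left_diff_distrib right_diff_distrib
  by (simp only: gibbs_diff gibbs_cmult gibbs_multc gibbs_const)

text \<open>Supplies the second derivative of the free energy. Differentiating a posterior mean with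
  respect to the noise gives a posterior covariance, and after integration by parts only squared
  covariances remain.\<close>

lemma DERIV_info_line:
  assumes s0: "\<And>k. k \<in> K \<Longrightarrow> s0 k \<ge> 0" and s1: "\<And>k. k \<in> K \<Longrightarrow> s1 k \<ge> 0"
    and \<tau>: "0 < \<tau>" "\<tau> < 1"
  shows "((\<lambda>t. info (line s0 s1 t) f) has_real_derivative
    (\<Sum>k\<in>K. (s1 k - s0 k) * (\<integral>z. 2 * Z (line s0 s1 \<tau>) z * (cov (line s0 s1 \<tau>) z f (u k))\<^sup>2 \<partial>gaussK K) / 2)) (at \<tau>)"
proof -
  obtain c d where c: "c \<ge> 0" and d: "d \<ge> 0" and e:
    "\<And>t z x. 0 \<le> t \<Longrightarrow> t \<le> 1 \<Longrightarrow> x \<in> \<Omega> \<Longrightarrow>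
      \<bar>expo (line s0 s1 t) z x\<bar> \<le> c * (\<Sum>k\<in>K. \<bar>z k\<bar>) + d"
    using expo_bound_line[of s0 s1, OF s0 s1] by blast
  obtain b where b: "b \<ge> 1" and fb: "\<And>x. x \<in> \<Omega> \<Longrightarrow> \<bar>f x\<bar> \<le> b"
    using gibbs_abs_exists by blast
  define N where "N z = (\<Sum>k\<in>K. \<bar>z k\<bar>)" for z :: "'k \<Rightarrow> real"
  have Zb: "Z (line s0 s1 t) z \<le> exp (c * N z + d)" if "0 < t" "t < 1" for t z
    using Z_bounds(1)[of "line s0 s1 t" z "c * N z + d"] e[of t _ z] that unfolding N_def by auto
  have wb: "\<bar>wsum (line s0 s1 t) z g\<bar> \<le> B * exp (c * N z + d)"
    if "0 < t" "t < 1" "\<And>x. x \<in> \<Omega> \<Longrightarrow> \<bar>g x\<bar> \<le> B" "B \<ge> 0" for t z g B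
    by (rule order_trans[OF wsum_abs_le[OF that(3)] mult_left_mono[OF Zb[OF that(1,2)] that(4)]])
  have gb: "\<bar>gibbs (line s0 s1 t) z f\<bar> \<le> b" for t z by (rule gibbs_abs_le[OF fb])
  have gb2: "\<bar>(gibbs (line s0 s1 t) z f)\<^sup>2\<bar> \<le> b\<^sup>2" for t z
    using power_mono[OF gb abs_ge_zero, where n = 2] unfolding power2_abs abs_power2 by assumption
  have u2: "\<bar>(u k x)\<^sup>2\<bar> \<le> U\<^sup>2" if "k \<in> K" "x \<in> \<Omega>" for k x
    using power_mono[OF u_le_U[OF that] abs_ge_zero, of 2] unfolding power2_abs abs_power2 .
  have UU: "U \<le> U\<^sup>2" using U_ge_1 by (simp add: power2_eq_square)
  \<comment> \<open>The factor 8 is what \<open>R\<close> needs: twice the square of a covariance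
    that is at most \<open>2 * (b * U)\<close>. The bounds for the other terms are smaller.\<close>
  define C where "C = 8 * (b\<^sup>2 * U\<^sup>2)"
  have C0: "0 \<le> b\<^sup>2 * U\<^sup>2" by simp
  have key: "\<bar>2 * gibbs (line s0 s1 t) z f * wsum (line s0 s1 t) z (\<lambda>x. f x * h x)
      - (gibbs (line s0 s1 t) z f)\<^sup>2 * wsum (line s0 s1 t) z h\<bar> \<le> exp (c * N z + (d + C))"
    if t: "0 < t" "t < 1" and h: "\<And>x. x \<in> \<Omega> \<Longrightarrow> \<bar>h x\<bar> \<le> B" "B \<ge> 0" "B \<le> U\<^sup>2" for t z h B
  proof -
    let ?E = "exp (c * N z + d)" and ?s = "line s0 s1 t"
    have "\<bar>f x * h x\<bar> \<le> b * B" if "x \<in> \<Omega>" for x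
      unfolding abs_mult using fb[OF that] h(1)[OF that] b by (intro mult_mono) auto
    then have w1: "\<bar>wsum ?s z (\<lambda>x. f x * h x)\<bar> \<le> (b * B) * ?E"
      using h(2) b by (intro wb[OF t]) auto
    have w2: "\<bar>wsum ?s z h\<bar> \<le> B * ?E" by (rule wb[OF t h(1,2)])
    have "\<bar>gibbs ?s z f * wsum ?s z (\<lambda>x. f x * h x)\<bar> \<le> b * ((b * B) * ?E)"
      unfolding abs_mult using gb w1 b by (intro mult_mono) auto
    moreover have "\<bar>(gibbs ?s z f)\<^sup>2 * wsum ?s z h\<bar> \<le> b\<^sup>2 * (B * ?E)"
      unfolding abs_mult[of "(gibbs ?s z f)\<^sup>2"] using gb2 w2 by (intro mult_mono) auto
    ultimately have "\<bar>2 * gibbs ?s z f * wsum ?s z (\<lambda>x. f x * h x) - (gibbs ?s z f)\<^sup>2 * wsum ?s z h\<bar>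
        \<le> (3 * (b\<^sup>2 * B)) * ?E" by (simp add: power2_eq_square)
    then have "\<bar>2 * gibbs ?s z f * wsum ?s z (\<lambda>x. f x * h x) - (gibbs ?s z f)\<^sup>2 * wsum ?s z h\<bar>
        \<le> exp ((c * N z + d) + C)"
    proof (rule le_exp_mono)
      show "0 \<le> 3 * (b\<^sup>2 * B)" using h(2) by simp
      have "b\<^sup>2 * B \<le> b\<^sup>2 * U\<^sup>2" using h(3) by (intro mult_left_mono) auto
      then show "3 * (b\<^sup>2 * B) \<le> C" unfolding C_def using C0 by linarith
    qed
    then show ?thesis by (simp only: add.assoc)
  qed
  have "((\<lambda>t. \<integral>z. Z (line s0 s1 t) z * (gibbs (line s0 s1 t) z f)\<^sup>2 \<partial>gaussK K) has_real_derivative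
    (\<Sum>k\<in>K. (s1 k - s0 k) * (\<integral>z. 2 * Z (line s0 s1 \<tau>) z * (cov (line s0 s1 \<tau>) z f (u k))\<^sup>2 \<partial>gaussK K) / 2)) (at \<tau>)"
  proof (rule gaussK_heat_flow[where c = c and d = "d + C" and K = K
        and G = "\<lambda>t k z. 2 * gibbs (line s0 s1 t) z f * wsum (line s0 s1 t) z (\<lambda>x. f x * u k x)
          - (gibbs (line s0 s1 t) z f)\<^sup>2 * wsum (line s0 s1 t) z (u k)"
        and Q = "\<lambda>t k z. 2 * gibbs (line s0 s1 t) z f * wsum (line s0 s1 t) z (\<lambda>x. f x * (u k x)\<^sup>2)
          - (gibbs (line s0 s1 t) z f)\<^sup>2 * wsum (line s0 s1 t) z (\<lambda>x. (u k x)\<^sup>2)"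
        and R = "\<lambda>t k z. 2 * Z (line s0 s1 t) z * (cov (line s0 s1 t) z f (u k))\<^sup>2"])
    fix t :: real and z assume t: "0 < t" "t < 1"
    let ?s = "line s0 s1 t"
    have "\<bar>Z ?s z * (gibbs ?s z f)\<^sup>2\<bar> \<le> exp (c * N z + d) * b\<^sup>2"
      unfolding abs_mult using Zb[OF t, of z] Z_pos[of ?s z] gb2 by (intro mult_mono) auto
    then have "\<bar>Z ?s z * (gibbs ?s z f)\<^sup>2\<bar> \<le> b\<^sup>2 * exp (c * N z + d)" by (simp only: mult.commute)
    then have "\<bar>Z ?s z * (gibbs ?s z f)\<^sup>2\<bar> \<le> exp ((c * N z + d) + C)"
    proof (rule le_exp_mono)
      have "b\<^sup>2 * 1 \<le> b\<^sup>2 * U\<^sup>2" using U_ge_1 by (intro mult_left_mono) auto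
      then show "b\<^sup>2 \<le> C" unfolding C_def using C0 by linarith
    qed simp
    then show "\<bar>Z ?s z * (gibbs ?s z f)\<^sup>2\<bar> \<le> exp (c * (\<Sum>k\<in>K. \<bar>z k\<bar>) + (d + C))"
      unfolding N_def by (simp only: add.assoc)
    show "((\<lambda>t. Z (line s0 s1 t) z * (gibbs (line s0 s1 t) z f)\<^sup>2) has_real_derivative
      (\<Sum>k\<in>K. (s1 k - s0 k) * (z k / (2 * sqrt (s0 k + t * (s1 k - s0 k))) *
        (2 * gibbs ?s z f * wsum ?s z (\<lambda>x. f x * u k x) - (gibbs ?s z f)\<^sup>2 * wsum ?s z (u k))
        - (2 * gibbs ?s z f * wsum ?s z (\<lambda>x. f x * (u k x)\<^sup>2) - (gibbs ?s z f)\<^sup>2 * wsum ?s z (\<lambda>x. (u k x)\<^sup>2)) / 2))) (at t)"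
    proof -
      define D where "D h = (\<Sum>k\<in>K. (s1 k - s0 k) * (z k / (2 * sqrt (line s0 s1 t k)) * wsum (line s0 s1 t) z (\<lambda>x. h x * u k x)
        - wsum (line s0 s1 t) z (\<lambda>x. h x * (u k x)\<^sup>2) / 2))" for h
      have dW: "((\<lambda>t. wsum (line s0 s1 t) z h) has_real_derivative D h) (at t)" for h
        unfolding D_def line_def by (rule DERIV_wsum_path[OF s0 s1 t])
      define g where "g = gibbs ?s z f"
      have Z0: "Z ?s z \<noteq> 0" using Z_pos[of ?s z] by simp
      \<comment> \<open>Written as the square of \<open>wsum f\<close> over \<open>Z\<close>, the
        integrand needs only derivatives of \<open>wsum\<close> along the segment.\<close>
      have eq: "(\<lambda>t. Z (line s0 s1 t) z * (gibbs (line s0 s1 t) z f)\<^sup>2)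
          = (\<lambda>t. wsum (line s0 s1 t) z f * wsum (line s0 s1 t) z f / Z (line s0 s1 t) z)"
      proof
        fix t
        show "Z (line s0 s1 t) z * (gibbs (line s0 s1 t) z f)\<^sup>2
          = wsum (line s0 s1 t) z f * wsum (line s0 s1 t) z f / Z (line s0 s1 t) z"
          using Z_pos[of "line s0 s1 t" z] by (simp add: gibbs_def power2_eq_square)
      qed
      show ?thesis unfolding eq
      proof (rule DERIV_cong[OF DERIV_divide[OF DERIV_mult[OF dW dW] dW Z0]])
        have W: "wsum ?s z f = Z ?s z * g" unfolding g_def by (rule wsum_eq_gibbs)
        have "((D f * wsum ?s z f + D f * wsum ?s z f) * Z ?s z - wsum ?s z f * wsum ?s z f * D (\<lambda>_. 1)) / (Z ?s z * Z ?s z)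
          = 2 * g * D f - g\<^sup>2 * D (\<lambda>_. 1)"
          unfolding W using Z0 by (simp add: field_simps power2_eq_square)
        also have "\<dots> = (\<Sum>k\<in>K. (s1 k - s0 k) * (z k / (2 * sqrt (line s0 s1 t k)) *
        (2 * g * wsum ?s z (\<lambda>x. f x * u k x) - g\<^sup>2 * wsum ?s z (u k))
        - (2 * g * wsum ?s z (\<lambda>x. f x * (u k x)\<^sup>2) - g\<^sup>2 * wsum ?s z (\<lambda>x. (u k x)\<^sup>2)) / 2))"
          unfolding D_def sum_distrib_left sum_subtractf[symmetric] mult_1_left
        proof (intro sum.cong refl)
          have "\<And>v y a b c d :: real. 2 * g * (v * (y * a - c / 2)) - g\<^sup>2 * (v * (y * b - d / 2))
            = v * (y * (2 * g * a - g\<^sup>2 * b) - (2 * g * c - g\<^sup>2 * d) / 2)" by (simp add: algebra_simps diff_divide_distrib)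
          then show "2 * g * ((s1 k - s0 k) * (z k / (2 * sqrt (line s0 s1 t k)) * wsum ?s z (\<lambda>x. f x * u k x) - wsum ?s z (\<lambda>x. f x * (u k x)\<^sup>2) / 2))
            - g\<^sup>2 * ((s1 k - s0 k) * (z k / (2 * sqrt (line s0 s1 t k)) * wsum ?s z (u k) - wsum ?s z (\<lambda>x. (u k x)\<^sup>2) / 2))
            = (s1 k - s0 k) * (z k / (2 * sqrt (line s0 s1 t k)) *
            (2 * g * wsum ?s z (\<lambda>x. f x * u k x) - g\<^sup>2 * wsum ?s z (u k))
            - (2 * g * wsum ?s z (\<lambda>x. f x * (u k x)\<^sup>2) - g\<^sup>2 * wsum ?s z (\<lambda>x. (u k x)\<^sup>2)) / 2)" for k
            by (rule meta_allE)
        qed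
        finally show "((D f * wsum ?s z f + D f * wsum ?s z f) * Z ?s z - wsum ?s z f * wsum ?s z f * D (\<lambda>_. 1)) / (Z ?s z * Z ?s z)
          = (\<Sum>k\<in>K. (s1 k - s0 k) * (z k / (2 * sqrt (s0 k + t * (s1 k - s0 k))) *
        (2 * gibbs ?s z f * wsum ?s z (\<lambda>x. f x * u k x) - (gibbs ?s z f)\<^sup>2 * wsum ?s z (u k))
        - (2 * gibbs ?s z f * wsum ?s z (\<lambda>x. f x * (u k x)\<^sup>2) - (gibbs ?s z f)\<^sup>2 * wsum ?s z (\<lambda>x. (u k x)\<^sup>2)) / 2))"
          unfolding line_def[of s0 s1 t, symmetric] g_def .
      qed
    qed
    fix k assume k: "k \<in> K"
    show "\<bar>2 * gibbs ?s z f * wsum ?s z (\<lambda>x. f x * u k x) - (gibbs ?s z f)\<^sup>2 * wsum ?s z (u k)\<bar>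
        \<le> exp (c * (\<Sum>k\<in>K. \<bar>z k\<bar>) + (d + C))"
      unfolding N_def[symmetric] by (rule key[OF t u_le_U[OF k] _ UU]) (use U_ge_1 in auto)
    show "\<bar>2 * gibbs ?s z f * wsum ?s z (\<lambda>x. f x * (u k x)\<^sup>2) - (gibbs ?s z f)\<^sup>2 * wsum ?s z (\<lambda>x. (u k x)\<^sup>2)\<bar>
        \<le> exp (c * (\<Sum>k\<in>K. \<bar>z k\<bar>) + (d + C))"
      unfolding N_def[symmetric] by (rule key[OF t u2[OF k] _ order_refl]) auto
    show "\<bar>2 * Z ?s z * (cov ?s z f (u k))\<^sup>2\<bar> \<le> exp (c * (\<Sum>k\<in>K. \<bar>z k\<bar>) + (d + C))"
    proof -
      have 1: "\<bar>gibbs ?s z (\<lambda>x. f x * u k x)\<bar> \<le> b * U"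
        by (rule gibbs_abs_le) (use fb u_le_U[OF k] b in \<open>auto simp: abs_mult intro!: mult_mono\<close>)
      have 2: "\<bar>gibbs ?s z f * gibbs ?s z (u k)\<bar> \<le> b * U"
        unfolding abs_mult using gb gibbs_abs_le[OF u_le_U[OF k]] b by (intro mult_mono) auto
      have "\<bar>cov ?s z f (u k)\<bar> \<le> 2 * (b * U)" unfolding cov_def using 1 2 by linarith
      from power_mono[OF this abs_ge_zero, where n = 2]
      have 3: "(cov ?s z f (u k))\<^sup>2 \<le> 4 * (b\<^sup>2 * U\<^sup>2)" unfolding power2_abs by (simp add: power_mult_distrib)
      have "\<bar>2 * Z ?s z * (cov ?s z f (u k))\<^sup>2\<bar> = 2 * (Z ?s z * (cov ?s z f (u k))\<^sup>2)"
        using Z_pos[of ?s z] by (simp add: abs_mult)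
      also have "\<dots> \<le> 2 * (exp (c * N z + d) * (4 * (b\<^sup>2 * U\<^sup>2)))"
        using Zb[OF t, of z] Z_pos[of ?s z] 3 by (intro mult_left_mono mult_mono) auto
      also have "\<dots> = C * exp (c * N z + d)" by (simp add: C_def)
      finally have "\<bar>2 * Z ?s z * (cov ?s z f (u k))\<^sup>2\<bar> \<le> exp ((c * N z + d) + C)"
        by (rule le_exp_mono) (auto simp: C_def)
      then show ?thesis unfolding N_def by (simp only: add.assoc)
    qed
    show "((\<lambda>y. 2 * gibbs ?s (z(k := y)) f * wsum ?s (z(k := y)) (\<lambda>x. f x * u k x)
        - (gibbs ?s (z(k := y)) f)\<^sup>2 * wsum ?s (z(k := y)) (u k)) has_real_derivative
      sqrt (s0 k + t * (s1 k - s0 k)) * (2 * gibbs ?s z f * wsum ?s z (\<lambda>x. f x * (u k x)\<^sup>2)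
        - (gibbs ?s z f)\<^sup>2 * wsum ?s z (\<lambda>x. (u k x)\<^sup>2) + 2 * Z ?s z * (cov ?s z f (u k))\<^sup>2)) (at (z k))"
    proof -
      let ?r = "sqrt (line s0 s1 t k)"
      define g where "g = gibbs ?s z f"
      define A where "A = wsum ?s z (\<lambda>x. f x * u k x)"
      define B where "B = wsum ?s z (u k)"
      define A' where "A' = wsum ?s z (\<lambda>x. f x * (u k x)\<^sup>2)"
      define B' where "B' = wsum ?s z (\<lambda>x. (u k x)\<^sup>2)"
      define V where "V = cov ?s z f (u k)"
      have dg: "((\<lambda>y. gibbs ?s (z(k := y)) f) has_real_derivative ?r * V) (at (z k))"
        unfolding V_def cov_def by (rule DERIV_gibbs_coord[OF k])
      have dA: "((\<lambda>y. wsum ?s (z(k := y)) (\<lambda>x. f x * u k x)) has_real_derivative ?r * A') (at (z k))"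
        unfolding A'_def power2_eq_square mult.assoc[symmetric] by (rule DERIV_wsum_coord[OF k])
      have dB: "((\<lambda>y. wsum ?s (z(k := y)) (u k)) has_real_derivative ?r * B') (at (z k))"
        unfolding B'_def power2_eq_square by (rule DERIV_wsum_coord[OF k])
      \<comment> \<open>Splits the mixed sum into covariance and product of means. The products
        cancel against the derivative of the squared mean, and the covariance, multiplied by the
        derivative \<open>?r * V\<close> of the mean, leaves
        \<open>2 * Z * V\<^sup>2\<close>.\<close>
      have AB: "A = Z ?s z * V + g * B"
        unfolding A_def B_def V_def g_def cov_def wsum_eq_gibbs[of ?s z "\<lambda>x. f x * u k x"]
          wsum_eq_gibbs[of ?s z "u k"] by (simp add: algebra_simps)
      show ?thesis unfolding power2_eq_square[of "gibbs ?s _ f"]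
      proof (rule DERIV_cong[OF DERIV_diff[OF DERIV_mult[OF DERIV_cmult[OF dg] dA] DERIV_mult[OF DERIV_mult[OF dg dg] dB]]])
        have "2 * (?r * V) * A + ?r * A' * (2 * g) - ((?r * V * g + ?r * V * g) * B + ?r * B' * (g * g))
          = ?r * (2 * g * A' - g * g * B' + 2 * Z ?s z * V\<^sup>2)"
          unfolding AB by (simp add: algebra_simps power2_eq_square)
        then show "2 * (?r * V) * wsum ?s (z(k := z k)) (\<lambda>x. f x * u k x) + ?r * A' * (2 * gibbs ?s (z(k := z k)) f)
          - ((?r * V * gibbs ?s (z(k := z k)) f + ?r * V * gibbs ?s (z(k := z k)) f) * wsum ?s (z(k := z k)) (u k)
            + ?r * B' * (gibbs ?s (z(k := z k)) f * gibbs ?s (z(k := z k)) f))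
          = sqrt (s0 k + t * (s1 k - s0 k)) * (2 * gibbs ?s z f * wsum ?s z (\<lambda>x. f x * (u k x)\<^sup>2)
        - gibbs ?s z f * gibbs ?s z f * wsum ?s z (\<lambda>x. (u k x)\<^sup>2) + 2 * Z ?s z * (cov ?s z f (u k))\<^sup>2)"
          unfolding line_def[of s0 s1 t, symmetric] fun_upd_triv A_def B_def A'_def B'_def g_def V_def .
      qed
    qed
  qed (use s0 s1 \<tau> c finite_K in auto)
  then show ?thesis unfolding info_def .
qed

end

section \<open>Variance of functions of independent variables\<close>

lemma
  assumes "prob_space M" "i \<in> I" and [measurable]: "h \<in> borel_measurable M"
  shows integrable_PiM_component: "integrable (PiM I (\<lambda>_. M)) (\<lambda>\<omega>. h (\<omega> i)) \<longleftrightarrow> integrable M (h :: 'a \<Rightarrow> real)"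
    and integral_PiM_component: "(\<integral>\<omega>. h (\<omega> i) \<partial>PiM I (\<lambda>_. M)) = (\<integral>x. h x \<partial>M)"
proof -
  have [measurable]: "(\<lambda>\<omega>. \<omega> i) \<in> measurable (PiM I (\<lambda>_. M)) M" using assms(2) by simp
  have d: "distr (PiM I (\<lambda>_. M)) M (\<lambda>\<omega>. \<omega> i) = M" using distr_PiM_component[of I "\<lambda>_. M" i] assms by simp
  show "integrable (PiM I (\<lambda>_. M)) (\<lambda>\<omega>. h (\<omega> i)) \<longleftrightarrow> integrable M h"
    by (subst (2) d[symmetric], subst integrable_distr_eq) auto
  show "(\<integral>\<omega>. h (\<omega> i) \<partial>PiM I (\<lambda>_. M)) = (\<integral>x. h x \<partial>M)"
    by (subst d[symmetric], subst integral_distr) auto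
qed

lemma (in prob_space) integral_sq_shift:
  fixes f :: "'a \<Rightarrow> real"
  assumes "integrable M f" "integrable M (\<lambda>x. (f x)\<^sup>2)"
  shows "integrable M (\<lambda>x. (f x - c)\<^sup>2)"
    "(\<integral>x. (f x - c)\<^sup>2 \<partial>M) = (\<integral>x. (f x)\<^sup>2 \<partial>M) - 2 * c * (\<integral>x. f x \<partial>M) + c\<^sup>2"
proof -
  have e: "(f x - c)\<^sup>2 = (f x)\<^sup>2 - (2 * c) * f x + c\<^sup>2" for x by (simp add: power2_eq_square algebra_simps)
  show "integrable M (\<lambda>x. (f x - c)\<^sup>2)" unfolding e using assms by simp
  show "(\<integral>x. (f x - c)\<^sup>2 \<partial>M) = (\<integral>x. (f x)\<^sup>2 \<partial>M) - 2 * c * (\<integral>x. f x \<partial>M) + c\<^sup>2"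
    unfolding e using assms by (simp add: prob_space)
qed

lemma (in prob_space) integrable_of_sq:
  assumes [measurable]: "f \<in> borel_measurable M" and sq: "integrable M (\<lambda>x. (f x :: real)\<^sup>2)"
  shows "integrable M f"
proof (rule Bochner_Integration.integrable_bound)
  show "integrable M (\<lambda>x. 1 + (f x)\<^sup>2)" using sq by simp
  have "\<bar>y\<bar> \<le> 1 + y\<^sup>2" for y :: real
    using sum_squares_bound[of 1 "\<bar>y\<bar>"] by (simp add: power2_eq_square)
  then show "AE x in M. norm (f x) \<le> norm (1 + (f x)\<^sup>2)" by (intro AE_I2) simp
qed simp

lemma integrable_sq_growth:
  fixes f :: "('i \<Rightarrow> real) \<Rightarrow> real"
  assumes M: "prob_space M" and I: "finite I"
    and [measurable]: "f \<in> borel_measurable (PiM I (\<lambda>_. M))" "g \<in> borel_measurable M"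
    and g: "integrable M (\<lambda>y. (g y :: real)\<^sup>2)"
    and gr: "\<And>\<omega>. \<omega> \<in> space (PiM I (\<lambda>_. M)) \<Longrightarrow> \<bar>f \<omega>\<bar> \<le> A + (\<Sum>i\<in>I. \<bar>g (\<omega> i)\<bar>)"
  shows "integrable (PiM I (\<lambda>_. M)) (\<lambda>\<omega>. (f \<omega>)\<^sup>2)" "integrable (PiM I (\<lambda>_. M)) f"
proof -
  interpret P: prob_space "PiM I (\<lambda>_. M)" using M by (rule prob_space_PiM)
  have ig: "integrable (PiM I (\<lambda>_. M)) (\<lambda>\<omega>. (g (\<omega> i))\<^sup>2)" if "i \<in> I" for i
    using integrable_PiM_component[OF M that, of "\<lambda>y. (g y)\<^sup>2"] g by simp
  show 1: "integrable (PiM I (\<lambda>_. M)) (\<lambda>\<omega>. (f \<omega>)\<^sup>2)"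
  proof (rule Bochner_Integration.integrable_bound)
    show "integrable (PiM I (\<lambda>_. M)) (\<lambda>\<omega>. 2 * A\<^sup>2 + 2 * ((\<Sum>i\<in>I. (g (\<omega> i))\<^sup>2) * card I))"
      using ig by simp
    show "AE \<omega> in PiM I (\<lambda>_. M). norm ((f \<omega>)\<^sup>2) \<le> norm (2 * A\<^sup>2 + 2 * ((\<Sum>i\<in>I. (g (\<omega> i))\<^sup>2) * card I))"
    proof (rule AE_I2)
      fix \<omega> assume w: "\<omega> \<in> space (PiM I (\<lambda>_. M))"
      let ?S = "\<Sum>i\<in>I. \<bar>g (\<omega> i)\<bar>"
      have "(f \<omega>)\<^sup>2 \<le> (A + ?S)\<^sup>2"
        using power_mono[OF gr[OF w] abs_ge_zero, of 2] by simp
      also have "\<dots> \<le> 2 * A\<^sup>2 + 2 * ?S\<^sup>2"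
        using sum_squares_bound[of A ?S] by (simp add: power2_sum)
      also have "?S\<^sup>2 \<le> (\<Sum>i\<in>I. (g (\<omega> i))\<^sup>2) * card I"
        using sum_squared_le_sum_of_squares[of "\<lambda>i. \<bar>g (\<omega> i)\<bar>" I] by simp
      finally show "norm ((f \<omega>)\<^sup>2) \<le> norm (2 * A\<^sup>2 + 2 * ((\<Sum>i\<in>I. (g (\<omega> i))\<^sup>2) * card I))"
        by simp
    qed
  qed measurable
  show "integrable (PiM I (\<lambda>_. M)) f" by (rule P.integrable_of_sq[OF _ 1]) simp
qed

text \<open>Efron--Stein, with each coordinate resampled to the deterministic reference value \<open>y0\<close>.\<close>
lemma efron_stein:
  fixes f :: "('i \<Rightarrow> real) \<Rightarrow> real" and d :: "'i \<Rightarrow> real \<Rightarrow> real"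
  assumes M: "prob_space M" and I: "finite I"
    and "f \<in> borel_measurable (PiM I (\<lambda>_. M))" and g [measurable]: "g \<in> borel_measurable M"
    and g2: "integrable M (\<lambda>y. (g y :: real)\<^sup>2)"
    and "\<And>X. X \<in> space (PiM I (\<lambda>_. M)) \<Longrightarrow> \<bar>f X\<bar> \<le> A + (\<Sum>i\<in>I. \<bar>g (X i)\<bar>)"
    and "\<And>i. i \<in> I \<Longrightarrow> d i \<in> borel_measurable M"
    and "\<And>i. i \<in> I \<Longrightarrow> integrable M (\<lambda>y. (d i y)\<^sup>2)"
    and y0: "y0 \<in> space M"
    and "\<And>X i y. X \<in> space (PiM I (\<lambda>_. M)) \<Longrightarrow> i \<in> I \<Longrightarrow> y \<in> space M \<Longrightarrow>
      \<bar>f (X(i := y)) - f (X(i := y0))\<bar> \<le> d i y"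
  shows "(\<integral>X. (f X - (\<integral>X. f X \<partial>PiM I (\<lambda>_. M)))\<^sup>2 \<partial>PiM I (\<lambda>_. M)) \<le> (\<Sum>i\<in>I. \<integral>y. (d i y)\<^sup>2 \<partial>M)"
  using I assms(3) assms(6-8,10)
proof (induction I arbitrary: f A rule: finite_induct)
  case empty
  have "PiM {} (\<lambda>_. M) = count_space {\<lambda>k::'i. undefined}" by (simp add: PiM_empty)
  then show ?case by (simp add: lebesgue_integral_count_space_finite)
next
  case (insert i J)
  interpret M: prob_space M by (rule M)
  interpret PJ: prob_space "PiM J (\<lambda>_. M)" using M by (rule prob_space_PiM)
  interpret PS: product_sigma_finite "\<lambda>_::'i. M"
    by (simp add: product_sigma_finite_def M.sigma_finite_measure_axioms)
  note [measurable] = insert.prems(1)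
  let ?I = "insert i J"
  have spI: "x(i := y) \<in> space (PiM ?I (\<lambda>_. M))" if "x \<in> space (PiM J (\<lambda>_. M))" "y \<in> space M" for x y
    using that by (auto simp: space_PiM PiE_iff extensional_def)
  have i1: "integrable (PiM ?I (\<lambda>_. M)) (\<lambda>X. (f X)\<^sup>2)" and i2: "integrable (PiM ?I (\<lambda>_. M)) f"
    using integrable_sq_growth[OF M finite.insertI[OF insert.hyps(1)] insert.prems(1) g g2 insert.prems(2)] by auto
  define h where "h x = (\<integral>y. f (x(i := y)) \<partial>M)" for x
  define \<mu> where "\<mu> = (\<integral>X. f X \<partial>PiM ?I (\<lambda>_. M))"
  define G where "G = (\<integral>y. \<bar>g y\<bar> \<partial>M)"
  have [measurable]: "h \<in> borel_measurable (PiM J (\<lambda>_. M))" unfolding h_def by measurable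
  have ig: "integrable M g" by (rule M.integrable_of_sq[OF g g2])
  have \<mu>h: "\<mu> = (\<integral>x. h x \<partial>PiM J (\<lambda>_. M))"
    unfolding \<mu>_def h_def by (rule PS.product_integral_insert[OF insert.hyps i2])
  have slice: "integrable M (\<lambda>y. (f (x(i := y)))\<^sup>2)" "integrable M (\<lambda>y. f (x(i := y)))"
      "\<bar>h x\<bar> \<le> (A + G) + (\<Sum>j\<in>J. \<bar>g (x j)\<bar>)"
    if x: "x \<in> space (PiM J (\<lambda>_. M))" for x
  proof -
    have [measurable]: "(\<lambda>y. f (x(i := y))) \<in> borel_measurable M"
      using x by measurable
    have gr: "\<bar>f (x(i := y))\<bar> \<le> (A + (\<Sum>j\<in>J. \<bar>g (x j)\<bar>)) + \<bar>g y\<bar>" if "y \<in> space M" for y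
    proof -
      have "(\<Sum>j\<in>J. \<bar>g ((x(i := y)) j)\<bar>) = (\<Sum>j\<in>J. \<bar>g (x j)\<bar>)"
        using insert.hyps by (intro sum.cong) auto
      then have "(\<Sum>j\<in>?I. \<bar>g ((x(i := y)) j)\<bar>) = \<bar>g y\<bar> + (\<Sum>j\<in>J. \<bar>g (x j)\<bar>)"
        by (subst sum.insert[OF insert.hyps]) simp
      then show ?thesis using insert.prems(2)[OF spI[OF x that]] by linarith
    qed
    let ?B = "A + (\<Sum>j\<in>J. \<bar>g (x j)\<bar>)"
    show 1: "integrable M (\<lambda>y. (f (x(i := y)))\<^sup>2)"
    proof (rule Bochner_Integration.integrable_bound)
      show "integrable M (\<lambda>y. 2 * ?B\<^sup>2 + 2 * (g y)\<^sup>2)" using g2 by simp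
      show "AE y in M. norm ((f (x(i := y)))\<^sup>2) \<le> norm (2 * ?B\<^sup>2 + 2 * (g y)\<^sup>2)"
      proof (rule AE_I2)
        fix y assume "y \<in> space M"
        from power_mono[OF gr[OF this] abs_ge_zero, of 2]
        have "(f (x(i := y)))\<^sup>2 \<le> (?B + \<bar>g y\<bar>)\<^sup>2" by simp
        also have "\<dots> \<le> 2 * ?B\<^sup>2 + 2 * (g y)\<^sup>2"
          using sum_squares_bound[of ?B "\<bar>g y\<bar>"] by (simp add: power2_sum)
        finally show "norm ((f (x(i := y)))\<^sup>2) \<le> norm (2 * ?B\<^sup>2 + 2 * (g y)\<^sup>2)" by simp
      qed
    qed measurable
    show 2: "integrable M (\<lambda>y. f (x(i := y)))" by (rule M.integrable_of_sq[OF _ 1]) simp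
    have "\<bar>h x\<bar> \<le> (\<integral>y. \<bar>f (x(i := y))\<bar> \<partial>M)" unfolding h_def by (rule integral_abs_bound)
    also have "\<dots> \<le> (\<integral>y. ?B + \<bar>g y\<bar> \<partial>M)"
      using 2 ig gr by (intro integral_mono) auto
    also have "\<dots> = ?B + G" using ig by (simp add: G_def M.prob_space)
    finally show "\<bar>h x\<bar> \<le> (A + G) + (\<Sum>j\<in>J. \<bar>g (x j)\<bar>)" by simp
  qed
  \<comment> \<open>Averaging over coordinate \<open>i\<close> keeps the sensitivities
    \<open>d j\<close> of the remaining coordinates, so the induction hypothesis applies to
    \<open>h\<close>; the growth constant becomes \<open>A + G\<close>.\<close>
  have IH: "(\<integral>X. (h X - (\<integral>X. h X \<partial>PiM J (\<lambda>_. M)))\<^sup>2 \<partial>PiM J (\<lambda>_. M)) \<le> (\<Sum>i\<in>J. \<integral>y. (d i y)\<^sup>2 \<partial>M)"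
  proof (rule insert.IH[OF _ slice(3)])
    show "h \<in> borel_measurable (PiM J (\<lambda>_. M))" by measurable
    show "d j \<in> borel_measurable M" if "j \<in> J" for j by (rule insert.prems(3)) (use that in simp)
    show "integrable M (\<lambda>y. (d j y)\<^sup>2)" if "j \<in> J" for j by (rule insert.prems(4)) (use that in simp)
    fix X j y assume w: "X \<in> space (PiM J (\<lambda>_. M))" and j: "j \<in> J" and y: "y \<in> space M"
    have sp: "X(j := y') \<in> space (PiM J (\<lambda>_. M))" if "y' \<in> space M" for y'
      using w j that by (auto simp: space_PiM PiE_iff extensional_def)
    have "h (X(j := y)) - h (X(j := y0)) = (\<integral>t. f ((X(j := y))(i := t)) - f ((X(j := y0))(i := t)) \<partial>M)"
      unfolding h_def using slice(2)[OF sp[OF y]] slice(2)[OF sp[OF y0]] by simp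
    also have "\<bar>\<dots>\<bar> \<le> (\<integral>t. \<bar>f ((X(j := y))(i := t)) - f ((X(j := y0))(i := t))\<bar> \<partial>M)"
      by (rule integral_abs_bound)
    also have "\<dots> \<le> (\<integral>t. d j y \<partial>M)"
    proof (rule integral_mono)
      fix t assume t: "t \<in> space M"
      have "j \<noteq> i" using j insert.hyps by auto
      then have eq: "(X(j := y'))(i := t) = (X(i := t))(j := y')" for y' by (rule fun_upd_twist)
      show "\<bar>f ((X(j := y))(i := t)) - f ((X(j := y0))(i := t))\<bar> \<le> d j y"
        unfolding eq by (rule insert.prems(5)[OF spI[OF w t] _ y]) (use j in simp)
    qed (use slice(2)[OF sp[OF y]] slice(2)[OF sp[OF y0]] in auto)
    finally show "\<bar>h (X(j := y)) - h (X(j := y0))\<bar> \<le> d j y" by (simp add: M.prob_space)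
  qed
  have hint: "integrable (PiM J (\<lambda>_. M)) (\<lambda>x. (h x - \<mu>)\<^sup>2)"
  proof (rule PJ.integral_sq_shift(1))
    have hm: "h \<in> borel_measurable (PiM J (\<lambda>_. M))" by measurable
    show "integrable (PiM J (\<lambda>_. M)) h"
      by (rule integrable_sq_growth(2)[OF M insert.hyps(1) hm g g2 slice(3)])
    show "integrable (PiM J (\<lambda>_. M)) (\<lambda>x. (h x)\<^sup>2)"
      by (rule integrable_sq_growth(1)[OF M insert.hyps(1) hm g g2 slice(3)])
  qed
  have fint: "integrable (PiM ?I (\<lambda>_. M)) (\<lambda>X. (f X - \<mu>)\<^sup>2)"
    by (rule prob_space.integral_sq_shift(1)[OF prob_space_PiM i2 i1]) (rule M)
  have "(\<integral>X. (f X - \<mu>)\<^sup>2 \<partial>PiM ?I (\<lambda>_. M)) = (\<integral>x. \<integral>y. (f (x(i := y)) - \<mu>)\<^sup>2 \<partial>M \<partial>PiM J (\<lambda>_. M))"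
    by (rule PS.product_integral_insert[OF insert.hyps fint])
  also have "\<dots> \<le> (\<integral>x. (\<integral>y. (d i y)\<^sup>2 \<partial>M) + (h x - \<mu>)\<^sup>2 \<partial>PiM J (\<lambda>_. M))"
  proof (rule integral_mono')
    fix x assume x: "x \<in> space (PiM J (\<lambda>_. M))"
    let ?s = "\<lambda>y. f (x(i := y))"
    let ?a = "?s y0"
    note v = M.integral_sq_shift[OF slice(2,1)[OF x]]
    \<comment> \<open>The second moment about \<open>\<mu>\<close> splits into the variance of the
      slice and \<open>(h x - \<mu>)\<^sup>2\<close>. The variance is at most the second moment
      about any constant, and the reference value \<open>?a\<close> is the constant that
      \<open>d i\<close> controls.\<close>
    have "(\<integral>y. (?s y - \<mu>)\<^sup>2 \<partial>M) = (\<integral>y. (?s y - ?a)\<^sup>2 \<partial>M) - (h x - ?a)\<^sup>2 + (h x - \<mu>)\<^sup>2"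
      unfolding v(2) h_def by (simp add: power2_eq_square algebra_simps)
    also have "\<dots> \<le> (\<integral>y. (?s y - ?a)\<^sup>2 \<partial>M) + (h x - \<mu>)\<^sup>2" by simp
    also have "(\<integral>y. (?s y - ?a)\<^sup>2 \<partial>M) \<le> (\<integral>y. (d i y)\<^sup>2 \<partial>M)"
    proof (rule integral_mono[OF v(1)])
      fix y assume y: "y \<in> space M"
      have "\<bar>f ((x(i := y0))(i := y)) - f ((x(i := y0))(i := y0))\<bar> \<le> d i y"
        by (rule insert.prems(5)[OF spI[OF x y0] _ y]) simp
      then have "\<bar>?s y - ?a\<bar> \<le> d i y" by simp
      from power_mono[OF this abs_ge_zero, of 2] show "(?s y - ?a)\<^sup>2 \<le> (d i y)\<^sup>2" by simp
    qed (use insert.prems(4) in auto)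
    finally show "(\<integral>y. (?s y - \<mu>)\<^sup>2 \<partial>M) \<le> (\<integral>y. (d i y)\<^sup>2 \<partial>M) + (h x - \<mu>)\<^sup>2" by simp
  qed (use hint in auto)
  also have "\<dots> = (\<integral>y. (d i y)\<^sup>2 \<partial>M) + (\<integral>x. (h x - \<mu>)\<^sup>2 \<partial>PiM J (\<lambda>_. M))"
    using hint by (simp add: PJ.prob_space)
  also have "\<dots> \<le> (\<Sum>i\<in>?I. \<integral>y. (d i y)\<^sup>2 \<partial>M)"
    using IH insert.hyps unfolding \<mu>h by simp
  finally show ?case unfolding \<mu>_def .
qed

section \<open>Convexity of the free energy\<close>

context finite_channel
begin

text \<open>A squared covariance is an expectation over two independent replicas of a product of
  centred features, so the quadratic form becomes the expectation of the square of
  \<open>\<Sum>j\<in>K. v j * a j x * a j y\<close>.\<close>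

lemma cov_form_nonneg: "(\<Sum>j\<in>K. \<Sum>k\<in>K. v j * v k * (cov s z (u j) (u k))\<^sup>2) \<ge> 0"
proof -
  define a where "a k x = u k x - gibbs s z (u k)" for k x
  have "(cov s z (u j) (u k))\<^sup>2 = gibbs s z (\<lambda>x. gibbs s z (\<lambda>y. a j x * a k x * (a j y * a k y)))" for j k
    unfolding cov_eq a_def power2_eq_square by (simp only: gibbs_cmult gibbs_multc)
  then have "(\<Sum>j\<in>K. \<Sum>k\<in>K. v j * v k * (cov s z (u j) (u k))\<^sup>2)
      = gibbs s z (\<lambda>x. gibbs s z (\<lambda>y. \<Sum>j\<in>K. \<Sum>k\<in>K. v j * v k * (a j x * a k x * (a j y * a k y))))"
    by (simp only: gibbs_sum gibbs_cmult)
  also have "\<dots> = gibbs s z (\<lambda>x. gibbs s z (\<lambda>y. (\<Sum>j\<in>K. v j * a j x * a j y)\<^sup>2))"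
    by (intro gibbs_cong) (simp add: power2_eq_square sum_product mult_ac)
  also have "\<dots> \<ge> gibbs s z (\<lambda>x. gibbs s z (\<lambda>y. 0))"
    by (intro gibbs_mono) simp
  finally show ?thesis by simp
qed

lemma line_0 [simp]: "line s0 s1 0 = s0" and line_1 [simp]: "line s0 s1 1 = s1"
  by (auto simp: line_def)

lemma continuous_wsum_line: "continuous_on A (\<lambda>t. wsum (line s0 s1 t) z f)"
  unfolding wsum_def expo_def line_def by (intro continuous_intros) auto

lemma tame_nonneg_line:
  assumes s0: "\<And>k. k \<in> K \<Longrightarrow> s0 k \<ge> 0" and s1: "\<And>k. k \<in> K \<Longrightarrow> s1 k \<ge> 0"
  obtains W where "integrable (gaussK K) W"
    "\<And>t z. 0 \<le> t \<Longrightarrow> t \<le> 1 \<Longrightarrow> Z (line s0 s1 t) z \<le> W z"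
    "\<And>t z. 0 \<le> t \<Longrightarrow> t \<le> 1 \<Longrightarrow> \<bar>Z (line s0 s1 t) z * ln (Z (line s0 s1 t) z)\<bar> \<le> W z"
proof -
  obtain c d where c: "c \<ge> 0" and d: "d \<ge> 0" and e:
    "\<And>t z x. 0 \<le> t \<Longrightarrow> t \<le> 1 \<Longrightarrow> x \<in> \<Omega> \<Longrightarrow>
      \<bar>expo (line s0 s1 t) z x\<bar> \<le> c * (\<Sum>k\<in>K. \<bar>z k\<bar>) + d"
    using expo_bound_line[of s0 s1, OF s0 s1] by blast
  define b where "b z = c * (\<Sum>k\<in>K. \<bar>z k\<bar>) + d" for z
  have b0: "b z \<ge> 0" for z unfolding b_def using c d by (simp add: sum_nonneg)
  have Zb: "Z (line s0 s1 t) z \<le> exp (b z)" "\<bar>ln (Z (line s0 s1 t) z)\<bar> \<le> b z"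
    if "0 \<le> t" "t \<le> 1" for t z
    using Z_bounds[of "line s0 s1 t" z "b z"] e[of t _ z] that unfolding b_def by auto
  have "integrable (gaussK K) (\<lambda>z. exp (2 * b z))"
    unfolding b_def using tame_integrable[OF finite_K tameI[of "\<lambda>z. exp (2 * (c * (\<Sum>k\<in>K. \<bar>z k\<bar>) + d))" K "2 * c" "2 * d"]] c
    by (simp add: algebra_simps)
  moreover have "Z (line s0 s1 t) z \<le> exp (2 * b z)" if "0 \<le> t" "t \<le> 1" for t z
  proof -
    have "exp (b z) \<le> exp (2 * b z)" using b0[of z] by simp
    then show ?thesis using Zb(1)[OF that, of z] by linarith
  qed
  moreover have "\<bar>Z (line s0 s1 t) z * ln (Z (line s0 s1 t) z)\<bar> \<le> exp (2 * b z)" if "0 \<le> t" "t \<le> 1" for t z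
  proof -
    have l: "\<bar>ln (Z (line s0 s1 t) z)\<bar> \<le> exp (b z)"
      using Zb(2)[OF that, of z] exp_ge_add_one_self[of "b z"] by linarith
    have "\<bar>Z (line s0 s1 t) z * ln (Z (line s0 s1 t) z)\<bar> \<le> exp (b z) * exp (b z)"
      unfolding abs_mult using Zb(1)[OF that, of z] Z_pos[of "line s0 s1 t" z] l by (intro mult_mono) auto
    then show ?thesis by (simp add: exp_add[symmetric])
  qed
  ultimately show ?thesis
    by (intro that[of "\<lambda>z. exp (2 * b z)"])
qed

text \<open>The derivative is available only inside the segment, since \<open>sqrt\<close> is not
  differentiable at zero. Continuity at the end points is what lets the mean value theorem start
  from a channel that is switched off.\<close>

lemma continuous_free_energy_line:
  assumes s0: "\<And>k. k \<in> K \<Longrightarrow> s0 k \<ge> 0" and s1: "\<And>k. k \<in> K \<Longrightarrow> s1 k \<ge> 0"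
  shows "continuous_on {0..1} (\<lambda>t. \<integral>z. Z (line s0 s1 t) z * ln (Z (line s0 s1 t) z) \<partial>gaussK K)"
proof -
  obtain W where W: "integrable (gaussK K) W"
    "\<And>t z. 0 \<le> t \<Longrightarrow> t \<le> 1 \<Longrightarrow> Z (line s0 s1 t) z \<le> W z"
    "\<And>t z. 0 \<le> t \<Longrightarrow> t \<le> 1 \<Longrightarrow> \<bar>Z (line s0 s1 t) z * ln (Z (line s0 s1 t) z)\<bar> \<le> W z"
    using tame_nonneg_line[of s0 s1, OF s0 s1] by metis
  show ?thesis
  proof (rule continuous_on_integral_dominated[OF _ _ _ W(1)])
    show "continuous_on {0..1} (\<lambda>t. Z (line s0 s1 t) z * ln (Z (line s0 s1 t) z))" for z
      by (intro continuous_on_mult continuous_on_ln continuous_wsum_line ballI less_imp_neq[OF Z_pos, symmetric])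
    show "\<bar>Z (line s0 s1 t) z * ln (Z (line s0 s1 t) z)\<bar> \<le> W z" if "t \<in> {0..1}" for t z
      using that by (intro W(3)) auto
    show "(\<lambda>z. Z (line s0 s1 t) z * ln (Z (line s0 s1 t) z)) \<in> borel_measurable (gaussK K)" for t
      by (intro borel_measurable_times borel_measurable_ln measurable_wsum')
  qed
qed

lemma continuous_info_line:
  assumes s0: "\<And>k. k \<in> K \<Longrightarrow> s0 k \<ge> 0" and s1: "\<And>k. k \<in> K \<Longrightarrow> s1 k \<ge> 0"
  shows "continuous_on {0..1} (\<lambda>t. info (line s0 s1 t) f)"
proof -
  obtain W where W: "integrable (gaussK K) W"
    "\<And>t z. 0 \<le> t \<Longrightarrow> t \<le> 1 \<Longrightarrow> Z (line s0 s1 t) z \<le> W z"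
    using tame_nonneg_line[of s0 s1, OF s0 s1] by metis
  obtain b where b: "b \<ge> 1" and fb: "\<And>x. x \<in> \<Omega> \<Longrightarrow> \<bar>f x\<bar> \<le> b"
    using gibbs_abs_exists by blast
  show ?thesis unfolding info_def
  proof (rule continuous_on_integral_dominated)
    show "integrable (gaussK K) (\<lambda>z. W z * b\<^sup>2)" using W(1) by simp
    show "continuous_on {0..1} (\<lambda>t. Z (line s0 s1 t) z * (gibbs (line s0 s1 t) z f)\<^sup>2)" for z
      unfolding gibbs_def
      by (intro continuous_on_mult continuous_on_power continuous_on_divide continuous_wsum_line ballI
          less_imp_neq[OF Z_pos, symmetric])
    fix t :: real and z assume t: "t \<in> {0..1}"
    have "(gibbs (line s0 s1 t) z f)\<^sup>2 \<le> b\<^sup>2"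
      using power_mono[OF gibbs_abs_le[OF fb, where s = "line s0 s1 t" and z = z] abs_ge_zero, where n = 2]
      unfolding power2_abs by assumption
    then show "\<bar>Z (line s0 s1 t) z * (gibbs (line s0 s1 t) z f)\<^sup>2\<bar> \<le> W z * b\<^sup>2"
      unfolding abs_mult using W(2)[of t z] t Z_pos[of "line s0 s1 t" z] by (intro mult_mono) auto
  next
    show "(\<lambda>z. Z (line s0 s1 t) z * (gibbs (line s0 s1 t) z f)\<^sup>2) \<in> borel_measurable (gaussK K)" for t
      by (intro borel_measurable_times borel_measurable_power measurable_wsum' measurable_gibbs)
  qed
qed

lemma free_energy_mvt:
  assumes s0: "\<And>k. k \<in> K \<Longrightarrow> s0 k \<ge> 0" and s1: "\<And>k. k \<in> K \<Longrightarrow> s1 k \<ge> 0"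
  obtains \<xi> where "0 < \<xi>" "\<xi> < 1"
    "free_energy s1 - free_energy s0 = (\<Sum>k\<in>K. (s1 k - s0 k) * info (line s0 s1 \<xi>) (u k) / 2)"
proof -
  have "\<exists>l z. 0 < z \<and> z < 1 \<and>
    ((\<lambda>t. \<integral>z. Z (line s0 s1 t) z * ln (Z (line s0 s1 t) z) \<partial>gaussK K) has_real_derivative l) (at z) \<and>
    (\<integral>z. Z (line s0 s1 1) z * ln (Z (line s0 s1 1) z) \<partial>gaussK K)
      - (\<integral>z. Z (line s0 s1 0) z * ln (Z (line s0 s1 0) z) \<partial>gaussK K) = (1 - 0) * l"
    by (rule MVT[OF zero_less_one continuous_free_energy_line[OF s0 s1]])
      (use DERIV_free_energy_line[of s0 s1, OF s0 s1] in \<open>auto simp: real_differentiable_def\<close>)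
  then obtain l \<xi> where \<xi>: "0 < \<xi>" "\<xi> < 1"
    and l: "((\<lambda>t. \<integral>z. Z (line s0 s1 t) z * ln (Z (line s0 s1 t) z) \<partial>gaussK K) has_real_derivative l) (at \<xi>)"
    and eq: "(\<integral>z. Z s1 z * ln (Z s1 z) \<partial>gaussK K) - (\<integral>z. Z s0 z * ln (Z s0 z) \<partial>gaussK K) = l"
    by auto
  have "l = (\<Sum>k\<in>K. (s1 k - s0 k) * info (line s0 s1 \<xi>) (u k) / 2)"
    by (rule DERIV_unique[OF l DERIV_free_energy_line[OF s0 s1 \<xi>]])
  then have "free_energy s1 - free_energy s0 = (\<Sum>k\<in>K. (s1 k - s0 k) * info (line s0 s1 \<xi>) (u k) / 2)"
    using eq free_energy_eq[of s0, OF s0] free_energy_eq[of s1, OF s1] by simp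
  with \<xi> show ?thesis by (rule that)
qed

text \<open>The slope \<open>D\<close> is nondecreasing along the segment, its derivative being a
  nonnegative form integrated against \<open>Z\<close>. The increment of the free energy equals
  \<open>D\<close> at an intermediate point and so is at least \<open>D 0\<close>.\<close>

lemma free_energy_tangent:
  assumes s0: "\<And>k. k \<in> K \<Longrightarrow> s0 k \<ge> 0" and s1: "\<And>k. k \<in> K \<Longrightarrow> s1 k \<ge> 0"
  shows "free_energy s1 \<ge> free_energy s0 + (\<Sum>k\<in>K. (s1 k - s0 k) * info s0 (u k) / 2)"
proof -
  define D where "D t = (\<Sum>k\<in>K. (s1 k - s0 k) * info (line s0 s1 t) (u k) / 2)" for t
  obtain \<xi> where \<xi>: "0 < \<xi>" "\<xi> < 1" and eq: "free_energy s1 - free_energy s0 = D \<xi>"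
    using free_energy_mvt[of s0 s1, OF s0 s1] unfolding D_def by blast
  have "D 0 \<le> D \<xi>"
  proof (rule DERIV_nonneg_imp_increasing_open[of 0 \<xi> D])
    show "0 \<le> \<xi>" using \<xi> by simp
    have "continuous_on {0..1} D"
      unfolding D_def by (intro continuous_intros continuous_info_line s0 s1) auto
    then show "continuous_on {0..\<xi>} D" by (rule continuous_on_subset) (use \<xi> in auto)
    fix t assume t: "0 < t" "t < \<xi>"
    then have t1: "t < 1" using \<xi> by simp
    let ?s = "line s0 s1 t"
    let ?v = "\<lambda>k. s1 k - s0 k"
    have "(D has_real_derivative (\<Sum>j\<in>K. ?v j * (\<Sum>k\<in>K. ?v k * (\<integral>z. 2 * Z ?s z * (cov ?s z (u j) (u k))\<^sup>2 \<partial>gaussK K) / 2) / 2)) (at t)"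
      unfolding D_def by (intro DERIV_sum DERIV_cdivide DERIV_cmult DERIV_info_line s0 s1 t t1)
    moreover have "(\<Sum>j\<in>K. ?v j * (\<Sum>k\<in>K. ?v k * (\<integral>z. 2 * Z ?s z * (cov ?s z (u j) (u k))\<^sup>2 \<partial>gaussK K) / 2) / 2) \<ge> 0"
    proof -
      have sp: "?s k \<ge> 0" if "k \<in> K" for k
        using line_bounds(1)[of s0 k s1 t] s0[OF that] s1[OF that] t t1 by simp
      have tc: "tame K (\<lambda>z. cov ?s z (u j) (u k))" for j k
        unfolding cov_def by (intro tame_diff tame_mult tame_gibbs)
      have int: "integrable (gaussK K) (\<lambda>z. Z ?s z * (cov ?s z (u j) (u k))\<^sup>2)" for j k
        unfolding power2_eq_square
        by (rule tame_integrable[OF finite_K tame_mult[OF tame_wsum tame_mult[OF tc tc]]]) (use sp in auto)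
      have "(\<Sum>j\<in>K. ?v j * (\<Sum>k\<in>K. ?v k * (\<integral>z. 2 * Z ?s z * (cov ?s z (u j) (u k))\<^sup>2 \<partial>gaussK K) / 2) / 2)
        = (\<Sum>j\<in>K. \<Sum>k\<in>K. ?v j * ?v k * (\<integral>z. Z ?s z * (cov ?s z (u j) (u k))\<^sup>2 \<partial>gaussK K)) / 2"
        unfolding sum_divide_distrib sum_distrib_left mult.assoc integral_mult_right_zero
        by (intro sum.cong refl) simp
      also have "\<dots> = (\<integral>z. (\<Sum>j\<in>K. \<Sum>k\<in>K. ?v j * ?v k * (Z ?s z * (cov ?s z (u j) (u k))\<^sup>2)) \<partial>gaussK K) / 2"
        using int by (simp add: Bochner_Integration.integral_sum Bochner_Integration.integrable_sum)
      also have "\<dots> = (\<integral>z. Z ?s z * (\<Sum>j\<in>K. \<Sum>k\<in>K. ?v j * ?v k * (cov ?s z (u j) (u k))\<^sup>2) \<partial>gaussK K) / 2"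
        by (intro arg_cong[where f = "\<lambda>x. x / 2"] Bochner_Integration.integral_cong refl)
          (simp add: sum_distrib_left mult_ac)
      also have "\<dots> \<ge> 0"
        by (intro divide_nonneg_nonneg integral_nonneg_AE AE_I2 mult_nonneg_nonneg cov_form_nonneg less_imp_le[OF Z_pos]) simp
      finally show ?thesis .
    qed
    ultimately show "\<exists>y. (D has_real_derivative y) (at t) \<and> 0 \<le> y" by blast
  qed
  then show ?thesis using eq by (simp add: D_def)
qed

section \<open>Planted expectations\<close>

lemma info_eq_planted:
  assumes "\<And>k. k \<in> K \<Longrightarrow> s k \<ge> 0"
  shows "info s f = planted s (\<lambda>x z. f x * gibbs s z f)"
proof -
  have "planted s (\<lambda>x z. f x * gibbs s z f) = (\<integral>z. wsum s z (\<lambda>x. f x * gibbs s z f) \<partial>gaussK K)"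
    by (rule planted_eq[OF assms tame_cmult[OF tame_gibbs]])
  also have "\<dots> = info s f"
    unfolding info_def wsum_multc wsum_eq_gibbs[of s _ f] by (simp add: power2_eq_square mult.assoc)
  finally show ?thesis by simp
qed

definition shift :: "('k \<Rightarrow> real) \<Rightarrow> 'x \<Rightarrow> ('k \<Rightarrow> real) \<Rightarrow> 'k \<Rightarrow> real" where
  "shift s x0 z = (\<lambda>k\<in>K. z k + sqrt (s k) * u k x0)"

lemma planted_shift: "planted s A = (\<Sum>x0\<in>\<Omega>. w x0 * (\<integral>z. A x0 (shift s x0 z) \<partial>gaussK K))"
  unfolding planted_def shift_def ..

lemma measurable_shift [measurable]: "shift s x0 \<in> measurable (gaussK K) (gaussK K)"
  unfolding shift_def by measurable

lemma tame_shift: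
  assumes "tame K f" shows "tame K (\<lambda>z. f (shift s x0 z))"
proof -
  from assms obtain c d where f [measurable]: "f \<in> borel_measurable (gaussK K)" and c: "c \<ge> 0"
    and b: "\<And>z. \<bar>f z\<bar> \<le> exp (c * (\<Sum>k\<in>K. \<bar>z k\<bar>) + d)" unfolding tame_def by blast
  show ?thesis
  proof (rule tameI[OF _ c])
    show "(\<lambda>z. f (shift s x0 z)) \<in> borel_measurable (gaussK K)"
      by (rule measurable_compose[OF measurable_shift f])
    fix z
    have "(\<Sum>k\<in>K. \<bar>shift s x0 z k\<bar>) \<le> (\<Sum>k\<in>K. \<bar>z k\<bar> + \<bar>sqrt (s k) * u k x0\<bar>)"
      unfolding shift_def by (intro sum_mono) auto
    then have "(\<Sum>k\<in>K. \<bar>shift s x0 z k\<bar>) \<le> (\<Sum>k\<in>K. \<bar>z k\<bar>) + (\<Sum>k\<in>K. \<bar>sqrt (s k) * u k x0\<bar>)"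
      by (simp only: sum.distrib)
    from mult_left_mono[OF this c]
    have "c * (\<Sum>k\<in>K. \<bar>shift s x0 z k\<bar>) + d \<le> c * (\<Sum>k\<in>K. \<bar>z k\<bar>) + (c * (\<Sum>k\<in>K. \<bar>sqrt (s k) * u k x0\<bar>) + d)"
      by (simp only: distrib_left add.assoc add_right_mono)
    then have "exp (c * (\<Sum>k\<in>K. \<bar>shift s x0 z k\<bar>) + d) \<le> exp (c * (\<Sum>k\<in>K. \<bar>z k\<bar>) + (c * (\<Sum>k\<in>K. \<bar>sqrt (s k) * u k x0\<bar>) + d))"
      by (simp only: exp_le_cancel_iff)
    from order_trans[OF b this]
    show "\<bar>f (shift s x0 z)\<bar> \<le> exp (c * (\<Sum>k\<in>K. \<bar>z k\<bar>) + (c * (\<Sum>k\<in>K. \<bar>sqrt (s k) * u k x0\<bar>) + d))" .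
  qed
qed

lemma tame_gibbs_shift: "tame K (\<lambda>z. gibbs s (shift s' x0 z) f)"
  by (rule tame_shift[OF tame_gibbs])

text \<open>Takes the expectation before the shift by the signal, so that two strengths of a channel
  can be compared for one and the same noise.\<close>

definition noise_exp :: "('x \<Rightarrow> ('k \<Rightarrow> real) \<Rightarrow> real) \<Rightarrow> real" where
  "noise_exp A = (\<Sum>x0\<in>\<Omega>. w x0 * (\<integral>z. A x0 z \<partial>gaussK K))"

lemma planted_noise_exp: "planted s A = noise_exp (\<lambda>x0 z. A x0 (shift s x0 z))"
  unfolding noise_exp_def planted_shift ..

lemma noise_exp_mono:
  assumes "\<And>x0. x0 \<in> \<Omega> \<Longrightarrow> tame K (A x0)" "\<And>x0. x0 \<in> \<Omega> \<Longrightarrow> tame K (B x0)"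
    "\<And>x0 z. x0 \<in> \<Omega> \<Longrightarrow> A x0 z \<le> B x0 z"
  shows "noise_exp A \<le> noise_exp B"
  unfolding noise_exp_def using assms w_nonneg
  by (intro sum_mono mult_left_mono integral_mono tame_integrable finite_K) auto

lemma noise_exp_add:
  assumes "\<And>x0. x0 \<in> \<Omega> \<Longrightarrow> tame K (A x0)" "\<And>x0. x0 \<in> \<Omega> \<Longrightarrow> tame K (B x0)"
  shows "noise_exp (\<lambda>x0 z. A x0 z + B x0 z) = noise_exp A + noise_exp B"
  unfolding noise_exp_def sum.distrib[symmetric] distrib_left[symmetric]
  by (intro sum.cong refl arg_cong2[where f = times] Bochner_Integration.integral_add tame_integrable finite_K assms)

lemma noise_exp_diff:
  assumes "\<And>x0. x0 \<in> \<Omega> \<Longrightarrow> tame K (A x0)" "\<And>x0. x0 \<in> \<Omega> \<Longrightarrow> tame K (B x0)"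
  shows "noise_exp (\<lambda>x0 z. A x0 z - B x0 z) = noise_exp A - noise_exp B"
  unfolding noise_exp_def sum_subtractf[symmetric] right_diff_distrib[symmetric]
  by (intro sum.cong refl arg_cong2[where f = times] Bochner_Integration.integral_diff tame_integrable finite_K assms)

lemma noise_exp_cmult: "noise_exp (\<lambda>x0 z. c * A x0 z) = c * noise_exp A"
  unfolding noise_exp_def integral_mult_right_zero sum_distrib_left by (intro sum.cong refl) simp

lemma noise_exp_const: "noise_exp (\<lambda>x0 z. c) = c"
  unfolding noise_exp_def
  by (simp add: prob_space.prob_space sum_distrib_right[symmetric] sum_w)

lemma noise_exp_sum:
  assumes "\<And>i x0. i \<in> I \<Longrightarrow> x0 \<in> \<Omega> \<Longrightarrow> tame K (A i x0)"
  shows "noise_exp (\<lambda>x0 z. \<Sum>i\<in>I. A i x0 z) = (\<Sum>i\<in>I. noise_exp (A i))"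
  using assms
  by (induction I rule: infinite_finite_induct)
    (simp_all add: noise_exp_const noise_exp_add tame_sum)

lemma noise_exp_abs: "\<bar>noise_exp A\<bar> \<le> noise_exp (\<lambda>x0 z. \<bar>A x0 z\<bar>)"
proof -
  have "\<bar>noise_exp A\<bar> \<le> (\<Sum>x0\<in>\<Omega>. \<bar>w x0 * (\<integral>z. A x0 z \<partial>gaussK K)\<bar>)"
    unfolding noise_exp_def by (rule sum_abs)
  also have "\<dots> \<le> noise_exp (\<lambda>x0 z. \<bar>A x0 z\<bar>)"
    unfolding noise_exp_def using w_nonneg
    by (intro sum_mono) (simp add: abs_mult mult_left_mono)
  finally show ?thesis .
qed

lemma expo_shift:
  assumes "\<And>k. k \<in> K \<Longrightarrow> s k \<ge> 0"
  shows "expo s (shift s x0 z) x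
    = (\<Sum>k\<in>K. sqrt (s k) * z k * u k x + s k * u k x0 * u k x - s k * (u k x)\<^sup>2 / 2)"
  unfolding expo_def shift_def
proof (intro sum.cong refl)
  fix k assume k: "k \<in> K"
  have "sqrt (s k) * (z k + sqrt (s k) * u k x0) * u k x
      = sqrt (s k) * z k * u k x + (sqrt (s k) * sqrt (s k)) * u k x0 * u k x"
    by (simp only: distrib_left distrib_right mult.assoc)
  then show "sqrt (s k) * (\<lambda>k\<in>K. z k + sqrt (s k) * u k x0) k * u k x - s k * (u k x)\<^sup>2 / 2
      = sqrt (s k) * z k * u k x + s k * u k x0 * u k x - s k * (u k x)\<^sup>2 / 2"
    using k assms[OF k] by (simp only: restrict_apply' real_sqrt_mult_self abs_of_nonneg)
qed

text \<open>Covers integrands that themselves depend on the noise: expanding in point masses of the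
  finite \<open>\<Omega>\<close> separates the posterior weight from the integrand.\<close>

lemma tame_gibbs_family:
  assumes h: "\<And>f. tame K (\<lambda>z. gibbs s (h z) f)" and B: "\<And>x. tame K (B x)"
  shows "tame K (\<lambda>z. gibbs s (h z) (\<lambda>x. B x z))"
proof -
  have "gibbs s (h z) (\<lambda>x. B x z) = (\<Sum>x\<in>\<Omega>. gibbs s (h z) (\<lambda>y. if y = x then 1 else 0) * B x z)" for z
  proof -
    have "gibbs s (h z) (\<lambda>x. B x z) = gibbs s (h z) (\<lambda>y. \<Sum>x\<in>\<Omega>. (if y = x then 1 else 0) * B x z)"
      by (rule gibbs_cong) (simp add: if_distrib[of "\<lambda>c. c * _"] finite_\<Omega> cong: if_cong)
    then show ?thesis by (simp only: gibbs_sum gibbs_multc)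
  qed
  then show ?thesis by (simp only:) (intro tame_sum tame_mult h B)
qed

text \<open>The Nishimori identity: under the planted measure the signal is one more replica.\<close>
lemma nishimori:
  assumes s: "\<And>k. k \<in> K \<Longrightarrow> s k \<ge> 0" and A: "\<And>x y. tame K (A x y)"
  shows "planted s (\<lambda>x0 z. gibbs s z (\<lambda>x. A x x0 z))
    = planted s (\<lambda>x0 z. gibbs s z (\<lambda>y. gibbs s z (\<lambda>x. A x y z)))"
proof -
  note g = tame_gibbs_family[of s "\<lambda>z. z", OF tame_gibbs]
  have "planted s (\<lambda>x0 z. gibbs s z (\<lambda>x. A x x0 z)) = (\<integral>z. wsum s z (\<lambda>y. gibbs s z (\<lambda>x. A x y z)) \<partial>gaussK K)"
    by (rule planted_eq[OF s g[OF A]])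
  also have "\<dots> = (\<integral>z. wsum s z (\<lambda>_. gibbs s z (\<lambda>y. gibbs s z (\<lambda>x. A x y z))) \<partial>gaussK K)"
    unfolding wsum_eq_gibbs[of s _ "\<lambda>y. gibbs s _ (\<lambda>x. A x y _)"] wsum_const[of s _ "gibbs s _ _"]
    by (simp only: mult.commute)
  also have "\<dots> = planted s (\<lambda>x0 z. gibbs s z (\<lambda>y. gibbs s z (\<lambda>x. A x y z)))"
    by (rule planted_eq[OF s g[OF g[OF A]], symmetric])
  finally show ?thesis .
qed

end

lemma abs_le_imp_sq: "\<bar>x\<bar> \<le> c \<Longrightarrow> x\<^sup>2 \<le> c\<^sup>2" for x c :: real
  using power_mono[OF _ abs_ge_zero, of x c 2] by simp

section \<open>Concentration of the overlap\<close>

text \<open>The channels in \<open>J\<close> are the side observations and share the strength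
  \<open>r\<^sup>2\<close>; those outside \<open>J\<close> keep the strength
  \<open>\<sigma>\<close>. Concentration is derived in this generality and instantiated to the
  tensor model later.\<close>

locale overlap_channel = finite_channel K \<Omega> w u
  for K :: "'k set" and \<Omega> :: "'x set" and w and u +
  fixes J :: "'k set" and C :: real and \<sigma> :: "'k \<Rightarrow> real"
  assumes J: "J \<subseteq> K" "J \<noteq> {}" and uC: "\<And>k x. k \<in> J \<Longrightarrow> x \<in> \<Omega> \<Longrightarrow> \<bar>u k x\<bar> \<le> C"
    and \<sigma>_nonneg: "\<And>k. k \<in> K \<Longrightarrow> \<sigma> k \<ge> 0"
begin

definition snr :: "real \<Rightarrow> 'k \<Rightarrow> real" where
  "snr r k = (if k \<in> J then r\<^sup>2 else \<sigma> k)"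

definition n :: real where "n = real (card J)"

definition overlap :: "'x \<Rightarrow> 'x \<Rightarrow> real" where
  "overlap x y = (\<Sum>k\<in>J. u k x * u k y) / n"

definition logZ :: "real \<Rightarrow> 'x \<Rightarrow> ('k \<Rightarrow> real) \<Rightarrow> real" where
  "logZ r x0 z = ln (Z (snr r) (shift (snr r) x0 z)) / n"

definition \<nu> :: "real \<Rightarrow> real" where "\<nu> r = free_energy (snr r) / n"

text \<open>\<open>ell\<close> is the derivative in \<open>r\<close> of the normalised log-likelihood; its fluctuations bound those of the
overlap (\<open>r_var_le\<close>) and are bounded by exponential tilting (\<open>tilt_bound\<close>).\<close>
definition ell :: "real \<Rightarrow> 'x \<Rightarrow> ('k \<Rightarrow> real) \<Rightarrow> 'x \<Rightarrow> real" where
  "ell r x0 z x = (\<Sum>k\<in>J. z k * u k x + 2 * r * u k x0 * u k x - r * (u k x)\<^sup>2) / n"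

definition m :: "real \<Rightarrow> real" where
  "m r = planted (snr r) (\<lambda>x0 z. gibbs (snr r) z (\<lambda>x. overlap x x0))"

definition var :: "real \<Rightarrow> real" where
  "var r = planted (snr r) (\<lambda>x0 z. gibbs (snr r) z (\<lambda>x. (overlap x x0 - m r)\<^sup>2))"

lemma finite_J: "finite J" using J finite_K finite_subset by blast

lemma n_pos: "n > 0" unfolding n_def using J finite_J by (simp add: card_gt_0_iff)

lemma C_nonneg: "C \<ge> 0"
proof -
  obtain k where k: "k \<in> J" using J by auto
  obtain x where x: "x \<in> \<Omega>" using exists_pos_w by auto
  show ?thesis using uC[OF k x] by simp
qed

lemma snr_nonneg: "k \<in> K \<Longrightarrow> snr r k \<ge> 0" unfolding snr_def using \<sigma>_nonneg by simp

lemma overlap_bound: "x \<in> \<Omega> \<Longrightarrow> y \<in> \<Omega> \<Longrightarrow> \<bar>overlap x y\<bar> \<le> C\<^sup>2"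
proof -
  assume xy: "x \<in> \<Omega>" "y \<in> \<Omega>"
  have "\<bar>\<Sum>k\<in>J. u k x * u k y\<bar> \<le> (\<Sum>k\<in>J. C\<^sup>2)"
    unfolding power2_eq_square
    by (rule order_trans[OF sum_abs sum_mono]) (auto simp: abs_mult intro!: mult_mono uC xy C_nonneg)
  then show ?thesis unfolding overlap_def using n_pos by (simp add: n_def abs_divide divide_le_eq mult.commute)
qed

lemma m_bound: "\<bar>m r\<bar> \<le> C\<^sup>2"
proof -
  have "\<bar>m r\<bar> \<le> noise_exp (\<lambda>x0 z. \<bar>gibbs (snr r) (shift (snr r) x0 z) (\<lambda>x. overlap x x0)\<bar>)"
    unfolding m_def planted_noise_exp by (rule noise_exp_abs)
  also have "\<dots> \<le> noise_exp (\<lambda>x0 z. C\<^sup>2)"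
    by (rule noise_exp_mono[OF tame_abs[OF tame_gibbs_shift] tame_const gibbs_abs_le[OF overlap_bound]])
  finally show ?thesis by (simp only: noise_exp_const)
qed

text \<open>For fixed signal and noise the exponent is a quadratic polynomial in the strength, whose
  slope at \<open>r\<close> is \<open>n * ell\<close>. The second-order coefficient contributed by
  one channel, \<open>u k x0 * u k x - (u k x)\<^sup>2 / 2\<close>, is at least
  \<open>- 3/2 * C\<^sup>2\<close>.\<close>

lemma expo_change:
  assumes r: "r \<ge> 0" "r' \<ge> 0" and x: "x \<in> \<Omega>" "x0 \<in> \<Omega>"
  shows "expo (snr r') (shift (snr r') x0 z) x
    \<ge> expo (snr r) (shift (snr r) x0 z) x + n * ((r' - r) * ell r x0 z x - 3/2 * C\<^sup>2 * (r' - r)\<^sup>2)"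
proof -
  let ?h = "\<lambda>r k. sqrt (snr r k) * z k * u k x + snr r k * u k x0 * u k x - snr r k * (u k x)\<^sup>2 / 2"
  have "expo (snr r') (shift (snr r') x0 z) x - expo (snr r) (shift (snr r) x0 z) x = (\<Sum>k\<in>K. ?h r' k - ?h r k)"
    by (simp only: expo_shift[of "snr _", OF snr_nonneg] sum_subtractf)
  also have "\<dots> = (\<Sum>k\<in>J. ?h r' k - ?h r k)"
    using J finite_K by (intro sum.mono_neutral_right) (auto simp: snr_def)
  also have "\<dots> = (\<Sum>k\<in>J. (r' - r) * (z k * u k x + 2 * r * u k x0 * u k x - r * (u k x)\<^sup>2)
      + (r' - r)\<^sup>2 * (u k x0 * u k x - (u k x)\<^sup>2 / 2))"
  proof (rule sum.cong[OF refl])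
    fix k assume "k \<in> J"
    then have eq: "?h q k = q * z k * u k x + q\<^sup>2 * u k x0 * u k x - q\<^sup>2 * (u k x)\<^sup>2 / 2" if "q \<ge> 0" for q
      using that by (simp add: snr_def)
    show "?h r' k - ?h r k = (r' - r) * (z k * u k x + 2 * r * u k x0 * u k x - r * (u k x)\<^sup>2)
      + (r' - r)\<^sup>2 * (u k x0 * u k x - (u k x)\<^sup>2 / 2)"
      unfolding eq[OF r(1)] eq[OF r(2)] by (simp add: power2_eq_square field_simps)
  qed
  also have "\<dots> = n * ((r' - r) * ell r x0 z x) + (r' - r)\<^sup>2 * (\<Sum>k\<in>J. u k x0 * u k x - (u k x)\<^sup>2 / 2)"
    unfolding ell_def sum.distrib sum_distrib_left[symmetric] using n_pos by simp
  finally have 1: "expo (snr r') (shift (snr r') x0 z) x - expo (snr r) (shift (snr r) x0 z) x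
    = n * ((r' - r) * ell r x0 z x) + (r' - r)\<^sup>2 * (\<Sum>k\<in>J. u k x0 * u k x - (u k x)\<^sup>2 / 2)" .
  have 2: "(r' - r)\<^sup>2 * (\<Sum>k\<in>J. u k x0 * u k x - (u k x)\<^sup>2 / 2) \<ge> (r' - r)\<^sup>2 * (\<Sum>k\<in>J. - (3/2 * C\<^sup>2))"
  proof (intro mult_left_mono sum_mono)
    fix k assume k: "k \<in> J"
    have "\<bar>u k x0 * u k x\<bar> \<le> C\<^sup>2" unfolding abs_mult power2_eq_square
      using uC[OF k] x C_nonneg by (intro mult_mono) auto
    moreover have "(u k x)\<^sup>2 \<le> C\<^sup>2" by (rule abs_le_imp_sq[OF uC[OF k x(1)]])
    ultimately show "- (3/2 * C\<^sup>2) \<le> u k x0 * u k x - (u k x)\<^sup>2 / 2" by linarith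
  qed simp
  have 3: "(r' - r)\<^sup>2 * (\<Sum>k\<in>J. - (3/2 * C\<^sup>2)) = - (n * (3/2 * C\<^sup>2 * (r' - r)\<^sup>2))"
    by (simp add: n_def)
  show ?thesis using 1 2 3 by (simp only: right_diff_distrib)
qed

abbreviation G :: "real \<Rightarrow> 'x \<Rightarrow> ('k \<Rightarrow> real) \<Rightarrow> ('x \<Rightarrow> real) \<Rightarrow> real" where
  "G r x0 z \<equiv> gibbs (snr r) (shift (snr r) x0 z)"

lemma Z_logZ: "Z (snr r) (shift (snr r) x0 z) = exp (n * logZ r x0 z)"
  unfolding logZ_def using n_pos Z_pos by simp

text \<open>Tilting the posterior weights at \<open>r\<close> by \<open>exp (n * e * ell)\<close>
  gives, up to the quadratic error, the weights at \<open>r + e\<close>. The exponential moment is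
  therefore controlled by a ratio of two partition functions with the same noise.\<close>

lemma tilt_bound:
  assumes r: "r \<ge> 0" "r + e \<ge> 0" and x0: "x0 \<in> \<Omega>"
  shows "G r x0 z (\<lambda>x. exp (n * e * (ell r x0 z x - c)))
    \<le> exp (n * (logZ (r + e) x0 z - logZ r x0 z - e * c + 3/2 * C\<^sup>2 * e\<^sup>2))"
proof -
  let ?s = "snr r" and ?y = "shift (snr r) x0 z"
  let ?D = "n * (e * c) + n * (3/2 * C\<^sup>2 * e\<^sup>2)"
  have "wsum ?s ?y (\<lambda>x. exp (n * e * (ell r x0 z x - c))) \<le> exp (n * logZ (r + e) x0 z) * exp (- n * (e * c) + n * (3/2 * C\<^sup>2 * e\<^sup>2))"
    unfolding Z_logZ[symmetric] wsum_def sum_distrib_right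
  proof (rule sum_mono)
    fix x assume x: "x \<in> \<Omega>"
    have "expo ?s ?y x + n * e * (ell r x0 z x - c)
        \<le> expo (snr (r + e)) (shift (snr (r + e)) x0 z) x + (- n * (e * c) + n * (3/2 * C\<^sup>2 * e\<^sup>2))"
      using expo_change[OF r x x0, of z] by (simp add: algebra_simps)
    then have "exp (expo ?s ?y x) * exp (n * e * (ell r x0 z x - c))
        \<le> exp (expo (snr (r + e)) (shift (snr (r + e)) x0 z) x) * exp (- n * (e * c) + n * (3/2 * C\<^sup>2 * e\<^sup>2))"
      by (simp only: exp_add[symmetric] exp_le_cancel_iff)
    from mult_left_mono[OF this w_nonneg[OF x]]
    show "w x * exp (expo ?s ?y x) * exp (n * e * (ell r x0 z x - c))
        \<le> w x * exp (expo (snr (r + e)) (shift (snr (r + e)) x0 z) x) * 1 * exp (- n * (e * c) + n * (3/2 * C\<^sup>2 * e\<^sup>2))"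
      by (simp only: mult.assoc mult_1_left)
  qed
  then have "G r x0 z (\<lambda>x. exp (n * e * (ell r x0 z x - c)))
      \<le> exp (n * logZ (r + e) x0 z) * exp (- n * (e * c) + n * (3/2 * C\<^sup>2 * e\<^sup>2)) / exp (n * logZ r x0 z)"
    unfolding gibbs_def Z_logZ by (rule divide_right_mono) simp
  also have "\<dots> = exp (n * (logZ (r + e) x0 z - logZ r x0 z - e * c + 3/2 * C\<^sup>2 * e\<^sup>2))"
    by (simp add: exp_add[symmetric] exp_diff[symmetric] algebra_simps)
  finally show ?thesis .
qed

text \<open>For \<open>l = n * \<delta> * (ell - c)\<close>, Jensen's inequality bounds the mean of
  \<open>\<bar>l\<bar>\<close> by the logarithm of the sum of the means of \<open>exp l\<close> and
  \<open>exp (- l)\<close>, and these are controlled by tilts of opposite sign. Having two summands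
  costs \<open>ln 2\<close>.\<close>

lemma ell_deviation_pathwise:
  assumes r: "\<delta> \<le> r" "0 < \<delta>" and x0: "x0 \<in> \<Omega>"
  shows "\<delta> * G r x0 z (\<lambda>x. \<bar>ell r x0 z x - c\<bar>) \<le> ln 2 / n
    + max 0 (logZ (r + \<delta>) x0 z - logZ r x0 z - \<delta> * c + 3/2 * C\<^sup>2 * \<delta>\<^sup>2)
    + max 0 (logZ (r - \<delta>) x0 z - logZ r x0 z + \<delta> * c + 3/2 * C\<^sup>2 * \<delta>\<^sup>2)"
    (is "_ \<le> _ + max 0 ?a + max 0 ?b")
proof -
  define A where "A = max 0 ?a + max 0 ?b"
  \<comment> \<open>Chosen so that \<open>exp (- B)\<close> times the bound
    \<open>2 * exp (n * A)\<close> equals 1; the tangent of \<open>exp\<close> at \<open>B\<close>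
    then does the work of Jensen's inequality.\<close>
  define B where "B = ln 2 + n * A"
  let ?l = "\<lambda>x. n * \<delta> * (ell r x0 z x - c)"
  have p1: "G r x0 z (\<lambda>x. exp (?l x)) \<le> exp (n * ?a)"
    using tilt_bound[of r \<delta> x0 z c] r x0 by simp
  have p2: "G r x0 z (\<lambda>x. exp (- ?l x)) \<le> exp (n * ?b)"
    using tilt_bound[of r "- \<delta>" x0 z c] r x0 by simp
  have le: "n * ?a \<le> n * A" "n * ?b \<le> n * A"
    using n_pos unfolding A_def by (auto intro!: mult_left_mono)
  have pt: "\<bar>?l x\<bar> \<le> exp (- B) * (exp (?l x) + exp (- ?l x)) + (B - 1)" for x
  proof -
    have "\<bar>?l x\<bar> - B + 1 \<le> exp (\<bar>?l x\<bar> - B)" using exp_ge_add_one_self[of "\<bar>?l x\<bar> - B"] by linarith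
    also have "\<dots> = exp (- B) * exp \<bar>?l x\<bar>" by (simp add: exp_add[symmetric])
    also have "\<dots> \<le> exp (- B) * (exp (?l x) + exp (- ?l x))"
      by (intro mult_left_mono) (auto simp: abs_if less_imp_le add_nonneg_nonneg)
    finally show ?thesis by linarith
  qed
  have "n * (\<delta> * G r x0 z (\<lambda>x. \<bar>ell r x0 z x - c\<bar>)) = G r x0 z (\<lambda>x. \<bar>?l x\<bar>)"
    using n_pos r by (simp only: abs_mult gibbs_cmult mult.assoc abs_of_pos)
  also have "\<dots> \<le> G r x0 z (\<lambda>x. exp (- B) * (exp (?l x) + exp (- ?l x)) + (B - 1))"
    by (rule gibbs_mono) (rule pt)
  also have "\<dots> = exp (- B) * (G r x0 z (\<lambda>x. exp (?l x)) + G r x0 z (\<lambda>x. exp (- ?l x))) + (B - 1)"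
    by (simp only: gibbs_add gibbs_cmult gibbs_const)
  also have "\<dots> \<le> exp (- B) * (exp (n * A) + exp (n * A)) + (B - 1)"
  proof -
    have "exp (n * ?a) \<le> exp (n * A)" "exp (n * ?b) \<le> exp (n * A)" using le by (simp_all only: exp_le_cancel_iff)
    then show ?thesis using p1 p2 by (intro add_right_mono mult_left_mono add_mono) (linarith | simp)+
  qed
  also have "exp (- B) * (exp (n * A) + exp (n * A)) = 1"
  proof -
    have "exp (n * A) + exp (n * A) = exp B" unfolding B_def by (simp add: exp_add)
    then show ?thesis by (simp add: exp_add[symmetric])
  qed
  finally have "n * (\<delta> * G r x0 z (\<lambda>x. \<bar>ell r x0 z x - c\<bar>)) \<le> n * (ln 2 / n + A)"
    unfolding B_def using n_pos by (simp add: distrib_left)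
  then have "\<delta> * G r x0 z (\<lambda>x. \<bar>ell r x0 z x - c\<bar>) \<le> ln 2 / n + A"
    using n_pos by (simp only: mult_le_cancel_left_pos)
  then show ?thesis unfolding A_def by (simp only: add.assoc)
qed

lemma tame_logZ: "tame K (\<lambda>z. logZ r x0 z)"
  unfolding logZ_def divide_inverse
  by (rule tame_mult[OF tame_shift[OF tame_ln_Z[of "snr r", OF snr_nonneg]] tame_const])

lemma tame_ell: "tame K (\<lambda>z. ell r x0 z x)"
  unfolding ell_def divide_inverse
proof (rule tame_mult[OF tame_sum tame_const])
  fix k assume "k \<in> J"
  then have "tame K (\<lambda>z. z k)" using J by (intro tame_coord finite_K) auto
  then show "tame K (\<lambda>z. z k * u k x + 2 * r * u k x0 * u k x - r * (u k x)\<^sup>2)"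
    by (intro tame_diff tame_add tame_mult[of _ "\<lambda>z. z k"] tame_const)
qed

lemma tame_G: "(\<And>x. tame K (B x)) \<Longrightarrow> tame K (\<lambda>z. G r x0 z (\<lambda>x. B x z))"
  by (rule tame_gibbs_family[OF tame_gibbs_shift])

text \<open>Passes from the random \<open>logZ\<close> to its mean \<open>\<nu>\<close>. The value
  at \<open>r\<close> enters both tilts, hence four fluctuation terms in all.\<close>

lemma ell_deviation:
  assumes r: "\<delta> \<le> r" "0 < \<delta>"
    and v: "\<And>\<rho>. \<rho> \<in> {r - \<delta>, r, r + \<delta>} \<Longrightarrow> noise_exp (\<lambda>x0 z. \<bar>logZ \<rho> x0 z - \<nu> \<rho>\<bar>) \<le> v"
  shows "\<delta> * noise_exp (\<lambda>x0 z. G r x0 z (\<lambda>x. \<bar>ell r x0 z x - c\<bar>)) \<le> ln 2 / n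
    + max 0 (\<nu> (r + \<delta>) - \<nu> r - \<delta> * c) + max 0 (\<nu> (r - \<delta>) - \<nu> r + \<delta> * c) + 3 * C\<^sup>2 * \<delta>\<^sup>2 + 4 * v"
proof -
  define \<xi> where "\<xi> \<rho> x0 z = \<bar>logZ \<rho> x0 z - \<nu> \<rho>\<bar>" for \<rho> x0 z
  have t: "tame K (\<xi> \<rho> x0)" for \<rho> x0
    unfolding \<xi>_def by (rule tame_abs[OF tame_diff[OF tame_logZ tame_const]])
  define B where "B = ln 2 / n + max 0 (\<nu> (r + \<delta>) - \<nu> r - \<delta> * c) + max 0 (\<nu> (r - \<delta>) - \<nu> r + \<delta> * c) + 3 * C\<^sup>2 * \<delta>\<^sup>2"
  have "noise_exp (\<lambda>x0 z. \<delta> * G r x0 z (\<lambda>x. \<bar>ell r x0 z x - c\<bar>))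
      \<le> noise_exp (\<lambda>x0 z. B + (\<xi> (r + \<delta>) x0 z + (\<xi> r x0 z + (\<xi> r x0 z + \<xi> (r - \<delta>) x0 z))))"
  proof (rule noise_exp_mono)
    fix x0 z assume x0: "x0 \<in> \<Omega>"
    have sq: "0 \<le> C\<^sup>2 * \<delta>\<^sup>2" by simp
    have "max 0 (logZ (r + \<delta>) x0 z - logZ r x0 z - \<delta> * c + 3/2 * C\<^sup>2 * \<delta>\<^sup>2)
        \<le> max 0 (\<nu> (r + \<delta>) - \<nu> r - \<delta> * c) + 3/2 * C\<^sup>2 * \<delta>\<^sup>2 + \<xi> (r + \<delta>) x0 z + \<xi> r x0 z"
      unfolding \<xi>_def using sq by linarith
    moreover have "max 0 (logZ (r - \<delta>) x0 z - logZ r x0 z + \<delta> * c + 3/2 * C\<^sup>2 * \<delta>\<^sup>2)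
        \<le> max 0 (\<nu> (r - \<delta>) - \<nu> r + \<delta> * c) + 3/2 * C\<^sup>2 * \<delta>\<^sup>2 + \<xi> (r - \<delta>) x0 z + \<xi> r x0 z"
      unfolding \<xi>_def using sq by linarith
    ultimately show "\<delta> * G r x0 z (\<lambda>x. \<bar>ell r x0 z x - c\<bar>)
        \<le> B + (\<xi> (r + \<delta>) x0 z + (\<xi> r x0 z + (\<xi> r x0 z + \<xi> (r - \<delta>) x0 z)))"
      using ell_deviation_pathwise[OF r x0, of z c] unfolding B_def by linarith
  qed (rule tame_cmult[OF tame_G[OF tame_abs[OF tame_diff[OF tame_ell tame_const]]]]
      tame_add[OF tame_const tame_add[OF t tame_add[OF t tame_add[OF t t]]]])+
  also have "\<dots> = B + (noise_exp (\<xi> (r + \<delta>)) + (noise_exp (\<xi> r) + (noise_exp (\<xi> r) + noise_exp (\<xi> (r - \<delta>)))))"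
    by (subst noise_exp_add[OF tame_const tame_add[OF t tame_add[OF t tame_add[OF t t]]]],
        subst noise_exp_add[OF t tame_add[OF t tame_add[OF t t]]],
        subst noise_exp_add[OF t tame_add[OF t t]], subst noise_exp_add[OF t t])
      (simp only: noise_exp_const)
  also have "\<dots> \<le> B + (v + (v + (v + v)))"
    using v[folded \<xi>_def] by (intro add_left_mono add_mono) auto
  finally show ?thesis unfolding B_def noise_exp_cmult by linarith
qed

lemma gibbs_shift_ibp:
  assumes k: "k \<in> K"
  shows "(\<integral>z. z k * gibbs s (shift s x0 z) f \<partial>gaussK K)
    = (\<integral>z. sqrt (s k) * cov s (shift s x0 z) f (u k) \<partial>gaussK K)"
proof -
  obtain b where b: "b \<ge> 1" and fb: "\<And>x. x \<in> \<Omega> \<Longrightarrow> \<bar>f x\<bar> \<le> b"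
    using gibbs_abs_exists by blast
  define D where "D = b + \<bar>sqrt (s k)\<bar> * (2 * (b * U))"
  have D: "y \<le> exp (0 * N + D)" if "y \<le> D" for y N :: real
    using that exp_ge_add_one_self[of D] unfolding mult_zero_left add_0_left by linarith
  show ?thesis
  proof (rule gaussK_integration_by_parts[OF finite_K k, where c = 0 and d = D])
    show "(\<lambda>z. gibbs s (shift s x0 z) f) \<in> borel_measurable (gaussK K)"
      by (rule measurable_compose[OF measurable_shift measurable_gibbs])
    show "(\<lambda>z. sqrt (s k) * cov s (shift s x0 z) f (u k)) \<in> borel_measurable (gaussK K)"
      by (rule borel_measurable_times[OF _ measurable_compose[OF measurable_shift measurable_cov]]) simp
    fix z :: "'k \<Rightarrow> real"
    have "\<bar>gibbs s (shift s x0 z) f\<bar> \<le> D"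
    proof -
      have "0 \<le> \<bar>sqrt (s k)\<bar> * (2 * (b * U))" using b U_ge_1 by simp
      with gibbs_abs_le[of f b s "shift s x0 z", OF fb] show ?thesis
        unfolding D_def by linarith
    qed
    then show "\<bar>gibbs s (shift s x0 z) f\<bar> \<le> exp (0 * (\<Sum>k\<in>K. \<bar>z k\<bar>) + D)" by (rule D)
    have 1: "\<bar>gibbs s (shift s x0 z) (\<lambda>x. f x * u k x)\<bar> \<le> b * U"
      by (rule gibbs_abs_le) (use fb u_le_U[OF k] b in \<open>auto simp: abs_mult intro!: mult_mono\<close>)
    have 2: "\<bar>gibbs s (shift s x0 z) f * gibbs s (shift s x0 z) (u k)\<bar> \<le> b * U"
      unfolding abs_mult
      using gibbs_abs_le[of f b s "shift s x0 z", OF fb] gibbs_abs_le[of "u k" U s "shift s x0 z", OF u_le_U[OF k]] b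
      by (intro mult_mono) auto
    have "\<bar>cov s (shift s x0 z) f (u k)\<bar> \<le> 2 * (b * U)" unfolding cov_def using 1 2 by linarith
    then have "\<bar>sqrt (s k) * cov s (shift s x0 z) f (u k)\<bar> \<le> \<bar>sqrt (s k)\<bar> * (2 * (b * U))"
      unfolding abs_mult by (intro mult_left_mono) auto
    then have "\<bar>sqrt (s k) * cov s (shift s x0 z) f (u k)\<bar> \<le> D" unfolding D_def using b by linarith
    then show "\<bar>sqrt (s k) * cov s (shift s x0 z) f (u k)\<bar> \<le> exp (0 * (\<Sum>k\<in>K. \<bar>z k\<bar>) + D)" by (rule D)
    let ?a = "sqrt (s k) * u k x0"
    have eq: "shift s x0 (z(k := y)) = (shift s x0 z)(k := y + ?a)" for y
      using k unfolding shift_def by auto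
    have pt: "shift s x0 z k = z k + ?a" using k unfolding shift_def by simp
    have "((\<lambda>y. gibbs s ((shift s x0 z)(k := y)) f) has_real_derivative sqrt (s k) * cov s (shift s x0 z) f (u k)) (at (z k + ?a))"
      using DERIV_gibbs_coord[OF k, of s "shift s x0 z" f] unfolding cov_def pt .
    then show "((\<lambda>y. gibbs s (shift s x0 (z(k := y))) f) has_real_derivative sqrt (s k) * cov s (shift s x0 z) f (u k)) (at (z k))"
      unfolding eq by (subst (asm) DERIV_shift)
  qed simp
qed

text \<open>Integration by parts in \<open>z k\<close> produces \<open>r\<close> times a posterior
  covariance. Its first part cancels the term \<open>- r * (u k x)\<^sup>2\<close> of
  \<open>ell\<close>; what is left is the overlap with the signal, twice, minus the overlap of two
  replicas.\<close>

lemma noise_exp_ell: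
  assumes r: "r \<ge> 0"
  shows "noise_exp (\<lambda>x0 z. G r x0 z (\<lambda>x. ell r x0 z x * A x x0))
    = r * noise_exp (\<lambda>x0 z. 2 * G r x0 z (\<lambda>x. overlap x x0 * A x x0)
        - G r x0 z (\<lambda>x. A x x0 * G r x0 z (\<lambda>y. overlap x y)))"
  unfolding noise_exp_def sum_distrib_left
proof (rule sum.cong[OF refl])
  fix x0 assume x0: "x0 \<in> \<Omega>"
  have sq: "sqrt (snr r k) = r" if "k \<in> J" for k using that r by (simp add: snr_def)
  have JK: "k \<in> K" if "k \<in> J" for k using that J by auto
  have tcov: "tame K (\<lambda>z. cov (snr r) (shift (snr r) x0 z) f g)" for f g
    unfolding cov_def by (rule tame_diff[OF tame_gibbs_shift tame_mult[OF tame_gibbs_shift tame_gibbs_shift]])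
  note int = tame_integrable[OF finite_K]
  let ?L = "\<lambda>k z. z k * G r x0 z (\<lambda>x. u k x * A x x0)"
  let ?M = "\<lambda>k z. 2 * r * u k x0 * G r x0 z (\<lambda>x. u k x * A x x0) - r * G r x0 z (\<lambda>x. u k x * A x x0 * u k x)"
  have tL: "tame K (?L k)" if "k \<in> J" for k
    by (rule tame_mult[OF tame_coord[OF finite_K JK[OF that]] tame_gibbs_shift])
  have tM: "tame K (?M k)" for k
    by (rule tame_diff[OF tame_cmult[OF tame_gibbs_shift] tame_cmult[OF tame_gibbs_shift]])
  have "(\<integral>z. G r x0 z (\<lambda>x. ell r x0 z x * A x x0) \<partial>gaussK K) = (\<integral>z. (\<Sum>k\<in>J. ?L k z + ?M k z) / n \<partial>gaussK K)"
  proof (rule Bochner_Integration.integral_cong[OF refl])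
    fix z
    have "ell r x0 z x * A x x0 = (\<Sum>k\<in>J. z k * (u k x * A x x0) + (2 * r * u k x0 * (u k x * A x x0)
        - r * (u k x * A x x0 * u k x))) * (1 / n)" for x
      unfolding ell_def sum_distrib_right sum_divide_distrib
      by (intro sum.cong refl) (simp add: power2_eq_square algebra_simps diff_divide_distrib add_divide_distrib)
    then show "G r x0 z (\<lambda>x. ell r x0 z x * A x x0) = (\<Sum>k\<in>J. ?L k z + ?M k z) / n"
      by (simp only: gibbs_multc gibbs_sum gibbs_add gibbs_diff gibbs_cmult) simp
  qed
  also have "\<dots> = (\<Sum>k\<in>J. (\<integral>z. ?L k z \<partial>gaussK K) + (\<integral>z. ?M k z \<partial>gaussK K)) / n"
    unfolding integral_divide_zero
  proof (intro arg_cong[where f = "\<lambda>x. x / n"])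
    have "(\<integral>z. (\<Sum>k\<in>J. ?L k z + ?M k z) \<partial>gaussK K) = (\<Sum>k\<in>J. \<integral>z. ?L k z + ?M k z \<partial>gaussK K)"
      by (rule Bochner_Integration.integral_sum[OF int[OF tame_add[OF tL tM]]])
    also have "\<dots> = (\<Sum>k\<in>J. (\<integral>z. ?L k z \<partial>gaussK K) + (\<integral>z. ?M k z \<partial>gaussK K))"
      by (rule sum.cong[OF refl]) (rule Bochner_Integration.integral_add[OF int[OF tL] int[OF tM]])
    finally show "(\<integral>z. (\<Sum>k\<in>J. ?L k z + ?M k z) \<partial>gaussK K)
      = (\<Sum>k\<in>J. (\<integral>z. ?L k z \<partial>gaussK K) + (\<integral>z. ?M k z \<partial>gaussK K))" .
  qed
  also have "\<dots> = (\<Sum>k\<in>J. \<integral>z. r * (2 * (u k x0 * G r x0 z (\<lambda>x. u k x * A x x0))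
      - G r x0 z (\<lambda>x. u k x * A x x0) * G r x0 z (u k)) \<partial>gaussK K) / n"
  proof (intro arg_cong[where f = "\<lambda>x. x / n"] sum.cong refl)
    fix k assume k: "k \<in> J"
    have "(\<integral>z. ?L k z \<partial>gaussK K) = (\<integral>z. r * cov (snr r) (shift (snr r) x0 z) (\<lambda>x. u k x * A x x0) (u k) \<partial>gaussK K)"
      by (simp only: gibbs_shift_ibp[OF JK[OF k]] sq[OF k])
    then have "(\<integral>z. ?L k z \<partial>gaussK K) + (\<integral>z. ?M k z \<partial>gaussK K)
      = (\<integral>z. r * cov (snr r) (shift (snr r) x0 z) (\<lambda>x. u k x * A x x0) (u k) + ?M k z \<partial>gaussK K)"
      by (simp only: Bochner_Integration.integral_add[OF int[OF tame_cmult[OF tcov]] int[OF tM]])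
    also have "\<dots> = (\<integral>z. r * (2 * (u k x0 * G r x0 z (\<lambda>x. u k x * A x x0))
      - G r x0 z (\<lambda>x. u k x * A x x0) * G r x0 z (u k)) \<partial>gaussK K)"
      by (rule Bochner_Integration.integral_cong[OF refl]) (simp add: cov_def algebra_simps)
    finally show "(\<integral>z. ?L k z \<partial>gaussK K) + (\<integral>z. ?M k z \<partial>gaussK K)
      = (\<integral>z. r * (2 * (u k x0 * G r x0 z (\<lambda>x. u k x * A x x0))
      - G r x0 z (\<lambda>x. u k x * A x x0) * G r x0 z (u k)) \<partial>gaussK K)" .
  qed
  also have "\<dots> = (\<integral>z. (\<Sum>k\<in>J. r * (2 * (u k x0 * G r x0 z (\<lambda>x. u k x * A x x0))
      - G r x0 z (\<lambda>x. u k x * A x x0) * G r x0 z (u k))) / n \<partial>gaussK K)"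
    unfolding integral_divide_zero
    by (intro arg_cong[where f = "\<lambda>x. x / n"] Bochner_Integration.integral_sum[symmetric] int tame_cmult
        tame_diff[OF tame_cmult[OF tame_cmult[OF tame_gibbs_shift]] tame_mult[OF tame_gibbs_shift tame_gibbs_shift]])
  also have "\<dots> = (\<integral>z. r * (2 * G r x0 z (\<lambda>x. overlap x x0 * A x x0)
        - G r x0 z (\<lambda>x. A x x0 * G r x0 z (\<lambda>y. overlap x y))) \<partial>gaussK K)"
  proof (rule Bochner_Integration.integral_cong[OF refl])
    fix z
    have 1: "G r x0 z (\<lambda>x. overlap x x0 * A x x0) = (\<Sum>k\<in>J. u k x0 * G r x0 z (\<lambda>x. u k x * A x x0)) * (1 / n)"
    proof -
      have "overlap x x0 * A x x0 = (\<Sum>k\<in>J. u k x0 * (u k x * A x x0)) * (1 / n)" for x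
      proof -
        have "(\<Sum>k\<in>J. u k x0 * (u k x * A x x0)) = A x x0 * (\<Sum>k\<in>J. u k x * u k x0)"
          unfolding sum_distrib_left by (intro sum.cong refl) simp
        then show ?thesis unfolding overlap_def by simp
      qed
      then show ?thesis by (simp only: gibbs_multc gibbs_sum gibbs_cmult)
    qed
    have 2: "G r x0 z (\<lambda>x. A x x0 * G r x0 z (\<lambda>y. overlap x y))
        = (\<Sum>k\<in>J. G r x0 z (\<lambda>x. u k x * A x x0) * G r x0 z (u k)) * (1 / n)"
    proof -
      have "overlap x y = (\<Sum>k\<in>J. u k x * u k y) * (1 / n)" for x y unfolding overlap_def by simp
      then have "G r x0 z (\<lambda>y. overlap x y) = (\<Sum>k\<in>J. u k x * G r x0 z (u k)) * (1 / n)" for x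
        by (simp only: gibbs_multc gibbs_sum gibbs_cmult)
      then have "A x x0 * G r x0 z (\<lambda>y. overlap x y) = (\<Sum>k\<in>J. (u k x * A x x0) * G r x0 z (u k)) * (1 / n)" for x
      proof -
        have "(\<Sum>k\<in>J. (u k x * A x x0) * G r x0 z (u k)) = A x x0 * (\<Sum>k\<in>J. u k x * G r x0 z (u k))"
          unfolding sum_distrib_left by (intro sum.cong refl) simp
        then show ?thesis using \<open>\<And>x. G r x0 z (\<lambda>y. overlap x y) = (\<Sum>k\<in>J. u k x * G r x0 z (u k)) * (1 / n)\<close>[of x] by simp
      qed
      then show ?thesis by (simp only: gibbs_multc gibbs_sum)
    qed
    show "(\<Sum>k\<in>J. r * (2 * (u k x0 * G r x0 z (\<lambda>x. u k x * A x x0))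
      - G r x0 z (\<lambda>x. u k x * A x x0) * G r x0 z (u k))) / n
      = r * (2 * G r x0 z (\<lambda>x. overlap x x0 * A x x0) - G r x0 z (\<lambda>x. A x x0 * G r x0 z (\<lambda>y. overlap x y)))"
      unfolding 1 2 sum_distrib_left[symmetric] sum_subtractf
    proof -
      have "r * (2 * a - b) / n = r * (2 * (a * (1 / n)) - b * (1 / n))" for a b
        using n_pos by (simp add: field_simps)
      then show "r * (2 * (\<Sum>k\<in>J. u k x0 * G r x0 z (\<lambda>x. u k x * A x x0))
          - (\<Sum>k\<in>J. G r x0 z (\<lambda>x. u k x * A x x0) * G r x0 z (u k))) / n
        = r * (2 * ((\<Sum>k\<in>J. u k x0 * G r x0 z (\<lambda>x. u k x * A x x0)) * (1 / n))
          - (\<Sum>k\<in>J. G r x0 z (\<lambda>x. u k x * A x x0) * G r x0 z (u k)) * (1 / n))" .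
    qed
  qed
  finally have *: "(\<integral>z. G r x0 z (\<lambda>x. ell r x0 z x * A x x0) \<partial>gaussK K)
    = r * (\<integral>z. 2 * G r x0 z (\<lambda>x. overlap x x0 * A x x0)
        - G r x0 z (\<lambda>x. A x x0 * G r x0 z (\<lambda>y. overlap x y)) \<partial>gaussK K)"
    by (simp only: integral_mult_right_zero)
  show "w x0 * (\<integral>z. G r x0 z (\<lambda>x. ell r x0 z x * A x x0) \<partial>gaussK K)
    = r * (w x0 * (\<integral>z. 2 * G r x0 z (\<lambda>x. overlap x x0 * A x x0)
        - G r x0 z (\<lambda>x. A x x0 * G r x0 z (\<lambda>y. overlap x y)) \<partial>gaussK K))"
    unfolding * by simp
qed

text \<open>The centred overlap serves as test function in \<open>noise_exp_ell\<close>. The signal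
  term gives \<open>2 * var r\<close>, and the replica term costs at most \<open>var r\<close> by
  Young's inequality and the Nishimori identity. Since the centred overlap has mean zero,
  \<open>ell\<close> may be recentred by any \<open>c\<close>, and the centred overlap is then
  bounded by \<open>2 * C\<^sup>2\<close>.\<close>

lemma r_var_le:
  assumes r: "r \<ge> 0"
  shows "r * var r \<le> 2 * C\<^sup>2 * noise_exp (\<lambda>x0 z. G r x0 z (\<lambda>x. \<bar>ell r x0 z x - c\<bar>))"
proof -
  define A where "A x x0 = overlap x x0 - m r" for x x0
  have A_bound: "\<bar>A x x0\<bar> \<le> 2 * C\<^sup>2" if "x \<in> \<Omega>" "x0 \<in> \<Omega>" for x x0
    unfolding A_def using overlap_bound[OF that] m_bound[of r] by linarith
  note tG = tame_gibbs_shift[of "snr r" "snr r"]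
  have GG: "tame K (\<lambda>z. G r x0 z (\<lambda>x. B x * G r x0 z (D x)))" for B D x0
    by (rule tame_G[OF tame_cmult[OF tG]])
  have GG1: "tame K (\<lambda>z. G r x0 z (\<lambda>x. G r x0 z (D x)))" for D x0
    by (rule tame_G[OF tG])
  have m: "m r = noise_exp (\<lambda>x0 z. G r x0 z (\<lambda>x. overlap x x0))"
    unfolding m_def planted_noise_exp ..
  have var: "var r = noise_exp (\<lambda>x0 z. G r x0 z (\<lambda>x. A x x0 * A x x0))"
    unfolding var_def planted_noise_exp A_def power2_eq_square ..
  have A0: "noise_exp (\<lambda>x0 z. G r x0 z (\<lambda>x. A x x0)) = 0"
    unfolding A_def gibbs_diff gibbs_const noise_exp_diff[OF tG tame_const] noise_exp_const m[symmetric] by simp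
  \<comment> \<open>Two posterior samples are distributed like one sample and the signal, so their
    centred overlap has the same second moment.\<close>
  have nish: "noise_exp (\<lambda>x0 z. G r x0 z (\<lambda>x. G r x0 z (\<lambda>y. A x y * A x y))) = var r"
  proof -
    have "planted (snr r) (\<lambda>x0 z. gibbs (snr r) z (\<lambda>x. A x x0 * A x x0))
      = planted (snr r) (\<lambda>x0 z. gibbs (snr r) z (\<lambda>y. gibbs (snr r) z (\<lambda>x. A x y * A x y)))"
      by (rule nishimori[OF snr_nonneg tame_const])
    moreover have "A x y = A y x" for x y unfolding A_def overlap_def by (simp add: mult.commute)
    ultimately show ?thesis unfolding var planted_noise_exp by simp
  qed
  have "noise_exp (\<lambda>x0 z. G r x0 z (\<lambda>x. ell r x0 z x * A x x0))
    = r * noise_exp (\<lambda>x0 z. 2 * G r x0 z (\<lambda>x. overlap x x0 * A x x0)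
        - G r x0 z (\<lambda>x. A x x0 * G r x0 z (\<lambda>y. overlap x y)))"
    by (rule noise_exp_ell[OF r])
  also have "\<dots> \<ge> r * var r"
  proof (rule mult_left_mono[OF _ r])
    have o: "overlap x y = A x y + m r" for x y unfolding A_def by simp
    have e1: "2 * G r x0 z (\<lambda>x. overlap x x0 * A x x0) = 2 * G r x0 z (\<lambda>x. A x x0 * A x x0) + 2 * m r * G r x0 z (\<lambda>x. A x x0)" for x0 z
      unfolding o distrib_right gibbs_add gibbs_cmult by simp
    have e2: "G r x0 z (\<lambda>x. A x x0 * G r x0 z (\<lambda>y. overlap x y))
        = G r x0 z (\<lambda>x. A x x0 * G r x0 z (\<lambda>y. A x y)) + m r * G r x0 z (\<lambda>x. A x x0)" for x0 z
      unfolding o gibbs_add gibbs_const distrib_left gibbs_multc by simp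
    have le: "G r x0 z (\<lambda>x. A x x0 * G r x0 z (\<lambda>y. A x y))
        \<le> 1/2 * G r x0 z (\<lambda>x. A x x0 * A x x0) + 1/2 * G r x0 z (\<lambda>x. G r x0 z (\<lambda>y. A x y * A x y))" for x0 z
    proof -
      have "a * b \<le> 1/2 * (a * a) + 1/2 * (b * b)" for a b :: real
        using sum_squares_bound[of a b] by (simp add: power2_eq_square)
      then have "G r x0 z (\<lambda>x. G r x0 z (\<lambda>y. A x x0 * A x y))
        \<le> G r x0 z (\<lambda>x. G r x0 z (\<lambda>y. 1/2 * (A x x0 * A x x0) + 1/2 * (A x y * A x y)))"
        by (intro gibbs_mono)
      then show ?thesis by (simp only: gibbs_cmult gibbs_add gibbs_const)
    qed
    have "noise_exp (\<lambda>x0 z. G r x0 z (\<lambda>x. A x x0 * G r x0 z (\<lambda>y. A x y)))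
      \<le> noise_exp (\<lambda>x0 z. 1/2 * G r x0 z (\<lambda>x. A x x0 * A x x0) + 1/2 * G r x0 z (\<lambda>x. G r x0 z (\<lambda>y. A x y * A x y)))"
      by (rule noise_exp_mono[OF GG tame_add[OF tame_cmult[OF tG] tame_cmult[OF GG1]] le])
    also have "\<dots> = 1/2 * var r + 1/2 * var r"
      unfolding noise_exp_add[OF tame_cmult[OF tG] tame_cmult[OF GG1]] noise_exp_cmult nish var[symmetric] ..
    finally have c: "noise_exp (\<lambda>x0 z. G r x0 z (\<lambda>x. A x x0 * G r x0 z (\<lambda>y. A x y))) \<le> var r" by simp
    have "noise_exp (\<lambda>x0 z. 2 * G r x0 z (\<lambda>x. overlap x x0 * A x x0)
        - G r x0 z (\<lambda>x. A x x0 * G r x0 z (\<lambda>y. overlap x y)))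
      = (2 * var r + 2 * m r * 0) - (noise_exp (\<lambda>x0 z. G r x0 z (\<lambda>x. A x x0 * G r x0 z (\<lambda>y. A x y))) + m r * 0)"
      unfolding e1 e2
        noise_exp_diff[OF tame_add[OF tame_cmult[OF tG] tame_cmult[OF tG]] tame_add[OF GG tame_cmult[OF tG]]]
        noise_exp_add[OF tame_cmult[OF tG] tame_cmult[OF tG]] noise_exp_add[OF GG tame_cmult[OF tG]]
        noise_exp_cmult A0 var[symmetric] ..
    then show "var r \<le> noise_exp (\<lambda>x0 z. 2 * G r x0 z (\<lambda>x. overlap x x0 * A x x0)
        - G r x0 z (\<lambda>x. A x x0 * G r x0 z (\<lambda>y. overlap x y)))" using c by simp
  qed
  finally have 1: "r * var r \<le> noise_exp (\<lambda>x0 z. G r x0 z (\<lambda>x. ell r x0 z x * A x x0))" .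
  have tl: "tame K (\<lambda>z. G r x0 z (\<lambda>x. \<bar>ell r x0 z x - c\<bar>))" for x0
    by (rule tame_G[OF tame_abs[OF tame_diff[OF tame_ell tame_const]]])
  have "noise_exp (\<lambda>x0 z. G r x0 z (\<lambda>x. ell r x0 z x * A x x0))
      \<le> noise_exp (\<lambda>x0 z. 2 * C\<^sup>2 * G r x0 z (\<lambda>x. \<bar>ell r x0 z x - c\<bar>) + c * G r x0 z (\<lambda>x. A x x0))"
  proof (rule noise_exp_mono)
    show "tame K (\<lambda>z. G r x0 z (\<lambda>x. ell r x0 z x * A x x0))" for x0
      by (rule tame_G[OF tame_mult[OF tame_ell tame_const]])
    show "tame K (\<lambda>z. 2 * C\<^sup>2 * G r x0 z (\<lambda>x. \<bar>ell r x0 z x - c\<bar>) + c * G r x0 z (\<lambda>x. A x x0))" for x0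
      by (rule tame_add[OF tame_cmult[OF tl] tame_cmult[OF tG]])
    fix x0 z assume x0: "x0 \<in> \<Omega>"
    have "G r x0 z (\<lambda>x. ell r x0 z x * A x x0) \<le> G r x0 z (\<lambda>x. 2 * C\<^sup>2 * \<bar>ell r x0 z x - c\<bar> + c * A x x0)"
    proof (rule gibbs_mono)
      fix x assume x: "x \<in> \<Omega>"
      have "(ell r x0 z x - c) * A x x0 \<le> \<bar>ell r x0 z x - c\<bar> * \<bar>A x x0\<bar>" by (metis abs_ge_self abs_mult)
      also have "\<dots> \<le> \<bar>ell r x0 z x - c\<bar> * (2 * C\<^sup>2)" using A_bound[OF x x0] by (intro mult_left_mono) auto
      finally show "ell r x0 z x * A x x0 \<le> 2 * C\<^sup>2 * \<bar>ell r x0 z x - c\<bar> + c * A x x0"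
        by (simp add: algebra_simps)
    qed
    then show "G r x0 z (\<lambda>x. ell r x0 z x * A x x0) \<le> 2 * C\<^sup>2 * G r x0 z (\<lambda>x. \<bar>ell r x0 z x - c\<bar>) + c * G r x0 z (\<lambda>x. A x x0)"
      by (simp only: gibbs_add gibbs_cmult)
  qed
  also have "\<dots> = 2 * C\<^sup>2 * noise_exp (\<lambda>x0 z. G r x0 z (\<lambda>x. \<bar>ell r x0 z x - c\<bar>))"
    unfolding noise_exp_add[OF tame_cmult[OF tl] tame_cmult[OF tG]] noise_exp_cmult A0 by simp
  finally show ?thesis using 1 by linarith
qed

end

section \<open>Choice of the strength of the side channel\<close>

lemma abs_power_diff_le:
  fixes x y B :: real
  assumes "\<bar>x\<bar> \<le> B" "\<bar>y\<bar> \<le> B"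
  shows "\<bar>x ^ p - y ^ p\<bar> \<le> real p * B ^ (p - 1) * \<bar>x - y\<bar>"
proof (induction p)
  case (Suc p)
  have B: "B \<ge> 0" using assms by linarith
  have "x ^ Suc p - y ^ Suc p = x * (x ^ p - y ^ p) + (x - y) * y ^ p" by (simp add: algebra_simps)
  then have "\<bar>x ^ Suc p - y ^ Suc p\<bar> \<le> \<bar>x\<bar> * \<bar>x ^ p - y ^ p\<bar> + \<bar>x - y\<bar> * \<bar>y ^ p\<bar>"
    by (metis abs_mult abs_triangle_ineq)
  also have "\<dots> \<le> B * (real p * B ^ (p - 1) * \<bar>x - y\<bar>) + \<bar>x - y\<bar> * B ^ p"
    using Suc.IH assms B by (intro add_mono mult_mono) (auto simp: power_abs intro!: power_mono)
  also have "\<dots> = real (Suc p) * B ^ (Suc p - 1) * \<bar>x - y\<bar>"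
    by (cases p) (simp_all add: algebra_simps)
  finally show ?case .
qed simp

text \<open>Replaces the integration over \<open>r\<close> of the second derivative of the free energy.\<close>
lemma second_difference_pigeonhole:
  fixes f :: "real \<Rightarrow> real"
  assumes M: "M > 0" and D: "(f (a + real M * \<delta>) - f (a + (real M - 1) * \<delta>)) - (f a - f (a - \<delta>)) \<le> D"
  shows "\<exists>j<M. f (a + real j * \<delta> + \<delta>) + f (a + real j * \<delta> - \<delta>) - 2 * f (a + real j * \<delta>) \<le> D / real M"
proof (rule ccontr)
  let ?g = "\<lambda>j. f (a + real j * \<delta> + \<delta>) + f (a + real j * \<delta> - \<delta>) - 2 * f (a + real j * \<delta>)"
  let ?h = "\<lambda>j::nat. f (a + real j * \<delta>) - f (a + (real j - 1) * \<delta>)"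
  assume "\<not> ?thesis"
  then have "D / real M < ?g j" if "j < M" for j using that by force
  then have "(\<Sum>j<M. D / real M) < (\<Sum>j<M. ?g j)" using M by (intro sum_strict_mono) auto
  then have 1: "D < (\<Sum>j<M. ?g j)" using M by simp
  have "?g j = ?h (Suc j) - ?h j" for j
    by (simp add: algebra_simps)
  then have "(\<Sum>j<M. ?g j) = (\<Sum>j<M. ?h (Suc j) - ?h j)" by (intro sum.cong refl)
  also have "\<dots> = ?h M - ?h 0" by (rule sum_lessThan_telescope)
  finally show False using 1 D by simp
qed

context overlap_channel
begin

lemma info_snr: "info (snr r) f = planted (snr r) (\<lambda>x z. f x * gibbs (snr r) z f)"
  by (rule info_eq_planted[OF snr_nonneg])

lemma info_le: "k \<in> J \<Longrightarrow> info (snr r) (u k) \<le> C\<^sup>2"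
proof -
  assume k: "k \<in> J"
  have "info (snr r) (u k) = noise_exp (\<lambda>x z. u k x * G r x z (u k))"
    unfolding info_snr planted_noise_exp ..
  also have "\<dots> \<le> noise_exp (\<lambda>x z. C\<^sup>2)"
  proof (rule noise_exp_mono[OF tame_cmult[OF tame_gibbs_shift] tame_const])
    fix x z assume x: "x \<in> \<Omega>"
    have "\<bar>u k x * G r x z (u k)\<bar> \<le> C * C"
      unfolding abs_mult using uC[OF k x] gibbs_abs_le[of "u k" C "snr r" "shift (snr r) x z", OF uC[OF k]] C_nonneg
      by (intro mult_mono) auto
    then show "u k x * G r x z (u k) \<le> C\<^sup>2" by (simp add: power2_eq_square)
  qed
  finally show ?thesis by (simp only: noise_exp_const)
qed

lemma info_nonneg: "info s f \<ge> 0"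
  unfolding info_def by (intro integral_nonneg_AE AE_I2 mult_nonneg_nonneg less_imp_le[OF Z_pos]) simp

lemma \<nu>_increment:
  assumes "0 \<le> r" "r \<le> r'"
  shows "0 \<le> \<nu> r' - \<nu> r" "\<nu> r' - \<nu> r \<le> C\<^sup>2 / 2 * (r'\<^sup>2 - r\<^sup>2)"
proof -
  have sq: "r'\<^sup>2 - r\<^sup>2 \<ge> 0" using assms by (simp add: power_mono)
  obtain \<xi> where \<xi>: "0 < \<xi>" "\<xi> < 1"
    and eq: "free_energy (snr r') - free_energy (snr r) = (\<Sum>k\<in>K. (snr r' k - snr r k) * info (line (snr r) (snr r') \<xi>) (u k) / 2)"
    by (rule free_energy_mvt[of "snr r" "snr r'", OF snr_nonneg snr_nonneg])
  \<comment> \<open>A point of the segment between \<open>snr r\<close> and \<open>snr r'\<close> is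
    again of this form, with the squares of the strengths interpolated linearly.\<close>
  define q where "q = sqrt (r\<^sup>2 + \<xi> * (r'\<^sup>2 - r\<^sup>2))"
  have "line (snr r) (snr r') \<xi> = snr q"
    using \<xi> sq by (auto simp: line_def snr_def q_def fun_eq_iff add_nonneg_nonneg)
  then have eq: "free_energy (snr r') - free_energy (snr r) = (\<Sum>k\<in>K. (snr r' k - snr r k) * info (snr q) (u k) / 2)"
    using eq by simp
  also have "\<dots> = (\<Sum>k\<in>J. (r'\<^sup>2 - r\<^sup>2) * info (snr q) (u k) / 2)"
    using J finite_K by (intro sum.mono_neutral_cong_right) (auto simp: snr_def)
  finally have eq: "free_energy (snr r') - free_energy (snr r) = (\<Sum>k\<in>J. (r'\<^sup>2 - r\<^sup>2) * info (snr q) (u k) / 2)" .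
  have "0 \<le> (\<Sum>k\<in>J. (r'\<^sup>2 - r\<^sup>2) * info (snr q) (u k) / 2)"
    using sq info_nonneg by (intro sum_nonneg) auto
  then show "0 \<le> \<nu> r' - \<nu> r" unfolding \<nu>_def eq[symmetric] diff_divide_distrib[symmetric] using n_pos by simp
  have "(\<Sum>k\<in>J. (r'\<^sup>2 - r\<^sup>2) * info (snr q) (u k) / 2) \<le> (\<Sum>k\<in>J. (r'\<^sup>2 - r\<^sup>2) * C\<^sup>2 / 2)"
    using sq info_le by (intro sum_mono divide_right_mono mult_left_mono) auto
  also have "\<dots> = n * (C\<^sup>2 / 2 * (r'\<^sup>2 - r\<^sup>2))" by (simp add: n_def)
  finally show "\<nu> r' - \<nu> r \<le> C\<^sup>2 / 2 * (r'\<^sup>2 - r\<^sup>2)"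
    unfolding \<nu>_def eq[symmetric] diff_divide_distrib[symmetric] using n_pos by (simp add: divide_le_eq mult.commute)
qed

text \<open>The mean overlap is the average squared posterior mean of the side channels. This makes
  it nonnegative and, by the I-MMSE relation, twice the slope of the normalised free energy in the
  ratio \<open>r\<^sup>2\<close>.\<close>

lemma m_eq_info: "m r = (\<Sum>k\<in>J. info (snr r) (u k)) / n"
proof -
  have "G r x0 z (\<lambda>x. overlap x x0) = (1 / n) * (\<Sum>k\<in>J. u k x0 * G r x0 z (u k))" for x0 z
  proof -
    have "overlap x x0 = (1 / n) * (\<Sum>k\<in>J. u k x0 * u k x)" for x
      unfolding overlap_def by (simp add: mult.commute)
    then show ?thesis by (simp only: gibbs_cmult gibbs_sum)
  qed
  then have "m r = (1 / n) * (\<Sum>k\<in>J. noise_exp (\<lambda>x0 z. u k x0 * G r x0 z (u k)))"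
    unfolding m_def planted_noise_exp by (simp only: noise_exp_cmult noise_exp_sum[OF tame_cmult[OF tame_gibbs_shift]])
  then show ?thesis unfolding info_snr planted_noise_exp by simp
qed

lemma m_nonneg: "m r \<ge> 0"
  unfolding m_eq_info using n_pos info_nonneg by (intro divide_nonneg_pos sum_nonneg) auto

text \<open>The first differences of \<open>\<nu>\<close> grow by at most
  \<open>2 * C\<^sup>2 * a * \<delta>\<close> across \<open>M\<close> grid points between
  \<open>a\<close> and \<open>2 * a\<close>, so one second difference is at most
  \<open>2 * C\<^sup>2 * \<delta>\<^sup>2\<close>. After division by \<open>a * \<delta>\<close> the
  curvature terms are of order \<open>1 / M\<close>, and the others vanish with \<open>1 / n\<close>
  and \<open>v\<close>. The fluctuation bound is required up to \<open>3 * a\<close> because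
  \<open>r + \<delta>\<close> is visited.\<close>

lemma overlap_concentration:
  assumes a: "a > 0" and M: "M > 0" and \<delta>: "\<delta> = a / real M"
    and v: "\<And>\<rho>. 0 \<le> \<rho> \<Longrightarrow> \<rho> \<le> 3 * a \<Longrightarrow> noise_exp (\<lambda>x0 z. \<bar>logZ \<rho> x0 z - \<nu> \<rho>\<bar>) \<le> v"
  obtains r where "a \<le> r" "r \<le> 2 * a"
    "var r \<le> 2 * C\<^sup>2 / (a * \<delta>) * (ln 2 / n + 5 * C\<^sup>2 * \<delta>\<^sup>2 + 4 * v)"
proof -
  have \<delta>0: "\<delta> > 0" and \<delta>a: "\<delta> \<le> a" and M\<delta>: "real M * \<delta> = a"
    using a M unfolding \<delta> by (auto simp: divide_le_eq)
  have "\<exists>j<M. \<nu> (a + real j * \<delta> + \<delta>) + \<nu> (a + real j * \<delta> - \<delta>) - 2 * \<nu> (a + real j * \<delta>) \<le> (2 * C\<^sup>2 * a * \<delta>) / real M"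
  proof (rule second_difference_pigeonhole[OF M])
    have e: "a + (real M - 1) * \<delta> = 2 * a - \<delta>" using M\<delta> by (simp add: algebra_simps)
    have "\<nu> (2 * a) - \<nu> (2 * a - \<delta>) \<le> C\<^sup>2 / 2 * ((2 * a)\<^sup>2 - (2 * a - \<delta>)\<^sup>2)"
      using \<delta>0 \<delta>a a by (intro \<nu>_increment) auto
    also have "\<dots> \<le> C\<^sup>2 / 2 * (4 * a * \<delta>)"
      by (intro mult_left_mono) (simp_all add: power2_eq_square algebra_simps)
    finally have "\<nu> (2 * a) - \<nu> (2 * a - \<delta>) \<le> 2 * C\<^sup>2 * a * \<delta>" by (simp add: mult_ac)
    moreover have "0 \<le> \<nu> a - \<nu> (a - \<delta>)" using \<delta>0 \<delta>a by (intro \<nu>_increment) auto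
    ultimately show "(\<nu> (a + real M * \<delta>) - \<nu> (a + (real M - 1) * \<delta>)) - (\<nu> a - \<nu> (a - \<delta>)) \<le> 2 * C\<^sup>2 * a * \<delta>"
      unfolding e M\<delta> by simp
  qed
  then obtain j where j: "j < M" and
    sd: "\<nu> (a + real j * \<delta> + \<delta>) + \<nu> (a + real j * \<delta> - \<delta>) - 2 * \<nu> (a + real j * \<delta>) \<le> 2 * C\<^sup>2 * a * \<delta> / real M" by blast
  define r where "r = a + real j * \<delta>"
  have "real j * \<delta> \<le> real M * \<delta>" using j \<delta>0 by (intro mult_right_mono) auto
  then have r: "a \<le> r" "r \<le> 2 * a" unfolding r_def M\<delta> using \<delta>0 by auto
  have "2 * C\<^sup>2 * a * \<delta> / real M = 2 * C\<^sup>2 * \<delta>\<^sup>2"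
    using M by (simp add: \<delta> power2_eq_square)
  then have sd': "\<nu> (r + \<delta>) + \<nu> (r - \<delta>) - 2 * \<nu> r \<le> 2 * C\<^sup>2 * \<delta>\<^sup>2" using sd unfolding r_def by simp
  \<comment> \<open>With the backward slope as centre the left tilt contributes nothing, and the
    right tilt contributes the positive part of the second difference.\<close>
  define c where "c = (\<nu> r - \<nu> (r - \<delta>)) / \<delta>"
  have c: "\<delta> * c = \<nu> r - \<nu> (r - \<delta>)" unfolding c_def using \<delta>0 by simp
  define E where "E = noise_exp (\<lambda>x0 z. G r x0 z (\<lambda>x. \<bar>ell r x0 z x - c\<bar>))"
  have "\<delta> * E \<le> ln 2 / n + max 0 (\<nu> (r + \<delta>) - \<nu> r - \<delta> * c) + max 0 (\<nu> (r - \<delta>) - \<nu> r + \<delta> * c) + 3 * C\<^sup>2 * \<delta>\<^sup>2 + 4 * v"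
    unfolding E_def
  proof (rule ell_deviation)
    show "\<delta> \<le> r" using r \<delta>a by simp
    show "noise_exp (\<lambda>x0 z. \<bar>logZ \<rho> x0 z - \<nu> \<rho>\<bar>) \<le> v" if "\<rho> \<in> {r - \<delta>, r, r + \<delta>}" for \<rho>
      using that r \<delta>a \<delta>0 by (intro v) auto
  qed (rule \<delta>0)
  moreover have "max 0 (\<nu> (r + \<delta>) - \<nu> r - \<delta> * c) \<le> 2 * C\<^sup>2 * \<delta>\<^sup>2"
    unfolding c using sd' by (simp add: max_def)
  moreover have "max 0 (\<nu> (r - \<delta>) - \<nu> r + \<delta> * c) = 0" unfolding c by simp
  ultimately have E: "\<delta> * E \<le> ln 2 / n + 5 * C\<^sup>2 * \<delta>\<^sup>2 + 4 * v" by linarith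
  have var0: "var r \<ge> 0"
  proof -
    have "noise_exp (\<lambda>x0 z. 0) \<le> var r" unfolding var_def planted_noise_exp
    proof (rule noise_exp_mono[OF tame_const tame_gibbs_shift])
      have "G r x0 z (\<lambda>_. 0) \<le> G r x0 z (\<lambda>x. (overlap x x0 - m r)\<^sup>2)" for x0 z by (intro gibbs_mono) simp
      then show "0 \<le> G r x0 z (\<lambda>x. (overlap x x0 - m r)\<^sup>2)" for x0 z by simp
    qed
    then show ?thesis by (simp only: noise_exp_const)
  qed
  have "a * var r \<le> r * var r" using r var0 by (intro mult_right_mono) auto
  also have "\<dots> \<le> 2 * C\<^sup>2 * E" unfolding E_def by (rule r_var_le) (use a r in auto)
  finally have "a * \<delta> * var r \<le> \<delta> * (2 * C\<^sup>2 * E)"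
    using \<delta>0 mult_left_mono[of "a * var r" "2 * C\<^sup>2 * E" \<delta>] by (simp add: mult_ac)
  also have "\<dots> = 2 * C\<^sup>2 * (\<delta> * E)" by simp
  also have "\<dots> \<le> 2 * C\<^sup>2 * (ln 2 / n + 5 * C\<^sup>2 * \<delta>\<^sup>2 + 4 * v)" by (rule mult_left_mono[OF E]) simp
  finally have "var r \<le> 2 * C\<^sup>2 / (a * \<delta>) * (ln 2 / n + 5 * C\<^sup>2 * \<delta>\<^sup>2 + 4 * v)"
    using a \<delta>0 by (simp add: pos_le_divide_eq mult_ac)
  with r show ?thesis by (rule that)
qed

text \<open>Powers are Lipschitz on the range of the overlap. Replacing \<open>\<bar>y\<bar>\<close>
  by \<open>t / 2 + y\<^sup>2 / (2 * t)\<close> brings in the variance without a square root and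
  leaves \<open>t\<close> to be chosen.\<close>

lemma overlap_power_le:
  assumes t: "t > 0"
  shows "planted (snr r) (\<lambda>x0 z. gibbs (snr r) z (\<lambda>x. overlap x x0 ^ p))
    \<le> m r ^ p + real p * (C\<^sup>2) ^ (p - 1) * (t / 2 + var r / (2 * t))"
proof -
  define L where "L = real p * (C\<^sup>2) ^ (p - 1)"
  have L0: "L \<ge> 0" unfolding L_def by simp
  have "noise_exp (\<lambda>x0 z. G r x0 z (\<lambda>x. overlap x x0 ^ p))
    \<le> noise_exp (\<lambda>x0 z. (m r ^ p + L * (t / 2)) + L / (2 * t) * G r x0 z (\<lambda>x. (overlap x x0 - m r)\<^sup>2))"
  proof (rule noise_exp_mono[OF tame_gibbs_shift tame_add[OF tame_const tame_cmult[OF tame_gibbs_shift]]])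
    fix x0 z assume x0: "x0 \<in> \<Omega>"
    have "G r x0 z (\<lambda>x. overlap x x0 ^ p) \<le> G r x0 z (\<lambda>x. (m r ^ p + L * (t / 2)) + L / (2 * t) * (overlap x x0 - m r)\<^sup>2)"
    proof (rule gibbs_mono)
      fix x assume x: "x \<in> \<Omega>"
      let ?y = "overlap x x0 - m r"
      have "\<bar>?y\<bar> \<le> t / 2 + ?y\<^sup>2 / (2 * t)"
        using sum_squares_bound[of t "\<bar>?y\<bar>"] t by (simp add: field_simps power2_eq_square)
      from mult_left_mono[OF this L0]
      have "overlap x x0 ^ p - m r ^ p \<le> L * (t / 2 + ?y\<^sup>2 / (2 * t))"
        using abs_power_diff_le[OF overlap_bound[OF x x0] m_bound[of r], of p] unfolding L_def by linarith
      then show "overlap x x0 ^ p \<le> (m r ^ p + L * (t / 2)) + L / (2 * t) * ?y\<^sup>2"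
        by (simp add: distrib_left)
    qed
    then show "G r x0 z (\<lambda>x. overlap x x0 ^ p) \<le> (m r ^ p + L * (t / 2)) + L / (2 * t) * G r x0 z (\<lambda>x. (overlap x x0 - m r)\<^sup>2)"
      by (simp only: gibbs_add gibbs_const gibbs_cmult)
  qed
  also have "\<dots> = (m r ^ p + L * (t / 2)) + L / (2 * t) * var r"
    unfolding noise_exp_add[OF tame_const tame_cmult[OF tame_gibbs_shift]] noise_exp_const noise_exp_cmult
      var_def planted_noise_exp ..
  finally show ?thesis unfolding L_def planted_noise_exp by (simp add: distrib_left)
qed

end

section \<open>Elementary symmetric polynomials\<close>

definition elem_sym :: "nat \<Rightarrow> 'i set \<Rightarrow> ('i \<Rightarrow> real) \<Rightarrow> real" where
  "elem_sym p A a = (\<Sum>S | S \<subseteq> A \<and> card S = p. \<Prod>i\<in>S. a i)"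

lemma elem_sym_0 [simp]: "finite A \<Longrightarrow> elem_sym 0 A a = 1"
proof -
  assume A: "finite A"
  have "S = {}" if "S \<subseteq> A" "card S = 0" for S
    using that finite_subset[OF that(1) A] by simp
  then have "{S. S \<subseteq> A \<and> card S = 0} = {{}}" by auto
  then show ?thesis unfolding elem_sym_def by simp
qed

lemma elem_sym_Suc_empty [simp]: "elem_sym (Suc p) {} a = 0"
  unfolding elem_sym_def by (rule sum.neutral) auto

lemma elem_sym_insert:
  assumes "finite A" "i \<notin> A"
  shows "elem_sym (Suc p) (insert i A) a = elem_sym (Suc p) A a + a i * elem_sym p A a"
proof -
  let ?P = "{S. S \<subseteq> insert i A \<and> card S = Suc p}"
  let ?Q = "{S. S \<subseteq> A \<and> card S = Suc p}" and ?R = "{S. S \<subseteq> A \<and> card S = p}"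
  have inj: "inj_on (insert i) ?R"
  proof (rule inj_onI)
    fix S S' assume "S \<in> ?R" "S' \<in> ?R" and eq: "insert i S = insert i S'"
    then have "i \<notin> S" "i \<notin> S'" using assms(2) by auto
    then show "S = S'" using eq insert_ident[of i S S'] by simp
  qed
  have P: "?P = ?Q \<union> insert i ` ?R"
  proof (intro set_eqI iffI)
    fix S assume S: "S \<in> ?P"
    show "S \<in> ?Q \<union> insert i ` ?R"
    proof (cases "i \<in> S")
      case True
      have "finite S" using S finite_subset[of S "insert i A"] assms(1) by simp
      then have "S - {i} \<in> ?R" using S True by auto
      moreover have "S = insert i (S - {i})" using True by auto
      ultimately show ?thesis by blast
    qed (use S in auto)
  next
    fix S assume S: "S \<in> ?Q \<union> insert i ` ?R"
    then show "S \<in> ?P"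
    proof
      assume "S \<in> insert i ` ?R"
      then obtain S' where S': "S = insert i S'" "S' \<subseteq> A" "card S' = p" by auto
      then have "finite S'" "i \<notin> S'" using assms finite_subset[of S' A] by auto
      then show ?thesis using S' by auto
    qed auto
  qed
  have fin: "finite ?Q" "finite ?R" using assms(1) by (auto intro: finite_subset[of _ "Pow A"])
  have "elem_sym (Suc p) (insert i A) a = (\<Sum>S\<in>?Q. \<Prod>i\<in>S. a i) + (\<Sum>S\<in>insert i ` ?R. \<Prod>i\<in>S. a i)"
    unfolding elem_sym_def P using fin assms by (intro sum.union_disjoint) auto
  also have "(\<Sum>S\<in>insert i ` ?R. \<Prod>i\<in>S. a i) = (\<Sum>S\<in>?R. a i * (\<Prod>i\<in>S. a i))"
    unfolding sum.reindex[OF inj] comp_def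
  proof (rule sum.cong[OF refl])
    fix S assume "S \<in> ?R"
    then have "finite S" "i \<notin> S" using assms finite_subset[of S A] by auto
    then show "(\<Prod>i\<in>insert i S. a i) = a i * (\<Prod>i\<in>S. a i)" by simp
  qed
  finally show ?thesis unfolding elem_sym_def sum_distrib_left .
qed

text \<open>The remainder collects the higher terms of a binomial expansion with positive
  coefficients, so it is largest in absolute value at \<open>s = N * c\<close> and
  \<open>a = c\<close>. Both sides obey the same recursion in \<open>p\<close>, which is how the
  induction runs.\<close>

lemma power_add_remainder:
  fixes s a c N :: real
  assumes "\<bar>s\<bar> \<le> N * c" "\<bar>a\<bar> \<le> c" "N \<ge> 0"
  shows "\<bar>(s + a) ^ Suc p - s ^ Suc p - real (Suc p) * a * s ^ p\<bar>
    \<le> c ^ Suc p * ((N + 1) ^ Suc p - N ^ Suc p - real (Suc p) * N ^ p)"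
proof (induction p)
  case 0 show ?case by simp
next
  case (Suc p)
  let ?R = "\<lambda>p. (s + a) ^ Suc p - s ^ Suc p - real (Suc p) * a * s ^ p"
  let ?N = "\<lambda>p. (N + 1) ^ Suc p - N ^ Suc p - real (Suc p) * N ^ p"
  have c: "c \<ge> 0" using assms by linarith
  have eq: "?R (Suc p) = (s + a) * ?R p + real (Suc p) * (a * a * s ^ p)"
    by (simp add: algebra_simps)
  have eqN: "?N (Suc p) = (N + 1) * ?N p + real (Suc p) * N ^ p"
    by (simp add: algebra_simps)
  have sp: "\<bar>s ^ p\<bar> \<le> (N * c) ^ p" unfolding power_abs using assms(1) by (intro power_mono) auto
  have "\<bar>s + a\<bar> \<le> (N + 1) * c" using assms by (simp add: distrib_right)
  then have 1: "\<bar>(s + a) * ?R p\<bar> \<le> ((N + 1) * c) * (c ^ Suc p * ?N p)"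
    unfolding abs_mult using Suc.IH assms c by (intro mult_mono) auto
  have "\<bar>a\<bar> * \<bar>a\<bar> * \<bar>s ^ p\<bar> \<le> c * c * (N * c) ^ p"
    using assms c sp by (intro mult_mono) auto
  then have 2: "\<bar>real (Suc p) * (a * a * s ^ p)\<bar> \<le> real (Suc p) * (c * c * (N * c) ^ p)"
    using mult_left_mono[of "\<bar>a\<bar> * \<bar>a\<bar> * \<bar>s ^ p\<bar>" "c * c * (N * c) ^ p" "real (Suc p)"] by (simp add: abs_mult)
  have "\<bar>?R (Suc p)\<bar> \<le> ((N + 1) * c) * (c ^ Suc p * ?N p) + real (Suc p) * (c * c * (N * c) ^ p)"
    unfolding eq using 1 2 by linarith
  also have "\<dots> = c ^ Suc (Suc p) * ?N (Suc p)"
    unfolding eqN by (simp add: power_mult_distrib algebra_simps)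
  finally show ?case .
qed

text \<open>The power of the sum runs over all \<open>p\<close>-tuples,
  \<open>fact p * elem_sym p A a\<close> over those with distinct entries; the bound counts the
  others, each of size at most \<open>c ^ p\<close>. Induction on \<open>A\<close> avoids tuples,
  because the bound satisfies the same recursion as the error.\<close>

lemma elem_sym_approx:
  fixes a :: "'i \<Rightarrow> real"
  assumes A: "finite A" and a: "\<And>i. i \<in> A \<Longrightarrow> \<bar>a i\<bar> \<le> c"
  shows "\<bar>fact p * elem_sym p A a - (\<Sum>i\<in>A. a i) ^ p\<bar>
    \<le> c ^ p * (real (card A) ^ p - fact p * real (card A choose p))"
  using A a
proof (induction A arbitrary: p rule: finite_induct)
  case empty
  show ?case by (cases p) auto
next
  case (insert i A)
  show ?case
  proof (cases p)
    case (Suc q)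
    let ?s = "\<Sum>i\<in>A. a i" and ?N = "real (card A)"
    have c: "c \<ge> 0" using insert.prems[of i] by simp
    have s: "\<bar>?s\<bar> \<le> ?N * c"
    proof -
      have "(\<Sum>i\<in>A. \<bar>a i\<bar>) \<le> ?N * c"
        using sum_bounded_above[of A "\<lambda>i. \<bar>a i\<bar>" c] insert.prems by simp
      then show ?thesis using sum_abs[of a A] by linarith
    qed
    have IH: "\<bar>fact p * elem_sym p A a - ?s ^ p\<bar> \<le> c ^ p * (?N ^ p - fact p * real (card A choose p))" for p
      by (rule insert.IH) (use insert.prems in auto)
    have eq: "fact (Suc q) * elem_sym (Suc q) (insert i A) a - (?s + a i) ^ Suc q
      = (fact (Suc q) * elem_sym (Suc q) A a - ?s ^ Suc q)
        + real (Suc q) * a i * (fact q * elem_sym q A a - ?s ^ q)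
        - ((?s + a i) ^ Suc q - ?s ^ Suc q - real (Suc q) * a i * ?s ^ q)"
      unfolding elem_sym_insert[OF insert.hyps] by (simp add: algebra_simps)
    have "\<bar>real (Suc q) * a i * (fact q * elem_sym q A a - ?s ^ q)\<bar>
        \<le> real (Suc q) * c * (c ^ q * (?N ^ q - fact q * real (card A choose q)))"
      unfolding abs_mult[of "real (Suc q) * a i"] using IH[of q] insert.prems[of i] c
      by (intro mult_mono) (auto simp: abs_mult intro!: mult_left_mono)
    moreover have "\<bar>(?s + a i) ^ Suc q - ?s ^ Suc q - real (Suc q) * a i * ?s ^ q\<bar>
        \<le> c ^ Suc q * ((?N + 1) ^ Suc q - ?N ^ Suc q - real (Suc q) * ?N ^ q)"
      by (rule power_add_remainder[OF s]) (use insert.prems in auto)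
    ultimately have "\<bar>fact (Suc q) * elem_sym (Suc q) (insert i A) a - (?s + a i) ^ Suc q\<bar>
      \<le> c ^ Suc q * (?N ^ Suc q - fact (Suc q) * real (card A choose Suc q))
        + real (Suc q) * c * (c ^ q * (?N ^ q - fact q * real (card A choose q)))
        + c ^ Suc q * ((?N + 1) ^ Suc q - ?N ^ Suc q - real (Suc q) * ?N ^ q)"
      unfolding eq using IH[of "Suc q"] by linarith
    also have "\<dots> = c ^ Suc q * ((?N + 1) ^ Suc q - fact (Suc q) * (real (card A choose Suc q) + real (card A choose q)))"
      by (simp add: algebra_simps)
    also have "\<dots> = c ^ Suc q * (real (card (insert i A)) ^ Suc q - fact (Suc q) * real (card (insert i A) choose Suc q))"
      using insert.hyps by (simp add: add.commute)
    finally show ?thesis using insert.hyps Suc by (simp add: add.commute)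
  qed (use insert.hyps in simp)
qed

text \<open>\<open>fact p * (N choose p)\<close> is the falling factorial, which acquires the factor
  \<open>N - p\<close> in the step. The step adds at most \<open>(p + p\<^sup>2) * N ^ p\<close> to
  the gap, and \<open>p + p\<^sup>2 \<le> (p + 1)\<^sup>2\<close>.\<close>

lemma power_minus_falling_le:
  "real N ^ p - fact p * real (N choose p) \<le> (real p)\<^sup>2 * real N ^ (p - 1)"
proof (induction p)
  case (Suc p)
  show ?case
  proof (cases "p \<le> N")
    case True
    have "fact (Suc p) * real (N choose Suc p) = fact p * (real (Suc p) * real (N choose Suc p))" by simp
    also have "real (Suc p) * real (N choose Suc p) = real ((N - p) * (N choose p))"
      by (simp only: of_nat_mult[symmetric] binomial_absorption binomial_absorb_comp)
    also have "fact p * \<dots> = (real N - real p) * (fact p * real (N choose p))"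
      using True by (simp add: of_nat_diff)
    finally have eq: "fact (Suc p) * real (N choose Suc p) = (real N - real p) * (fact p * real (N choose p))" .
    have le: "(real N - real p) * (real N ^ p - (real p)\<^sup>2 * real N ^ (p - 1)) \<le> (real N - real p) * (fact p * real (N choose p))"
      using Suc.IH True by (intro mult_left_mono) auto
    have pw: "real N * real N ^ (p - 1) = real N ^ p" if "p > 0" using that by (cases p) auto
    have "real N ^ Suc p - (real N - real p) * (real N ^ p - (real p)\<^sup>2 * real N ^ (p - 1))
      = real p * real N ^ p + (real N - real p) * ((real p)\<^sup>2 * real N ^ (p - 1))"
      by (simp add: algebra_simps)
    also have "\<dots> \<le> real p * real N ^ p + (real p)\<^sup>2 * real N ^ p"
    proof (cases "p = 0")
      case False
      have "(real N - real p) * ((real p)\<^sup>2 * real N ^ (p - 1)) \<le> real N * ((real p)\<^sup>2 * real N ^ (p - 1))"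
        by (intro mult_right_mono) auto
      also have "\<dots> = (real p)\<^sup>2 * real N ^ p" using pw False by (simp add: mult.left_commute)
      finally show ?thesis by simp
    qed simp
    also have "\<dots> \<le> (real (Suc p))\<^sup>2 * real N ^ (Suc p - 1)"
    proof -
      have "(real p + (real p)\<^sup>2) * real N ^ p \<le> (real (Suc p))\<^sup>2 * real N ^ p"
        by (intro mult_right_mono) (auto simp: power2_eq_square algebra_simps)
      then show ?thesis by (simp add: distrib_right)
    qed
    finally show ?thesis using le unfolding eq by linarith
  next
    case False
    then have "real N ^ Suc p = real N * real N ^ p" "real N \<le> (real (Suc p))\<^sup>2"
      using mult_mono[of 1 "real (Suc p)" "real N" "real (Suc p)"] by (auto simp: power2_eq_square)
    then have "real N ^ Suc p \<le> (real (Suc p))\<^sup>2 * real N ^ p" by (auto intro: mult_right_mono)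
    then show ?thesis using False by (simp add: binomial_eq_0)
  qed
qed simp

section \<open>Gaussian channels with a square-integrable input\<close>

lemma
  assumes "prob_space A" "prob_space B"
  shows distr_pair_fst': "distr (A \<Otimes>\<^sub>M B) A fst = A" and distr_pair_snd': "distr (A \<Otimes>\<^sub>M B) B snd = B"
proof -
  interpret A: prob_space A by fact
  interpret B: prob_space B by fact
  show "distr (A \<Otimes>\<^sub>M B) A fst = A"
  proof (rule measure_eqI)
    fix X assume X: "X \<in> sets (distr (A \<Otimes>\<^sub>M B) A fst)"
    then have "fst -` X \<inter> space (A \<Otimes>\<^sub>M B) = X \<times> space B"
      using sets.sets_into_space[of X A] by (auto simp: space_pair_measure)
    then show "emeasure (distr (A \<Otimes>\<^sub>M B) A fst) X = emeasure A X"
      using X by (simp add: emeasure_distr B.emeasure_pair_measure_Times B.emeasure_space_1)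
  qed simp
  show "distr (A \<Otimes>\<^sub>M B) B snd = B"
  proof (rule measure_eqI)
    fix X assume X: "X \<in> sets (distr (A \<Otimes>\<^sub>M B) B snd)"
    then have "snd -` X \<inter> space (A \<Otimes>\<^sub>M B) = space A \<times> X"
      using sets.sets_into_space[of X B] by (auto simp: space_pair_measure)
    then show "emeasure (distr (A \<Otimes>\<^sub>M B) B snd) X = emeasure B X"
      using X by (simp add: emeasure_distr B.emeasure_pair_measure_Times A.emeasure_space_1)
  qed simp
qed

lemma
  assumes "prob_space A" "prob_space B" and f: "f \<in> borel_measurable A"
  shows integrable_pair_fst: "integrable (A \<Otimes>\<^sub>M B) (\<lambda>\<omega>. f (fst \<omega>) :: real) \<longleftrightarrow> integrable A f"
    and integral_pair_fst: "(\<integral>\<omega>. f (fst \<omega>) \<partial>(A \<Otimes>\<^sub>M B)) = (\<integral>x. f x \<partial>A)"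
  using integrable_distr_eq[OF measurable_fst[of A B] f] integral_distr[OF measurable_fst[of A B] f]
  unfolding distr_pair_fst'[OF assms(1,2)] by auto

lemma integrable_pair_snd:
  assumes "prob_space A" "prob_space B" and f: "f \<in> borel_measurable B"
  shows "integrable (A \<Otimes>\<^sub>M B) (\<lambda>\<omega>. f (snd \<omega>) :: real) \<longleftrightarrow> integrable B f"
  using integrable_distr_eq[OF measurable_snd[of A B] f] unfolding distr_pair_snd'[OF assms(1,2)] by auto

lemma integrable_mult_of_sq:
  fixes f g :: "'a \<Rightarrow> real"
  assumes [measurable]: "f \<in> borel_measurable M" "g \<in> borel_measurable M"
    and "integrable M (\<lambda>x. (f x)\<^sup>2)" "integrable M (\<lambda>x. (g x)\<^sup>2)"
  shows "integrable M (\<lambda>x. f x * g x)"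
proof (rule Bochner_Integration.integrable_bound)
  show "integrable M (\<lambda>x. (f x)\<^sup>2 + (g x)\<^sup>2)" using assms by simp
  have "\<bar>a * b\<bar> \<le> a\<^sup>2 + b\<^sup>2" for a b :: real
  proof -
    have "0 \<le> \<bar>a\<bar> * \<bar>b\<bar>" by simp
    moreover have "2 * (\<bar>a\<bar> * \<bar>b\<bar>) \<le> a\<^sup>2 + b\<^sup>2"
      using sum_squares_bound[of "\<bar>a\<bar>" "\<bar>b\<bar>"] by (simp only: power2_abs mult.assoc)
    ultimately show ?thesis unfolding abs_mult by linarith
  qed
  then show "AE x in M. norm (f x * g x) \<le> norm ((f x)\<^sup>2 + (g x)\<^sup>2)" by (intro AE_I2) simp
qed measurable

text \<open>Here the signal-to-noise ratios are absorbed into \<open>u\<close>, unlike in \<open>finite_channel\<close>.\<close>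
definition obs_expo :: "'k set \<Rightarrow> ('k \<Rightarrow> 'a \<Rightarrow> real) \<Rightarrow> ('k \<Rightarrow> real) \<Rightarrow> 'a \<Rightarrow> real" where
  "obs_expo K u y x = (\<Sum>k\<in>K. y k * u k x - (u k x)\<^sup>2 / 2)"

definition obs_Z :: "'a measure \<Rightarrow> 'k set \<Rightarrow> ('k \<Rightarrow> 'a \<Rightarrow> real) \<Rightarrow> ('k \<Rightarrow> real) \<Rightarrow> real" where
  "obs_Z P K u y = (\<integral>x. exp (obs_expo K u y x) \<partial>P)"

definition obs_of :: "'k set \<Rightarrow> ('k \<Rightarrow> 'a \<Rightarrow> real) \<Rightarrow> 'a \<times> ('k \<Rightarrow> real) \<Rightarrow> 'k \<Rightarrow> real" where
  "obs_of K u \<omega> = (\<lambda>k\<in>K. snd \<omega> k + u k (fst \<omega>))"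

definition chan_free :: "'a measure \<Rightarrow> 'k set \<Rightarrow> ('k \<Rightarrow> 'a \<Rightarrow> real) \<Rightarrow> real" where
  "chan_free P K u = (\<integral>\<omega>. ln (obs_Z P K u (obs_of K u \<omega>)) \<partial>(P \<Otimes>\<^sub>M gaussK K))"

locale square_signal = prob_space P for P :: "'a measure" +
  fixes K :: "'k set" and u :: "'k \<Rightarrow> 'a \<Rightarrow> real"
  assumes K: "finite K" and u_meas: "\<And>k. k \<in> K \<Longrightarrow> u k \<in> borel_measurable P"
    and u_sq: "\<And>k. k \<in> K \<Longrightarrow> integrable P (\<lambda>x. (u k x)\<^sup>2)"
begin

abbreviation Q :: "('a \<times> ('k \<Rightarrow> real)) measure" where "Q \<equiv> P \<Otimes>\<^sub>M gaussK K"

lemma prob_Q: "prob_space Q"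
proof -
  interpret G: prob_space "gaussK K" by simp
  interpret pair_prob_space P "gaussK K" ..
  show ?thesis by unfold_locales
qed

lemma u_int: "k \<in> K \<Longrightarrow> integrable P (u k)"
  by (rule integrable_of_sq[OF u_meas u_sq])

lemma coord_meas: "k \<in> K \<Longrightarrow> (\<lambda>z. z k) \<in> borel_measurable (gaussK K)"
  by (simp add: gaussK_def)

lemma coord_sq_int: "k \<in> K \<Longrightarrow> integrable (gaussK K) (\<lambda>z. (z k)\<^sup>2)"
  unfolding power2_eq_square by (rule tame_integrable[OF K tame_mult[OF tame_coord[OF K] tame_coord[OF K]]])

lemma coord_mean:
  assumes "k \<in> K" shows "(\<integral>z. z k \<partial>gaussK K) = 0"
proof -
  have "(\<integral>z. z k * 1 \<partial>gaussK K) = (\<integral>z. 0 \<partial>gaussK K)"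
    by (rule gaussK_integration_by_parts[OF K assms, where c = 0 and d = 0 and g = "\<lambda>_. 1" and g' = "\<lambda>_. 0"]) simp_all
  then show ?thesis by simp
qed

text \<open>Completing the square gives a bound that does not involve \<open>x\<close>, so the
  likelihood is integrable although the signal has only second moments.\<close>

lemma expo_le: "obs_expo K u y x \<le> (\<Sum>k\<in>K. (y k)\<^sup>2)"
  unfolding obs_expo_def
proof (rule sum_mono)
  fix k
  have "y k * u k x \<le> (y k)\<^sup>2 / 2 + (u k x)\<^sup>2 / 2" using sum_squares_bound[of "y k" "u k x"] by simp
  moreover have "(y k)\<^sup>2 / 2 \<le> (y k)\<^sup>2" by simp
  ultimately show "y k * u k x - (u k x)\<^sup>2 / 2 \<le> (y k)\<^sup>2" by linarith
qed

lemma expo_meas [measurable]: "(\<lambda>x. obs_expo K u y x) \<in> borel_measurable P"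
  unfolding obs_expo_def using u_meas by measurable

lemma exp_expo_int: "integrable P (\<lambda>x. exp (obs_expo K u y x))"
  by (rule integrable_const_bound[of _ "exp (\<Sum>k\<in>K. (y k)\<^sup>2)"]) (auto simp: expo_le)

lemma expo_int: "integrable P (\<lambda>x. obs_expo K u y x)"
  unfolding obs_expo_def by (intro Bochner_Integration.integrable_sum Bochner_Integration.integrable_diff
      integrable_mult_right integrable_divide u_int u_sq)

lemma Z_pos: "obs_Z P K u y > 0"
proof -
  have "\<not> (AE x in P. exp (obs_expo K u y x) = 0)" using emeasure_space_1 by (simp add: AE_False)
  then have "obs_Z P K u y \<noteq> 0" unfolding obs_Z_def
    by (subst integral_nonneg_eq_0_iff_AE[OF exp_expo_int]) auto
  moreover have "obs_Z P K u y \<ge> 0" unfolding obs_Z_def by (intro integral_nonneg_AE) auto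
  ultimately show ?thesis by simp
qed

lemma Z_le: "obs_Z P K u y \<le> exp (\<Sum>k\<in>K. (y k)\<^sup>2)"
proof -
  have "obs_Z P K u y \<le> (\<integral>x. exp (\<Sum>k\<in>K. (y k)\<^sup>2) \<partial>P)" unfolding obs_Z_def
    by (rule integral_mono[OF exp_expo_int]) (auto simp: expo_le)
  then show ?thesis by (simp add: prob_space)
qed

lemma ln_Z_ge: "ln (obs_Z P K u y) \<ge> (\<integral>x. obs_expo K u y x \<partial>P)"
proof -
  let ?c = "\<integral>x. obs_expo K u y x \<partial>P"
  have "(\<integral>x. exp ?c * (1 + (obs_expo K u y x - ?c)) \<partial>P) \<le> obs_Z P K u y"
    unfolding obs_Z_def
  proof (rule integral_mono[OF _ exp_expo_int])
    fix x
    have "exp ?c * (1 + (obs_expo K u y x - ?c)) \<le> exp ?c * exp (obs_expo K u y x - ?c)"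
      by (intro mult_left_mono exp_ge_add_one_self) simp
    then show "exp ?c * (1 + (obs_expo K u y x - ?c)) \<le> exp (obs_expo K u y x)"
      by (simp add: exp_add[symmetric])
  qed (use expo_int in simp)
  moreover have "(\<integral>x. exp ?c * (1 + (obs_expo K u y x - ?c)) \<partial>P) = exp ?c"
    using expo_int by (simp add: prob_space)
  ultimately have "exp ?c \<le> obs_Z P K u y" by simp
  then show ?thesis using Z_pos by (simp add: ln_ge_iff)
qed

lemma obs_of_meas [measurable]: "obs_of K u \<in> measurable Q (gaussK K)"
proof -
  have "(\<lambda>\<omega>. \<lambda>k\<in>K. snd \<omega> k + u k (fst \<omega>)) \<in> measurable Q (PiM K (\<lambda>_. ngauss))"
  proof (rule measurable_restrict)
    fix k assume k: "k \<in> K"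
    have "(\<lambda>\<omega>. u k (fst \<omega>)) \<in> borel_measurable Q" by (rule measurable_compose[OF measurable_fst u_meas[OF k]])
    moreover have "(\<lambda>\<omega>. snd \<omega> k) \<in> borel_measurable Q" by (rule measurable_compose[OF measurable_snd coord_meas[OF k]])
    ultimately have "(\<lambda>\<omega>. snd \<omega> k + u k (fst \<omega>)) \<in> borel_measurable Q" by (rule borel_measurable_add[rotated])
    then show "(\<lambda>\<omega>. snd \<omega> k + u k (fst \<omega>)) \<in> measurable Q ngauss" by (simp cong: measurable_cong_sets)
  qed
  then show ?thesis unfolding obs_of_def[abs_def] gaussK_def .
qed

lemma joint_expo_meas [measurable]: "(\<lambda>p. obs_expo K u (fst p) (snd p)) \<in> borel_measurable (gaussK K \<Otimes>\<^sub>M P)"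
proof -
  have 1: "(\<lambda>p. fst p k) \<in> borel_measurable (gaussK K \<Otimes>\<^sub>M P)" if "k \<in> K" for k
    by (rule measurable_compose[OF measurable_fst coord_meas[OF that]])
  have 2: "(\<lambda>p. u k (snd p)) \<in> borel_measurable (gaussK K \<Otimes>\<^sub>M P)" if "k \<in> K" for k
    by (rule measurable_compose[OF measurable_snd u_meas[OF that]])
  show ?thesis unfolding obs_expo_def
    by (intro borel_measurable_sum borel_measurable_diff borel_measurable_times borel_measurable_divide
        borel_measurable_power borel_measurable_const 1 2)
qed

lemma Z_meas [measurable]: "obs_Z P K u \<in> borel_measurable (gaussK K)"
proof -
  have "(\<lambda>y. \<integral>x. exp (obs_expo K u (fst (y, x)) (snd (y, x))) \<partial>P) \<in> borel_measurable (gaussK K)"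
    by (rule borel_measurable_lebesgue_integral) (simp add: split_beta')
  then show ?thesis unfolding obs_Z_def[abs_def] by simp
qed

lemma obs_sq_int: "k \<in> K \<Longrightarrow> integrable Q (\<lambda>\<omega>. (obs_of K u \<omega> k)\<^sup>2)"
proof -
  assume k: "k \<in> K"
  have p: "prob_space P" by unfold_locales
  have m1: "(\<lambda>\<omega>. u k (fst \<omega>)) \<in> borel_measurable Q" by (rule measurable_compose[OF measurable_fst u_meas[OF k]])
  have m2: "(\<lambda>\<omega>. snd \<omega> k) \<in> borel_measurable Q" by (rule measurable_compose[OF measurable_snd coord_meas[OF k]])
  have 1: "integrable Q (\<lambda>\<omega>. (u k (fst \<omega>))\<^sup>2)"
    using integrable_pair_fst[OF p prob_space_gaussK, of "\<lambda>x. (u k x)\<^sup>2" K] u_sq[OF k] u_meas[OF k] by simp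
  have 2: "integrable Q (\<lambda>\<omega>. (snd \<omega> k)\<^sup>2)"
    using integrable_pair_snd[OF p prob_space_gaussK, of "\<lambda>z. (z k)\<^sup>2" K] coord_sq_int[OF k] coord_meas[OF k] by simp
  have "(obs_of K u \<omega> k)\<^sup>2 = (snd \<omega> k)\<^sup>2 + (u k (fst \<omega>))\<^sup>2 + 2 * (snd \<omega> k * u k (fst \<omega>))" for \<omega>
    using k by (simp add: obs_of_def power2_eq_square algebra_simps)
  then show "integrable Q (\<lambda>\<omega>. (obs_of K u \<omega> k)\<^sup>2)"
    using 1 2 integrable_mult_of_sq[OF m2 m1 2 1] by simp
qed

text \<open>From above \<open>ln Z\<close> is bounded by the squared norm of the observation, from
  below by Jensen's inequality in terms of the first two moments of the signal. Both bounds are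
  quadratic in an observation with finite second moment.\<close>

lemma ln_Z_int: "integrable Q (\<lambda>\<omega>. ln (obs_Z P K u (obs_of K u \<omega>)))"
proof (rule Bochner_Integration.integrable_bound)
  define c where "c = (\<Sum>k\<in>K. (\<integral>x. u k x \<partial>P)\<^sup>2 + (\<integral>x. (u k x)\<^sup>2 \<partial>P))"
  interpret Q: prob_space Q by (rule prob_Q)
  show "integrable Q (\<lambda>\<omega>. (\<Sum>k\<in>K. (obs_of K u \<omega> k)\<^sup>2) + c)"
    using obs_sq_int by (intro Bochner_Integration.integrable_add Bochner_Integration.integrable_sum) auto
  have c0: "c \<ge> 0" unfolding c_def by (intro sum_nonneg add_nonneg_nonneg integral_nonneg_AE) auto
  show "AE \<omega> in Q. norm (ln (obs_Z P K u (obs_of K u \<omega>))) \<le> norm ((\<Sum>k\<in>K. (obs_of K u \<omega> k)\<^sup>2) + c)"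
  proof (rule AE_I2)
    fix \<omega>
    define y where "y = obs_of K u \<omega>"
    have s0: "(\<Sum>k\<in>K. (y k)\<^sup>2) \<ge> 0" by (intro sum_nonneg) auto
    have up: "ln (obs_Z P K u y) \<le> (\<Sum>k\<in>K. (y k)\<^sup>2)" 
      using Z_le[of y] Z_pos[of y] ln_le_cancel_iff[of "obs_Z P K u y" "exp (\<Sum>k\<in>K. (y k)\<^sup>2)"] by simp
    have "(\<integral>x. obs_expo K u y x \<partial>P) = (\<Sum>k\<in>K. y k * (\<integral>x. u k x \<partial>P) - (\<integral>x. (u k x)\<^sup>2 \<partial>P) / 2)"
      unfolding obs_expo_def using u_int u_sq by (simp add: Bochner_Integration.integral_sum)
    also have "\<dots> \<ge> (\<Sum>k\<in>K. - (y k)\<^sup>2 - ((\<integral>x. u k x \<partial>P)\<^sup>2 + (\<integral>x. (u k x)\<^sup>2 \<partial>P)))"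
    proof (rule sum_mono)
      fix k
      have "- (y k)\<^sup>2 - a\<^sup>2 \<le> y k * a" for a :: real
      proof -
        have "- (2 * (y k * a)) \<le> (y k)\<^sup>2 + a\<^sup>2" using sum_squares_bound[of "y k" "- a"] by simp
        then show ?thesis using zero_le_power2[of "y k"] zero_le_power2[of a] by linarith
      qed
      from this[of "\<integral>x. u k x \<partial>P"]
      have "- (y k)\<^sup>2 - (\<integral>x. u k x \<partial>P)\<^sup>2 \<le> y k * (\<integral>x. u k x \<partial>P)" .
      moreover have "(\<integral>x. (u k x)\<^sup>2 \<partial>P) \<ge> 0" by (intro integral_nonneg_AE) auto
      ultimately show "- (y k)\<^sup>2 - ((\<integral>x. u k x \<partial>P)\<^sup>2 + (\<integral>x. (u k x)\<^sup>2 \<partial>P)) \<le> y k * (\<integral>x. u k x \<partial>P) - (\<integral>x. (u k x)\<^sup>2 \<partial>P) / 2"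
        by linarith
    qed
    also have "(\<Sum>k\<in>K. - (y k)\<^sup>2 - ((\<integral>x. u k x \<partial>P)\<^sup>2 + (\<integral>x. (u k x)\<^sup>2 \<partial>P))) = - (\<Sum>k\<in>K. (y k)\<^sup>2) - c"
      unfolding c_def by (simp only: sum_subtractf sum_negf)
    finally have "- (\<Sum>k\<in>K. (y k)\<^sup>2) - c \<le> ln (obs_Z P K u y)" using ln_Z_ge[of y] by linarith
    then show "norm (ln (obs_Z P K u (obs_of K u \<omega>))) \<le> norm ((\<Sum>k\<in>K. (obs_of K u \<omega> k)\<^sup>2) + c)"
      unfolding y_def[symmetric] using up s0 c0 by (simp add: abs_le_iff)
  qed
  show "(\<lambda>\<omega>. ln (obs_Z P K u (obs_of K u \<omega>))) \<in> borel_measurable Q"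
    by (rule measurable_compose[OF measurable_compose[OF obs_of_meas Z_meas]]) simp
qed

text \<open>Joint law of signal, noise and one posterior sample, given as a density against an
  independent copy of the prior.\<close>

definition replica :: "(('a \<times> ('k \<Rightarrow> real)) \<times> 'a) measure" where
  "replica = density (Q \<Otimes>\<^sub>M P) (\<lambda>p. ennreal (exp (obs_expo K u (obs_of K u (fst p)) (snd p)) / obs_Z P K u (obs_of K u (fst p))))"

lemma dens_meas [measurable]:
  "(\<lambda>p. exp (obs_expo K u (obs_of K u (fst p)) (snd p)) / obs_Z P K u (obs_of K u (fst p))) \<in> borel_measurable (Q \<Otimes>\<^sub>M P)"
proof -
  have "(\<lambda>p. (obs_of K u (fst p), snd p)) \<in> measurable (Q \<Otimes>\<^sub>M P) (gaussK K \<Otimes>\<^sub>M P)" by measurable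
  from measurable_compose[OF this joint_expo_meas]
  have [measurable]: "(\<lambda>p. obs_expo K u (obs_of K u (fst p)) (snd p)) \<in> borel_measurable (Q \<Otimes>\<^sub>M P)" by simp
  show ?thesis by measurable
qed

text \<open>The Nishimori identity for a general prior, as an equality of joint laws.\<close>
lemma distr_replica:
  "distr replica (P \<Otimes>\<^sub>M gaussK K) (\<lambda>p. (snd p, obs_of K u (fst p)))
    = distr Q (P \<Otimes>\<^sub>M gaussK K) (\<lambda>\<omega>. (fst \<omega>, obs_of K u \<omega>))"
proof (rule measure_eqI)
  interpret GK: prob_space "gaussK K" by simp
  interpret PG: pair_prob_space P "gaussK K" ..
  interpret Q: prob_space Q by (rule prob_Q)
  fix A assume "A \<in> sets (distr replica (P \<Otimes>\<^sub>M gaussK K) (\<lambda>p. (snd p, obs_of K u (fst p))))"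
  then have A [measurable]: "A \<in> sets (P \<Otimes>\<^sub>M gaussK K)" by simp
  let ?h = "\<lambda>x y. indicator A (x, y) :: ennreal"
  let ?w = "\<lambda>y x. ennreal (exp (obs_expo K u y x))"
  define F where "F y = (\<integral>\<^sup>+x. ennreal (exp (obs_expo K u y x) / obs_Z P K u y) * ?h x y \<partial>P)" for y
  have e [measurable]: "(\<lambda>(y, x). obs_expo K u y x) \<in> borel_measurable (gaussK K \<Otimes>\<^sub>M P)"
    using joint_expo_meas by (simp add: split_beta')
  have e' [measurable]: "(\<lambda>(x, y). obs_expo K u y x) \<in> borel_measurable (P \<Otimes>\<^sub>M gaussK K)"
    using measurable_compose[OF measurable_pair_swap' joint_expo_meas] by (simp add: split_beta')
  have F [measurable]: "F \<in> borel_measurable (gaussK K)" unfolding F_def by measurable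
  have r [measurable]: "(\<lambda>p. (snd p, obs_of K u (fst p))) \<in> measurable (Q \<Otimes>\<^sub>M P) (P \<Otimes>\<^sub>M gaussK K)" by measurable
  have sh: "(\<integral>\<^sup>+z. g (obs_of K u (x, z)) \<partial>gaussK K) = (\<integral>\<^sup>+z. g z * ?w z x \<partial>gaussK K)"
    if g: "g \<in> borel_measurable (gaussK K)" for g x
    using nn_integral_gaussK_shift[OF K g, of "\<lambda>k. u k x"]
    by (simp add: obs_of_def obs_expo_def mult.commute)
  have wint: "(\<integral>\<^sup>+x. ?w y x \<partial>P) = ennreal (obs_Z P K u y)" for y
    unfolding obs_Z_def by (rule nn_integral_eq_integral[OF exp_expo_int]) simp
  have "emeasure (distr replica (P \<Otimes>\<^sub>M gaussK K) (\<lambda>p. (snd p, obs_of K u (fst p)))) A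
      = (\<integral>\<^sup>+p. ?h (snd p) (obs_of K u (fst p)) \<partial>replica)"
    by (subst nn_integral_indicator[symmetric], simp) (subst nn_integral_distr, auto simp: replica_def)
  also have "\<dots> = (\<integral>\<^sup>+p. ennreal (exp (obs_expo K u (obs_of K u (fst p)) (snd p)) / obs_Z P K u (obs_of K u (fst p)))
      * ?h (snd p) (obs_of K u (fst p)) \<partial>(Q \<Otimes>\<^sub>M P))"
    unfolding replica_def by (subst nn_integral_density) (auto intro: measurable_compose[OF r])
  also have "\<dots> = (\<integral>\<^sup>+\<omega>. F (obs_of K u \<omega>) \<partial>Q)"
    unfolding F_def by (subst nn_integral_fst[symmetric]) (auto intro: measurable_compose[OF r])
  also have "\<dots> = (\<integral>\<^sup>+x. \<integral>\<^sup>+z. F (obs_of K u (x, z)) \<partial>gaussK K \<partial>P)"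
    by (subst GK.nn_integral_fst[symmetric]) auto
  also have "\<dots> = (\<integral>\<^sup>+x. \<integral>\<^sup>+z. F z * ?w z x \<partial>gaussK K \<partial>P)"
    by (simp only: sh[OF F])
  also have "\<dots> = (\<integral>\<^sup>+z. \<integral>\<^sup>+x. F z * ?w z x \<partial>P \<partial>gaussK K)"
    by (rule PG.Fubini'[symmetric]) measurable
  \<comment> \<open>Integrating out the original signal produces \<open>Z\<close>, which cancels the
    normalisation of the posterior; the posterior sample takes the place of the signal.\<close>
  also have "\<dots> = (\<integral>\<^sup>+z. \<integral>\<^sup>+x. ?w z x * ?h x z \<partial>P \<partial>gaussK K)"
  proof (rule nn_integral_cong)
    fix z assume z: "z \<in> space (gaussK K)"
    have hm [measurable]: "(\<lambda>x. ?h x z) \<in> borel_measurable P" using z by measurable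
    have "(\<integral>\<^sup>+x. F z * ?w z x \<partial>P) = F z * ennreal (obs_Z P K u z)"
      by (subst nn_integral_cmult) (auto simp: wint)
    also have "\<dots> = (\<integral>\<^sup>+x. ennreal (exp (obs_expo K u z x) / obs_Z P K u z) * ?h x z * ennreal (obs_Z P K u z) \<partial>P)"
      unfolding F_def by (rule nn_integral_multc[symmetric]) measurable
    also have "\<dots> = (\<integral>\<^sup>+x. ?w z x * ?h x z \<partial>P)"
    proof (rule nn_integral_cong)
      fix x
      have "ennreal (exp (obs_expo K u z x) / obs_Z P K u z) * ennreal (obs_Z P K u z) = ?w z x"
        using Z_pos[of z] by (subst ennreal_mult[symmetric]) auto
      then show "ennreal (exp (obs_expo K u z x) / obs_Z P K u z) * ?h x z * ennreal (obs_Z P K u z) = ?w z x * ?h x z"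
        unfolding \<open>ennreal _ * ennreal (obs_Z P K u z) = ?w z x\<close>[symmetric] by (simp only: ac_simps)
    qed
    finally show "(\<integral>\<^sup>+x. F z * ?w z x \<partial>P) = (\<integral>\<^sup>+x. ?w z x * ?h x z \<partial>P)" .
  qed
  also have "\<dots> = (\<integral>\<^sup>+x. \<integral>\<^sup>+z. ?h x z * ?w z x \<partial>gaussK K \<partial>P)"
    by (subst PG.Fubini') (simp_all add: mult.commute)
  also have "\<dots> = (\<integral>\<^sup>+x. \<integral>\<^sup>+z. ?h x (obs_of K u (x, z)) \<partial>gaussK K \<partial>P)"
  proof (rule nn_integral_cong)
    fix x assume x: "x \<in> space P"
    then have "(\<lambda>y. ?h x y) \<in> borel_measurable (gaussK K)" by measurable
    from sh[OF this, of x] show "(\<integral>\<^sup>+z. ?h x z * ?w z x \<partial>gaussK K) = (\<integral>\<^sup>+z. ?h x (obs_of K u (x, z)) \<partial>gaussK K)" by simp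
  qed
  also have "\<dots> = (\<integral>\<^sup>+\<omega>. ?h (fst \<omega>) (obs_of K u \<omega>) \<partial>Q)"
    by (subst GK.nn_integral_fst[symmetric]) auto
  also have "\<dots> = emeasure (distr Q (P \<Otimes>\<^sub>M gaussK K) (\<lambda>\<omega>. (fst \<omega>, obs_of K u \<omega>))) A"
    by (subst nn_integral_indicator[symmetric], simp) (subst nn_integral_distr, auto)
  finally show "emeasure (distr replica (P \<Otimes>\<^sub>M gaussK K) (\<lambda>p. (snd p, obs_of K u (fst p)))) A
    = emeasure (distr Q (P \<Otimes>\<^sub>M gaussK K) (\<lambda>\<omega>. (fst \<omega>, obs_of K u \<omega>))) A" .
qed simp

lemma prob_P: "prob_space P" by unfold_locales

lemma sets_replica [measurable_cong]: "sets replica = sets (Q \<Otimes>\<^sub>M P)" by (simp add: replica_def)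

lemma
  assumes f: "f \<in> borel_measurable (P \<Otimes>\<^sub>M gaussK K)"
  shows integrable_replica_snd: "integrable replica (\<lambda>p. f (snd p, obs_of K u (fst p)) :: real)
      \<longleftrightarrow> integrable Q (\<lambda>\<omega>. f (fst \<omega>, obs_of K u \<omega>))"
    and integral_replica_snd: "(\<integral>p. f (snd p, obs_of K u (fst p)) \<partial>replica) = (\<integral>\<omega>. f (fst \<omega>, obs_of K u \<omega>) \<partial>Q)"
proof -
  have r: "(\<lambda>p. (snd p, obs_of K u (fst p))) \<in> measurable replica (P \<Otimes>\<^sub>M gaussK K)" by measurable
  have q: "(\<lambda>\<omega>. (fst \<omega>, obs_of K u \<omega>)) \<in> measurable Q (P \<Otimes>\<^sub>M gaussK K)" by measurable
  show "integrable replica (\<lambda>p. f (snd p, obs_of K u (fst p))) \<longleftrightarrow> integrable Q (\<lambda>\<omega>. f (fst \<omega>, obs_of K u \<omega>))"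
    using integrable_distr_eq[OF r f] integrable_distr_eq[OF q f] unfolding distr_replica by simp
  show "(\<integral>p. f (snd p, obs_of K u (fst p)) \<partial>replica) = (\<integral>\<omega>. f (fst \<omega>, obs_of K u \<omega>) \<partial>Q)"
    using integral_distr[OF r f] integral_distr[OF q f] unfolding distr_replica by simp
qed

lemma distr_replica_fst: "distr replica Q fst = Q"
proof (rule measure_eqI)
  fix A assume "A \<in> sets (distr replica Q fst)"
  then have A [measurable]: "A \<in> sets Q" by simp
  have "emeasure (distr replica Q fst) A = (\<integral>\<^sup>+p. indicator A (fst p) \<partial>replica)"
    by (subst nn_integral_indicator[symmetric], simp) (subst nn_integral_distr, auto simp: replica_def)
  also have "\<dots> = (\<integral>\<^sup>+p. ennreal (exp (obs_expo K u (obs_of K u (fst p)) (snd p)) / obs_Z P K u (obs_of K u (fst p)))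
      * indicator A (fst p) \<partial>(Q \<Otimes>\<^sub>M P))"
    unfolding replica_def by (subst nn_integral_density) auto
  also have "\<dots> = (\<integral>\<^sup>+\<omega>. \<integral>\<^sup>+x. ennreal (exp (obs_expo K u (obs_of K u \<omega>) x) / obs_Z P K u (obs_of K u \<omega>))
      * indicator A \<omega> \<partial>P \<partial>Q)"
    by (subst nn_integral_fst[symmetric]) auto
  also have "\<dots> = (\<integral>\<^sup>+\<omega>. indicator A \<omega> \<partial>Q)"
  proof (rule nn_integral_cong)
    fix \<omega>
    let ?y = "obs_of K u \<omega>"
    have "(\<integral>\<^sup>+x. ennreal (exp (obs_expo K u ?y x) / obs_Z P K u ?y) \<partial>P) = ennreal (\<integral>x. exp (obs_expo K u ?y x) / obs_Z P K u ?y \<partial>P)"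
      using exp_expo_int Z_pos[of ?y] by (intro nn_integral_eq_integral) (auto intro: less_imp_le)
    also have "(\<integral>x. exp (obs_expo K u ?y x) / obs_Z P K u ?y \<partial>P) = 1"
      using Z_pos[of ?y] by (simp add: obs_Z_def[symmetric])
    finally have 1: "(\<integral>\<^sup>+x. ennreal (exp (obs_expo K u ?y x) / obs_Z P K u ?y) \<partial>P) = 1" by simp
    have "(\<integral>\<^sup>+x. ennreal (exp (obs_expo K u ?y x) / obs_Z P K u ?y) * indicator A \<omega> \<partial>P)
        = (\<integral>\<^sup>+x. ennreal (exp (obs_expo K u ?y x) / obs_Z P K u ?y) \<partial>P) * indicator A \<omega>"
      by (rule nn_integral_multc) simp
    then show "(\<integral>\<^sup>+x. ennreal (exp (obs_expo K u ?y x) / obs_Z P K u ?y) * indicator A \<omega> \<partial>P) = indicator A \<omega>"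
      by (simp only: 1 mult_1_left)
  qed
  finally show "emeasure (distr replica Q fst) A = emeasure Q A" by simp
qed simp

lemma integrable_replica_fst:
  assumes f: "f \<in> borel_measurable Q"
  shows "integrable replica (\<lambda>p. f (fst p) :: real) \<longleftrightarrow> integrable Q f"
    and "(\<integral>p. f (fst p) \<partial>replica) = (\<integral>\<omega>. f \<omega> \<partial>Q)"
proof -
  have r: "fst \<in> measurable replica Q" by measurable
  show "integrable replica (\<lambda>p. f (fst p)) \<longleftrightarrow> integrable Q f" "(\<integral>p. f (fst p) \<partial>replica) = (\<integral>\<omega>. f \<omega> \<partial>Q)"
    using integrable_distr_eq[OF r f] integral_distr[OF r f] unfolding distr_replica_fst by auto
qed

text \<open>Jensen's inequality for the posterior of the channel \<open>u\<close>.\<close>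
lemma gibbs_variational:
  assumes v: "square_signal P K v"
    and D: "integrable replica (\<lambda>p. obs_expo K v (obs_of K v (fst p)) (snd p) - obs_expo K u (obs_of K u (fst p)) (snd p))"
  shows "(\<integral>p. obs_expo K v (obs_of K v (fst p)) (snd p) - obs_expo K u (obs_of K u (fst p)) (snd p) \<partial>replica)
    \<le> chan_free P K v - chan_free P K u"
proof -
  interpret v: square_signal P K v by (rule v)
  interpret Q: prob_space Q by (rule prob_Q)
  interpret QP: pair_prob_space Q P ..
  let ?q = "\<lambda>\<omega> x. exp (obs_expo K u (obs_of K u \<omega>) x) / obs_Z P K u (obs_of K u \<omega>)"
  let ?D = "\<lambda>\<omega> x. obs_expo K v (obs_of K v \<omega>) x - obs_expo K u (obs_of K u \<omega>) x"
  have Dm [measurable]: "(\<lambda>p. ?D (fst p) (snd p)) \<in> borel_measurable (Q \<Otimes>\<^sub>M P)"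
    using borel_measurable_integrable[OF D] by (simp cong: measurable_cong_sets add: sets_replica)
  have int: "integrable (Q \<Otimes>\<^sub>M P) (\<lambda>p. ?q (fst p) (snd p) * ?D (fst p) (snd p))"
    using D unfolding replica_def
    by (subst (asm) integrable_density) (auto intro!: AE_I2 divide_nonneg_nonneg less_imp_le[OF Z_pos])
  have "(\<integral>p. ?D (fst p) (snd p) \<partial>replica) = (\<integral>p. ?q (fst p) (snd p) * ?D (fst p) (snd p) \<partial>(Q \<Otimes>\<^sub>M P))"
    unfolding replica_def
    by (subst integral_density) (auto intro!: AE_I2 divide_nonneg_nonneg less_imp_le[OF Z_pos])
  also have "\<dots> = (\<integral>\<omega>. \<integral>x. ?q \<omega> x * ?D \<omega> x \<partial>P \<partial>Q)"
    using QP.integral_fst'[OF int] by simp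
  also have "\<dots> \<le> (\<integral>\<omega>. ln (obs_Z P K v (obs_of K v \<omega>)) - ln (obs_Z P K u (obs_of K u \<omega>)) \<partial>Q)"
  proof (rule integral_mono_AE)
    show "integrable Q (\<lambda>\<omega>. \<integral>x. ?q \<omega> x * ?D \<omega> x \<partial>P)"
      using QP.integrable_fst'[OF int] by simp
    show "integrable Q (\<lambda>\<omega>. ln (obs_Z P K v (obs_of K v \<omega>)) - ln (obs_Z P K u (obs_of K u \<omega>)))"
      using v.ln_Z_int ln_Z_int by (rule Bochner_Integration.integrable_diff)
    show "AE \<omega> in Q. (\<integral>x. ?q \<omega> x * ?D \<omega> x \<partial>P) \<le> ln (obs_Z P K v (obs_of K v \<omega>)) - ln (obs_Z P K u (obs_of K u \<omega>))"
      using QP.AE_integrable_fst'[OF int]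
    proof eventually_elim
      fix \<omega>
      assume "integrable P (\<lambda>x. ?q (fst (\<omega>, x)) (snd (\<omega>, x)) * ?D (fst (\<omega>, x)) (snd (\<omega>, x)))"
      then have i: "integrable P (\<lambda>x. ?q \<omega> x * ?D \<omega> x)" by simp
      define y y' where "y = obs_of K u \<omega>" and "y' = obs_of K v \<omega>"
      define q where "q x = ?q \<omega> x" for x
      define E where "E x = ?D \<omega> x" for x
      define c where "c = (\<integral>x. q x * E x \<partial>P)"
      have iq: "integrable P q" unfolding q_def using exp_expo_int by simp
      have q1: "(\<integral>x. q x \<partial>P) = 1" unfolding q_def using Z_pos[of y] by (simp add: y_def obs_Z_def[symmetric])
      have iqE: "integrable P (\<lambda>x. q x * E x)" using i unfolding q_def E_def .
      have "(\<integral>x. exp c * (q x * E x) + exp c * (1 - c) * q x \<partial>P) \<le> (\<integral>x. exp (obs_expo K v y' x) / obs_Z P K u y \<partial>P)"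
      proof (rule integral_mono)
        fix x
        have "exp c * (1 + (E x - c)) \<le> exp c * exp (E x - c)" by (intro mult_left_mono exp_ge_add_one_self) simp
        also have "\<dots> = exp (E x)" by (simp add: exp_add[symmetric])
        finally have "q x * (exp c * (1 + (E x - c))) \<le> q x * exp (E x)"
          unfolding q_def using Z_pos by (intro mult_left_mono divide_nonneg_nonneg) (auto intro: less_imp_le)
        also have "\<dots> = exp (obs_expo K v y' x) / obs_Z P K u y"
          unfolding q_def E_def y_def y'_def by (simp add: exp_diff)
        finally show "exp c * (q x * E x) + exp c * (1 - c) * q x \<le> exp (obs_expo K v y' x) / obs_Z P K u y"
          by (simp add: algebra_simps)
      qed (use iq iqE v.exp_expo_int in auto)
      moreover have "(\<integral>x. exp c * (q x * E x) + exp c * (1 - c) * q x \<partial>P) = exp c * c + exp c * (1 - c)"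
        using iq iqE q1 by (simp add: c_def)
      ultimately have "exp c \<le> obs_Z P K v y' / obs_Z P K u y"
        by (simp add: obs_Z_def[symmetric] algebra_simps)
      then have "c \<le> ln (obs_Z P K v y' / obs_Z P K u y)"
        using v.Z_pos[of y'] Z_pos[of y] by (simp add: ln_ge_iff)
      then show "(\<integral>x. ?q \<omega> x * ?D \<omega> x \<partial>P) \<le> ln (obs_Z P K v (obs_of K v \<omega>)) - ln (obs_Z P K u (obs_of K u \<omega>))"
        using v.Z_pos[of y'] Z_pos[of y] unfolding c_def q_def E_def y_def y'_def by (simp add: ln_div)
    qed
  qed
  also have "\<dots> = chan_free P K v - chan_free P K u"
    unfolding chan_free_def by (rule Bochner_Integration.integral_diff[OF v.ln_Z_int ln_Z_int])
  finally show ?thesis .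
qed

text \<open>Inserts into \<open>gibbs_variational\<close> the difference of the exponents, split
  into a part that sees signal and noise only through the observation, and a cross term. By the
  Nishimori identity the first part has as mean minus half the squared distance of the signals. The
  cross term pairs \<open>v - u\<close> at the signal with \<open>v\<close> at the posterior sample;
  signal and sample both have the law of the prior, so Young's inequality with parameter
  \<open>t\<close> bounds it by second moments.\<close>

lemma chan_free_compare:
  assumes v: "square_signal P K v" and t: "t > 0"
  shows "chan_free P K v - chan_free P K u \<ge>
    - ((1 + t) / 2 * (\<Sum>k\<in>K. \<integral>x. (v k x - u k x)\<^sup>2 \<partial>P)) - (\<Sum>k\<in>K. \<integral>x. (v k x)\<^sup>2 \<partial>P) / (2 * t)"
proof -
  interpret v: square_signal P K v by (rule v)
  interpret GK: prob_space "gaussK K" by simp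
  interpret PG: pair_prob_space P "gaussK K" ..
  define d where "d k x = v k x - u k x" for k x
  have dm [measurable]: "d k \<in> borel_measurable P" if "k \<in> K" for k
    unfolding d_def[abs_def] using u_meas[OF that] v.u_meas[OF that] by simp
  have dsq: "integrable P (\<lambda>x. (d k x)\<^sup>2)" if k: "k \<in> K" for k
  proof -
    have "(d k x)\<^sup>2 = (v k x)\<^sup>2 - 2 * (v k x * u k x) + (u k x)\<^sup>2" for x
      by (simp add: d_def power2_eq_square algebra_simps)
    then show ?thesis
      using u_sq[OF k] v.u_sq[OF k] integrable_mult_of_sq[OF v.u_meas[OF k] u_meas[OF k] v.u_sq[OF k] u_sq[OF k]] by simp
  qed
  have ufst: "(\<lambda>\<omega>. f (fst \<omega>)) \<in> borel_measurable Q" if "f \<in> borel_measurable P" for f :: "'a \<Rightarrow> real"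
    by (rule measurable_compose[OF measurable_fst that])
  define h where "h k \<omega> = snd \<omega> k * d k (fst \<omega>) - (v k (fst \<omega>))\<^sup>2 / 2 + (u k (fst \<omega>))\<^sup>2 / 2" for k \<omega>
  have hm: "h k \<in> borel_measurable (P \<Otimes>\<^sub>M gaussK K)" if "k \<in> K" for k
    unfolding h_def[abs_def]
    using ufst[OF dm[OF that]] ufst[OF u_meas[OF that]] ufst[OF v.u_meas[OF that]]
      measurable_compose[OF measurable_snd coord_meas[OF that], of P] by simp
  \<comment> \<open>With the true signal in the first slot the products complete to a square, and
    the noise term has mean zero.\<close>
  have h: "integrable Q (\<lambda>\<omega>. h k (fst \<omega>, obs_of K u \<omega>)) \<and>
      (\<integral>\<omega>. h k (fst \<omega>, obs_of K u \<omega>) \<partial>Q) = - (\<integral>x. (d k x)\<^sup>2 \<partial>P) / 2" if k: "k \<in> K" for k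
  proof -
    have eq: "h k (fst \<omega>, obs_of K u \<omega>) = snd \<omega> k * d k (fst \<omega>) - (d k (fst \<omega>))\<^sup>2 / 2" for \<omega>
      unfolding h_def using k by (simp add: obs_of_def d_def power2_eq_square field_simps)
    have d2: "integrable Q (\<lambda>\<omega>. (d k (fst \<omega>))\<^sup>2)" "(\<integral>\<omega>. (d k (fst \<omega>))\<^sup>2 \<partial>Q) = (\<integral>x. (d k x)\<^sup>2 \<partial>P)"
      using integrable_pair_fst[OF prob_P prob_space_gaussK, of "\<lambda>x. (d k x)\<^sup>2" K]
        integral_pair_fst[OF prob_P prob_space_gaussK, of "\<lambda>x. (d k x)\<^sup>2" K] dsq[OF k] dm[OF k] by auto
    have z2: "integrable Q (\<lambda>\<omega>. (snd \<omega> k)\<^sup>2)"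
      using integrable_pair_snd[OF prob_P prob_space_gaussK, of "\<lambda>z. (z k)\<^sup>2" K] coord_sq_int[OF k] coord_meas[OF k] by simp
    have zd: "integrable Q (\<lambda>\<omega>. snd \<omega> k * d k (fst \<omega>))"
      by (rule integrable_mult_of_sq[OF _ ufst[OF dm[OF k]] z2 d2(1)])
        (rule measurable_compose[OF measurable_snd coord_meas[OF k]])
    have "(\<integral>\<omega>. snd \<omega> k * d k (fst \<omega>) \<partial>Q) = (\<integral>x. \<integral>z. z k * d k x \<partial>gaussK K \<partial>P)"
      using PG.integral_fst'[OF zd] by simp
    also have "\<dots> = 0" using coord_mean[OF k] by simp
    finally show ?thesis unfolding eq using zd d2 by simp
  qed
  have hr: "integrable replica (\<lambda>p. h k (snd p, obs_of K u (fst p)))"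
      "(\<integral>p. h k (snd p, obs_of K u (fst p)) \<partial>replica) = - (\<integral>x. (d k x)\<^sup>2 \<partial>P) / 2" if k: "k \<in> K" for k
    using integrable_replica_snd[OF hm[OF k]] integral_replica_snd[OF hm[OF k]] h[OF k] by auto
  have d2r: "integrable replica (\<lambda>p. (d k (fst (fst p)))\<^sup>2)" "(\<integral>p. (d k (fst (fst p)))\<^sup>2 \<partial>replica) = (\<integral>x. (d k x)\<^sup>2 \<partial>P)"
    if k: "k \<in> K" for k
    using integrable_replica_fst[of "\<lambda>\<omega>. (d k (fst \<omega>))\<^sup>2"] ufst[of "\<lambda>x. (d k x)\<^sup>2"]
      integrable_pair_fst[OF prob_P prob_space_gaussK, of "\<lambda>x. (d k x)\<^sup>2" K]
      integral_pair_fst[OF prob_P prob_space_gaussK, of "\<lambda>x. (d k x)\<^sup>2" K] dsq[OF k] dm[OF k] by auto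
  have v2r: "integrable replica (\<lambda>p. (v k (snd p))\<^sup>2)" "(\<integral>p. (v k (snd p))\<^sup>2 \<partial>replica) = (\<integral>x. (v k x)\<^sup>2 \<partial>P)"
    if k: "k \<in> K" for k
    using integrable_replica_snd[of "\<lambda>q. (v k (fst q))\<^sup>2"] integral_replica_snd[of "\<lambda>q. (v k (fst q))\<^sup>2"]
      ufst[of "\<lambda>x. (v k x)\<^sup>2"] integrable_pair_fst[OF prob_P prob_space_gaussK, of "\<lambda>x. (v k x)\<^sup>2" K]
      integral_pair_fst[OF prob_P prob_space_gaussK, of "\<lambda>x. (v k x)\<^sup>2" K] v.u_sq[OF k] v.u_meas[OF k] by auto
  have dvr: "integrable replica (\<lambda>p. d k (fst (fst p)) * v k (snd p))" if k: "k \<in> K" for k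
  proof (rule integrable_mult_of_sq[OF _ _ d2r(1)[OF k] v2r(1)[OF k]])
    show "(\<lambda>p. d k (fst (fst p))) \<in> borel_measurable replica"
      using measurable_compose[OF measurable_fst ufst[OF dm[OF k]], of P] by (simp cong: measurable_cong_sets add: sets_replica)
    show "(\<lambda>p. v k (snd p)) \<in> borel_measurable replica"
      using measurable_compose[OF measurable_snd v.u_meas[OF k], of Q] by (simp cong: measurable_cong_sets add: sets_replica)
  qed
  have D: "obs_expo K v (obs_of K v \<omega>) x - obs_expo K u (obs_of K u \<omega>) x
      = (\<Sum>k\<in>K. h k (x, obs_of K u \<omega>) + d k (fst \<omega>) * v k x)" for \<omega> x
    unfolding obs_expo_def sum_subtractf[symmetric]
    by (intro sum.cong refl) (simp add: h_def d_def obs_of_def algebra_simps)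
  have lower: "- (t / 2 * (\<integral>x. (d k x)\<^sup>2 \<partial>P)) - (\<integral>x. (v k x)\<^sup>2 \<partial>P) / (2 * t) \<le> (\<integral>p. d k (fst (fst p)) * v k (snd p) \<partial>replica)"
    if k: "k \<in> K" for k
  proof -
    have "(\<integral>p. - (t / 2 * (d k (fst (fst p)))\<^sup>2) - (v k (snd p))\<^sup>2 / (2 * t) \<partial>replica) \<le> (\<integral>p. d k (fst (fst p)) * v k (snd p) \<partial>replica)"
    proof (rule integral_mono[OF _ dvr[OF k]])
      show "integrable replica (\<lambda>p. - (t / 2 * (d k (fst (fst p)))\<^sup>2) - (v k (snd p))\<^sup>2 / (2 * t))"
        using d2r(1)[OF k] v2r(1)[OF k] by simp
      have "- (t / 2 * a\<^sup>2) - b\<^sup>2 / (2 * t) \<le> a * b" for a b :: real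
      proof -
        have "0 \<le> (t * a + b)\<^sup>2 / (2 * t)" using t by simp
        also have "\<dots> = t / 2 * a\<^sup>2 + a * b + b\<^sup>2 / (2 * t)" using t by (simp add: power2_eq_square field_simps)
        finally show ?thesis by linarith
      qed
      then show "- (t / 2 * (d k (fst (fst p)))\<^sup>2) - (v k (snd p))\<^sup>2 / (2 * t) \<le> d k (fst (fst p)) * v k (snd p)" for p .
    qed
    then show ?thesis using d2r[OF k] v2r[OF k] by simp
  qed
  have hd: "integrable replica (\<lambda>p. h k (snd p, obs_of K u (fst p)) + d k (fst (fst p)) * v k (snd p))" if "k \<in> K" for k
    by (rule Bochner_Integration.integrable_add[OF hr(1)[OF that] dvr[OF that]])
  have "- ((1 + t) / 2 * (\<Sum>k\<in>K. \<integral>x. (d k x)\<^sup>2 \<partial>P)) - (\<Sum>k\<in>K. \<integral>x. (v k x)\<^sup>2 \<partial>P) / (2 * t)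
      = (\<Sum>k\<in>K. - (\<integral>x. (d k x)\<^sup>2 \<partial>P) / 2 + (- (t / 2 * (\<integral>x. (d k x)\<^sup>2 \<partial>P)) - (\<integral>x. (v k x)\<^sup>2 \<partial>P) / (2 * t)))"
    unfolding sum_distrib_left sum_divide_distrib sum_negf[symmetric] sum_subtractf[symmetric]
    by (intro sum.cong refl) (simp add: field_simps)
  also have "\<dots> \<le> (\<Sum>k\<in>K. (\<integral>p. h k (snd p, obs_of K u (fst p)) + d k (fst (fst p)) * v k (snd p) \<partial>replica))"
    using lower by (intro sum_mono) (simp add: Bochner_Integration.integral_add[OF hr(1) dvr] hr(2))
  also have "\<dots> = (\<integral>p. obs_expo K v (obs_of K v (fst p)) (snd p) - obs_expo K u (obs_of K u (fst p)) (snd p) \<partial>replica)"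
    unfolding D by (rule Bochner_Integration.integral_sum[symmetric]) (rule hd)
  also have "\<dots> \<le> chan_free P K v - chan_free P K u"
    by (rule gibbs_variational[OF v]) (unfold D, rule Bochner_Integration.integrable_sum, rule hd)
  finally show ?thesis unfolding d_def .
qed

end

section \<open>Finite alphabets as discretised signals\<close>

context finite_channel
begin

lemma ln_Z_lipschitz:
  assumes "\<And>x. x \<in> \<Omega> \<Longrightarrow> \<bar>expo s y x - expo s y' x\<bar> \<le> D"
  shows "\<bar>ln (Z s y) - ln (Z s y')\<bar> \<le> D"
proof -
  have le: "ln (Z s a) \<le> ln (Z s b) + D" if "\<And>x. x \<in> \<Omega> \<Longrightarrow> \<bar>expo s a x - expo s b x\<bar> \<le> D" for a b
  proof -
    have "Z s a \<le> exp D * Z s b" unfolding wsum_def sum_distrib_left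
    proof (rule sum_mono)
      fix x assume x: "x \<in> \<Omega>"
      have "exp (expo s a x) \<le> exp D * exp (expo s b x)"
        using that[OF x] unfolding exp_add[symmetric] by (simp add: abs_le_iff)
      from mult_left_mono[OF this w_nonneg[OF x]]
      show "w x * exp (expo s a x) * 1 \<le> exp D * (w x * exp (expo s b x) * 1)" by (simp add: mult_ac)
    qed
    then have "ln (Z s a) \<le> ln (exp D * Z s b)"
      using Z_pos[of s a] Z_pos[of s b] by (subst ln_le_cancel_iff) auto
    then show ?thesis using Z_pos[of s b] by (simp add: ln_mult)
  qed
  have "ln (Z s y) \<le> ln (Z s y') + D" by (rule le[OF assms])
  moreover have "ln (Z s y') \<le> ln (Z s y) + D" by (rule le) (use assms in \<open>simp add: abs_minus_commute\<close>)
  ultimately show ?thesis by linarith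
qed

lemma gibbs_square_le: "(gibbs s z f)\<^sup>2 \<le> gibbs s z (\<lambda>x. (f x)\<^sup>2)"
proof -
  have "gibbs s z (\<lambda>x. 0) \<le> gibbs s z (\<lambda>x. (f x - gibbs s z f) * (f x - gibbs s z f))"
    by (rule gibbs_mono) simp
  then show ?thesis unfolding cov_eq[symmetric] cov_def by (simp add: power2_eq_square)
qed

lemma info_le_second_moment:
  assumes s: "\<And>k. k \<in> K \<Longrightarrow> s k \<ge> 0"
  shows "info s f \<le> (\<Sum>x\<in>\<Omega>. w x * (f x)\<^sup>2)"
proof -
  have "info s f \<le> (\<integral>z. wsum s z (\<lambda>x. (f x)\<^sup>2) \<partial>gaussK K)"
    unfolding info_def wsum_eq_gibbs[of s _ "\<lambda>x. (f x)\<^sup>2"]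
  proof (rule integral_mono)
    have t: "tame K (\<lambda>z. Z s z)" by (rule tame_wsum[OF s tame_const])
    show "integrable (gaussK K) (\<lambda>z. Z s z * (gibbs s z f)\<^sup>2)"
      unfolding power2_eq_square by (rule tame_integrable[OF finite_K tame_mult[OF t tame_mult[OF tame_gibbs tame_gibbs]]])
    show "integrable (gaussK K) (\<lambda>z. Z s z * gibbs s z (\<lambda>x. (f x)\<^sup>2))"
      by (rule tame_integrable[OF finite_K tame_mult[OF t tame_gibbs]])
    show "Z s z * (gibbs s z f)\<^sup>2 \<le> Z s z * gibbs s z (\<lambda>x. (f x)\<^sup>2)" for z
      using Z_pos[of s z] by (intro mult_left_mono gibbs_square_le) simp
  qed
  also have "\<dots> = planted s (\<lambda>x z. (f x)\<^sup>2)" by (rule planted_eq[OF s tame_const, symmetric])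
  also have "\<dots> = (\<Sum>x\<in>\<Omega>. w x * (f x)\<^sup>2)"
    unfolding planted_def by (simp add: prob_space.prob_space)
  finally show ?thesis .
qed

lemma integral_Z:
  assumes s: "\<And>k. k \<in> K \<Longrightarrow> s k \<ge> 0"
  shows "(\<integral>z. Z s z \<partial>gaussK K) = 1"
proof -
  have "(\<integral>z. Z s z \<partial>gaussK K) = planted s (\<lambda>x z. 1)" by (rule planted_eq[OF s tame_const, symmetric])
  also have "\<dots> = 1" unfolding planted_def by (simp add: prob_space.prob_space sum_w)
  finally show ?thesis .
qed

lemma
  assumes P: "prob_space P" and \<tau>: "\<tau> \<in> measurable P (count_space \<Omega>)"
    and w\<tau>: "\<And>x. x \<in> \<Omega> \<Longrightarrow> w x = measure P (\<tau> -` {x} \<inter> space P)"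
  shows integral_discrete: "(\<integral>X. g (\<tau> X) \<partial>P) = (\<Sum>x\<in>\<Omega>. w x * g x)"
    and integrable_discrete: "integrable P (\<lambda>X. g (\<tau> X) :: real)"
proof -
  interpret P: prob_space P by fact
  have S: "\<tau> -` {x} \<inter> space P \<in> sets P" if "x \<in> \<Omega>" for x
    by (rule measurable_sets[OF \<tau>]) (use that in auto)
  have eq: "g (\<tau> X) = (\<Sum>x\<in>\<Omega>. indicator (\<tau> -` {x} \<inter> space P) X * g x)" if X: "X \<in> space P" for X
  proof -
    have "\<tau> X \<in> \<Omega>" using measurable_space[OF \<tau> X] by simp
    then have "(\<Sum>x\<in>\<Omega>. indicator (\<tau> -` {x} \<inter> space P) X * g x) = (\<Sum>x\<in>\<Omega>. if x = \<tau> X then g x else 0)"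
      using X by (intro sum.cong) (auto simp: indicator_def)
    then show ?thesis using \<open>\<tau> X \<in> \<Omega>\<close> finite_\<Omega> by simp
  qed
  have i: "integrable P (\<lambda>X. indicator (\<tau> -` {x} \<inter> space P) X * g x)" if "x \<in> \<Omega>" for x
    using S[OF that] by (intro integrable_mult_left integrable_real_indicator) (auto simp: P.emeasure_eq_measure)
  have "integrable P (\<lambda>X. \<Sum>x\<in>\<Omega>. indicator (\<tau> -` {x} \<inter> space P) X * g x)"
    by (rule Bochner_Integration.integrable_sum[OF i])
  moreover have "integrable P (\<lambda>X. g (\<tau> X))
      = integrable P (\<lambda>X. \<Sum>x\<in>\<Omega>. indicator (\<tau> -` {x} \<inter> space P) X * g x)"
    by (rule Bochner_Integration.integrable_cong[OF refl]) (rule eq)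
  ultimately show "integrable P (\<lambda>X. g (\<tau> X))" by (simp only:)
  have "(\<integral>X. g (\<tau> X) \<partial>P) = (\<integral>X. (\<Sum>x\<in>\<Omega>. indicator (\<tau> -` {x} \<inter> space P) X * g x) \<partial>P)"
    by (rule Bochner_Integration.integral_cong[OF refl eq])
  also have "\<dots> = (\<Sum>x\<in>\<Omega>. \<integral>X. indicator (\<tau> -` {x} \<inter> space P) X * g x \<partial>P)"
    by (rule Bochner_Integration.integral_sum[OF i])
  also have "\<dots> = (\<Sum>x\<in>\<Omega>. w x * g x)"
    using S by (intro sum.cong refl) (simp add: w\<tau>)
  finally show "(\<integral>X. g (\<tau> X) \<partial>P) = (\<Sum>x\<in>\<Omega>. w x * g x)" .
qed

lemma square_signal_discrete:
  assumes P: "prob_space P" and \<tau>: "\<tau> \<in> measurable P (count_space \<Omega>)"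
    and w\<tau>: "\<And>x. x \<in> \<Omega> \<Longrightarrow> w x = measure P (\<tau> -` {x} \<inter> space P)"
  shows "square_signal P K (\<lambda>k X. sqrt (s k) * u k (\<tau> X))"
proof (intro square_signal.intro square_signal_axioms.intro P finite_K)
  show "(\<lambda>X. sqrt (s k) * u k (\<tau> X)) \<in> borel_measurable P" for k
    using borel_measurable_integrable[OF integrable_discrete[OF P \<tau> w\<tau>, of "\<lambda>x. sqrt (s k) * u k x"]] .
  show "integrable P (\<lambda>X. (sqrt (s k) * u k (\<tau> X))\<^sup>2)" for k
    by (rule integrable_discrete[OF P \<tau> w\<tau>, of "\<lambda>x. (sqrt (s k) * u k x)\<^sup>2"])
qed

text \<open>Lets the estimates for square-integrable signals compare a discretised model with the
  original one, on the probability space of the latter.\<close>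

lemma free_energy_eq_chan_free:
  assumes P: "prob_space P" and \<tau>: "\<tau> \<in> measurable P (count_space \<Omega>)"
    and w\<tau>: "\<And>x. x \<in> \<Omega> \<Longrightarrow> w x = measure P (\<tau> -` {x} \<inter> space P)"
    and s: "\<And>k. k \<in> K \<Longrightarrow> s k \<ge> 0"
  shows "chan_free P K (\<lambda>k X. sqrt (s k) * u k (\<tau> X)) = free_energy s"
proof -
  let ?u = "\<lambda>k X. sqrt (s k) * u k (\<tau> X)"
  interpret P: prob_space P by fact
  interpret GK: prob_space "gaussK K" by simp
  interpret PG: pair_prob_space P "gaussK K" ..
  interpret S: square_signal P K ?u by (rule square_signal_discrete[OF P \<tau> w\<tau>])
  have Z: "obs_Z P K ?u y = Z s y" for y
  proof -
    have "obs_expo K ?u y X = expo s y (\<tau> X)" for X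
      unfolding obs_expo_def expo_def using s by (intro sum.cong refl) (simp add: power_mult_distrib mult_ac)
    then have "obs_Z P K ?u y = (\<Sum>x\<in>\<Omega>. w x * exp (expo s y x))"
      unfolding obs_Z_def using integral_discrete[OF P \<tau> w\<tau>, of "\<lambda>x. exp (expo s y x)"] by simp
    then show ?thesis unfolding wsum_def by simp
  qed
  have o: "obs_of K ?u (X, z) = shift s (\<tau> X) z" for X z
    unfolding obs_of_def shift_def by simp
  have "chan_free P K ?u = (\<integral>X. \<integral>z. ln (obs_Z P K ?u (obs_of K ?u (X, z))) \<partial>gaussK K \<partial>P)"
    unfolding chan_free_def using PG.integral_fst'[OF S.ln_Z_int] by simp
  also have "\<dots> = (\<integral>X. \<integral>z. ln (Z s (shift s (\<tau> X) z)) \<partial>gaussK K \<partial>P)"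
    unfolding Z o ..
  also have "\<dots> = free_energy s"
    unfolding free_energy_def planted_shift
    by (rule integral_discrete[OF P \<tau> w\<tau>, of "\<lambda>x. \<integral>z. ln (Z s (shift s x z)) \<partial>gaussK K"])
  finally show ?thesis .
qed

end

text \<open>Convexity of the power: the gap for \<open>Suc p\<close> is \<open>x\<close> times the
  gap for \<open>p\<close> plus \<open>p * y ^ (p - 1) * (x - y)\<^sup>2\<close>.\<close>

lemma power_tangent:
  fixes x y :: real
  assumes "x \<ge> 0" "y \<ge> 0"
  shows "y ^ p + real p * y ^ (p - 1) * (x - y) \<le> x ^ p"
proof (induction p)
  case (Suc p)
  have "x * (y ^ p + real p * y ^ (p - 1) * (x - y)) \<le> x * x ^ p"
    using Suc.IH assms by (intro mult_left_mono) auto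
  moreover have "x * (y ^ p + real p * y ^ (p - 1) * (x - y)) - (y ^ Suc p + real (Suc p) * y ^ p * (x - y))
      = real p * y ^ (p - 1) * (x - y)\<^sup>2"
    by (cases p) (simp_all add: power2_eq_square algebra_simps)
  moreover have "real p * y ^ (p - 1) * (x - y)\<^sup>2 \<ge> 0" using assms by simp
  ultimately show ?case by simp
qed simp

text \<open>Free energy of a scalar channel with signal-to-noise ratio \<open>h\<close> and signal
  \<open>f x\<close>. Discretising the prior means changing \<open>f\<close> while the law
  \<open>PX\<close> stays, so that both versions share one probability space.\<close>

definition psi :: "real measure \<Rightarrow> (real \<Rightarrow> real) \<Rightarrow> real \<Rightarrow> real" where
  "psi PX f h = (\<integral>xz. ln (\<integral>x. exp (sqrt h * snd xz * f x + h * f x * f (fst xz) - h / 2 * (f x)\<^sup>2) \<partial>PX)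
      \<partial>(PX \<Otimes>\<^sub>M ngauss))"

lemma phi_RS_eq_psi:
  "phi_RS PX p \<Delta> m = psi PX (\<lambda>x. x) (m ^ (p - 1) / \<Delta>) - (real p - 1) / (2 * real p * \<Delta>) * m ^ p"
  unfolding phi_RS_def psi_def ngauss_def by (simp add: mult.commute)

lemma psi_eq_chan_free:
  assumes PX: "prob_space PX" and f: "f \<in> borel_measurable PX" and f2: "integrable PX (\<lambda>x. (f x)\<^sup>2)"
    and h: "h \<ge> 0"
  shows "psi PX f h = chan_free PX {()} (\<lambda>_ x. sqrt h * f x)"
proof -
  let ?u = "\<lambda>(_::unit) x. sqrt h * f x"
  interpret P: prob_space PX by fact
  interpret S: square_signal PX "{()}" ?u
    by (intro square_signal.intro square_signal_axioms.intro PX) (use f f2 in \<open>auto simp: power_mult_distrib\<close>)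
  interpret GK: prob_space "gaussK {()}" by simp
  interpret NG: prob_space ngauss by simp
  interpret PG: pair_prob_space PX "gaussK {()}" ..
  interpret PN: pair_prob_space PX ngauss ..
  define g where "g x z = ln (\<integral>y. exp (sqrt h * z * f y + h * f y * f x - h / 2 * (f y)\<^sup>2) \<partial>PX)" for x z
  have [measurable]: "f \<in> borel_measurable PX" by (rule f)
  have gm [measurable]: "(\<lambda>(x, z). g x z) \<in> borel_measurable (PX \<Otimes>\<^sub>M ngauss)"
    unfolding g_def by measurable
  have eq: "ln (obs_Z PX {()} ?u (obs_of {()} ?u \<omega>)) = g (fst \<omega>) (snd \<omega> ())" for \<omega>
  proof -
    have "obs_expo {()} ?u (obs_of {()} ?u \<omega>) y = sqrt h * snd \<omega> () * f y + h * f y * f (fst \<omega>) - h / 2 * (f y)\<^sup>2" for y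
    proof -
      have "sqrt h * f (fst \<omega>) * (sqrt h * f y) = (sqrt h * sqrt h) * f y * f (fst \<omega>)" by (simp only: mult_ac)
      also have "\<dots> = h * f y * f (fst \<omega>)" using h by simp
      finally have 1: "sqrt h * f (fst \<omega>) * (sqrt h * f y) = h * f y * f (fst \<omega>)" .
      have 2: "(sqrt h * f y)\<^sup>2 = h * (f y)\<^sup>2" using h by (simp add: power_mult_distrib)
      have "obs_expo {()} ?u (obs_of {()} ?u \<omega>) y
          = (snd \<omega> () + sqrt h * f (fst \<omega>)) * (sqrt h * f y) - (sqrt h * f y)\<^sup>2 / 2"
        unfolding obs_expo_def obs_of_def by simp
      then show ?thesis unfolding distrib_right 1 2 by simp
    qed
    then show ?thesis unfolding obs_Z_def g_def by simp
  qed
  have map: "(\<lambda>\<omega>. (fst \<omega>, snd \<omega> ())) \<in> measurable (PX \<Otimes>\<^sub>M gaussK {()}) (PX \<Otimes>\<^sub>M ngauss)"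
    unfolding gaussK_def by measurable
  have d: "distr (PX \<Otimes>\<^sub>M gaussK {()}) (PX \<Otimes>\<^sub>M ngauss) (\<lambda>\<omega>. (fst \<omega>, snd \<omega> ())) = PX \<Otimes>\<^sub>M ngauss"
  proof -
    have dn: "distr (gaussK {()}) ngauss (\<lambda>z. z ()) = ngauss"
      unfolding gaussK_def by (rule distr_PiM_component) auto
    have "distr PX PX id \<Otimes>\<^sub>M distr (gaussK {()}) ngauss (\<lambda>z. z ()) = distr (PX \<Otimes>\<^sub>M gaussK {()}) (PX \<Otimes>\<^sub>M ngauss) (\<lambda>(x, y). (id x, y ()))"
    proof (rule pair_measure_distr)
      show "sigma_finite_measure (distr (gaussK {()}) ngauss (\<lambda>z. z ()))"
        unfolding dn by (simp add: prob_space_imp_sigma_finite)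
    qed (auto simp: gaussK_def)
    moreover have "distr PX PX id = PX" by (simp add: distr_id[unfolded id_def] id_def)
    ultimately show ?thesis by (simp add: split_beta' dn)
  qed
  have "psi PX f h = (\<integral>\<omega>. g (fst \<omega>) (snd \<omega>) \<partial>(PX \<Otimes>\<^sub>M ngauss))" unfolding psi_def g_def ..
  also have "\<dots> = (\<integral>\<omega>. g (fst \<omega>) (snd \<omega> ()) \<partial>(PX \<Otimes>\<^sub>M gaussK {()}))"
    by (subst d[symmetric], subst integral_distr[OF map]) (use gm in \<open>auto simp: split_beta'\<close>)
  also have "\<dots> = chan_free PX {()} ?u" unfolding chan_free_def eq ..
  finally show ?thesis .
qed

section \<open>The spiked tensor model for a finitely valued prior\<close>

text \<open>The square of \<open>coef p N\<close>.\<close>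
definition coef2 :: "nat \<Rightarrow> nat \<Rightarrow> real" where
  "coef2 p N = fact (p - 1) / real N ^ (p - 1)"

text \<open>\<open>coef2 p N\<close> equals \<open>fact p / (p * N ^ (p - 1))\<close>, and
  \<open>fact p * elem_sym p A a\<close> differs from the power of the sum by a multiple of
  \<open>N ^ (p - 1)\<close>. The prefactor makes the error bounded in \<open>N\<close>, while the
  main term is of order \<open>N\<close>.\<close>

lemma coef2_elem_sym_approx:
  fixes a :: "'i \<Rightarrow> real"
  assumes A: "finite A" "card A = N" and N: "N \<ge> 1" and p: "p \<ge> 1" and a: "\<And>i. i \<in> A \<Longrightarrow> \<bar>a i\<bar> \<le> c"
  shows "\<bar>coef2 p N * elem_sym p A a - real N / real p * ((\<Sum>i\<in>A. a i) / real N) ^ p\<bar> \<le> real p * c ^ p"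
proof -
  obtain i where "i \<in> A" using A N by fastforce
  then have c: "c \<ge> 0" using a[of i] by simp
  have Np: "real N ^ (p - 1) > 0" using N by simp
  have 1: "coef2 p N * elem_sym p A a = (fact p * elem_sym p A a) / (real p * real N ^ (p - 1))"
  proof -
    have "fact p = real p * (fact (p - 1) :: real)" using p by (simp add: fact_reduce)
    then show ?thesis unfolding coef2_def using p Np by simp
  qed
  have 2: "real N / real p * ((\<Sum>i\<in>A. a i) / real N) ^ p = (\<Sum>i\<in>A. a i) ^ p / (real p * real N ^ (p - 1))"
  proof -
    have "real N ^ p = real N * real N ^ (p - 1)" using p by (cases p) auto
    then show ?thesis using p N by (simp add: power_divide)
  qed
  have "\<bar>fact p * elem_sym p A a - (\<Sum>i\<in>A. a i) ^ p\<bar> \<le> c ^ p * (real N ^ p - fact p * real (N choose p))"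
    using elem_sym_approx[OF A(1) a, where p = p] A(2) by simp
  also have "\<dots> \<le> c ^ p * ((real p)\<^sup>2 * real N ^ (p - 1))"
    using c by (intro mult_left_mono power_minus_falling_le) auto
  finally have "\<bar>fact p * elem_sym p A a - (\<Sum>i\<in>A. a i) ^ p\<bar> / (real p * real N ^ (p - 1))
      \<le> c ^ p * ((real p)\<^sup>2 * real N ^ (p - 1)) / (real p * real N ^ (p - 1))"
    using p Np by (intro divide_right_mono) auto
  also have "\<dots> = real p * c ^ p" using p N by (simp add: power2_eq_square)
  finally show ?thesis unfolding 1 2 diff_divide_distrib[symmetric] abs_divide using p Np by simp
qed

text \<open>The signal-to-noise ratios of all tensor entries add up to at most
  \<open>N / \<Delta>\<close>; this keeps estimates summed over the entries proportional to
  \<open>N\<close>.\<close>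

lemma coef2_choose_le:
  assumes "N \<ge> 1" "p \<ge> 1" shows "coef2 p N * real (N choose p) \<le> real N"
proof -
  have "fact (p - 1) * real (N choose p) \<le> fact p * real (N choose p)"
    by (intro mult_right_mono) (auto intro: fact_mono)
  also have "\<dots> \<le> real N ^ p"
  proof -
    have "real ((N choose p) * fact p) \<le> real (N ^ p)"
      by (simp only: of_nat_le_iff binomial_fact_pow)
    then show ?thesis by (simp add: mult.commute)
  qed
  also have "\<dots> = real N * real N ^ (p - 1)" using assms by (cases p) auto
  finally show ?thesis using assms unfolding coef2_def by (simp add: divide_le_eq)
qed

text \<open>The prior is the law of \<open>T\<close> under \<open>PX\<close>.  Observations are indexed by sets: a \<open>p\<close>-element set carries the
tensor entry with weight \<open>t\<close>, and the singleton \<open>{i}\<close> the side observation of the \<open>i\<close>-th coordinate with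
signal-to-noise ratio \<open>h\<close>; the two families are disjoint because \<open>p \<ge> 2\<close>.\<close>
locale spiked = prob_space PX for PX :: "real measure" +
  fixes T :: "real \<Rightarrow> real" and V :: "real set" and C \<Delta> :: real and p N :: nat
  assumes sets_PX [measurable_cong]: "sets PX = sets borel" and T_meas [measurable]: "T \<in> borel_measurable borel"
    and finite_V: "finite V" and T_V: "\<And>x. T x \<in> V" and V_C: "\<And>v. v \<in> V \<Longrightarrow> \<bar>v\<bar> \<le> C"
    and p: "p \<ge> 2" and N: "N \<ge> 1" and \<Delta>: "\<Delta> > 0"
begin

definition q :: "real \<Rightarrow> real" where "q v = measure PX (T -` {v})"
definition \<Omega> :: "(nat \<Rightarrow> real) set" where "\<Omega> = PiE {..<N} (\<lambda>_. V)"
definition w :: "(nat \<Rightarrow> real) \<Rightarrow> real" where "w x = (\<Prod>i<N. q (x i))"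
definition Kp :: "nat set set" where "Kp = {S. S \<subseteq> {..<N} \<and> card S = p}"
definition J :: "nat set set" where "J = (\<lambda>i. {i}) ` {..<N}"
definition K :: "nat set set" where "K = Kp \<union> J"
definition u :: "nat set \<Rightarrow> (nat \<Rightarrow> real) \<Rightarrow> real" where "u S x = (\<Prod>i\<in>S. x i)"
definition P :: "(nat \<Rightarrow> real) measure" where "P = PiM {..<N} (\<lambda>_. PX)"
definition \<tau> :: "(nat \<Rightarrow> real) \<Rightarrow> nat \<Rightarrow> real" where "\<tau> X = (\<lambda>i\<in>{..<N}. T (X i))"
definition snrs :: "real \<Rightarrow> real \<Rightarrow> nat set \<Rightarrow> real" where
  "snrs t h S = (if S \<in> J then h else t * coef2 p N / \<Delta>)"

lemma space_PX [simp]: "space PX = UNIV" using sets_eq_imp_space_eq[OF sets_PX] by simp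

lemma finite_Kp: "finite Kp" unfolding Kp_def by (rule finite_subset[of _ "Pow {..<N}"]) auto

lemma Kp_J: "Kp \<inter> J = {}" using p by (auto simp: Kp_def J_def)

lemma card_Kp: "card Kp = N choose p" unfolding Kp_def using n_subsets[of "{..<N}" p] by simp

lemma sum_J: "(\<Sum>S\<in>J. f S) = (\<Sum>i<N. f {i})"
  unfolding J_def by (subst sum.reindex) (auto simp: inj_on_def)

lemma sum_K: "(\<Sum>S\<in>K. f S) = (\<Sum>S\<in>Kp. f S) + (\<Sum>i<N. f {i})"
  unfolding K_def sum_J[symmetric] using finite_Kp Kp_J by (intro sum.union_disjoint) (auto simp: J_def)

lemma single_in_J: "i < N \<Longrightarrow> {i} \<in> J" by (auto simp: J_def)

lemma u_single [simp]: "u {i} x = x i" by (simp add: u_def)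

lemma sum_Kp_prod: "(\<Sum>S\<in>Kp. \<Prod>i\<in>S. a i) = elem_sym p {..<N} a"
  unfolding elem_sym_def Kp_def ..

lemma T_measurable_V: "T \<in> measurable PX (count_space V)"
proof (subst measurable_count_space_eq2[OF finite_V], intro conjI ballI)
  show "T \<in> space PX \<rightarrow> V" using T_V by auto
  show "T -` {v} \<inter> space PX \<in> sets PX" for v using measurable_sets[OF T_meas, of "{v}"] by (simp add: sets_PX)
qed

lemma T_sets: "T -` {v} \<in> sets PX" using measurable_sets[OF T_meas, of "{v}"] by (simp add: sets_PX)

lemma q_nonneg: "q v \<ge> 0" by (simp add: q_def)

lemma sum_q: "(\<Sum>v\<in>V. q v) = 1"
proof -
  have "(\<Sum>v\<in>V. q v) = measure PX (\<Union>v\<in>V. T -` {v})"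
    unfolding q_def using finite_V T_sets
    by (intro finite_measure_finite_Union[symmetric]) (auto simp: disjoint_family_on_def)
  also have "(\<Union>v\<in>V. T -` {v}) = space PX" using T_V by auto
  finally show ?thesis by (simp only: prob_space)
qed

lemma sum_prod_\<Omega>:
  fixes f :: "nat \<Rightarrow> real \<Rightarrow> real"
  shows "(\<Sum>x\<in>\<Omega>. \<Prod>i<N. f i (x i)) = (\<Prod>i<N. \<Sum>v\<in>V. f i v)"
  unfolding \<Omega>_def using prod_sum_PiE[of "{..<N}" "\<lambda>_. V" f] by (simp add: finite_V)

sublocale finite_channel K \<Omega> w u
proof
  show "finite K" unfolding K_def J_def using finite_Kp by simp
  show "finite \<Omega>" unfolding \<Omega>_def by (intro finite_PiE) (auto simp: finite_V)
  show "w x \<ge> 0" for x unfolding w_def by (intro prod_nonneg) (simp add: q_nonneg)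
  show "(\<Sum>x\<in>\<Omega>. w x) = 1" unfolding w_def by (simp add: sum_prod_\<Omega>[of "\<lambda>_. q"] sum_q)
qed

text \<open>The channel of a single coordinate, whose free energy is \<open>psi PX T h\<close>; at
  the decoupled point \<open>Z\<close> is a product of \<open>N\<close> such factors.\<close>

sublocale one: finite_channel "{()}" V q "\<lambda>_ v. v"
  by unfold_locales (auto simp: finite_V q_nonneg sum_q)

lemma prob_P: "prob_space P" unfolding P_def by (intro prob_space_PiM) unfold_locales

lemma \<tau>_vimage: "x \<in> \<Omega> \<Longrightarrow> \<tau> -` {x} \<inter> space P = PiE {..<N} (\<lambda>i. T -` {x i})"
  unfolding \<tau>_def P_def \<Omega>_def by (auto simp: space_PiM PiE_iff fun_eq_iff restrict_def extensional_def)

lemma \<tau>_meas: "\<tau> \<in> measurable P (count_space \<Omega>)"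
proof (subst measurable_count_space_eq2[OF finite_\<Omega>], intro conjI ballI)
  show "\<tau> \<in> space P \<rightarrow> \<Omega>" using T_V by (auto simp: \<tau>_def \<Omega>_def)
  show "\<tau> -` {x} \<inter> space P \<in> sets P" if "x \<in> \<Omega>" for x
    unfolding \<tau>_vimage[OF that] unfolding P_def by (intro sets_PiM_I_finite) (auto simp: T_sets)
qed

lemma w_\<tau>: "x \<in> \<Omega> \<Longrightarrow> w x = measure P (\<tau> -` {x} \<inter> space P)"
proof -
  assume x: "x \<in> \<Omega>"
  interpret PS: product_sigma_finite "\<lambda>_::nat. PX"
    by (simp add: product_sigma_finite_def sigma_finite_measure_axioms)
  have "emeasure P (\<tau> -` {x} \<inter> space P) = (\<Prod>i<N. emeasure PX (T -` {x i}))"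
    unfolding \<tau>_vimage[OF x] unfolding P_def by (rule PS.emeasure_PiM) (auto simp: T_sets)
  also have "\<dots> = ennreal (w x)"
    unfolding w_def q_def by (simp add: emeasure_eq_measure prod_ennreal)
  finally show ?thesis unfolding measure_def using w_nonneg[OF x] by simp
qed

lemma q_T: "v \<in> V \<Longrightarrow> q v = measure PX (T -` {v} \<inter> space PX)" by (simp add: q_def)

lemma integral_T: "(\<integral>y. g (T y) \<partial>PX) = (\<Sum>v\<in>V. q v * g v)"
  by (rule one.integral_discrete[OF _ T_measurable_V q_T]) unfold_locales

lemma marginal: assumes "i < N" shows "(\<Sum>x\<in>\<Omega>. w x * g (x i)) = (\<Sum>v\<in>V. q v * g v)"
proof -
  have pp: "prob_space PX" by unfold_locales
  have gT: "(\<lambda>y. g (T y)) \<in> borel_measurable PX"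
    by (rule borel_measurable_integrable[OF one.integrable_discrete[OF pp T_measurable_V q_T, of g]])
  have "(\<Sum>x\<in>\<Omega>. w x * g (x i)) = (\<integral>X. g (\<tau> X i) \<partial>P)"
    by (rule integral_discrete[OF prob_P \<tau>_meas w_\<tau>, symmetric])
  also have "\<dots> = (\<integral>X. g (T (X i)) \<partial>PiM {..<N} (\<lambda>_. PX))"
    using assms unfolding P_def \<tau>_def by simp
  also have "\<dots> = (\<integral>y. g (T y) \<partial>PX)"
    using assms by (intro integral_PiM_component[OF pp _ gT]) auto
  finally show ?thesis by (simp only: integral_T)
qed

lemma \<Omega>_bound: "x \<in> \<Omega> \<Longrightarrow> i < N \<Longrightarrow> \<bar>x i\<bar> \<le> C"
  using V_C by (auto simp: \<Omega>_def)

lemma C_nonneg: "C \<ge> 0" using V_C[OF T_V[of 0]] by simp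

lemma coef2_nonneg: "coef2 p N \<ge> 0" unfolding coef2_def by simp

lemma snrs_nonneg: "t \<ge> 0 \<Longrightarrow> h \<ge> 0 \<Longrightarrow> snrs t h S \<ge> 0"
  unfolding snrs_def using coef2_nonneg \<Delta> by simp

lemma snrs_single: "i < N \<Longrightarrow> snrs t h {i} = h" by (simp add: snrs_def single_in_J)

lemma snrs_Kp: "S \<in> Kp \<Longrightarrow> snrs t h S = t * coef2 p N / \<Delta>" using Kp_J by (auto simp: snrs_def)

definition \<zeta> :: "real \<Rightarrow> real \<Rightarrow> (real \<Rightarrow> real) \<Rightarrow> real" where
  "\<zeta> h y f = (\<Sum>v\<in>V. q v * exp (sqrt h * y * v - h * v\<^sup>2 / 2) * f v)"

lemma wsum_factor:
  "wsum (snrs 0 h) z (\<lambda>x. \<Prod>i<N. f i (x i)) = (\<Prod>i<N. \<zeta> h (z {i}) (f i))"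
proof -
  have "expo (snrs 0 h) z x = (\<Sum>i<N. sqrt h * z {i} * x i - h * (x i)\<^sup>2 / 2)" for x
    unfolding expo_def sum_K by (simp add: snrs_single snrs_Kp)
  then have "wsum (snrs 0 h) z (\<lambda>x. \<Prod>i<N. f i (x i))
      = (\<Sum>x\<in>\<Omega>. \<Prod>i<N. q (x i) * exp (sqrt h * z {i} * x i - h * (x i)\<^sup>2 / 2) * f i (x i))"
    unfolding wsum_def w_def by (simp add: exp_sum prod.distrib)
  also have "\<dots> = (\<Prod>i<N. \<zeta> h (z {i}) (f i))"
    unfolding \<zeta>_def by (rule sum_prod_\<Omega>)
  finally show ?thesis .
qed

lemma \<zeta>_eq_one: "\<zeta> h y f = one.wsum (\<lambda>_. h) (\<lambda>_. y) f"
  unfolding \<zeta>_def one.wsum_def one.expo_def by simp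

lemma \<zeta>_pos: "\<zeta> h y (\<lambda>_. 1) > 0" unfolding \<zeta>_eq_one by (rule one.Z_pos)

lemma Z_factor: "Z (snrs 0 h) z = (\<Prod>i<N. \<zeta> h (z {i}) (\<lambda>_. 1))"
  using wsum_factor[of h z "\<lambda>_ _. 1"] by simp

lemma gibbs_factor:
  assumes "S \<subseteq> {..<N}"
  shows "gibbs (snrs 0 h) z (u S) = (\<Prod>i\<in>S. gibbs (snrs 0 h) z (u {i}))"
proof -
  define g where "g i = \<zeta> h (z {i}) (\<lambda>v. v) / \<zeta> h (z {i}) (\<lambda>_. 1)" for i
  have *: "gibbs (snrs 0 h) z (u R) = (\<Prod>i\<in>R. g i)" if R: "R \<subseteq> {..<N}" for R
  proof -
    have eq: "(\<Prod>i\<in>R. a i) = (\<Prod>i<N. if i \<in> R then a i else 1)" for a :: "nat \<Rightarrow> real"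
      using R by (simp add: prod.If_cases Int_absorb1)
    have "wsum (snrs 0 h) z (u R) = (\<Prod>i<N. \<zeta> h (z {i}) (\<lambda>v. if i \<in> R then v else 1))"
    proof -
      have "u R = (\<lambda>x. \<Prod>i<N. if i \<in> R then x i else 1)" by (rule ext) (simp add: u_def eq)
      then show ?thesis by (simp only: wsum_factor[of h z "\<lambda>i v. if i \<in> R then v else 1"])
    qed
    then have "gibbs (snrs 0 h) z (u R) = (\<Prod>i<N. \<zeta> h (z {i}) (\<lambda>v. if i \<in> R then v else 1) / \<zeta> h (z {i}) (\<lambda>_. 1))"
      unfolding gibbs_def Z_factor by (simp add: prod_dividef)
    also have "\<dots> = (\<Prod>i<N. if i \<in> R then g i else 1)"
      using \<zeta>_pos[of h] by (intro prod.cong refl) (auto simp: g_def less_imp_neq[symmetric])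
    finally show ?thesis unfolding eq .
  qed
  have "(\<Prod>i\<in>S. gibbs (snrs 0 h) z (u {i})) = (\<Prod>i\<in>S. g i)"
    using assms by (intro prod.cong refl) (subst *, auto)
  then show ?thesis using *[OF assms] by simp
qed

lemma free_energy_decoupled:
  assumes h: "h \<ge> 0"
  shows "free_energy (snrs 0 h) = real N * psi PX T h"
proof -
  have pp: "prob_space PX" by unfold_locales
  define L where "L y = ln (\<zeta> h y (\<lambda>_. 1))" for y
  define G where "G v = (\<integral>y. L (y + sqrt h * v) \<partial>ngauss)" for v
  have Lm: "L \<in> borel_measurable borel" unfolding L_def \<zeta>_def by measurable
  have Lm': "(\<lambda>y. L (y + a)) \<in> borel_measurable ngauss" for a
    using measurable_compose[OF _ Lm, of "\<lambda>y. y + a" ngauss] by simp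
  have one_int: "integrable (gaussK {()}) (\<lambda>z. L (z () + sqrt h * v))" for v
  proof -
    have "tame {()} (\<lambda>z. ln (one.Z (\<lambda>_. h) (one.shift (\<lambda>_. h) v z)))"
      by (rule one.tame_shift[OF one.tame_ln_Z]) (rule h)
    moreover have "one.Z (\<lambda>_. h) (one.shift (\<lambda>_. h) v z) = \<zeta> h (z () + sqrt h * v) (\<lambda>_. 1)" for z
      unfolding one.wsum_def one.expo_def one.shift_def \<zeta>_def by simp
    ultimately show ?thesis unfolding L_def by (intro tame_integrable) auto
  qed
  have Lint: "integrable ngauss (\<lambda>y. L (y + a))" if "a = sqrt h * v" for a v
    using one_int[of v] integrable_PiM_component[OF prob_space_ngauss, of "()" "{()}" "\<lambda>y. L (y + a)"] Lm'[of a]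
    unfolding that gaussK_def by simp
  have psi: "psi PX T h = (\<Sum>v\<in>V. q v * G v)"
  proof -
    have "psi PX T h = chan_free PX {()} (\<lambda>_ x. sqrt h * T x)"
      by (rule psi_eq_chan_free[OF pp _ _ h])
        (use one.integrable_discrete[OF pp T_measurable_V q_T, of "\<lambda>v. v\<^sup>2"]
          borel_measurable_integrable[OF one.integrable_discrete[OF pp T_measurable_V q_T, of "\<lambda>v. v"]] in simp_all)
    also have "\<dots> = one.free_energy (\<lambda>_. h)"
      by (rule one.free_energy_eq_chan_free[OF pp T_measurable_V q_T h])
    also have "\<dots> = (\<Sum>v\<in>V. q v * (\<integral>z. L (z () + sqrt h * v) \<partial>gaussK {()}))"
      unfolding one.free_energy_def one.planted_def one.wsum_def one.expo_def L_def \<zeta>_def by simp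
    also have "\<dots> = (\<Sum>v\<in>V. q v * G v)"
    proof (intro sum.cong refl arg_cong2[where f = times])
      fix v
      show "(\<integral>z. L (z () + sqrt h * v) \<partial>gaussK {()}) = G v"
        unfolding G_def gaussK_def
        by (rule integral_PiM_component[OF prob_space_ngauss _ Lm']) simp
    qed
    finally show ?thesis .
  qed
  have lnZ: "ln (Z (snrs 0 h) (shift (snrs 0 h) x0 z)) = (\<Sum>i<N. L (z {i} + sqrt h * x0 i))" for x0 z
  proof -
    have "{i} \<in> K" if "i < N" for i using that by (simp add: K_def single_in_J)
    then have "\<zeta> h (shift (snrs 0 h) x0 z {i}) (\<lambda>_. 1) = \<zeta> h (z {i} + sqrt h * x0 i) (\<lambda>_. 1)" if "i < N" for i
      using that unfolding shift_def by (simp add: snrs_single)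
    then show ?thesis unfolding Z_factor L_def
      using less_imp_neq[OF \<zeta>_pos, symmetric] by (subst ln_prod) auto
  qed
  have "free_energy (snrs 0 h) = (\<Sum>x0\<in>\<Omega>. w x0 * (\<Sum>i<N. G (x0 i)))"
    unfolding free_energy_def planted_shift lnZ
  proof (intro sum.cong refl arg_cong2[where f = times])
    fix x0
    have c: "integrable (gaussK K) (\<lambda>z. L (z {i} + sqrt h * x0 i)) \<and> (\<integral>z. L (z {i} + sqrt h * x0 i) \<partial>gaussK K) = G (x0 i)"
      if "i \<in> {..<N}" for i
    proof -
      have i: "{i} \<in> K" using that by (simp add: K_def single_in_J)
      show ?thesis unfolding G_def gaussK_def
        using integrable_PiM_component[OF prob_space_ngauss i Lm'] integral_PiM_component[OF prob_space_ngauss i Lm']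
          Lint[OF refl, of "x0 i"] by simp
    qed
    have "(\<integral>z. (\<Sum>i<N. L (z {i} + sqrt h * x0 i)) \<partial>gaussK K) = (\<Sum>i<N. \<integral>z. L (z {i} + sqrt h * x0 i) \<partial>gaussK K)"
      by (rule Bochner_Integration.integral_sum) (rule c[THEN conjunct1])
    also have "\<dots> = (\<Sum>i<N. G (x0 i))" by (rule sum.cong[OF refl]) (rule c[THEN conjunct2])
    finally show "(\<integral>z. (\<Sum>i<N. L (z {i} + sqrt h * x0 i)) \<partial>gaussK K) = (\<Sum>i<N. G (x0 i))" .
  qed
  also have "\<dots> = (\<Sum>i<N. \<Sum>x0\<in>\<Omega>. w x0 * G (x0 i))"
    unfolding sum_distrib_left by (rule sum.swap)
  also have "\<dots> = (\<Sum>i<N. psi PX T h)" unfolding psi by (intro sum.cong refl) (simp add: marginal)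
  finally show ?thesis by simp
qed

text \<open>Convexity of the power enters twice. With \<open>R\<close> the average squared posterior
  mean at the decoupled point, the tangent at \<open>\<mu>\<close> shows that the mean of
  \<open>R ^ p\<close> is at least \<open>\<mu> ^ p\<close>; the tangent at \<open>m\<close> then
  gives \<open>\<mu> ^ p - p * m ^ (p - 1) * \<mu> \<ge> - (p - 1) * m ^ p\<close>. The choice
  \<open>h = m ^ (p - 1) / \<Delta>\<close> makes the linear term agree with what the removal of the
  side channel costs.\<close>

lemma lower_bound:
  assumes m: "m \<ge> 0"
  shows "free_energy (snrs 1 0) / real N \<ge> psi PX T (m ^ (p - 1) / \<Delta>) - (real p - 1) / (2 * real p * \<Delta>) * m ^ p
    - real p * (C\<^sup>2) ^ p / (2 * \<Delta> * real N)"
proof -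
  define h where "h = m ^ (p - 1) / \<Delta>"
  have h: "h \<ge> 0" using m \<Delta> by (simp add: h_def)
  have s0: "snrs 0 h k \<ge> 0" for k using h by (intro snrs_nonneg) auto
  have s1: "snrs 1 0 k \<ge> 0" for k by (intro snrs_nonneg) auto
  define g where "g z i = (gibbs (snrs 0 h) z (u {i}))\<^sup>2" for z i
  define R where "R z = (\<Sum>i<N. g z i) / real N" for z
  define \<mu> where "\<mu> = (\<Sum>i<N. info (snrs 0 h) (u {i})) / real N"
  have gb: "\<bar>g z i\<bar> \<le> C\<^sup>2" if "i < N" for z i
    unfolding g_def using gibbs_abs_le[of "u {i}" C "snrs 0 h" z] \<Omega>_bound[OF _ that]
    by (simp add: abs_le_imp_sq)
  have R0: "R z \<ge> 0" for z unfolding R_def g_def by (intro divide_nonneg_nonneg sum_nonneg) auto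
  have \<mu>0: "\<mu> \<ge> 0" unfolding \<mu>_def info_def
    by (intro divide_nonneg_nonneg sum_nonneg integral_nonneg_AE AE_I2 mult_nonneg_nonneg less_imp_le[OF Z_pos]) auto
  have tZ: "tame K (\<lambda>z. Z (snrs 0 h) z)" by (rule tame_wsum[OF s0 tame_const])
  have tg: "tame K (\<lambda>z. g z i)" for i unfolding g_def power2_eq_square by (rule tame_mult[OF tame_gibbs tame_gibbs])
  have tR: "tame K R" unfolding R_def divide_inverse by (rule tame_mult[OF tame_sum tame_const]) (rule tg)
  have iZ: "integrable (gaussK K) (\<lambda>z. Z (snrs 0 h) z)" by (rule tame_integrable[OF finite_K tZ])
  have iZg: "integrable (gaussK K) (\<lambda>z. Z (snrs 0 h) z * g z i)" for i by (rule tame_integrable[OF finite_K tame_mult[OF tZ tg]])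
  have iZR: "integrable (gaussK K) (\<lambda>z. Z (snrs 0 h) z * R z)" by (rule tame_integrable[OF finite_K tame_mult[OF tZ tR]])
  have ZR: "(\<integral>z. Z (snrs 0 h) z * R z \<partial>gaussK K) = \<mu>"
  proof -
    have "(\<integral>z. Z (snrs 0 h) z * R z \<partial>gaussK K) = (\<integral>z. (\<Sum>i<N. Z (snrs 0 h) z * g z i) / real N \<partial>gaussK K)"
      unfolding R_def by (simp add: sum_distrib_left)
    also have "\<dots> = \<mu>" unfolding \<mu>_def info_def g_def[symmetric]
      by (simp only: integral_divide_zero Bochner_Integration.integral_sum[OF iZg])
    finally show ?thesis .
  qed
  define E where "E = real p * (C\<^sup>2) ^ p"
  have pair: "coef2 p N * (\<Sum>S\<in>Kp. info (snrs 0 h) (u S)) \<ge> real N / real p * \<mu> ^ p - E"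
  proof -
    have iS: "integrable (gaussK K) (\<lambda>z. Z (snrs 0 h) z * (gibbs (snrs 0 h) z (u S))\<^sup>2)" for S
      unfolding power2_eq_square by (rule tame_integrable[OF finite_K tame_mult[OF tZ tame_mult[OF tame_gibbs tame_gibbs]]])
    \<comment> \<open>The tangent is integrated against the weight \<open>Z\<close>, which has mass
      1 and under which \<open>R\<close> has mean \<open>\<mu>\<close>, so its linear part drops
      out.\<close>
    have "real N / real p * \<mu> ^ p - E = (\<integral>z. Z (snrs 0 h) z * (real N / real p * (\<mu> ^ p - real p * \<mu> ^ (p - 1) * \<mu>) - E)
        + (real N / real p * (real p * \<mu> ^ (p - 1))) * (Z (snrs 0 h) z * R z) \<partial>gaussK K)"
    proof -
      have "(\<integral>z. Z (snrs 0 h) z * (real N / real p * (\<mu> ^ p - real p * \<mu> ^ (p - 1) * \<mu>) - E)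
        + (real N / real p * (real p * \<mu> ^ (p - 1))) * (Z (snrs 0 h) z * R z) \<partial>gaussK K)
        = (real N / real p * (\<mu> ^ p - real p * \<mu> ^ (p - 1) * \<mu>) - E) + (real N / real p * (real p * \<mu> ^ (p - 1))) * \<mu>"
        by (simp only: Bochner_Integration.integral_add[OF integrable_mult_left[OF iZ] integrable_mult_right[OF iZR]]
            integral_mult_left_zero integral_mult_right_zero ZR integral_Z[of "snrs 0 h", OF s0] mult_1_left)
      also have "\<dots> = real N / real p * \<mu> ^ p - E" by (simp add: right_diff_distrib)
      finally show ?thesis by simp
    qed
    also have "\<dots> \<le> (\<integral>z. coef2 p N * (\<Sum>S\<in>Kp. Z (snrs 0 h) z * (gibbs (snrs 0 h) z (u S))\<^sup>2) \<partial>gaussK K)"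
    proof (rule integral_mono)
      show "integrable (gaussK K) (\<lambda>z. Z (snrs 0 h) z * (real N / real p * (\<mu> ^ p - real p * \<mu> ^ (p - 1) * \<mu>) - E)
        + (real N / real p * (real p * \<mu> ^ (p - 1))) * (Z (snrs 0 h) z * R z))"
        using iZ iZR by simp
      show "integrable (gaussK K) (\<lambda>z. coef2 p N * (\<Sum>S\<in>Kp. Z (snrs 0 h) z * (gibbs (snrs 0 h) z (u S))\<^sup>2))"
        by (intro integrable_mult_right Bochner_Integration.integrable_sum iS)
      fix z
      \<comment> \<open>Posterior means of monomials are products at the decoupled point, so their
        squares sum to an elementary symmetric polynomial in the nonnegative numbers
        \<open>g z i\<close>.\<close>
      have eqS: "(\<Sum>S\<in>Kp. (gibbs (snrs 0 h) z (u S))\<^sup>2) = elem_sym p {..<N} (g z)"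
        unfolding sum_Kp_prod[symmetric] g_def
        by (intro sum.cong refl) (simp add: Kp_def gibbs_factor prod_power_distrib)
      have "\<bar>coef2 p N * elem_sym p {..<N} (g z) - real N / real p * R z ^ p\<bar> \<le> E"
        unfolding R_def E_def using N p gb by (intro coef2_elem_sym_approx) auto
      moreover have "real N / real p * (\<mu> ^ p + real p * \<mu> ^ (p - 1) * (R z - \<mu>)) \<le> real N / real p * R z ^ p"
        by (intro mult_left_mono power_tangent R0 \<mu>0) simp
      ultimately have "real N / real p * (\<mu> ^ p + real p * \<mu> ^ (p - 1) * (R z - \<mu>)) - E
          \<le> coef2 p N * (\<Sum>S\<in>Kp. (gibbs (snrs 0 h) z (u S))\<^sup>2)" unfolding eqS by linarith
      note L = mult_left_mono[OF this less_imp_le[OF Z_pos[of "snrs 0 h" z]]]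
      have gen: "\<And>x a b c r y e :: real. x * (a * (b + c * (r - y)) - e) = x * (a * (b - c * y) - e) + (a * c) * (x * r)"
        by (simp add: algebra_simps)
      show "Z (snrs 0 h) z * (real N / real p * (\<mu> ^ p - real p * \<mu> ^ (p - 1) * \<mu>) - E)
        + (real N / real p * (real p * \<mu> ^ (p - 1))) * (Z (snrs 0 h) z * R z)
        \<le> coef2 p N * (\<Sum>S\<in>Kp. Z (snrs 0 h) z * (gibbs (snrs 0 h) z (u S))\<^sup>2)"
        using L unfolding gen sum_distrib_left[symmetric] mult.left_commute[of "Z (snrs 0 h) z" "coef2 p N"] .
    qed
    also have "\<dots> = coef2 p N * (\<Sum>S\<in>Kp. info (snrs 0 h) (u S))"
      unfolding info_def by (simp only: integral_mult_right_zero Bochner_Integration.integral_sum[OF iS])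
    finally show ?thesis .
  qed
  have "free_energy (snrs 1 0) \<ge> free_energy (snrs 0 h) + (\<Sum>S\<in>K. (snrs 1 0 S - snrs 0 h S) * info (snrs 0 h) (u S) / 2)"
    by (rule free_energy_tangent[OF s0 s1])
  also have "(\<Sum>S\<in>K. (snrs 1 0 S - snrs 0 h S) * info (snrs 0 h) (u S) / 2)
      = (coef2 p N * (\<Sum>S\<in>Kp. info (snrs 0 h) (u S))) / (2 * \<Delta>) - h / 2 * (real N * \<mu>)"
  proof -
    have "(\<Sum>S\<in>Kp. (snrs 1 0 S - snrs 0 h S) * info (snrs 0 h) (u S) / 2) = (\<Sum>S\<in>Kp. coef2 p N / (2 * \<Delta>) * info (snrs 0 h) (u S))"
      by (intro sum.cong refl) (simp add: snrs_Kp)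
    moreover have "(\<Sum>i<N. (snrs 1 0 {i} - snrs 0 h {i}) * info (snrs 0 h) (u {i}) / 2) = (\<Sum>i<N. - (h / 2) * info (snrs 0 h) (u {i}))"
      by (intro sum.cong refl) (simp add: snrs_single)
    ultimately show ?thesis unfolding sum_K sum_distrib_left[symmetric] \<mu>_def using N by simp
  qed
  finally have 1: "free_energy (snrs 1 0) \<ge> real N * psi PX T h
      + ((coef2 p N * (\<Sum>S\<in>Kp. info (snrs 0 h) (u S))) / (2 * \<Delta>) - h / 2 * (real N * \<mu>))"
    unfolding free_energy_decoupled[OF h] by simp
  have 2: "(real N / real p * \<mu> ^ p - E) / (2 * \<Delta>) \<le> (coef2 p N * (\<Sum>S\<in>Kp. info (snrs 0 h) (u S))) / (2 * \<Delta>)"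
    using pair \<Delta> by (intro divide_right_mono) auto
  have young: "- (real p - 1) * m ^ p \<le> \<mu> ^ p - real p * m ^ (p - 1) * \<mu>"
  proof -
    have "m ^ (p - 1) * m = m ^ p" using p by (cases p) auto
    then show ?thesis using power_tangent[OF \<mu>0 m, of p] by (simp add: algebra_simps)
  qed
  have "real N / (2 * real p * \<Delta>) * (- (real p - 1) * m ^ p) \<le> real N / (2 * real p * \<Delta>) * (\<mu> ^ p - real p * m ^ (p - 1) * \<mu>)"
    using \<Delta> by (intro mult_left_mono[OF young]) simp
  also have "\<dots> = (real N / real p * \<mu> ^ p) / (2 * \<Delta>) - h / 2 * (real N * \<mu>)"
    unfolding h_def using p \<Delta> by (simp add: field_simps)
  finally have 3: "real N / (2 * real p * \<Delta>) * (- (real p - 1) * m ^ p) \<le> (real N / real p * \<mu> ^ p) / (2 * \<Delta>) - h / 2 * (real N * \<mu>)" .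
  have "free_energy (snrs 1 0) \<ge> real N * psi PX T h - real N * ((real p - 1) / (2 * real p * \<Delta>) * m ^ p) - E / (2 * \<Delta>)"
  proof -
    have "a / D * (- b * c) = - (a * (b / D * c))" for a b c D :: real by simp
    then have e: "real N / (2 * real p * \<Delta>) * (- (real p - 1) * m ^ p) = - (real N * ((real p - 1) / (2 * real p * \<Delta>) * m ^ p))" .
    show ?thesis using 1 2[unfolded diff_divide_distrib] 3 unfolding e by linarith
  qed
  then have "free_energy (snrs 1 0) / real N \<ge> (real N * psi PX T h - real N * ((real p - 1) / (2 * real p * \<Delta>) * m ^ p) - E / (2 * \<Delta>)) / real N"
    by (rule divide_right_mono) simp
  also have "(real N * psi PX T h - real N * ((real p - 1) / (2 * real p * \<Delta>) * m ^ p) - E / (2 * \<Delta>)) / real N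
      = psi PX T h - (real p - 1) / (2 * real p * \<Delta>) * m ^ p - E / (2 * \<Delta> * real N)"
    using N by (simp add: diff_divide_distrib)
  finally show ?thesis unfolding h_def E_def .
qed

end

lemma abs_le_young: "t > 0 \<Longrightarrow> \<bar>y\<bar> \<le> t / 2 + y\<^sup>2 / (2 * t)" for y t :: real
  using sum_squares_bound[of t "\<bar>y\<bar>"] by (simp add: field_simps power2_eq_square)

lemma ngauss_second_moment: "integrable ngauss (\<lambda>y. y\<^sup>2)" "(\<integral>y. y\<^sup>2 \<partial>ngauss) = 1"
proof -
  have 1: "(\<integral>z. z () * z () \<partial>gaussK {()}) = (\<integral>z. 1 \<partial>gaussK {()})"
  proof (rule gaussK_integration_by_parts[where c = 1 and d = 0])
    fix z :: "unit \<Rightarrow> real"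
    show "((\<lambda>y. (z(() := y)) ()) has_real_derivative 1) (at (z ()))" by simp
    show "\<bar>z ()\<bar> \<le> exp (1 * (\<Sum>k\<in>{()}. \<bar>z k\<bar>) + 0)"
    proof -
      have "\<bar>z ()\<bar> \<le> exp \<bar>z ()\<bar>" using exp_ge_add_one_self[of "\<bar>z ()\<bar>"] by linarith
      then show ?thesis by simp
    qed
    show "\<bar>1\<bar> \<le> exp (1 * (\<Sum>k\<in>{()}. \<bar>z k\<bar>) + 0)" by simp
  qed (auto simp: gaussK_def)
  have 2: "integrable (gaussK {()}) (\<lambda>z. z () * z ())"
    by (rule tame_integrable[OF _ tame_mult[OF tame_coord tame_coord]]) auto
  have m: "(\<lambda>y. y\<^sup>2) \<in> borel_measurable ngauss" by simp
  show "integrable ngauss (\<lambda>y. y\<^sup>2)"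
    using 2 integrable_PiM_component[OF prob_space_ngauss, of "()" "{()}" "\<lambda>y. y\<^sup>2"] unfolding gaussK_def
    by (simp add: power2_eq_square)
  show "(\<integral>y. y\<^sup>2 \<partial>ngauss) = 1"
    using 1 integral_PiM_component[OF prob_space_ngauss, of "()" "{()}" "\<lambda>y. y\<^sup>2"]
      prob_space.prob_space[OF prob_space_gaussK, of "{()}"] unfolding gaussK_def
    by (simp add: power2_eq_square)
qed

section \<open>Fluctuations of the free energy\<close>

context finite_channel
begin

lemma expo_diff: "expo s y x - expo s y' x = (\<Sum>k\<in>K. sqrt (s k) * (y k - y' k) * u k x)"
  unfolding expo_def sum_subtractf[symmetric] by (intro sum.cong refl) (simp add: algebra_simps)

text \<open>\<open>ln Z\<close> is Lipschitz in the noise of channel \<open>k\<close> with constant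
  \<open>sqrt (s k) * b k\<close>, and unit noise has second moment 1, so Efron--Stein with
  reference value 0 sums the squares of these constants.\<close>

lemma ln_Z_noise_variance:
  assumes b: "\<And>k x. k \<in> K \<Longrightarrow> x \<in> \<Omega> \<Longrightarrow> \<bar>u k x\<bar> \<le> b k" and s: "\<And>k. k \<in> K \<Longrightarrow> s k \<ge> 0"
  defines "L \<equiv> \<lambda>x0 z. ln (Z s (shift s x0 z))"
  shows "integrable (gaussK K) (\<lambda>z. (L x0 z - (\<integral>z. L x0 z \<partial>gaussK K))\<^sup>2)"
    "(\<integral>z. (L x0 z - (\<integral>z. L x0 z \<partial>gaussK K))\<^sup>2 \<partial>gaussK K) \<le> (\<Sum>k\<in>K. s k * (b k)\<^sup>2)"
proof -
  obtain x where x: "x \<in> \<Omega>" using exists_pos_w by auto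
  have b0: "b k \<ge> 0" if "k \<in> K" for k using b[OF that x] by simp
  have tL: "tame K (L x0)" unfolding L_def by (rule tame_shift[OF tame_ln_Z[OF s]])
  show "integrable (gaussK K) (\<lambda>z. (L x0 z - (\<integral>z. L x0 z \<partial>gaussK K))\<^sup>2)"
    unfolding power2_eq_square by (rule tame_integrable[OF finite_K tame_mult[OF tame_diff[OF tL tame_const] tame_diff[OF tL tame_const]]])
  have lip: "\<bar>L x0 z - L x0 z'\<bar> \<le> (\<Sum>k\<in>K. sqrt (s k) * b k * \<bar>z k - z' k\<bar>)" for z z'
    unfolding L_def
  proof (rule ln_Z_lipschitz)
    fix x assume x: "x \<in> \<Omega>"
    have "\<bar>expo s (shift s x0 z) x - expo s (shift s x0 z') x\<bar> \<le> (\<Sum>k\<in>K. \<bar>sqrt (s k) * (shift s x0 z k - shift s x0 z' k) * u k x\<bar>)"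
      unfolding expo_diff by (rule sum_abs)
    also have "\<dots> \<le> (\<Sum>k\<in>K. sqrt (s k) * b k * \<bar>z k - z' k\<bar>)"
    proof (rule sum_mono)
      fix k assume k: "k \<in> K"
      have "\<bar>sqrt (s k) * (shift s x0 z k - shift s x0 z' k) * u k x\<bar> = sqrt (s k) * \<bar>u k x\<bar> * \<bar>z k - z' k\<bar>"
        using k s[OF k] by (simp add: shift_def abs_mult)
      also have "\<dots> \<le> sqrt (s k) * b k * \<bar>z k - z' k\<bar>"
        using b[OF k x] s[OF k] by (intro mult_right_mono mult_left_mono) auto
      finally show "\<bar>sqrt (s k) * (shift s x0 z k - shift s x0 z' k) * u k x\<bar> \<le> sqrt (s k) * b k * \<bar>z k - z' k\<bar>" .
    qed
    finally show "\<bar>expo s (shift s x0 z) x - expo s (shift s x0 z') x\<bar> \<le> (\<Sum>k\<in>K. sqrt (s k) * b k * \<bar>z k - z' k\<bar>)" .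
  qed
  define G where "G = (\<Sum>k\<in>K. sqrt (s k) * b k)"
  have Gk: "sqrt (s k) * b k \<le> G" if "k \<in> K" for k
    unfolding G_def using that finite_K b0 s by (intro member_le_sum) auto
  have d2: "(sqrt (s k) * b k * \<bar>y\<bar>)\<^sup>2 = s k * (b k)\<^sup>2 * y\<^sup>2" if "k \<in> K" for k y
    using s[OF that] by (simp add: power_mult_distrib)
  have "(\<integral>z. (L x0 z - (\<integral>z. L x0 z \<partial>PiM K (\<lambda>_. ngauss)))\<^sup>2 \<partial>PiM K (\<lambda>_. ngauss))
      \<le> (\<Sum>k\<in>K. \<integral>y. (sqrt (s k) * b k * \<bar>y\<bar>)\<^sup>2 \<partial>ngauss)"
  proof (rule efron_stein[OF prob_space_ngauss finite_K, where g = "\<lambda>y. G * y" and A = "\<bar>L x0 (\<lambda>_. 0)\<bar>" and ?y0.0 = 0])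
    show "L x0 \<in> borel_measurable (PiM K (\<lambda>_. ngauss))" using tame_measurable[OF tL] unfolding gaussK_def .
    show "integrable ngauss (\<lambda>y. (G * y)\<^sup>2)"
      unfolding power_mult_distrib by (rule integrable_mult_right[OF ngauss_second_moment(1)])
    show "integrable ngauss (\<lambda>y. (sqrt (s k) * b k * \<bar>y\<bar>)\<^sup>2)" if "k \<in> K" for k
      unfolding d2[OF that] by (rule integrable_mult_right[OF ngauss_second_moment(1)])
    fix X :: "'k \<Rightarrow> real"
    have "\<bar>L x0 X - L x0 (\<lambda>_. 0)\<bar> \<le> (\<Sum>k\<in>K. sqrt (s k) * b k * \<bar>X k - 0\<bar>)" by (rule lip)
    also have "\<dots> \<le> (\<Sum>k\<in>K. \<bar>G * X k\<bar>)"
    proof (rule sum_mono)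
      fix k assume k: "k \<in> K"
      have "sqrt (s k) * b k * \<bar>X k\<bar> \<le> \<bar>G\<bar> * \<bar>X k\<bar>" using Gk[OF k] by (intro mult_right_mono) auto
      then show "sqrt (s k) * b k * \<bar>X k - 0\<bar> \<le> \<bar>G * X k\<bar>" by (simp add: abs_mult)
    qed
    finally show "\<bar>L x0 X\<bar> \<le> \<bar>L x0 (\<lambda>_. 0)\<bar> + (\<Sum>k\<in>K. \<bar>G * X k\<bar>)" by linarith
    fix k y assume k: "k \<in> K"
    have "\<bar>L x0 (X(k := y)) - L x0 (X(k := 0))\<bar> \<le> (\<Sum>j\<in>K. sqrt (s j) * b j * \<bar>(X(k := y)) j - (X(k := 0)) j\<bar>)" by (rule lip)
    also have "\<dots> = sqrt (s k) * b k * \<bar>y\<bar>" by (subst sum.remove[OF finite_K k]) simp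
    finally show "\<bar>L x0 (X(k := y)) - L x0 (X(k := 0))\<bar> \<le> sqrt (s k) * b k * \<bar>y\<bar>" .
  qed simp_all
  also have "\<dots> = (\<Sum>k\<in>K. s k * (b k)\<^sup>2)"
    by (intro sum.cong refl) (simp add: d2 ngauss_second_moment)
  finally show "(\<integral>z. (L x0 z - (\<integral>z. L x0 z \<partial>gaussK K))\<^sup>2 \<partial>gaussK K) \<le> (\<Sum>k\<in>K. s k * (b k)\<^sup>2)"
    unfolding gaussK_def .
qed

end

context spiked
begin

sublocale ov: overlap_channel K \<Omega> w u J C "\<lambda>_. coef2 p N / \<Delta>"
proof
  show "J \<subseteq> K" unfolding K_def by auto
  show "J \<noteq> {}" using single_in_J[of 0] N by auto
  show "\<bar>u k x\<bar> \<le> C" if "k \<in> J" "x \<in> \<Omega>" for k x using that \<Omega>_bound by (auto simp: J_def)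
  show "0 \<le> coef2 p N / \<Delta>" using coef2_nonneg \<Delta> by simp
qed

lemma ov_snr: "ov.snr r = snrs 1 (r\<^sup>2)"
  by (simp add: fun_eq_iff ov.snr_def snrs_def)

lemma ov_n: "ov.n = real N"
proof -
  have "card J = N" unfolding J_def by (subst card_image) (auto simp: inj_on_def)
  then show ?thesis unfolding ov.n_def by simp
qed

definition ub :: "nat set \<Rightarrow> real" where "ub S = (if S \<in> J then C else C ^ p)"

lemma u_le_ub: "S \<in> K \<Longrightarrow> x \<in> \<Omega> \<Longrightarrow> \<bar>u S x\<bar> \<le> ub S"
proof -
  assume S: "S \<in> K" and x: "x \<in> \<Omega>"
  have sub: "S \<subseteq> {..<N}" using S by (auto simp: K_def Kp_def J_def)
  have "\<bar>u S x\<bar> = (\<Prod>i\<in>S. \<bar>x i\<bar>)" unfolding u_def by (rule abs_prod)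
  also have "\<dots> \<le> (\<Prod>i\<in>S. C)" using \<Omega>_bound[OF x] sub by (intro prod_mono) auto
  also have "\<dots> = ub S" using S Kp_J by (auto simp: ub_def K_def J_def Kp_def)
  finally show ?thesis .
qed

lemma sum_snr_ub: "(\<Sum>S\<in>K. ov.snr r S * (ub S)\<^sup>2) \<le> real N * ((C ^ p)\<^sup>2 / \<Delta> + r\<^sup>2 * C\<^sup>2)"
proof -
  have "(\<Sum>S\<in>Kp. ov.snr r S * (ub S)\<^sup>2) = (\<Sum>S\<in>Kp. coef2 p N / \<Delta> * (C ^ p)\<^sup>2)"
    by (intro sum.cong refl) (use Kp_J in \<open>auto simp: ov_snr snrs_Kp ub_def\<close>)
  also have "\<dots> = (coef2 p N * real (N choose p)) * ((C ^ p)\<^sup>2 / \<Delta>)" by (simp add: card_Kp)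
  also have "\<dots> \<le> real N * ((C ^ p)\<^sup>2 / \<Delta>)"
    using N p \<Delta> by (intro mult_right_mono coef2_choose_le) auto
  finally have "(\<Sum>S\<in>Kp. ov.snr r S * (ub S)\<^sup>2) \<le> real N * ((C ^ p)\<^sup>2 / \<Delta>)" .
  moreover have "(\<Sum>i<N. ov.snr r {i} * (ub {i})\<^sup>2) = (\<Sum>i<N. r\<^sup>2 * C\<^sup>2)"
    by (intro sum.cong refl) (simp add: ov_snr snrs_single ub_def single_in_J)
  ultimately show ?thesis unfolding sum_K by (simp add: distrib_left)
qed

text \<open>A coordinate lies in at most \<open>N choose (p - 1)\<close> tensor entries, a number
  that \<open>coef2 p N\<close> compensates. Changing one coordinate of the signal therefore changes
  the exponents by an amount bounded in \<open>N\<close>.\<close>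

lemma coef2_card_containing: "coef2 p N * real (card {S \<in> Kp. i \<in> S}) \<le> 1"
proof -
  let ?A = "{S \<in> Kp. i \<in> S}" and ?B = "{S. S \<subseteq> {..<N} \<and> card S = p - 1}"
  have "card ?A \<le> card ?B"
  proof (rule card_inj_on_le[where f = "\<lambda>S. S - {i}"])
    show "inj_on (\<lambda>S. S - {i}) ?A" by (rule inj_onI) auto
    show "(\<lambda>S. S - {i}) ` ?A \<subseteq> ?B"
    proof (intro image_subsetI)
      fix S assume S: "S \<in> ?A"
      then have "finite S" using finite_subset[of S "{..<N}"] by (auto simp: Kp_def)
      then show "S - {i} \<in> ?B" using S by (auto simp: Kp_def)
    qed
    show "finite ?B" by (rule finite_subset[of _ "Pow {..<N}"]) auto
  qed
  then have "card ?A \<le> N choose (p - 1)" using n_subsets[of "{..<N}" "p - 1"] by simp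
  then have "real (fact (p - 1) * card ?A) \<le> real (fact (p - 1) * (N choose (p - 1)))"
    by (simp only: of_nat_le_iff mult_le_mono2)
  also have "\<dots> \<le> real (N ^ (p - 1))"
    unfolding of_nat_le_iff mult.commute[of "fact (p - 1)"] by (rule binomial_fact_pow)
  finally show ?thesis unfolding coef2_def using N by (simp add: divide_le_eq)
qed

definition sens :: "real \<Rightarrow> real" where "sens r = 2 * (C ^ p)\<^sup>2 / \<Delta> + 2 * r\<^sup>2 * C\<^sup>2"

text \<open>Only the entries containing \<open>i\<close> and the side channel of \<open>i\<close>
  are affected; each changes by at most \<open>2 * (ub S)\<^sup>2\<close> times its signal-to-noise
  ratio. The two summands of \<open>sens\<close> are these two contributions.\<close>

lemma signal_sensitivity:
  assumes x: "x0 \<in> \<Omega>" "x1 \<in> \<Omega>" and eq: "\<And>j. j \<noteq> i \<Longrightarrow> x0 j = x1 j" and i: "i < N"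
  shows "\<bar>ln (Z (ov.snr r) (shift (ov.snr r) x0 z)) - ln (Z (ov.snr r) (shift (ov.snr r) x1 z))\<bar> \<le> sens r"
proof (rule ln_Z_lipschitz)
  fix x assume xx: "x \<in> \<Omega>"
  let ?s = "ov.snr r"
  have ubn: "ub S \<ge> 0" for S unfolding ub_def using C_nonneg by simp
  have "expo ?s (shift ?s x0 z) x - expo ?s (shift ?s x1 z) x = (\<Sum>S\<in>K. ?s S * (u S x0 - u S x1) * u S x)"
    unfolding expo_diff
  proof (intro sum.cong refl)
    fix S assume S: "S \<in> K"
    have "sqrt (?s S) * (shift ?s x0 z S - shift ?s x1 z S) * u S x
      = (sqrt (?s S) * sqrt (?s S)) * (u S x0 - u S x1) * u S x"
      unfolding shift_def restrict_apply'[OF S] by (simp add: algebra_simps)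
    then show "sqrt (?s S) * (shift ?s x0 z S - shift ?s x1 z S) * u S x = ?s S * (u S x0 - u S x1) * u S x"
      using ov.snr_nonneg[OF S, of r] by simp
  qed
  also have "\<bar>\<dots>\<bar> \<le> (\<Sum>S\<in>K. ?s S * (if i \<in> S then 2 * (ub S)\<^sup>2 else 0))"
  proof (rule order_trans[OF sum_abs sum_mono])
    fix S assume S: "S \<in> K"
    have "\<bar>(u S x0 - u S x1) * u S x\<bar> \<le> (if i \<in> S then 2 * (ub S)\<^sup>2 else 0)"
    proof (cases "i \<in> S")
      case True
      have "\<bar>u S x0 - u S x1\<bar> \<le> 2 * ub S" using u_le_ub[OF S x(1)] u_le_ub[OF S x(2)] by linarith
      then have "\<bar>u S x0 - u S x1\<bar> * \<bar>u S x\<bar> \<le> (2 * ub S) * ub S"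
        using u_le_ub[OF S xx] ubn by (intro mult_mono) auto
      then show ?thesis using True by (simp add: abs_mult power2_eq_square)
    next
      case False
      have "u S x0 = u S x1" unfolding u_def
      proof (rule prod.cong[OF refl])
        fix j assume "j \<in> S"
        then have "j \<noteq> i" using False by auto
        then show "x0 j = x1 j" by (rule eq)
      qed
      then show ?thesis using False by simp
    qed
    from mult_left_mono[OF this ov.snr_nonneg[OF S, of r]]
    show "\<bar>?s S * (u S x0 - u S x1) * u S x\<bar> \<le> ?s S * (if i \<in> S then 2 * (ub S)\<^sup>2 else 0)"
      using ov.snr_nonneg[OF S, of r] by (simp add: abs_mult mult.assoc)
  qed
  also have "\<dots> \<le> sens r"
  proof -
    have "(\<Sum>S\<in>Kp. ?s S * (if i \<in> S then 2 * (ub S)\<^sup>2 else 0)) = (\<Sum>S\<in>Kp. if i \<in> S then coef2 p N / \<Delta> * (2 * (C ^ p)\<^sup>2) else 0)"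
      by (intro sum.cong refl) (use Kp_J in \<open>auto simp: ov_snr snrs_Kp ub_def\<close>)
    also have "\<dots> = (\<Sum>S\<in>{S \<in> Kp. i \<in> S}. coef2 p N / \<Delta> * (2 * (C ^ p)\<^sup>2))"
      using finite_Kp by (rule sum.inter_filter[symmetric])
    also have "\<dots> = (coef2 p N * real (card {S \<in> Kp. i \<in> S})) * (2 * (C ^ p)\<^sup>2 / \<Delta>)" by simp
    also have "\<dots> \<le> 1 * (2 * (C ^ p)\<^sup>2 / \<Delta>)"
      using \<Delta> by (intro mult_right_mono coef2_card_containing) auto
    finally have 1: "(\<Sum>S\<in>Kp. ?s S * (if i \<in> S then 2 * (ub S)\<^sup>2 else 0)) \<le> 2 * (C ^ p)\<^sup>2 / \<Delta>" by simp
    have "(\<Sum>j<N. ?s {j} * (if i \<in> {j} then 2 * (ub {j})\<^sup>2 else 0)) = (\<Sum>j<N. if j = i then 2 * r\<^sup>2 * C\<^sup>2 else 0)"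
      by (intro sum.cong refl) (auto simp: ov_snr snrs_single ub_def single_in_J)
    also have "\<dots> = 2 * r\<^sup>2 * C\<^sup>2" using i by simp
    finally show ?thesis using 1 unfolding sum_K sens_def by linarith
  qed
  finally show "\<bar>expo ?s (shift ?s x0 z) x - expo ?s (shift ?s x1 z) x\<bar> \<le> sens r" .
qed

text \<open>The noise at fixed signal, and the signal after averaging over the noise, each
  contribute a variance of order \<open>N\<close>. Young's inequality with \<open>t = sqrt N\<close>
  turns these into a mean absolute deviation of order \<open>sqrt N\<close>, and division by
  \<open>N\<close> gives the rate.\<close>

lemma free_energy_deviation:
  "noise_exp (\<lambda>x0 z. \<bar>ov.logZ r x0 z - ov.\<nu> r\<bar>)
    \<le> (1 + ((C ^ p)\<^sup>2 / \<Delta> + r\<^sup>2 * C\<^sup>2 + (sens r)\<^sup>2) / 2) / sqrt (real N)"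
proof -
  define s where "s = ov.snr r"
  define L where "L x0 z = ln (Z s (shift s x0 z))" for x0 z
  define F where "F x0 = (\<integral>z. L x0 z \<partial>gaussK K)" for x0
  define \<mu> where "\<mu> = (\<Sum>x0\<in>\<Omega>. w x0 * F x0)"
  define t where "t = sqrt (real N)"
  define V1 where "V1 = (C ^ p)\<^sup>2 / \<Delta> + r\<^sup>2 * C\<^sup>2"
  have t: "t > 0" "t * t = real N" using N by (auto simp: t_def)
  have sn: "s k \<ge> 0" if "k \<in> K" for k unfolding s_def by (rule ov.snr_nonneg[OF that])
  have tL: "tame K (L x0)" for x0 unfolding L_def by (rule tame_shift[OF tame_ln_Z[OF sn]])
  have \<mu>: "free_energy s = \<mu>" unfolding free_energy_def planted_shift \<mu>_def F_def L_def ..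
  have varz: "integrable (gaussK K) (\<lambda>z. (L x0 z - F x0)\<^sup>2)" "(\<integral>z. (L x0 z - F x0)\<^sup>2 \<partial>gaussK K) \<le> real N * V1" for x0
  proof -
    show "integrable (gaussK K) (\<lambda>z. (L x0 z - F x0)\<^sup>2)"
      unfolding F_def L_def by (rule ln_Z_noise_variance(1)[OF u_le_ub sn])
    have "(\<integral>z. (L x0 z - F x0)\<^sup>2 \<partial>gaussK K) \<le> (\<Sum>S\<in>K. s S * (ub S)\<^sup>2)"
      unfolding F_def L_def by (rule ln_Z_noise_variance(2)[OF u_le_ub sn])
    also have "\<dots> \<le> real N * V1" unfolding s_def V1_def by (rule sum_snr_ub)
    finally show "(\<integral>z. (L x0 z - F x0)\<^sup>2 \<partial>gaussK K) \<le> real N * V1" .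
  qed
  have \<tau>\<Omega>: "\<tau> X \<in> \<Omega>" for X unfolding \<tau>_def \<Omega>_def using T_V by auto
  have dF: "\<bar>F x1 - F x2\<bar> \<le> sens r"
    if x: "x1 \<in> \<Omega>" "x2 \<in> \<Omega>" "\<And>j. j \<noteq> i \<Longrightarrow> x1 j = x2 j" "i < N" for x1 x2 i
  proof -
    have i1: "integrable (gaussK K) (L x1)" and i2: "integrable (gaussK K) (L x2)"
      by (rule tame_integrable[OF finite_K tL])+
    have "F x1 - F x2 = (\<integral>z. L x1 z - L x2 z \<partial>gaussK K)"
      unfolding F_def by (rule Bochner_Integration.integral_diff[OF i1 i2, symmetric])
    then have "\<bar>F x1 - F x2\<bar> \<le> (\<integral>z. \<bar>L x1 z - L x2 z\<bar> \<partial>gaussK K)"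
      using integral_abs_bound[of "gaussK K" "\<lambda>z. L x1 z - L x2 z"] by simp
    also have "\<dots> \<le> (\<integral>z. sens r \<partial>gaussK K)"
    proof (rule integral_mono)
      show "integrable (gaussK K) (\<lambda>z. \<bar>L x1 z - L x2 z\<bar>)"
        by (rule tame_integrable[OF finite_K tame_abs[OF tame_diff[OF tL tL]]])
      show "integrable (gaussK K) (\<lambda>z. sens r)" by (rule tame_integrable[OF finite_K tame_const])
      show "\<bar>L x1 z - L x2 z\<bar> \<le> sens r" for z
        unfolding L_def s_def by (rule signal_sensitivity[OF x])
    qed
    finally show ?thesis by (simp add: prob_space.prob_space)
  qed
  have varx: "(\<Sum>x0\<in>\<Omega>. w x0 * (F x0 - \<mu>)\<^sup>2) \<le> real N * (sens r)\<^sup>2"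
  proof -
    have pp: "prob_space PX" by unfold_locales
    obtain A where A: "A \<ge> 1" "\<And>x. x \<in> \<Omega> \<Longrightarrow> \<bar>F x\<bar> \<le> A" using gibbs_abs_exists[of F] by blast
    have intF: "(\<integral>X. g (F (\<tau> X)) \<partial>PiM {..<N} (\<lambda>_. PX)) = (\<Sum>x0\<in>\<Omega>. w x0 * g (F x0))" for g
      using integral_discrete[OF prob_P \<tau>_meas w_\<tau>, of "\<lambda>x. g (F x)"] unfolding P_def .
    \<comment> \<open>The averaged free energy is viewed as a function of the \<open>N\<close>
      independent draws from \<open>PX\<close>, through \<open>\<tau>\<close>. It is bounded, so the
      growth function can be zero.\<close>
    have "(\<integral>X. (F (\<tau> X) - (\<integral>X. F (\<tau> X) \<partial>PiM {..<N} (\<lambda>_. PX)))\<^sup>2 \<partial>PiM {..<N} (\<lambda>_. PX)) \<le> (\<Sum>i<N. \<integral>y. (sens r)\<^sup>2 \<partial>PX)"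
    proof (rule efron_stein[OF pp, where g = "\<lambda>_. 0" and A = A and ?y0.0 = 0])
      show "(\<lambda>X. F (\<tau> X)) \<in> borel_measurable (PiM {..<N} (\<lambda>_. PX))"
        using borel_measurable_integrable[OF integrable_discrete[OF prob_P \<tau>_meas w_\<tau>, of F]] unfolding P_def .
      show "\<bar>F (\<tau> X)\<bar> \<le> A + (\<Sum>i<N. \<bar>0\<bar>)" for X using A(2)[OF \<tau>\<Omega>[of X]] by simp
      fix X i and y :: real assume i: "i \<in> {..<N}"
      show "\<bar>F (\<tau> (X(i := y))) - F (\<tau> (X(i := 0)))\<bar> \<le> sens r"
      proof (rule dF[OF \<tau>\<Omega> \<tau>\<Omega>])
        show "\<tau> (X(i := y)) j = \<tau> (X(i := 0)) j" if "j \<noteq> i" for j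
          using that by (simp add: \<tau>_def restrict_def)
        show "i < N" using i by simp
      qed
    qed simp_all
    also have "\<dots> = real N * (sens r)\<^sup>2" using prob_space by simp
    finally show ?thesis unfolding intF[of "\<lambda>x. x"] intF[of "\<lambda>x. (x - _)\<^sup>2"] \<mu>_def .
  qed
  have "noise_exp (\<lambda>x0 z. \<bar>L x0 z - \<mu>\<bar>) \<le> (\<Sum>x0\<in>\<Omega>. w x0 * (t + (real N * V1) / (2 * t) + (F x0 - \<mu>)\<^sup>2 / (2 * t)))"
    unfolding noise_exp_def
  proof (intro sum_mono mult_left_mono w_nonneg)
    fix x0 assume "x0 \<in> \<Omega>"
    have "(\<integral>z. \<bar>L x0 z - \<mu>\<bar> \<partial>gaussK K) \<le> (\<integral>z. (t + (F x0 - \<mu>)\<^sup>2 / (2 * t)) + (L x0 z - F x0)\<^sup>2 / (2 * t) \<partial>gaussK K)"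
    proof (rule integral_mono)
      show "integrable (gaussK K) (\<lambda>z. \<bar>L x0 z - \<mu>\<bar>)" by (rule tame_integrable[OF finite_K tame_abs[OF tame_diff[OF tL tame_const]]])
      show "integrable (gaussK K) (\<lambda>z. (t + (F x0 - \<mu>)\<^sup>2 / (2 * t)) + (L x0 z - F x0)\<^sup>2 / (2 * t))"
        by (rule Bochner_Integration.integrable_add[OF tame_integrable[OF finite_K tame_const] integrable_divide[OF varz(1)]])
      show "\<bar>L x0 z - \<mu>\<bar> \<le> (t + (F x0 - \<mu>)\<^sup>2 / (2 * t)) + (L x0 z - F x0)\<^sup>2 / (2 * t)" for z
        using abs_le_young[OF t(1), of "L x0 z - F x0"] abs_le_young[OF t(1), of "F x0 - \<mu>"] by linarith
    qed
    also have "\<dots> = (t + (F x0 - \<mu>)\<^sup>2 / (2 * t)) + (\<integral>z. (L x0 z - F x0)\<^sup>2 \<partial>gaussK K) / (2 * t)"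
      by (subst Bochner_Integration.integral_add[OF tame_integrable[OF finite_K tame_const] integrable_divide[OF varz(1)]])
        (simp add: prob_space.prob_space)
    also have "\<dots> \<le> (t + (F x0 - \<mu>)\<^sup>2 / (2 * t)) + (real N * V1) / (2 * t)"
      using t(1) by (intro add_left_mono divide_right_mono varz(2)) auto
    finally show "(\<integral>z. \<bar>L x0 z - \<mu>\<bar> \<partial>gaussK K) \<le> t + (real N * V1) / (2 * t) + (F x0 - \<mu>)\<^sup>2 / (2 * t)" by simp
  qed
  also have "\<dots> = t + (real N * V1) / (2 * t) + (\<Sum>x0\<in>\<Omega>. w x0 * (F x0 - \<mu>)\<^sup>2) / (2 * t)"
    unfolding distrib_left sum.distrib sum_distrib_right[symmetric] times_divide_eq_right sum_divide_distrib[symmetric] by (simp add: sum_w sum_distrib_right[symmetric] sum_divide_distrib[symmetric])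
  also have "\<dots> \<le> t + (real N * V1) / (2 * t) + (real N * (sens r)\<^sup>2) / (2 * t)"
    using t(1) by (intro add_left_mono divide_right_mono varx) auto
  also have "\<dots> = t * (1 + (V1 + (sens r)\<^sup>2) / 2)"
    using t unfolding t(2)[symmetric] by (simp add: field_simps)
  finally have main: "noise_exp (\<lambda>x0 z. \<bar>L x0 z - \<mu>\<bar>) \<le> t * (1 + (V1 + (sens r)\<^sup>2) / 2)" .
  have "noise_exp (\<lambda>x0 z. \<bar>ov.logZ r x0 z - ov.\<nu> r\<bar>) = noise_exp (\<lambda>x0 z. (1 / real N) * \<bar>L x0 z - \<mu>\<bar>)"
  proof -
    have "ov.logZ r x0 z - ov.\<nu> r = (1 / real N) * (L x0 z - \<mu>)" for x0 z
      unfolding ov.logZ_def ov.\<nu>_def ov_n s_def[symmetric] L_def \<mu> by (simp add: diff_divide_distrib)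
    then show ?thesis by (simp add: abs_mult)
  qed
  also have "\<dots> = noise_exp (\<lambda>x0 z. \<bar>L x0 z - \<mu>\<bar>) / real N" unfolding noise_exp_cmult by simp
  also have "\<dots> \<le> (t * (1 + (V1 + (sens r)\<^sup>2) / 2)) / (t * t)"
    unfolding t(2)[symmetric] using t(1) by (intro divide_right_mono main) simp
  also have "\<dots> = (1 + (V1 + (sens r)\<^sup>2) / 2) / t" using t(1) by simp
  finally show ?thesis unfolding V1_def t_def .
qed

text \<open>The tangent starts at the full tensor with side strength \<open>r\<^sup>2\<close> and
  ends at no tensor with strength \<open>r\<^sup>2 + m ^ (p - 1) / \<Delta>\<close>. Per coordinate
  it gains \<open>m ^ p / (2 * \<Delta>)\<close> from the side channel and loses at most about
  \<open>m ^ p / (2 * p * \<Delta>)\<close> with the tensor; the difference is the correction term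
  of the potential. The bound on \<open>m\<close> by the second moment is recorded because the
  potentials of two priors are later compared only on a bounded range.\<close>

lemma upper_bound:
  assumes a: "a > 0" and M: "M > 0" and t: "t > 0"
  defines "\<delta> \<equiv> a / real M"
  defines "v \<equiv> (1 + ((C ^ p)\<^sup>2 / \<Delta> + (3 * a)\<^sup>2 * C\<^sup>2 + (sens (3 * a))\<^sup>2) / 2) / sqrt (real N)"
  defines "Vr \<equiv> 2 * C\<^sup>2 / (a * \<delta>) * (ln 2 / real N + 5 * C\<^sup>2 * \<delta>\<^sup>2 + 4 * v)"
  shows "\<exists>m\<ge>0. m \<le> (\<integral>y. (T y)\<^sup>2 \<partial>PX) \<and> free_energy (snrs 1 0) / real N
    \<le> psi PX T (m ^ (p - 1) / \<Delta>) - (real p - 1) / (2 * real p * \<Delta>) * m ^ p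
      + 2 * a\<^sup>2 * C\<^sup>2 + (C\<^sup>2) ^ (p - 1) * (t / 2 + Vr / (2 * t)) / (2 * \<Delta>) + real p * (C\<^sup>2) ^ p / (2 * \<Delta> * real N)"
proof -
  have vb: "noise_exp (\<lambda>x0 z. \<bar>ov.logZ \<rho> x0 z - ov.\<nu> \<rho>\<bar>) \<le> v" if \<rho>: "0 \<le> \<rho>" "\<rho> \<le> 3 * a" for \<rho>
  proof -
    have sq: "\<rho>\<^sup>2 \<le> (3 * a)\<^sup>2" using \<rho> by (intro power_mono) auto
    have 1: "\<rho>\<^sup>2 * C\<^sup>2 \<le> (3 * a)\<^sup>2 * C\<^sup>2" using sq by (intro mult_right_mono) auto
    have s0: "0 \<le> sens \<rho>" unfolding sens_def using \<Delta> by simp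
    have "sens \<rho> \<le> sens (3 * a)" unfolding sens_def mult.assoc using 1 by linarith
    then have 2: "(sens \<rho>)\<^sup>2 \<le> (sens (3 * a))\<^sup>2" using s0 by (intro power_mono) auto
    have "noise_exp (\<lambda>x0 z. \<bar>ov.logZ \<rho> x0 z - ov.\<nu> \<rho>\<bar>)
        \<le> (1 + ((C ^ p)\<^sup>2 / \<Delta> + \<rho>\<^sup>2 * C\<^sup>2 + (sens \<rho>)\<^sup>2) / 2) / sqrt (real N)" by (rule free_energy_deviation)
    also have "\<dots> \<le> v" unfolding v_def using 1 2 by (intro divide_right_mono) auto
    finally show ?thesis .
  qed
  obtain r where r: "a \<le> r" "r \<le> 2 * a" and var: "ov.var r \<le> Vr"
    using ov.overlap_concentration[OF a M, of \<delta> v] vb unfolding Vr_def ov_n \<delta>_def by blast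
  define m where "m = ov.m r"
  have m0: "m \<ge> 0" unfolding m_def by (rule ov.m_nonneg)
  define g where "g = m ^ (p - 1) / \<Delta>"
  have g0: "g \<ge> 0" unfolding g_def using m0 \<Delta> by simp
  have sn: "snrs t h k \<ge> 0" if "t \<ge> 0" "h \<ge> 0" for t h k by (rule snrs_nonneg[OF that])
  have sec: "info s (u {i}) \<le> (\<integral>y. (T y)\<^sup>2 \<partial>PX)" if "i < N" "\<And>k. s k \<ge> 0" for s i
  proof -
    have "info s (u {i}) \<le> (\<Sum>x\<in>\<Omega>. w x * (u {i} x)\<^sup>2)" by (rule info_le_second_moment[OF that(2)])
    also have "\<dots> = (\<Sum>v\<in>V. q v * v\<^sup>2)" using marginal[OF that(1), of "\<lambda>v. v\<^sup>2"] by simp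
    finally show ?thesis by (simp only: integral_T[of "\<lambda>v. v\<^sup>2"])
  qed
  have T2: "(\<integral>y. (T y)\<^sup>2 \<partial>PX) \<le> C\<^sup>2"
  proof -
    have "(\<integral>y. (T y)\<^sup>2 \<partial>PX) \<le> (\<Sum>v\<in>V. q v * C\<^sup>2)" unfolding integral_T[of "\<lambda>v. v\<^sup>2"]
      by (intro sum_mono mult_left_mono q_nonneg) (auto intro!: abs_le_imp_sq V_C)
    then show ?thesis by (simp add: sum_distrib_right[symmetric] sum_q)
  qed
  have mi: "(\<Sum>i<N. info (snrs 1 (r\<^sup>2)) (u {i})) = real N * m"
    unfolding m_def ov.m_eq_info ov_n sum_J ov_snr using N by simp
  have m_le: "m \<le> (\<integral>y. (T y)\<^sup>2 \<partial>PX)"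
  proof -
    have "real N * m \<le> (\<Sum>i<N. (\<integral>y. (T y)\<^sup>2 \<partial>PX))"
      unfolding mi[symmetric] by (intro sum_mono sec sn) auto
    then show ?thesis using N by simp
  qed
  define E where "E = real p * (C\<^sup>2) ^ p"
  define W where "W = real p * (C\<^sup>2) ^ (p - 1) * (t / 2 + Vr / (2 * t))"
  \<comment> \<open>Summed over the entries, the product of a monomial at the signal and at the
    posterior sample is an elementary symmetric polynomial in the products of coordinates, hence the
    \<open>p\<close>-th power of the overlap up to \<open>E\<close>.\<close>
  have "coef2 p N * (\<Sum>S\<in>Kp. info (snrs 1 (r\<^sup>2)) (u S)) \<le> real N / real p * (m ^ p + W) + E"
  proof -
    have ovl: "ov.overlap x x0 = (\<Sum>i<N. x i * x0 i) / real N" for x x0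
      unfolding ov.overlap_def ov_n sum_J by simp
    have "(\<Sum>S\<in>Kp. info (snrs 1 (r\<^sup>2)) (u S)) = noise_exp (\<lambda>x0 z. \<Sum>S\<in>Kp. u S x0 * ov.G r x0 z (u S))"
      unfolding ov_snr[symmetric] ov.info_snr planted_noise_exp
      by (rule noise_exp_sum[symmetric]) (rule tame_cmult[OF tame_gibbs_shift])
    also have "\<dots> = noise_exp (\<lambda>x0 z. ov.G r x0 z (\<lambda>x. elem_sym p {..<N} (\<lambda>i. x i * x0 i)))"
    proof -
      have "elem_sym p {..<N} (\<lambda>i. x i * x0 i) = (\<Sum>S\<in>Kp. u S x0 * u S x)" for x x0
        unfolding sum_Kp_prod[symmetric] u_def by (simp add: prod.distrib mult.commute)
      then show ?thesis by (simp only: gibbs_sum gibbs_cmult)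
    qed
    finally have "coef2 p N * (\<Sum>S\<in>Kp. info (snrs 1 (r\<^sup>2)) (u S))
        = noise_exp (\<lambda>x0 z. coef2 p N * ov.G r x0 z (\<lambda>x. elem_sym p {..<N} (\<lambda>i. x i * x0 i)))"
      by (simp only: noise_exp_cmult)
    also have "\<dots> \<le> noise_exp (\<lambda>x0 z. real N / real p * ov.G r x0 z (\<lambda>x. ov.overlap x x0 ^ p) + E)"
    proof (rule noise_exp_mono[OF tame_cmult[OF tame_gibbs_shift] tame_add[OF tame_cmult[OF tame_gibbs_shift] tame_const]])
      fix x0 z assume x0: "x0 \<in> \<Omega>"
      have "ov.G r x0 z (\<lambda>x. coef2 p N * elem_sym p {..<N} (\<lambda>i. x i * x0 i))
          \<le> ov.G r x0 z (\<lambda>x. real N / real p * ov.overlap x x0 ^ p + E)"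
      proof (rule gibbs_mono)
        fix x assume x: "x \<in> \<Omega>"
        have "\<bar>x i * x0 i\<bar> \<le> C\<^sup>2" if "i \<in> {..<N}" for i
          unfolding abs_mult power2_eq_square using that \<Omega>_bound[OF x] \<Omega>_bound[OF x0] C_nonneg
          by (intro mult_mono) auto
        then have "\<bar>coef2 p N * elem_sym p {..<N} (\<lambda>i. x i * x0 i) - real N / real p * ((\<Sum>i<N. x i * x0 i) / real N) ^ p\<bar> \<le> E"
          unfolding E_def using N p by (intro coef2_elem_sym_approx) auto
        then show "coef2 p N * elem_sym p {..<N} (\<lambda>i. x i * x0 i) \<le> real N / real p * ov.overlap x x0 ^ p + E"
          unfolding ovl by linarith
      qed
      then show "coef2 p N * ov.G r x0 z (\<lambda>x. elem_sym p {..<N} (\<lambda>i. x i * x0 i))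
          \<le> real N / real p * ov.G r x0 z (\<lambda>x. ov.overlap x x0 ^ p) + E"
        by (simp only: gibbs_cmult gibbs_add gibbs_const)
    qed
    also have "\<dots> = real N / real p * planted (ov.snr r) (\<lambda>x0 z. gibbs (ov.snr r) z (\<lambda>x. ov.overlap x x0 ^ p)) + E"
      unfolding noise_exp_add[OF tame_cmult[OF tame_gibbs_shift] tame_const] noise_exp_cmult noise_exp_const planted_noise_exp ..
    also have "\<dots> \<le> real N / real p * (m ^ p + W) + E"
    proof (intro add_right_mono mult_left_mono)
      have "planted (ov.snr r) (\<lambda>x0 z. gibbs (ov.snr r) z (\<lambda>x. ov.overlap x x0 ^ p))
          \<le> m ^ p + real p * (C\<^sup>2) ^ (p - 1) * (t / 2 + ov.var r / (2 * t))"
        unfolding m_def by (rule ov.overlap_power_le[OF t])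
      also have "real p * (C\<^sup>2) ^ (p - 1) * (t / 2 + ov.var r / (2 * t)) \<le> W"
        unfolding W_def using var t by (intro mult_left_mono add_left_mono divide_right_mono) auto
      finally show "planted (ov.snr r) (\<lambda>x0 z. gibbs (ov.snr r) z (\<lambda>x. ov.overlap x x0 ^ p)) \<le> m ^ p + W" by simp
    qed simp
    finally show ?thesis .
  qed
  then have pair: "(coef2 p N * (\<Sum>S\<in>Kp. info (snrs 1 (r\<^sup>2)) (u S))) / (2 * \<Delta>) \<le> (real N / real p * (m ^ p + W) + E) / (2 * \<Delta>)"
    using \<Delta> by (intro divide_right_mono) auto
  have "free_energy (snrs 0 (r\<^sup>2 + g)) \<ge> free_energy (snrs 1 (r\<^sup>2))
      + (\<Sum>S\<in>K. (snrs 0 (r\<^sup>2 + g) S - snrs 1 (r\<^sup>2) S) * info (snrs 1 (r\<^sup>2)) (u S) / 2)"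
    by (rule free_energy_tangent) (use g0 in \<open>auto intro!: sn\<close>)
  also have "(\<Sum>S\<in>K. (snrs 0 (r\<^sup>2 + g) S - snrs 1 (r\<^sup>2) S) * info (snrs 1 (r\<^sup>2)) (u S) / 2)
      = g / 2 * (real N * m) - (coef2 p N * (\<Sum>S\<in>Kp. info (snrs 1 (r\<^sup>2)) (u S))) / (2 * \<Delta>)"
  proof -
    have "(\<Sum>S\<in>Kp. (snrs 0 (r\<^sup>2 + g) S - snrs 1 (r\<^sup>2) S) * info (snrs 1 (r\<^sup>2)) (u S) / 2)
        = (\<Sum>S\<in>Kp. - (coef2 p N / (2 * \<Delta>)) * info (snrs 1 (r\<^sup>2)) (u S))"
      by (intro sum.cong refl) (simp add: snrs_Kp)
    moreover have "(\<Sum>i<N. (snrs 0 (r\<^sup>2 + g) {i} - snrs 1 (r\<^sup>2) {i}) * info (snrs 1 (r\<^sup>2)) (u {i}) / 2)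
        = (\<Sum>i<N. g / 2 * info (snrs 1 (r\<^sup>2)) (u {i}))"
      by (intro sum.cong refl) (simp add: snrs_single)
    ultimately show ?thesis unfolding sum_K sum_distrib_left[symmetric] mi by simp
  qed
  finally have 1: "free_energy (snrs 1 (r\<^sup>2)) + (g / 2 * (real N * m) - (coef2 p N * (\<Sum>S\<in>Kp. info (snrs 1 (r\<^sup>2)) (u S))) / (2 * \<Delta>))
      \<le> free_energy (snrs 0 (r\<^sup>2 + g))" .
  \<comment> \<open>The tangent at the absent side channel has nonnegative slope, so adding the side
    channel does not lower the free energy.\<close>
  have "free_energy (snrs 1 (r\<^sup>2)) \<ge> free_energy (snrs 1 0) + (\<Sum>S\<in>K. (snrs 1 (r\<^sup>2) S - snrs 1 0 S) * info (snrs 1 0) (u S) / 2)"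
    by (rule free_energy_tangent) (auto intro!: sn)
  moreover have "(\<Sum>S\<in>K. (snrs 1 (r\<^sup>2) S - snrs 1 0 S) * info (snrs 1 0) (u S) / 2) \<ge> 0"
    using ov.info_nonneg by (intro sum_nonneg divide_nonneg_nonneg mult_nonneg_nonneg) (auto simp: snrs_def)
  ultimately have 2: "free_energy (snrs 1 0) \<le> free_energy (snrs 1 (r\<^sup>2))" by linarith
  \<comment> \<open>Taking the surplus \<open>r\<^sup>2\<close> out of the decoupled point costs at
    most \<open>r\<^sup>2 / 2\<close> times \<open>C\<^sup>2\<close> per coordinate, and
    \<open>r \<le> 2 * a\<close>.\<close>
  have "free_energy (snrs 0 g) \<ge> free_energy (snrs 0 (r\<^sup>2 + g))
      + (\<Sum>S\<in>K. (snrs 0 g S - snrs 0 (r\<^sup>2 + g) S) * info (snrs 0 (r\<^sup>2 + g)) (u S) / 2)"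
    by (rule free_energy_tangent) (use g0 in \<open>auto intro!: sn\<close>)
  moreover have "(\<Sum>S\<in>K. (snrs 0 g S - snrs 0 (r\<^sup>2 + g) S) * info (snrs 0 (r\<^sup>2 + g)) (u S) / 2)
      = (\<Sum>i<N. - (r\<^sup>2 / 2) * info (snrs 0 (r\<^sup>2 + g)) (u {i}))"
  proof -
    have "(\<Sum>S\<in>Kp. (snrs 0 g S - snrs 0 (r\<^sup>2 + g) S) * info (snrs 0 (r\<^sup>2 + g)) (u S) / 2) = 0"
      by (intro sum.neutral) (simp add: snrs_Kp)
    moreover have "(\<Sum>i<N. (snrs 0 g {i} - snrs 0 (r\<^sup>2 + g) {i}) * info (snrs 0 (r\<^sup>2 + g)) (u {i}) / 2)
        = (\<Sum>i<N. - (r\<^sup>2 / 2) * info (snrs 0 (r\<^sup>2 + g)) (u {i}))"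
      by (intro sum.cong refl) (simp add: snrs_single)
    ultimately show ?thesis unfolding sum_K by simp
  qed
  moreover have "(\<Sum>i<N. - (r\<^sup>2 / 2) * info (snrs 0 (r\<^sup>2 + g)) (u {i})) \<ge> (\<Sum>i<N. - (2 * a\<^sup>2 * C\<^sup>2))"
  proof (rule sum_mono)
    fix i assume i: "i \<in> {..<N}"
    have "info (snrs 0 (r\<^sup>2 + g)) (u {i}) \<le> C\<^sup>2"
      using sec[of i "snrs 0 (r\<^sup>2 + g)"] T2 i sn[of 0 "r\<^sup>2 + g"] g0 by force
    moreover have "r\<^sup>2 \<le> (2 * a)\<^sup>2" using r a by (intro power_mono) auto
    ultimately have "r\<^sup>2 * info (snrs 0 (r\<^sup>2 + g)) (u {i}) \<le> (2 * a)\<^sup>2 * C\<^sup>2"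
      using ov.info_nonneg by (intro mult_mono) auto
    then show "- (2 * a\<^sup>2 * C\<^sup>2) \<le> - (r\<^sup>2 / 2) * info (snrs 0 (r\<^sup>2 + g)) (u {i})"
      by (simp add: power_mult_distrib)
  qed
  ultimately have 3: "free_energy (snrs 0 (r\<^sup>2 + g)) \<le> real N * psi PX T g + real N * (2 * a\<^sup>2 * C\<^sup>2)"
    unfolding free_energy_decoupled[OF g0] by simp
  have gm: "g / 2 * (real N * m) = real N * (m ^ p / (2 * \<Delta>))"
  proof -
    have "m ^ (p - 1) * m = m ^ p" using p by (cases p) auto
    show ?thesis unfolding g_def \<open>m ^ (p - 1) * m = m ^ p\<close>[symmetric] using \<Delta> by (simp add: field_simps)
  qed
  have 4: "(real N / real p * (m ^ p + W) + E) / (2 * \<Delta>) - real N * (m ^ p / (2 * \<Delta>))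
      = real N * (W / (2 * real p * \<Delta>) - (real p - 1) / (2 * real p * \<Delta>) * m ^ p + E / (2 * \<Delta> * real N))"
    using N p \<Delta> by (simp add: field_simps)
  have "free_energy (snrs 1 0) \<le> real N * psi PX T g + real N * (2 * a\<^sup>2 * C\<^sup>2)
      + real N * (W / (2 * real p * \<Delta>) - (real p - 1) / (2 * real p * \<Delta>) * m ^ p + E / (2 * \<Delta> * real N))"
    using 1 2 3 pair unfolding gm 4[symmetric] by linarith
  also have "\<dots> = real N * (psi PX T g - (real p - 1) / (2 * real p * \<Delta>) * m ^ p + 2 * a\<^sup>2 * C\<^sup>2
      + W / (2 * real p * \<Delta>) + E / (2 * \<Delta> * real N))"
    by (simp only: distrib_left[symmetric] right_diff_distrib[symmetric]) (simp add: algebra_simps)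
  finally have "free_energy (snrs 1 0) / real N \<le> psi PX T g - (real p - 1) / (2 * real p * \<Delta>) * m ^ p + 2 * a\<^sup>2 * C\<^sup>2
      + W / (2 * real p * \<Delta>) + E / (2 * \<Delta> * real N)"
    using N by (simp only: pos_divide_le_eq of_nat_0_less_iff mult.commute[of _ "real N"])
  moreover have "W / (2 * real p * \<Delta>) = (C\<^sup>2) ^ (p - 1) * (t / 2 + Vr / (2 * t)) / (2 * \<Delta>)"
    unfolding W_def using p by simp
  ultimately show ?thesis using m0 m_le unfolding g_def E_def by metis
qed

end

section \<open>Reduction to finitely valued priors\<close>

text \<open>Used with \<open>K\<close> the index set of all channels and \<open>J\<close> that of
  the tensor entries: rescaled and restricted unit noise is the noise of the model.\<close>

lemma distr_PiM_coordinates: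
  fixes \<phi> :: "real \<Rightarrow> real"
  assumes K: "finite K" and J: "J \<subseteq> K" and M: "prob_space M" and \<phi> [measurable]: "\<phi> \<in> measurable M M'"
  shows "distr (PiM K (\<lambda>_. M)) (PiM J (\<lambda>_. distr M M' \<phi>)) (\<lambda>z. \<lambda>k\<in>J. \<phi> (z k)) = PiM J (\<lambda>_. distr M M' \<phi>)"
proof -
  interpret M: prob_space M by fact
  interpret D: prob_space "distr M M' \<phi>" by (rule M.prob_space_distr) simp
  interpret PD: product_sigma_finite "\<lambda>_. distr M M' \<phi>"
    by (simp add: product_sigma_finite_def D.sigma_finite_measure_axioms)
  interpret PM: product_sigma_finite "\<lambda>_. M"
    by (simp add: product_sigma_finite_def M.sigma_finite_measure_axioms)
  have fJ: "finite J" by (rule finite_subset[OF J K])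
  have kK: "(\<lambda>z. z k) \<in> measurable (PiM K (\<lambda>_. M)) M" if "k \<in> J" for k
    by (rule measurable_component_singleton[OF subsetD[OF J that]])
  have meas: "(\<lambda>z. \<lambda>k\<in>J. \<phi> (z k)) \<in> measurable (PiM K (\<lambda>_. M)) (PiM J (\<lambda>_. distr M M' \<phi>))"
  proof (rule measurable_restrict)
    fix k assume "k \<in> J"
    have "(\<lambda>z. \<phi> (z k)) \<in> measurable (PiM K (\<lambda>_. M)) M'" by (rule measurable_compose[OF kK[OF \<open>k \<in> J\<close>] \<phi>])
    then show "(\<lambda>z. \<phi> (z k)) \<in> measurable (PiM K (\<lambda>_. M)) (distr M M' \<phi>)" by simp
  qed
  show ?thesis
  proof (rule PD.PiM_eqI[OF fJ])
    fix A assume A: "\<And>k. k \<in> J \<Longrightarrow> A k \<in> sets (distr M M' \<phi>)"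
    let ?B = "\<lambda>k. if k \<in> J then \<phi> -` A k \<inter> space M else space M"
    have "(\<lambda>z. \<lambda>k\<in>J. \<phi> (z k)) -` PiE J A \<inter> space (PiM K (\<lambda>_. M)) = PiE K ?B"
    proof (rule set_eqI)
      fix z
      have "(\<forall>k\<in>K. z k \<in> ?B k) \<longleftrightarrow> (\<forall>k\<in>J. \<phi> (z k) \<in> A k) \<and> (\<forall>k\<in>K. z k \<in> space M)"
      proof (intro iffI conjI ballI)
        assume l: "\<forall>k\<in>K. z k \<in> ?B k"
        show "\<phi> (z k) \<in> A k" if "k \<in> J" for k using bspec[OF l subsetD[OF J that]] that by simp
        show "z k \<in> space M" if "k \<in> K" for k using bspec[OF l that] by (simp split: if_splits)
      next
        fix k assume "(\<forall>k\<in>J. \<phi> (z k) \<in> A k) \<and> (\<forall>k\<in>K. z k \<in> space M)" "k \<in> K"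
        then show "z k \<in> ?B k" by simp
      qed
      moreover have "z \<in> (\<lambda>z. \<lambda>k\<in>J. \<phi> (z k)) -` PiE J A \<inter> space (PiM K (\<lambda>_. M))
        \<longleftrightarrow> (\<forall>k\<in>J. \<phi> (z k) \<in> A k) \<and> (\<forall>k\<in>K. z k \<in> space M) \<and> z \<in> extensional K"
        by (simp add: space_PiM PiE_iff)
      ultimately show "z \<in> (\<lambda>z. \<lambda>k\<in>J. \<phi> (z k)) -` PiE J A \<inter> space (PiM K (\<lambda>_. M)) \<longleftrightarrow> z \<in> PiE K ?B"
        unfolding PiE_iff by (simp only: conj_assoc)
    qed
    then have "emeasure (distr (PiM K (\<lambda>_. M)) (PiM J (\<lambda>_. distr M M' \<phi>)) (\<lambda>z. \<lambda>k\<in>J. \<phi> (z k))) (PiE J A)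
        = emeasure (PiM K (\<lambda>_. M)) (PiE K ?B)"
      using A fJ by (subst emeasure_distr[OF meas]) (auto intro!: sets_PiM_I_finite)
    also have "\<dots> = (\<Prod>k\<in>K. emeasure M (?B k))"
      using A by (intro PM.emeasure_PiM[OF K]) (auto intro: measurable_sets[OF \<phi>])
    also have "\<dots> = (\<Prod>k\<in>J. emeasure M (?B k))"
      using J K by (intro prod.mono_neutral_right) (auto simp: M.emeasure_space_1)
    also have "\<dots> = (\<Prod>k\<in>J. emeasure (distr M M' \<phi>) (A k))"
      using A by (intro prod.cong refl) (simp add: emeasure_distr)
    finally show "emeasure (distr (PiM K (\<lambda>_. M)) (PiM J (\<lambda>_. distr M M' \<phi>)) (\<lambda>z. \<lambda>k\<in>J. \<phi> (z k))) (PiE J A)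
      = (\<Prod>k\<in>J. emeasure (distr M M' \<phi>) (A k))" .
  qed simp
qed

lemma distr_ngauss_scale:
  assumes "\<Delta> > 0" shows "distr ngauss lborel (\<lambda>x. sqrt \<Delta> * x) = gauss \<Delta>"
proof -
  interpret prob_space ngauss by simp
  have "distributed ngauss lborel (\<lambda>x. x) (normal_density 0 1)"
    unfolding distributed_def by (simp add: ngauss_def distr_id2)
  from normal_density_affine[OF this _ , of "sqrt \<Delta>" 0]
  have "distributed ngauss lborel (\<lambda>x. 0 + sqrt \<Delta> * x) (normal_density 0 (sqrt \<Delta>))" using assms by simp
  then show ?thesis unfolding distributed_def gauss_def by simp
qed

lemma coef_sq:
  assumes N: "N \<ge> 1" and p: "p \<ge> 1" shows "(coef p N)\<^sup>2 = coef2 p N"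
proof -
  have "(real N powr ((real p - 1) / 2))\<^sup>2 = real N powr real (p - 1)"
    using N p by (simp add: power2_eq_square powr_add[symmetric] of_nat_diff)
  also have "\<dots> = real N ^ (p - 1)" using N by (intro powr_realpow) simp
  finally show ?thesis unfolding coef_def coef2_def power_divide by simp
qed

lemma psi_compare:
  assumes PX: "prob_space PX" and f: "f \<in> borel_measurable PX" "integrable PX (\<lambda>x. (f x)\<^sup>2)"
    and g: "g \<in> borel_measurable PX" "integrable PX (\<lambda>x. (g x)\<^sup>2)" and h: "h \<ge> 0" and t: "t > 0"
  shows "psi PX g h - psi PX f h \<ge>
    - ((1 + t) / 2 * (h * (\<integral>x. (g x - f x)\<^sup>2 \<partial>PX))) - h * (\<integral>x. (g x)\<^sup>2 \<partial>PX) / (2 * t)"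
proof -
  have ss: "square_signal PX {()} (\<lambda>_ x. sqrt h * f' x)"
    if "f' \<in> borel_measurable PX" "integrable PX (\<lambda>x. (f' x)\<^sup>2)" for f'
    by (intro square_signal.intro square_signal_axioms.intro PX) (use that in \<open>auto simp: power_mult_distrib\<close>)
  interpret S: square_signal PX "{()}" "\<lambda>_ x. sqrt h * f x" by (rule ss[OF f])
  have "(\<integral>x. (sqrt h * g x - sqrt h * f x)\<^sup>2 \<partial>PX) = h * (\<integral>x. (g x - f x)\<^sup>2 \<partial>PX)"
    unfolding right_diff_distrib[symmetric] power_mult_distrib real_sqrt_pow2[OF h] by simp
  moreover have "(\<integral>x. (sqrt h * g x)\<^sup>2 \<partial>PX) = h * (\<integral>x. (g x)\<^sup>2 \<partial>PX)"
    unfolding power_mult_distrib real_sqrt_pow2[OF h] by simp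
  ultimately show ?thesis
    using S.chan_free_compare[OF ss[OF g] t] unfolding psi_eq_chan_free[OF PX f h] psi_eq_chan_free[OF PX g h] by simp
qed

context spiked
begin

lemma
  fixes f :: "real \<Rightarrow> real"
  assumes S: "S \<subseteq> {..<N}" and f: "integrable PX f"
  shows integrable_prod_P: "integrable P (\<lambda>X. \<Prod>i\<in>S. f (X i))"
    and integral_prod_P: "(\<integral>X. (\<Prod>i\<in>S. f (X i)) \<partial>P) = (\<integral>x. f x \<partial>PX) ^ card S"
proof -
  interpret PS: product_sigma_finite "\<lambda>_::nat. PX"
    by (simp add: product_sigma_finite_def sigma_finite_measure_axioms)
  define F where "F i = (if i \<in> S then f else (\<lambda>_. 1))" for i
  have Fi: "integrable PX (F i)" for i unfolding F_def using f by simp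
  have eq: "(\<Prod>i\<in>S. f (X i)) = (\<Prod>i<N. F i (X i))" for X
  proof -
    have "(\<Prod>i<N. F i (X i)) = (\<Prod>i\<in>S. F i (X i))"
      using S by (intro prod.mono_neutral_right) (auto simp: F_def)
    then show ?thesis by (simp add: F_def)
  qed
  show "integrable P (\<lambda>X. \<Prod>i\<in>S. f (X i))"
    unfolding eq P_def by (rule PS.product_integrable_prod) (auto simp: Fi)
  have "(\<integral>X. (\<Prod>i\<in>S. f (X i)) \<partial>P) = (\<Prod>i<N. \<integral>x. F i x \<partial>PX)"
    unfolding eq P_def by (rule PS.product_integral_prod) (auto simp: Fi)
  also have "\<dots> = (\<Prod>i\<in>S. \<integral>x. F i x \<partial>PX)"
    using S by (intro prod.mono_neutral_right) (auto simp: F_def prob_space[simplified])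
  finally show "(\<integral>X. (\<Prod>i\<in>S. f (X i)) \<partial>P) = (\<integral>x. f x \<partial>PX) ^ card S" by (simp add: F_def)
qed

text \<open>The signal before discretisation, with its normalisation absorbed. The side channels
  stay in the index set with strength zero, so that the original and the discretised model share
  \<open>K\<close>.\<close>

definition sig :: "nat set \<Rightarrow> (nat \<Rightarrow> real) \<Rightarrow> real" where "sig S X = sqrt (snrs 1 0 S) * u S X"

lemma Kp_tuples: "Kp = tuples N p" by (simp add: Kp_def tuples_def)

lemma sqrt_snr_Kp: "S \<in> Kp \<Longrightarrow> sqrt (snrs 1 0 S) = coef p N / sqrt \<Delta>"
proof -
  assume S: "S \<in> Kp"
  have "coef p N \<ge> 0" unfolding coef_def by simp
  moreover have "snrs 1 0 S = (coef p N)\<^sup>2 / \<Delta>" using snrs_Kp[OF S, of 1 0] coef_sq[of N p] N p by simp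
  ultimately show ?thesis by (simp add: real_sqrt_divide)
qed

lemma sum_K_pairwise: "(\<And>i. i < N \<Longrightarrow> f {i} = 0) \<Longrightarrow> (\<Sum>S\<in>K. f S) = (\<Sum>S\<in>Kp. f S)" for f :: "nat set \<Rightarrow> real"
  unfolding sum_K by simp

text \<open>Dividing the observations by \<open>sqrt \<Delta>\<close> gives unit noise, and the
  Hamiltonian becomes the log-likelihood ratio. Only the entries in \<open>Kp\<close> are
  prescribed, as the other channels carry zero signal.\<close>

lemma partition_fn_eq_obs_Z:
  assumes y: "\<And>S. S \<in> Kp \<Longrightarrow> y S = obs p N X0 W S / sqrt \<Delta>"
  shows "partition_fn PX p \<Delta> N (obs p N X0 W) = obs_Z P K sig y"
proof -
  have "hamiltonian p \<Delta> N (obs p N X0 W) X = obs_expo K sig y X" for X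
  proof -
    have "obs_expo K sig y X = (\<Sum>S\<in>Kp. y S * sig S X - (sig S X)\<^sup>2 / 2)"
      unfolding obs_expo_def by (rule sum_K_pairwise) (simp add: sig_def snrs_single)
    also have "\<dots> = (\<Sum>S\<in>Kp. 1 / \<Delta> * (coef p N * obs p N X0 W S * u S X
        - fact (p - 1) / (2 * real N ^ (p - 1)) * (u S X)\<^sup>2))"
    proof (rule sum.cong[OF refl])
      fix S assume S: "S \<in> Kp"
      have c: "fact (p - 1) / (2 * real N ^ (p - 1)) = (coef p N)\<^sup>2 / 2"
        unfolding coef_sq[of N p, OF N order_trans[OF one_le_numeral p]] coef2_def by simp
      have sd: "sqrt \<Delta> * sqrt \<Delta> = \<Delta>" "sqrt \<Delta> > 0" using \<Delta> by simp_all
      have "y S * sig S X = 1 / \<Delta> * (coef p N * obs p N X0 W S * u S X)"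
        unfolding sig_def sqrt_snr_Kp[OF S] y[OF S] using sd by simp
      moreover have "(sig S X)\<^sup>2 = 1 / \<Delta> * ((coef p N)\<^sup>2 * (u S X)\<^sup>2)"
        unfolding sig_def sqrt_snr_Kp[OF S] using \<Delta> by (simp add: power_mult_distrib power_divide)
      ultimately show "y S * sig S X - (sig S X)\<^sup>2 / 2 = 1 / \<Delta> * (coef p N * obs p N X0 W S * u S X
          - fact (p - 1) / (2 * real N ^ (p - 1)) * (u S X)\<^sup>2)"
        unfolding c by (simp add: right_diff_distrib)
    qed
    finally show ?thesis unfolding hamiltonian_def Kp_tuples u_def by (simp add: sum_distrib_left)
  qed
  then show ?thesis unfolding partition_fn_def obs_Z_def P_def by simp
qed

context
  assumes x2: "integrable PX (\<lambda>x. x\<^sup>2)"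
begin

lemma square_signal_sig: "square_signal P K sig"
proof (intro square_signal.intro square_signal_axioms.intro prob_P finite_K)
  fix S assume "S \<in> K"
  then have S: "S \<subseteq> {..<N}" by (auto simp: K_def Kp_def J_def)
  have "integrable P (\<lambda>X. (snrs 1 0 S) * (\<Prod>i\<in>S. (X i)\<^sup>2))"
    by (rule integrable_mult_right[OF integrable_prod_P[OF S x2]])
  then show "integrable P (\<lambda>X. (sig S X)\<^sup>2)"
    unfolding sig_def u_def power_mult_distrib using snrs_nonneg[of 1 0 S] by (simp add: prod_power_distrib)
  have "integrable PX (\<lambda>x. x)" by (rule integrable_of_sq[OF _ x2]) simp
  from borel_measurable_integrable[OF integrable_prod_P[OF S this]]
  show "sig S \<in> borel_measurable P" unfolding sig_def[abs_def] u_def by (intro borel_measurable_times) simp_all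
qed

text \<open>Change of variables between the noise of the model and unit noise on \<open>K\<close>.
  The map \<open>\<phi>\<close> carries the latter to the former; \<open>pr\<close>, which pads with
  zeros, serves to transfer measurability of the integrand to the noise of the model.\<close>

lemma free_entropy_eq_chan_free: "free_entropy PX p \<Delta> N = chan_free P K sig / real N"
proof -
  interpret S: square_signal P K sig by (rule square_signal_sig)
  define G where "G = PiM Kp (\<lambda>_. gauss \<Delta>)"
  define \<phi> where "\<phi> z = (\<lambda>S\<in>Kp. sqrt \<Delta> * z S)" for z :: "nat set \<Rightarrow> real"
  define pr where "pr V = (\<lambda>S\<in>K. if S \<in> Kp then V S / sqrt \<Delta> else 0)" for V :: "nat set \<Rightarrow> real"
  have gauss: "gauss \<Delta> = distr ngauss lborel (\<lambda>x. sqrt \<Delta> * x)" by (rule distr_ngauss_scale[OF \<Delta>, symmetric])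
  have Kp_K: "Kp \<subseteq> K" unfolding K_def by simp
  have sets_gauss: "sets (gauss \<Delta>) = sets borel" by (simp add: gauss_def)
  have G: "distr (gaussK K) G \<phi> = G"
    unfolding G_def gaussK_def \<phi>_def[abs_def] gauss
    by (rule distr_PiM_coordinates[OF finite_K Kp_K prob_space_ngauss]) (simp add: ngauss_def)
  have \<phi>_meas: "\<phi> \<in> measurable (gaussK K) G"
    unfolding \<phi>_def[abs_def] G_def
  proof (rule measurable_restrict)
    fix S assume "S \<in> Kp"
    then have "(\<lambda>z. z S) \<in> borel_measurable (gaussK K)" using Kp_K by (intro S.coord_meas) auto
    then have "(\<lambda>z. sqrt \<Delta> * z S) \<in> borel_measurable (gaussK K)" by simp
    then show "(\<lambda>z. sqrt \<Delta> * z S) \<in> measurable (gaussK K) (gauss \<Delta>)"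
      unfolding measurable_cong_sets[OF refl sets_gauss] .
  qed
  have pr_meas: "pr \<in> measurable G (gaussK K)"
    unfolding pr_def[abs_def] gaussK_def
  proof (rule measurable_restrict)
    fix S
    have "(\<lambda>V. V S) \<in> borel_measurable G" if "S \<in> Kp"
      unfolding measurable_cong_sets[OF refl sets_gauss, symmetric] G_def
      by (rule measurable_component_singleton[OF that])
    then have "(\<lambda>V. if S \<in> Kp then V S / sqrt \<Delta> else 0) \<in> borel_measurable G" by (cases "S \<in> Kp") simp_all
    then show "(\<lambda>V. if S \<in> Kp then V S / sqrt \<Delta> else 0) \<in> measurable G ngauss"
      by (simp add: ngauss_def)
  qed
  let ?F = "\<lambda>X W. ln (partition_fn PX p \<Delta> N (obs p N X W))"
  have Fpr: "?F X W = ln (obs_Z P K sig (obs_of K sig (X, pr W)))" for X W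
  proof (intro arg_cong[of _ _ ln] partition_fn_eq_obs_Z)
    fix S assume S: "S \<in> Kp"
    then have "S \<in> K" using Kp_K by auto
    then show "obs_of K sig (X, pr W) S = obs p N X W S / sqrt \<Delta>"
      unfolding obs_of_def pr_def sig_def sqrt_snr_Kp[OF S] obs_def u_def using S by (simp add: add_divide_distrib sqrt_snr_Kp)
  qed
  have F\<phi>: "?F X (\<phi> z) = ln (obs_Z P K sig (obs_of K sig (X, z)))" for X z
  proof (intro arg_cong[of _ _ ln] partition_fn_eq_obs_Z)
    fix S assume S: "S \<in> Kp"
    then have "S \<in> K" using Kp_K by auto
    then show "obs_of K sig (X, z) S = obs p N X (\<phi> z) S / sqrt \<Delta>"
      unfolding obs_of_def \<phi>_def sig_def sqrt_snr_Kp[OF S] obs_def u_def using S \<Delta> by (simp add: add_divide_distrib sqrt_snr_Kp)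
  qed
  have pair_pr: "(\<lambda>XW. (fst XW, pr (snd XW))) \<in> measurable (P \<Otimes>\<^sub>M G) (P \<Otimes>\<^sub>M gaussK K)"
    by (intro measurable_Pair measurable_fst measurable_compose[OF measurable_snd pr_meas])
  have pair_\<phi>: "(\<lambda>Xz. (fst Xz, \<phi> (snd Xz))) \<in> measurable (P \<Otimes>\<^sub>M gaussK K) (P \<Otimes>\<^sub>M G)"
    by (intro measurable_Pair measurable_fst measurable_compose[OF measurable_snd \<phi>_meas])
  have "(\<lambda>XW. ln (obs_Z P K sig (obs_of K sig (fst XW, pr (snd XW))))) \<in> borel_measurable (P \<Otimes>\<^sub>M G)"
    using measurable_compose[OF pair_pr, of "\<lambda>\<omega>. ln (obs_Z P K sig (obs_of K sig \<omega>))" borel]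
      borel_measurable_integrable[OF S.ln_Z_int] by simp
  then have F_meas: "(\<lambda>XW. ?F (fst XW) (snd XW)) \<in> borel_measurable (P \<Otimes>\<^sub>M G)" unfolding Fpr .
  have "P \<Otimes>\<^sub>M G = distr (P \<Otimes>\<^sub>M gaussK K) (P \<Otimes>\<^sub>M G) (\<lambda>Xz. (fst Xz, \<phi> (snd Xz)))"
  proof -
    interpret GK: prob_space "gaussK K" by simp
    have "prob_space G" using GK.prob_space_distr[OF \<phi>_meas] unfolding G .
    then interpret Gp: prob_space G .
    have sf: "sigma_finite_measure (distr (gaussK K) G \<phi>)" unfolding G by unfold_locales
    have "P \<Otimes>\<^sub>M G = distr P P (\<lambda>x. x) \<Otimes>\<^sub>M distr (gaussK K) G \<phi>" unfolding G by (simp only: distr_id2)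
    also have "\<dots> = distr (P \<Otimes>\<^sub>M gaussK K) (P \<Otimes>\<^sub>M G) (\<lambda>(x, y). (x, \<phi> y))"
      by (rule pair_measure_distr[OF measurable_ident_sets[OF refl] \<phi>_meas sf])
    finally show ?thesis by (simp only: case_prod_beta')
  qed
  then have "(\<integral>XW. ?F (fst XW) (snd XW) \<partial>(P \<Otimes>\<^sub>M G))
      = (\<integral>Xz. ?F (fst (fst Xz, \<phi> (snd Xz))) (snd (fst Xz, \<phi> (snd Xz))) \<partial>(P \<Otimes>\<^sub>M gaussK K))"
    using integral_distr[OF pair_\<phi> F_meas] by simp
  also have "\<dots> = chan_free P K sig" unfolding chan_free_def fst_conv snd_conv F\<phi> prod.collapse ..
  finally show ?thesis unfolding free_entropy_def G_def P_def Kp_tuples by simp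
qed

text \<open>By independence the squared distance of a monomial in the original coordinates from the
  same monomial in the discretised ones is the combination of \<open>p\<close>-th powers bounded by
  \<open>\<kappa>\<close>. The entries together have weight at most \<open>N / \<Delta>\<close>, so
  the estimate per coordinate is uniform in \<open>N\<close>. The absolute value comes from applying
  \<open>chan_free_compare\<close> in both directions.\<close>

lemma free_entropy_compare:
  assumes t: "t > 0" and A: "(\<integral>x. x\<^sup>2 \<partial>PX) \<le> A" "(\<integral>x. (T x)\<^sup>2 \<partial>PX) \<le> A"
    and \<kappa>: "(\<integral>x. x\<^sup>2 \<partial>PX) ^ p - 2 * (\<integral>x. x * T x \<partial>PX) ^ p + (\<integral>x. (T x)\<^sup>2 \<partial>PX) ^ p \<le> \<kappa>" "0 \<le> \<kappa>"
  shows "\<bar>free_entropy PX p \<Delta> N - free_energy (snrs 1 0) / real N\<bar> \<le> ((1 + t) / 2 * \<kappa> + A ^ p / (2 * t)) / \<Delta>"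
proof -
  define UT where "UT S X = sqrt (snrs 1 0 S) * u S (\<tau> X)" for S X
  interpret S: square_signal P K sig by (rule square_signal_sig)
  have ssT: "square_signal P K UT"
    unfolding UT_def[abs_def] by (rule square_signal_discrete[OF prob_P \<tau>_meas w_\<tau>])
  interpret ST: square_signal P K UT by (rule ssT)
  have T2: "integrable PX (\<lambda>x. (T x)\<^sup>2)"
    by (rule one.integrable_discrete[OF _ T_measurable_V q_T]) unfold_locales
  have xT: "integrable PX (\<lambda>x. x * T x)"
    by (rule integrable_mult_of_sq[OF _ _ x2 T2]) simp_all
  have fT: "chan_free P K UT = free_energy (snrs 1 0)"
    unfolding UT_def[abs_def] by (rule free_energy_eq_chan_free[OF prob_P \<tau>_meas w_\<tau> snrs_nonneg]) auto
  have A0: "0 \<le> A" by (rule order_trans[OF integral_nonneg_AE A(1)]) simp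
  have bound: "(\<Sum>S\<in>K. \<integral>X. f S X \<partial>P) \<le> real N * (c / \<Delta>)"
    if f: "\<And>S. S \<in> Kp \<Longrightarrow> (\<integral>X. f S X \<partial>P) \<le> snrs 1 0 S * c" and f0: "\<And>S. S \<in> J \<Longrightarrow> f S = (\<lambda>_. 0)" and c: "c \<ge> 0"
    for f :: "nat set \<Rightarrow> (nat \<Rightarrow> real) \<Rightarrow> real" and c
  proof -
    have "(\<Sum>S\<in>K. \<integral>X. f S X \<partial>P) = (\<Sum>S\<in>Kp. \<integral>X. f S X \<partial>P)"
      by (rule sum_K_pairwise) (simp add: f0 single_in_J)
    also have "\<dots> \<le> (\<Sum>S\<in>Kp. coef2 p N / \<Delta> * c)"
      by (rule sum_mono) (use f in \<open>simp add: snrs_Kp\<close>)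
    also have "\<dots> = (coef2 p N * real (N choose p)) * (c / \<Delta>)" by (simp add: card_Kp)
    also have "\<dots> \<le> real N * (c / \<Delta>)" using N p \<Delta> c by (intro mult_right_mono coef2_choose_le) auto
    finally show ?thesis .
  qed
  have sub: "S \<subseteq> {..<N}" "card S = p" if "S \<in> Kp" for S using that by (auto simp: Kp_def)
  have u\<tau>: "u S (\<tau> X) = (\<Prod>i\<in>S. T (X i))" if "S \<in> Kp" for S X
    unfolding u_def \<tau>_def using sub(1)[OF that] by (intro prod.cong) auto
  have sq: "(sqrt (snrs 1 0 S))\<^sup>2 = snrs 1 0 S" for S using snrs_nonneg[of 1 0 S] by simp
  have J0: "snrs 1 0 S = 0" if "S \<in> J" for S using that by (simp add: snrs_def)
  have d1: "(\<Sum>S\<in>K. \<integral>X. (UT S X - sig S X)\<^sup>2 \<partial>P) \<le> real N * (\<kappa> / \<Delta>)"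
  proof (rule bound[OF _ _ \<kappa>(2)])
    fix S assume S: "S \<in> Kp"
    have "(UT S X - sig S X)\<^sup>2 = snrs 1 0 S * ((\<Prod>i\<in>S. (X i)\<^sup>2) - 2 * (\<Prod>i\<in>S. X i * T (X i)) + (\<Prod>i\<in>S. (T (X i))\<^sup>2))" for X
      unfolding UT_def sig_def u\<tau>[OF S] right_diff_distrib[symmetric] power_mult_distrib sq
      unfolding u_def by (simp add: prod.distrib prod_power_distrib power2_diff mult_ac)
    then have "(\<integral>X. (UT S X - sig S X)\<^sup>2 \<partial>P)
        = snrs 1 0 S * ((\<integral>x. x\<^sup>2 \<partial>PX) ^ p - 2 * (\<integral>x. x * T x \<partial>PX) ^ p + (\<integral>x. (T x)\<^sup>2 \<partial>PX) ^ p)"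
      using integrable_prod_P[OF sub(1)[OF S] x2] integrable_prod_P[OF sub(1)[OF S] xT] integrable_prod_P[OF sub(1)[OF S] T2]
        integral_prod_P[OF sub(1)[OF S] x2] integral_prod_P[OF sub(1)[OF S] xT] integral_prod_P[OF sub(1)[OF S] T2] sub(2)[OF S]
      by simp
    then show "(\<integral>X. (UT S X - sig S X)\<^sup>2 \<partial>P) \<le> snrs 1 0 S * \<kappa>"
      using \<kappa>(1) snrs_nonneg[of 1 0 S] by (simp only: mult_left_mono zero_le_one order_refl)
  qed (simp add: UT_def sig_def J0)
  have d2: "(\<Sum>S\<in>K. \<integral>X. (sig S X)\<^sup>2 \<partial>P) \<le> real N * (A ^ p / \<Delta>)"
  proof (rule bound)
    fix S assume S: "S \<in> Kp"
    have "(\<integral>X. (sig S X)\<^sup>2 \<partial>P) = snrs 1 0 S * (\<integral>x. x\<^sup>2 \<partial>PX) ^ p"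
      using integral_prod_P[OF sub(1)[OF S] x2] sub(2)[OF S]
      unfolding sig_def power_mult_distrib sq u_def by (simp add: prod_power_distrib)
    also have "\<dots> \<le> snrs 1 0 S * A ^ p"
      using A by (intro mult_left_mono power_mono integral_nonneg_AE snrs_nonneg) auto
    finally show "(\<integral>X. (sig S X)\<^sup>2 \<partial>P) \<le> snrs 1 0 S * A ^ p" .
  qed (use A0 in \<open>simp_all add: sig_def J0\<close>)
  have d3: "(\<Sum>S\<in>K. \<integral>X. (UT S X)\<^sup>2 \<partial>P) \<le> real N * (A ^ p / \<Delta>)"
  proof (rule bound)
    fix S assume S: "S \<in> Kp"
    have "(\<integral>X. (UT S X)\<^sup>2 \<partial>P) = snrs 1 0 S * (\<integral>x. (T x)\<^sup>2 \<partial>PX) ^ p"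
      using integral_prod_P[OF sub(1)[OF S] T2] sub(2)[OF S]
      unfolding UT_def power_mult_distrib sq u\<tau>[OF S] by (simp add: prod_power_distrib)
    also have "\<dots> \<le> snrs 1 0 S * A ^ p"
      using A by (intro mult_left_mono power_mono integral_nonneg_AE snrs_nonneg) auto
    finally show "(\<integral>X. (UT S X)\<^sup>2 \<partial>P) \<le> snrs 1 0 S * A ^ p" .
  qed (use A0 in \<open>simp_all add: UT_def J0\<close>)
  define B where "B = ((1 + t) / 2 * \<kappa> + A ^ p / (2 * t)) / \<Delta>"
  have B: "(1 + t) / 2 * D + E / (2 * t) \<le> real N * B"
    if "D \<le> real N * (\<kappa> / \<Delta>)" "E \<le> real N * (A ^ p / \<Delta>)" for D E
  proof -
    have "(1 + t) / 2 * D + E / (2 * t) \<le> (1 + t) / 2 * (real N * (\<kappa> / \<Delta>)) + real N * (A ^ p / \<Delta>) / (2 * t)"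
      using that t by (intro add_mono mult_left_mono divide_right_mono) auto
    also have "\<dots> = real N * B" unfolding B_def using t \<Delta> by (simp add: field_simps)
    finally show ?thesis .
  qed
  have d1': "(\<Sum>S\<in>K. \<integral>X. (sig S X - UT S X)\<^sup>2 \<partial>P) \<le> real N * (\<kappa> / \<Delta>)"
    using d1 by (simp only: power2_commute)
  have "\<bar>chan_free P K sig - chan_free P K UT\<bar> \<le> real N * B"
    using S.chan_free_compare[OF ssT t] ST.chan_free_compare[OF square_signal_sig t] B[OF d1 d3] B[OF d1' d2] by linarith
  then have "\<bar>(chan_free P K sig - chan_free P K UT) / real N\<bar> \<le> B"
    using N by (simp add: abs_divide divide_le_eq mult.commute)
  then show ?thesis unfolding free_entropy_eq_chan_free fT[symmetric] B_def diff_divide_distrib .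
qed

end

end

section \<open>Approximation of the prior and choice of constants\<close>

text \<open>Simple functions that converge to the identity and are dominated by
  \<open>2 * \<bar>x\<bar>\<close>. The last expression tends to zero because the two moments
  involving \<open>T\<close> in it converge to the second moment of the prior.\<close>

lemma finite_range_approximation:
  fixes PX :: "real measure"
  assumes PX: "prob_space PX" and sets_PX: "sets PX = sets borel" and x2: "integrable PX (\<lambda>x. x\<^sup>2)" and \<eta>: "\<eta> > 0"
  obtains T C where "T \<in> borel_measurable borel" "finite (range T)" "\<And>x. \<bar>T x\<bar> \<le> C"
    "(\<integral>x. (T x)\<^sup>2 \<partial>PX) \<le> 4 * (\<integral>x. x\<^sup>2 \<partial>PX)" "(\<integral>x. (x - T x)\<^sup>2 \<partial>PX) \<le> \<eta>"
    "(\<integral>x. x\<^sup>2 \<partial>PX) ^ p - 2 * (\<integral>x. x * T x \<partial>PX) ^ p + (\<integral>x. (T x)\<^sup>2 \<partial>PX) ^ p \<le> \<eta>"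
proof -
  note [measurable_cong] = sets_PX
  obtain F :: "nat \<Rightarrow> real \<Rightarrow> real" where F: "\<And>i. simple_function borel (F i)" "\<And>x. (\<lambda>i. F i x) \<longlonglongrightarrow> x"
    "\<And>i x. dist (F i x) 0 \<le> 2 * dist x 0"
    using borel_measurable_implies_sequence_metric[of "\<lambda>x. x" "borel :: real measure" 0] by auto
  have Fm [measurable]: "F i \<in> borel_measurable borel" for i by (rule borel_measurable_simple_function[OF F(1)])
  have F2: "\<bar>F i x\<bar> \<le> 2 * \<bar>x\<bar>" for i x using F(3)[of i x] by simp
  \<comment> \<open>The dominating constant 9 is the square of 3, from
    \<open>\<bar>x - F i x\<bar> \<le> 3 * \<bar>x\<bar>\<close>; it covers the other two moments as
    well.\<close>
  have lim: "(\<lambda>i. \<integral>x. g x (F i x) \<partial>PX) \<longlonglongrightarrow> (\<integral>x. g x x \<partial>PX)"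
    if "\<And>i. (\<lambda>x. g x (F i x)) \<in> borel_measurable PX" "(\<lambda>x. g x x) \<in> borel_measurable PX"
      and "\<And>x. (\<lambda>i. g x (F i x)) \<longlonglongrightarrow> g x x" "\<And>i x. \<bar>g x (F i x)\<bar> \<le> 9 * x\<^sup>2" for g :: "real \<Rightarrow> real \<Rightarrow> real"
    by (rule integral_dominated_convergence[where w = "\<lambda>x. 9 * x\<^sup>2"]) (use that x2 in auto)
  have sqF: "(F i x)\<^sup>2 \<le> 4 * x\<^sup>2" for i x using power_mono[OF F2[of i x], of 2] by (simp add: power_mult_distrib)
  have xF: "\<bar>x * F i x\<bar> \<le> 2 * x\<^sup>2" for i x
    using mult_left_mono[OF F2[of i x], of "\<bar>x\<bar>"] by (simp add: abs_mult power2_eq_square)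
  have l1: "(\<lambda>i. \<integral>x. (F i x)\<^sup>2 \<partial>PX) \<longlonglongrightarrow> (\<integral>x. x\<^sup>2 \<partial>PX)"
  proof (rule lim)
    show "\<bar>(F i x)\<^sup>2\<bar> \<le> 9 * x\<^sup>2" for i x using order_trans[OF sqF, of x "9 * x\<^sup>2" i] by simp
  qed (measurable, intro tendsto_intros F(2))
  have l2: "(\<lambda>i. \<integral>x. x * F i x \<partial>PX) \<longlonglongrightarrow> (\<integral>x. x\<^sup>2 \<partial>PX)" unfolding power2_eq_square
  proof (rule lim)
    show "\<bar>x * F i x\<bar> \<le> 9 * x\<^sup>2" for i x using order_trans[OF xF, of x "9 * x\<^sup>2" i] by simp
  qed (measurable, intro tendsto_intros F(2))
  have dF: "\<bar>(x - F i x)\<^sup>2\<bar> \<le> 9 * x\<^sup>2" for i x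
  proof -
    have "(x - F i x)\<^sup>2 = x\<^sup>2 - 2 * (x * F i x) + (F i x)\<^sup>2" by (simp add: power2_diff)
    then have "(x - F i x)\<^sup>2 \<le> 9 * x\<^sup>2" using sqF[of i x] abs_le_D2[OF xF[of x i]] by linarith
    then show ?thesis by simp
  qed
  have l3: "(\<lambda>i. \<integral>x. (x - F i x)\<^sup>2 \<partial>PX) \<longlonglongrightarrow> 0"
  proof -
    have "(\<lambda>i. \<integral>x. (x - F i x)\<^sup>2 \<partial>PX) \<longlonglongrightarrow> (\<integral>x. (x - x)\<^sup>2 \<partial>PX)"
      by (rule lim[of "\<lambda>x y. (x - y)\<^sup>2"]) (measurable, intro tendsto_intros F(2), rule dF)
    then show ?thesis by simp
  qed
  have "(\<lambda>i. (\<integral>x. x\<^sup>2 \<partial>PX) ^ p - 2 * (\<integral>x. x * F i x \<partial>PX) ^ p + (\<integral>x. (F i x)\<^sup>2 \<partial>PX) ^ p)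
      \<longlonglongrightarrow> (\<integral>x. x\<^sup>2 \<partial>PX) ^ p - 2 * (\<integral>x. x\<^sup>2 \<partial>PX) ^ p + (\<integral>x. x\<^sup>2 \<partial>PX) ^ p"
    by (intro tendsto_intros l1 l2)
  then have l4: "(\<lambda>i. (\<integral>x. x\<^sup>2 \<partial>PX) ^ p - 2 * (\<integral>x. x * F i x \<partial>PX) ^ p + (\<integral>x. (F i x)\<^sup>2 \<partial>PX) ^ p) \<longlonglongrightarrow> 0" by simp
  have "eventually (\<lambda>i. (\<integral>x. (x - F i x)\<^sup>2 \<partial>PX) < \<eta> \<and>
      (\<integral>x. x\<^sup>2 \<partial>PX) ^ p - 2 * (\<integral>x. x * F i x \<partial>PX) ^ p + (\<integral>x. (F i x)\<^sup>2 \<partial>PX) ^ p < \<eta>) sequentially"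
    using order_tendstoD(2)[OF l3 \<eta>] order_tendstoD(2)[OF l4 \<eta>] by (rule eventually_conj)
  then obtain i where i: "(\<integral>x. (x - F i x)\<^sup>2 \<partial>PX) < \<eta>"
      "(\<integral>x. x\<^sup>2 \<partial>PX) ^ p - 2 * (\<integral>x. x * F i x \<partial>PX) ^ p + (\<integral>x. (F i x)\<^sup>2 \<partial>PX) ^ p < \<eta>"
    unfolding eventually_sequentially by blast
  have fin: "finite (range (F i))" using F(1)[of i] by (simp add: simple_function_def)
  have "(\<integral>x. (F i x)\<^sup>2 \<partial>PX) \<le> (\<integral>x. 4 * x\<^sup>2 \<partial>PX)"
  proof (rule integral_mono)
    show "integrable PX (\<lambda>x. (F i x)\<^sup>2)"
      by (rule Bochner_Integration.integrable_bound[of _ "\<lambda>x. 4 * x\<^sup>2"]) (use x2 sqF in simp_all)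
  qed (use x2 sqF in simp_all)
  then have e: "(\<integral>x. (F i x)\<^sup>2 \<partial>PX) \<le> 4 * (\<integral>x. x\<^sup>2 \<partial>PX)" by simp
  show thesis
  proof (rule that[OF Fm fin _ e])
    show "\<bar>F i x\<bar> \<le> Max (abs ` range (F i))" for x using fin by (intro Max_ge) auto
  qed (use i in simp_all)
qed

text \<open>Matches the form of the comparison estimates: \<open>t\<close> is taken large to make
  the second term small, and only then is \<open>\<eta>\<close> chosen to beat the factor
  \<open>1 + t\<close>.\<close>

lemma young_constants:
  fixes c \<epsilon> :: real
  assumes c: "c \<ge> 0" and \<epsilon>: "\<epsilon> > 0"
  obtains t \<eta> where "t > 0" "\<eta> > 0" "(1 + t) / 2 * (c * \<eta>) + c / (2 * t) \<le> \<epsilon>"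
proof
  define t where "t = c / \<epsilon> + 1"
  define \<eta> where "\<eta> = \<epsilon> / ((1 + t) * (c + 1))"
  show t: "t > 0" unfolding t_def using c \<epsilon> by (simp add: add_nonneg_pos)
  show "\<eta> > 0" unfolding \<eta>_def using t c \<epsilon> by simp
  have "c / (2 * t) \<le> \<epsilon> / 2" using t \<epsilon> c unfolding t_def by (simp add: field_simps)
  moreover have "(1 + t) / 2 * (c * \<eta>) = \<epsilon> / 2 * (c / (c + 1))"
    unfolding \<eta>_def using t c by simp
  moreover have "\<epsilon> / 2 * (c / (c + 1)) \<le> \<epsilon> / 2 * 1" using c \<epsilon> by (intro mult_left_mono) auto
  ultimately show "(1 + t) / 2 * (c * \<eta>) + c / (2 * t) \<le> \<epsilon>" by linarith
qed

text \<open>Each of three terms receives \<open>\<epsilon> / 4\<close>: \<open>t\<close> handles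
  \<open>D * (t / 2)\<close>, \<open>a\<close> the cost of the side channel, and \<open>M\<close>,
  chosen last, the curvature term of the variance bound, which is divided by \<open>t\<close>. The
  terms containing \<open>N\<close> tend to zero once these are fixed.\<close>

lemma vanishing_remainder:
  fixes B C D \<epsilon> k :: real and g :: "real \<Rightarrow> real"
  assumes D: "D \<ge> 0" and \<epsilon>: "\<epsilon> > 0"
  obtains a t M where "a > 0" "t > 0" "M > (0::nat)"
    "eventually (\<lambda>N. 2 * a\<^sup>2 * C\<^sup>2 + D * (t / 2 + (2 * C\<^sup>2 / (a * (a / real M)) *
        (ln 2 / real N + 5 * C\<^sup>2 * (a / real M)\<^sup>2 + 4 * (g a / sqrt (real N)))) / (2 * t)) + B / real N < \<epsilon>) sequentially"
proof -
  define t where "t = \<epsilon> / (2 * (D + 1))"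
  define a where "a = min 1 (\<epsilon> / (8 * (C\<^sup>2 + 1)))"
  \<comment> \<open>Coefficient of \<open>1 / M\<close> in the variance term:
    \<open>2 * C\<^sup>2 / (a * \<delta>)\<close> times
    \<open>5 * C\<^sup>2 * \<delta>\<^sup>2\<close> is \<open>10 * C ^ 4 / M\<close> for
    \<open>\<delta> = a / M\<close>.\<close>
  define E where "E = D * (10 * C ^ 4) / (2 * t)"
  have t: "t > 0" unfolding t_def using D \<epsilon> by simp
  have c1: "C\<^sup>2 + 1 > 0" by (simp add: add_nonneg_pos)
  have a: "a > 0" unfolding a_def using c1 \<epsilon> by simp
  obtain M where M: "real M > max 0 (4 * E / \<epsilon>)" using reals_Archimedean2 by blast
  have M0: "M > 0" using M by simp
  have "2 * a\<^sup>2 * C\<^sup>2 \<le> \<epsilon> / 4"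
  proof -
    have "a * a \<le> 1 * (\<epsilon> / (8 * (C\<^sup>2 + 1)))" using a by (intro mult_mono) (auto simp: a_def)
    then have "2 * a\<^sup>2 * C\<^sup>2 \<le> 2 * (\<epsilon> / (8 * (C\<^sup>2 + 1))) * C\<^sup>2"
      unfolding power2_eq_square[of a] by (intro mult_right_mono) auto
    also have "\<dots> = \<epsilon> / 4 * (C\<^sup>2 / (C\<^sup>2 + 1))"
    proof -
      have "2 * (\<epsilon> / (8 * k)) * C\<^sup>2 = \<epsilon> / 4 * (C\<^sup>2 / k)" for k by (cases "k = 0") (simp_all add: field_simps)
      then show ?thesis .
    qed
    also have "\<dots> \<le> \<epsilon> / 4 * 1" using c1 \<epsilon> by (intro mult_left_mono) auto
    finally show ?thesis by simp
  qed
  moreover have "D * (t / 2) \<le> \<epsilon> / 4"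
  proof -
    have "D * (t / 2) = \<epsilon> / 4 * (D / (D + 1))" unfolding t_def using D by (simp add: field_simps)
    also have "\<dots> \<le> \<epsilon> / 4 * 1" using D \<epsilon> by (intro mult_left_mono) auto
    finally show ?thesis by simp
  qed
  moreover have "D * ((2 * C\<^sup>2 / (a * (a / real M)) * (0 + 5 * C\<^sup>2 * (a / real M)\<^sup>2 + 4 * 0)) / (2 * t)) < \<epsilon> / 4"
  proof -
    have "2 * C\<^sup>2 / (a * (a / real M)) * (5 * C\<^sup>2 * (a / real M)\<^sup>2) = 10 * C ^ 4 / real M"
      using a M0 by (simp add: power2_eq_square power4_eq_xxxx field_simps)
    then have "D * ((2 * C\<^sup>2 / (a * (a / real M)) * (0 + 5 * C\<^sup>2 * (a / real M)\<^sup>2 + 4 * 0)) / (2 * t)) = E / real M"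
      unfolding E_def by (simp add: mult.commute)
    also have "\<dots> < \<epsilon> / 4" using M M0 \<epsilon> by (simp add: field_simps)
    finally show ?thesis .
  qed
  ultimately have small: "2 * a\<^sup>2 * C\<^sup>2 + D * (t / 2 + (2 * C\<^sup>2 / (a * (a / real M)) *
      (0 + 5 * C\<^sup>2 * (a / real M)\<^sup>2 + 4 * 0)) / (2 * t)) + 0 < \<epsilon>"
    unfolding distrib_left[of D] using \<epsilon> by linarith
  have over_N: "(\<lambda>N. c / real N) \<longlonglongrightarrow> 0" for c by (rule lim_const_over_n)
  have "(\<lambda>N. 1 / sqrt (real N)) \<longlonglongrightarrow> 0"
    using tendsto_real_sqrt[OF over_N[of 1]] by (simp add: real_sqrt_divide)
  from tendsto_mult_left[OF this, of "g a"]
  have over_sqrt: "(\<lambda>N. g a / sqrt (real N)) \<longlonglongrightarrow> 0" by simp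
  have "(\<lambda>N. 2 * a\<^sup>2 * C\<^sup>2 + D * (t / 2 + (2 * C\<^sup>2 / (a * (a / real M)) *
        (ln 2 / real N + 5 * C\<^sup>2 * (a / real M)\<^sup>2 + 4 * (g a / sqrt (real N)))) / (2 * t)) + B / real N)
    \<longlonglongrightarrow> 2 * a\<^sup>2 * C\<^sup>2 + D * (t / 2 + (2 * C\<^sup>2 / (a * (a / real M)) *
        (0 + 5 * C\<^sup>2 * (a / real M)\<^sup>2 + 4 * 0)) / (2 * t)) + 0"
    using t by (intro tendsto_add tendsto_mult tendsto_divide tendsto_const over_N over_sqrt) simp
  from that[OF a t M0 order_tendstoD(2)[OF this small]] show thesis .
qed

section \<open>The limit for a prior with finite second moment\<close>

locale finite_second_moment = prob_space PX for PX :: "real measure" +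
  fixes p :: nat and \<Delta> :: real
  assumes p: "p \<ge> 2" and \<Delta>: "\<Delta> > 0" and sets_PX: "sets PX = sets borel" and x2: "integrable PX (\<lambda>x. x\<^sup>2)"
begin

text \<open>The factor 4 comes from discretisations dominated by \<open>2 * \<bar>x\<bar>\<close>,
  so \<open>A\<close> bounds the second moments of both priors.\<close>

definition A :: real where "A = 4 * (\<integral>x. x\<^sup>2 \<partial>PX)"

lemma A: "(\<integral>x. x\<^sup>2 \<partial>PX) \<le> A" "0 \<le> A"
proof -
  have "0 \<le> (\<integral>x. x\<^sup>2 \<partial>PX)" by (rule integral_nonneg_AE) simp
  then show "(\<integral>x. x\<^sup>2 \<partial>PX) \<le> A" "0 \<le> A" unfolding A_def by simp_all
qed

text \<open>The discretisation is chosen before \<open>N\<close> and serves all \<open>N\<close> at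
  once. The error in the scalar potential grows with \<open>h\<close>, hence the range up to
  \<open>H\<close>. The free energy is written with fully qualified constants because
  \<open>N\<close> varies here and no instance of \<open>spiked\<close> is fixed.\<close>

lemma finite_range_reduction:
  assumes H: "H \<ge> 0" and \<epsilon>: "\<epsilon> > 0"
  obtains T C where "\<And>N. N \<ge> 1 \<Longrightarrow> spiked PX T (range T) C \<Delta> p N" "(\<integral>x. (T x)\<^sup>2 \<partial>PX) \<le> A"
    "\<And>N. N \<ge> 1 \<Longrightarrow> \<bar>free_entropy PX p \<Delta> N
        - finite_channel.free_energy (spiked.K p N) (spiked.\<Omega> (range T) N) (spiked.w PX T N) spiked.u (spiked.snrs \<Delta> p N 1 0) / real N\<bar> \<le> \<epsilon>"
    "\<And>h. 0 \<le> h \<Longrightarrow> h \<le> H \<Longrightarrow> \<bar>psi PX (\<lambda>x. x) h - psi PX T h\<bar> \<le> \<epsilon>"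
proof -
  have PX: "prob_space PX" by unfold_locales
  \<comment> \<open>Sum of the four coefficients with which the distance and the size of the signals
    enter, two from the tensor and two from the scalar channel.\<close>
  define c where "c = 1 / \<Delta> + A ^ p / \<Delta> + H + H * A"
  have c: "1 / \<Delta> \<le> c" "A ^ p / \<Delta> \<le> c" "H \<le> c" "H * A \<le> c" "0 \<le> c"
    unfolding c_def using \<Delta> A(2) H by simp_all
  obtain t \<eta> where t: "t > 0" and \<eta>: "\<eta> > 0" and le: "(1 + t) / 2 * (c * \<eta>) + c / (2 * t) \<le> \<epsilon>"
    using young_constants[OF c(5) \<epsilon>] by blast
  have small: "(1 + t) / 2 * x + y / (2 * t) \<le> \<epsilon>" if "x \<le> c * \<eta>" "y \<le> c" for x y
  proof -
    have "(1 + t) / 2 * x + y / (2 * t) \<le> (1 + t) / 2 * (c * \<eta>) + c / (2 * t)"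
      using that t by (intro add_mono mult_left_mono divide_right_mono) auto
    then show ?thesis using le by linarith
  qed
  obtain T C where T: "T \<in> borel_measurable borel" "finite (range T)" "\<And>x. \<bar>T x\<bar> \<le> C"
    "(\<integral>x. (T x)\<^sup>2 \<partial>PX) \<le> 4 * (\<integral>x. x\<^sup>2 \<partial>PX)" "(\<integral>x. (x - T x)\<^sup>2 \<partial>PX) \<le> \<eta>"
    "(\<integral>x. x\<^sup>2 \<partial>PX) ^ p - 2 * (\<integral>x. x * T x \<partial>PX) ^ p + (\<integral>x. (T x)\<^sup>2 \<partial>PX) ^ p \<le> \<eta>"
    using finite_range_approximation[OF PX sets_PX x2 \<eta>, of p] by blast
  have TA: "(\<integral>x. (T x)\<^sup>2 \<partial>PX) \<le> A" using T(4) unfolding A_def .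
  have sp: "spiked PX T (range T) C \<Delta> p N" if "N \<ge> 1" for N
    by (intro spiked.intro spiked_axioms.intro PX sets_PX T(1,2) p that \<Delta>) (use T(3) in auto)
  show thesis
  proof (rule that[OF sp TA])
    fix N :: nat assume N: "N \<ge> 1"
    interpret spiked PX T "range T" C \<Delta> p N by (rule sp[OF N])
    have "\<bar>free_entropy PX p \<Delta> N - free_energy (snrs 1 0) / real N\<bar> \<le> ((1 + t) / 2 * \<eta> + A ^ p / (2 * t)) / \<Delta>"
      by (rule free_entropy_compare[OF x2 t A(1) TA T(6)]) (use \<eta> in simp)
    also have "\<dots> = (1 + t) / 2 * (1 / \<Delta> * \<eta>) + A ^ p / \<Delta> / (2 * t)"
      by (simp add: add_divide_distrib)
    also have "\<dots> \<le> \<epsilon>" using c \<eta> by (intro small mult_right_mono) auto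
    finally show "\<bar>free_entropy PX p \<Delta> N - free_energy (snrs 1 0) / real N\<bar> \<le> \<epsilon>" .
  next
    fix h assume h: "0 \<le> h" "h \<le> H"
    have m: "(\<lambda>x. x) \<in> borel_measurable PX" "T \<in> borel_measurable PX"
      using T(1) unfolding measurable_cong_sets[OF sets_PX refl] by simp_all
    have T2: "integrable PX (\<lambda>x. (T x)\<^sup>2)"
    proof (rule integrable_const_bound)
      show "AE x in PX. norm ((T x)\<^sup>2) \<le> C\<^sup>2" using T(3) by (intro AE_I2) (simp add: abs_le_square_iff[symmetric] order_trans[OF _ abs_ge_self])
    qed (use m in simp)
    have bnd: "(1 + t) / 2 * (h * D) + h * E / (2 * t) \<le> \<epsilon>" if "0 \<le> D" "D \<le> \<eta>" "0 \<le> E" "E \<le> A" for D E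
    proof (rule small)
      have "h * D \<le> H * \<eta>" using h that H by (intro mult_mono) auto
      also have "\<dots> \<le> c * \<eta>" using c \<eta> by (intro mult_right_mono) auto
      finally show "h * D \<le> c * \<eta>" .
      have "h * E \<le> H * A" using h that H by (intro mult_mono) auto
      then show "h * E \<le> c" using c(4) by linarith
    qed
    have nn: "0 \<le> (\<integral>x. (f x)\<^sup>2 \<partial>PX)" for f :: "real \<Rightarrow> real" by (rule integral_nonneg_AE) simp
    have "(\<integral>x. (T x - x)\<^sup>2 \<partial>PX) \<le> \<eta>" using T(5) by (simp only: power2_commute)
    then show "\<bar>psi PX (\<lambda>x. x) h - psi PX T h\<bar> \<le> \<epsilon>"
      using psi_compare[OF PX m(1) x2 m(2) T2 h(1) t] bnd[OF nn _ nn TA, of "\<lambda>x. T x - x"]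
        psi_compare[OF PX m(2) T2 m(1) x2 h(1) t] bnd[OF nn T(5) nn A(1)] by linarith
  qed
qed

lemma free_entropy_ge:
  assumes m: "m \<ge> 0" and \<epsilon>: "\<epsilon> > 0"
  shows "eventually (\<lambda>N. phi_RS PX p \<Delta> m - \<epsilon> \<le> free_entropy PX p \<Delta> N) sequentially"
proof -
  define h where "h = m ^ (p - 1) / \<Delta>"
  have h: "h \<ge> 0" unfolding h_def using m \<Delta> by simp
  have e3: "\<epsilon> / 3 > 0" using \<epsilon> by simp
  obtain T C where sp: "\<And>N. N \<ge> 1 \<Longrightarrow> spiked PX T (range T) C \<Delta> p N" and "(\<integral>x. (T x)\<^sup>2 \<partial>PX) \<le> A"
    and fe: "\<And>N. N \<ge> 1 \<Longrightarrow> \<bar>free_entropy PX p \<Delta> N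
        - finite_channel.free_energy (spiked.K p N) (spiked.\<Omega> (range T) N) (spiked.w PX T N) spiked.u (spiked.snrs \<Delta> p N 1 0) / real N\<bar> \<le> \<epsilon> / 3"
    and ps: "\<And>h'. 0 \<le> h' \<Longrightarrow> h' \<le> h \<Longrightarrow> \<bar>psi PX (\<lambda>x. x) h' - psi PX T h'\<bar> \<le> \<epsilon> / 3"
    using finite_range_reduction[OF h e3] by blast
  have "(\<lambda>N. real p * (C\<^sup>2) ^ p / (2 * \<Delta>) / real N) \<longlonglongrightarrow> 0" by (rule lim_const_over_n)
  then have "eventually (\<lambda>N. real p * (C\<^sup>2) ^ p / (2 * \<Delta>) / real N < \<epsilon> / 3) sequentially"
    using \<epsilon> by (intro order_tendstoD(2)) auto
  then show ?thesis using eventually_ge_at_top[of 1]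
  proof eventually_elim
    case (elim N)
    interpret spiked PX T "range T" C \<Delta> p N by (rule sp[OF elim(2)])
    show ?case
      using lower_bound[OF m] fe[OF elim(2)] ps[OF h order_refl] elim(1)
      unfolding phi_RS_eq_psi h_def[symmetric] divide_divide_eq_left by linarith
  qed
qed

lemma free_entropy_le:
  assumes \<epsilon>: "\<epsilon> > 0"
  shows "eventually (\<lambda>N. \<exists>m\<ge>0. free_entropy PX p \<Delta> N \<le> phi_RS PX p \<Delta> m + \<epsilon>) sequentially"
proof -
  \<comment> \<open>The \<open>m\<close> of the upper bound varies with \<open>N\<close> but stays
    below \<open>A\<close>, so \<open>m ^ (p - 1) / \<Delta>\<close> stays below this
    \<open>H\<close>.\<close>
  define H where "H = A ^ (p - 1) / \<Delta>"
  have H: "H \<ge> 0" unfolding H_def using A \<Delta> by simp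
  have e3: "\<epsilon> / 3 > 0" using \<epsilon> by simp
  obtain T C where sp: "\<And>N. N \<ge> 1 \<Longrightarrow> spiked PX T (range T) C \<Delta> p N" and TA: "(\<integral>x. (T x)\<^sup>2 \<partial>PX) \<le> A"
    and fe: "\<And>N. N \<ge> 1 \<Longrightarrow> \<bar>free_entropy PX p \<Delta> N
        - finite_channel.free_energy (spiked.K p N) (spiked.\<Omega> (range T) N) (spiked.w PX T N) spiked.u (spiked.snrs \<Delta> p N 1 0) / real N\<bar> \<le> \<epsilon> / 3"
    and ps: "\<And>h. 0 \<le> h \<Longrightarrow> h \<le> H \<Longrightarrow> \<bar>psi PX (\<lambda>x. x) h - psi PX T h\<bar> \<le> \<epsilon> / 3"
    using finite_range_reduction[OF H e3] by blast
  \<comment> \<open>The numerator of the fluctuation bound \<open>v\<close> in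
    \<open>upper_bound\<close>, with \<open>sens (3 * a)\<close> unfolded.\<close>
  define g where "g a = 1 + ((C ^ p)\<^sup>2 / \<Delta> + (3 * a)\<^sup>2 * C\<^sup>2 + (2 * (C ^ p)\<^sup>2 / \<Delta> + 2 * (3 * a)\<^sup>2 * C\<^sup>2)\<^sup>2) / 2" for a
  define D where "D = (C\<^sup>2) ^ (p - 1) / (2 * \<Delta>)"
  define B where "B = real p * (C\<^sup>2) ^ p / (2 * \<Delta>)"
  have D: "D \<ge> 0" unfolding D_def using \<Delta> by simp
  obtain a t M where a: "a > 0" and t: "t > 0" and M: "M > (0::nat)" and ev:
    "eventually (\<lambda>N. 2 * a\<^sup>2 * C\<^sup>2 + D * (t / 2 + (2 * C\<^sup>2 / (a * (a / real M)) *
        (ln 2 / real N + 5 * C\<^sup>2 * (a / real M)\<^sup>2 + 4 * (g a / sqrt (real N)))) / (2 * t)) + B / real N < \<epsilon> / 3) sequentially"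
    by (rule vanishing_remainder[OF D, of "\<epsilon> / 3" C g B]) (use \<epsilon> in simp)
  show ?thesis using ev eventually_ge_at_top[of 1]
  proof eventually_elim
    case (elim N)
    interpret spiked PX T "range T" C \<Delta> p N by (rule sp[OF elim(2)])
    from upper_bound[OF a M t] obtain m where m: "m \<ge> 0" "m \<le> (\<integral>x. (T x)\<^sup>2 \<partial>PX)"
      and ub: "free_energy (snrs 1 0) / real N \<le> psi PX T (m ^ (p - 1) / \<Delta>) - (real p - 1) / (2 * real p * \<Delta>) * m ^ p
        + 2 * a\<^sup>2 * C\<^sup>2 + D * (t / 2 + (2 * C\<^sup>2 / (a * (a / real M)) *
        (ln 2 / real N + 5 * C\<^sup>2 * (a / real M)\<^sup>2 + 4 * (g a / sqrt (real N)))) / (2 * t)) + B / real N"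
      unfolding sens_def g_def D_def B_def times_divide_eq_left divide_divide_eq_left by blast
    have h: "0 \<le> m ^ (p - 1) / \<Delta>" "m ^ (p - 1) / \<Delta> \<le> H"
      unfolding H_def using m TA \<Delta> by (auto intro!: divide_right_mono power_mono)
    have "free_entropy PX p \<Delta> N \<le> phi_RS PX p \<Delta> m + \<epsilon>"
      using ub fe[OF elim(2)] ps[OF h] elim(1) unfolding phi_RS_eq_psi by linarith
    then show ?case using m by blast
  qed
qed

text \<open>Stated in the extended reals, so that finiteness of the supremum is not
  presupposed.\<close>

lemma free_entropy_tendsto:
  "(\<lambda>N. ereal (free_entropy PX p \<Delta> N)) \<longlonglongrightarrow> (SUP m\<in>{0..}. ereal (phi_RS PX p \<Delta> m))"
proof (rule order_tendstoI)
  fix l assume "l < (SUP m\<in>{0..}. ereal (phi_RS PX p \<Delta> m))"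
  then obtain m where m: "m \<ge> 0" "l < ereal (phi_RS PX p \<Delta> m)" by (auto simp: less_SUP_iff)
  then obtain r where r: "l < ereal r" "r < phi_RS PX p \<Delta> m" using ereal_dense2[OF m(2)] by auto
  from free_entropy_ge[OF m(1), of "phi_RS PX p \<Delta> m - r"] r(2)
  have "eventually (\<lambda>N. r \<le> free_entropy PX p \<Delta> N) sequentially" by simp
  then show "eventually (\<lambda>N. l < ereal (free_entropy PX p \<Delta> N)) sequentially"
    by eventually_elim (rule less_le_trans[OF r(1)], simp)
next
  fix y assume "(SUP m\<in>{0..}. ereal (phi_RS PX p \<Delta> m)) < y"
  then obtain s where s: "(SUP m\<in>{0..}. ereal (phi_RS PX p \<Delta> m)) < ereal s" "ereal s < y" using ereal_dense2 by blast
  \<comment> \<open>A second value between the supremum and \<open>y\<close> is inserted, since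
    \<open>r - s > 0\<close> is the slack spent on \<open>free_entropy_le\<close>.\<close>
  obtain r where r: "ereal s < ereal r" "ereal r < y" using ereal_dense2[OF s(2)] by blast
  have le: "phi_RS PX p \<Delta> m \<le> s" if "m \<ge> 0" for m
  proof -
    have "ereal (phi_RS PX p \<Delta> m) \<le> (SUP m\<in>{0..}. ereal (phi_RS PX p \<Delta> m))" using that by (intro SUP_upper) simp
    then show ?thesis using s(1) by (simp add: order.strict_trans1 less_imp_le flip: ereal_less_eq(3))
  qed
  have "r - s > 0" using r(1) by simp
  from free_entropy_le[OF this] show "eventually (\<lambda>N. ereal (free_entropy PX p \<Delta> N) < y) sequentially"
  proof eventually_elim
    case (elim N)
    then obtain m where "m \<ge> 0" "free_entropy PX p \<Delta> N \<le> phi_RS PX p \<Delta> m + (r - s)" by blast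
    then have "free_entropy PX p \<Delta> N \<le> r" using le[of m] by linarith
    then have "ereal (free_entropy PX p \<Delta> N) \<le> ereal r" by simp
    then show ?case using r(2) by (rule le_less_trans)
  qed
qed

end

theorem theorem1:
  fixes PX :: "real measure" and p :: nat and \<Delta> :: real
  assumes "p \<ge> 2"
    and "\<Delta> > 0"
    and "prob_space PX"
    and "sets PX = sets borel"
    and "integrable PX (\<lambda>x. x\<^sup>2)"
  shows "(\<lambda>N. ereal (free_entropy PX p \<Delta> N)) \<longlonglongrightarrow> (SUP m\<in>{0..}. ereal (phi_RS PX p \<Delta> m))"
proof -
  interpret finite_second_moment PX p \<Delta>
    by (intro finite_second_moment.intro finite_second_moment_axioms.intro assms)
  show ?thesis by (rule free_entropy_tendsto)
qed

end
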